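(* Let $D$ be a simply connected domain with a marked boundary point $q$, let $b\in\mathbb R$, and let $w:(D,q)\to(\mathbb H,\infty)$ be a conformal map onto the upper half-plane. Let $\Phi_{(0)}$ be the Gaussian free field in $D$ (with Dirichlet boundary condition) and put $$\Phi\equiv\Phi_{(b)}=\Phi_{(0)}-2b\arg w',\qquad J=\partial\Phi .$$ Then $\Phi_{(b)}$ has a stress tensor, its Virasoro field is $$T=-\tfrac12\,J*J+ib\,\partial J,$$ and its central charge is $c=1-12b^2$.
   Context: Correlation functionals. Let $G$ be the Dirichlet Green's function of $D$. Functionals are finite linear combinations of commutative Wick products $\odot$ of $1$, of $\partial^j\bar\partial^k\Phi_{(0)}(z)$ and of $e^{\odot\alpha\Phi_{(0)}(z)}=\sum_n\alpha^n\Phi_{(0)}^{\odot n}(z)/n!$; the points $z$ are the nodes. $\mathbf E$ is linear, $\mathbf E[1]=1$, and $\mathbf E$ of a Wick product of one or more derivatives of $\Phi_{(0)}$ is $0$. The product of functionals with disjoint node sets is given by Wick's formula: the sum over all partial pairings of the factors with no pair inside one functional, of the product of pair expectations $\mathbf E[\partial^j\bar\partial^k\Phi_{(0)}(\zeta)\partial^l\bar\partial^m\Phi_{(0)}(z)]=2\,\partial_\zeta^j\bar\partial_\zeta^k\partial_z^l\bar\partial_z^mG(\zeta,z)$ times the Wick product of unpaired factors. Equalities and limits are understood in correlations with functionals having other nodes. Complex conjugation: $\overline{\Phi_{(0)}}=\Phi_{(0)}$, $\overline{\partial\Phi_{(0)}}=\bar\partial\Phi_{(0)}$, multiplicative for $\odot$.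 Fields. A non-random conformal field assigns to each local chart $\phi$ a smooth function $(f\|\phi)$. A Fock space field is a linear combination, with non-random conformal fields as coefficients, of Wick products of derivatives (in local charts) and Wick exponentials of $\Phi_{(0)}$. In a chart $\phi$ the function $w$ is replaced by $w\circ\phi^{-1}$, so $\arg w'$ means $\arg (w\circ\phi^{-1})'$. With $h$ the transition map between charts: a quadratic differential transforms by $X=(h')^2\widetilde X\circ h$; a Schwarzian form of order $\mu$ by $X=(h')^2\widetilde X\circ h+\mu S_h$, $S_h=(h''/h')'-\frac12(h''/h')^2$; a vector field is a $(-1,0)$-differential, $v=(h')^{-1}\tilde v\circ h$. $X$ is holomorphic if $\bar\partial X=0$ in correlations. For holomorphic $X$, the operator product expansion is $X(\zeta)Y(z)=\sum_n C_n(z)(\zeta-z)^n$ as $\zeta\to z$ (same chart for both points), and $X*Y:=C_0$. Lie derivative and stress tensor. For $v$ holomorphic near $z$ with flow $\psi_t$, $(X_t\|\phi)=(X\|\phi\circ\psi_{-t})$ and $\mathcal L_vX=\frac d{dt}|_{t=0}X_t$. If $A$ is a holomorphic quadratic differential, $W=(A,\bar A)$ is a stress tensor for $X$ if $\mathcal L_vX(z)=\frac1{2\pi i}\oint_{(z)}vA\,X(z)-\frac1{2\pi i}\oint_{(z)}\bar v\bar A\,X(z)$ for all local vector fields $v$, all $z$ near which $v$ is holomorphic, and all charts. $\mathcal F(W)$ is the linear space of all fields $X$ with stress tensor $W$. Virasoro field. A Fock space field $T$ is the Virasoro field for $\mathcal F(W)$ (and for a field having stress tensor $W$) if $T\in\mathcal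 F(W)$ and $T-A$ is a non-random holomorphic Schwarzian form; it is unique if it exists. The central charge $c$ is defined by: $T$ is a Schwarzian form of order $c/12$. *)

theory Defs
  imports "HOL-Complex_Analysis.Complex_Analysis" "HOL-Library.Multiset"
begin

section \<open>Wirtinger derivatives, smooth and harmonic functions\<close>

definition dz :: "(complex \<Rightarrow> complex) \<Rightarrow> complex \<Rightarrow> complex" where
  "dz f z = (frechet_derivative f (at z) 1 - \<i> * frechet_derivative f (at z) \<i>) / 2"

definition dzbar :: "(complex \<Rightarrow> complex) \<Rightarrow> complex \<Rightarrow> complex" where
  "dzbar f z = (frechet_derivative f (at z) 1 + \<i> * frechet_derivative f (at z) \<i>) / 2"

text \<open>Used for open \<open>S\<close> only, where it says that \<open>f\<close> is \<open>C\<^sup>\<infinity>\<close> in the real sense.\<close>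

definition smooth_on :: "complex set \<Rightarrow> (complex \<Rightarrow> complex) \<Rightarrow> bool" where
  "smooth_on S f \<longleftrightarrow> (\<forall>j k. ((dz ^^ j) ((dzbar ^^ k) f)) differentiable_on S)"

definition harmonic_on :: "complex set \<Rightarrow> (complex \<Rightarrow> real) \<Rightarrow> bool" where
  "harmonic_on S u \<longleftrightarrow> smooth_on S (\<lambda>z. complex_of_real (u z)) \<and>
     (\<forall>z\<in>S. dz (dzbar (\<lambda>z. complex_of_real (u z))) z = 0)"

text \<open>The normalisation is \<open>G \<zeta> z = - ln \<bar>\<zeta> - z\<bar> + harmonic\<close>, without a factor \<open>1/(2\<pi>)\<close>. If \<open>D\<close> is
  unbounded, \<open>\<infinity>\<close> is one of its boundary points (otherwise the last clause is void).\<close>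

definition dirichlet_green :: "complex set \<Rightarrow> (complex \<Rightarrow> complex \<Rightarrow> real) \<Rightarrow> bool" where
  "dirichlet_green D G \<longleftrightarrow> (\<forall>z\<in>D.
     (\<exists>u. harmonic_on D u \<and> (\<forall>\<zeta>\<in>D - {z}. G \<zeta> z = u \<zeta> - ln (dist \<zeta> z))) \<and>
     (\<forall>p\<in>frontier D. ((\<lambda>\<zeta>. G \<zeta> z) \<longlongrightarrow> 0) (at p within D)) \<and>
     ((\<lambda>\<zeta>. G \<zeta> z) \<longlongrightarrow> 0) (inf at_infinity (principal D)))"

definition is_arg_branch ::
  "'a::topological_space set \<Rightarrow> ('a \<Rightarrow> complex) \<Rightarrow> ('a \<Rightarrow> real) \<Rightarrow> bool" where
  "is_arg_branch S f a \<longleftrightarrow>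
     continuous_on S a \<and> (\<forall>x\<in>S. f x = complex_of_real (cmod (f x)) * cis (a x))"


section \<open>Marked boundary points\<close>

text \<open>A marked boundary point is a prime end, represented by a null chain of crosscuts. Diameters are
  taken in the spherical metric, since \<open>D\<close> may be unbounded and the prime end may lie at \<open>\<infinity>\<close>.
  Crosscuts with finite end points suffice to represent every prime end.\<close>

definition chordal_dist :: "complex \<Rightarrow> complex \<Rightarrow> real" where
  "chordal_dist x y = 2 * cmod (x - y) / (sqrt (1 + (cmod x)\<^sup>2) * sqrt (1 + (cmod y)\<^sup>2))"

definition crosscut :: "complex set \<Rightarrow> complex set \<Rightarrow> bool" where
  "crosscut D C \<longleftrightarrow> (\<exists>g. path g \<and> pathstart g \<in> frontier D \<and> pathfinish g \<in> frontier D \<and>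
     inj_on g {0<..<1} \<and> C = g ` {0<..<1} \<and> C \<subseteq> D)"

text \<open>The part of \<open>D - C n\<close> that contains the later crosscuts.\<close>

definition inner_region :: "complex set \<Rightarrow> (nat \<Rightarrow> complex set) \<Rightarrow> nat \<Rightarrow> complex set" where
  "inner_region D C n = {z. \<exists>y\<in>C (Suc n). connected_component (D - C n) y z}"

definition prime_end :: "complex set \<Rightarrow> (nat \<Rightarrow> complex set) \<Rightarrow> bool" where
  "prime_end D C \<longleftrightarrow>
     (\<forall>n. crosscut D (C n)) \<and>
     (\<forall>n. closure (C n) \<inter> closure (C (Suc n)) = {}) \<and>
     (\<forall>n\<ge>1. C 0 \<subseteq> D - C n \<and> C (Suc n) \<subseteq> D - C n \<and>
        (\<forall>x\<in>C 0. \<forall>y\<in>C (Suc n). \<not> connected_component (D - C n) x y)) \<and>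
     (\<forall>e>0. \<forall>\<^sub>F n in sequentially. \<forall>x\<in>C n. \<forall>y\<in>C n. chordal_dist x y < e)"

definition prime_end_to_infinity ::
  "complex set \<Rightarrow> (nat \<Rightarrow> complex set) \<Rightarrow> (complex \<Rightarrow> complex) \<Rightarrow> bool" where
  "prime_end_to_infinity D C w \<longleftrightarrow> (\<forall>R. \<exists>n. \<forall>z\<in>inner_region D C n. R < cmod (w z))"


section \<open>Local charts\<close>

text \<open>The function \<open>arg (w \<circ> \<phi>\<inverse>)'\<close> is multivalued, and its branch cannot be chosen for all charts
  \<open>\<phi>\<close> at once so that it varies continuously with \<open>\<phi>\<close>, as Lie derivatives require: rotating a chart
  through a full turn changes it by \<open>2\<pi>\<close>. A chart therefore carries a branch of \<open>arg \<phi>'\<close>.\<close>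

datatype chart =
  Chart (cdom: "complex set") (cmap: "complex \<Rightarrow> complex") (carg: "complex \<Rightarrow> real")

definition is_chart :: "complex set \<Rightarrow> chart \<Rightarrow> bool" where
  "is_chart D \<phi> \<longleftrightarrow> open (cdom \<phi>) \<and> cdom \<phi> \<subseteq> D \<and> cmap \<phi> holomorphic_on cdom \<phi> \<and>
     inj_on (cmap \<phi>) (cdom \<phi>) \<and> is_arg_branch (cdom \<phi>) (deriv (cmap \<phi>)) (carg \<phi>)"

definition cinv :: "chart \<Rightarrow> complex \<Rightarrow> complex" where
  "cinv \<phi> = inv_into (cdom \<phi>) (cmap \<phi>)"

definition cimage :: "chart \<Rightarrow> complex set" where
  "cimage \<phi> = cmap \<phi> ` cdom \<phi>"

definition transition :: "chart \<Rightarrow> chart \<Rightarrow> complex \<Rightarrow> complex" where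
  "transition \<phi> \<phi>' z = cmap \<phi>' (cinv \<phi> z)"


section \<open>Correlation functionals\<close>

text \<open>The atom \<open>(\<phi>, j, k, z)\<close> stands for \<open>(\<partial>\<^sup>j \<partial>bar\<^sup>k \<Phi>\<^sub>(\<^sub>0\<^sub>) \<parallel> \<phi>)(z)\<close>, with \<open>z\<close> in the image of the chart
  \<open>\<phi>\<close>; its node is \<open>cinv \<phi> z\<close>. A functional is the family of its coefficients with respect to the
  commutative Wick monomials in the atoms; a Wick exponential has infinitely many nonzero
  coefficients.\<close>

type_synonym atom = "chart \<times> nat \<times> nat \<times> complex"
type_synonym functional = "atom multiset \<Rightarrow> complex"

definition wick_one :: functional where
  "wick_one M = (if M = {#} then 1 else 0)"

definition wick_atom :: "atom \<Rightarrow> functional" where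
  "wick_atom a M = (if M = {#a#} then 1 else 0)"

definition wick_exp :: "complex \<Rightarrow> atom \<Rightarrow> functional" where
  "wick_exp \<alpha> a M = (if set_mset M \<subseteq> {a} then \<alpha> ^ size M / fact (size M) else 0)"

definition wick_prod :: "functional \<Rightarrow> functional \<Rightarrow> functional" where
  "wick_prod X Y M = (\<Sum>A\<in>{A. A \<subseteq># M}. X A * Y (M - A))"

text \<open>Functionals with all nodes in \<open>S\<close>.\<close>

inductive is_functional :: "complex set \<Rightarrow> complex set \<Rightarrow> functional \<Rightarrow> bool" for D S where
  one: "is_functional D S wick_one"
| atom: "\<lbrakk>is_chart D \<phi>; z \<in> cimage \<phi>; cinv \<phi> z \<in> S\<rbrakk> \<Longrightarrow> is_functional D S (wick_atom (\<phi>, j, k, z))"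
| exp: "\<lbrakk>is_chart D \<phi>; z \<in> cimage \<phi>; cinv \<phi> z \<in> S\<rbrakk> \<Longrightarrow> is_functional D S (wick_exp \<alpha> (\<phi>, 0, 0, z))"
| prod: "\<lbrakk>is_functional D S X; is_functional D S Y\<rbrakk> \<Longrightarrow> is_functional D S (wick_prod X Y)"
| add: "\<lbrakk>is_functional D S X; is_functional D S Y\<rbrakk> \<Longrightarrow> is_functional D S (\<lambda>M. X M + Y M)"
| scale: "is_functional D S X \<Longrightarrow> is_functional D S (\<lambda>M. c * X M)"

definition expect :: "functional \<Rightarrow> complex" where
  "expect X = X {#}"

fun pair_expect :: "(complex \<Rightarrow> complex \<Rightarrow> real) \<Rightarrow> atom \<Rightarrow> atom \<Rightarrow> complex" where
  "pair_expect G (\<phi>, j, k, \<zeta>) (\<phi>', l, m, z) =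
     2 * (dz ^^ j) ((dzbar ^^ k) (\<lambda>x. (dz ^^ l) ((dzbar ^^ m)
       (\<lambda>y. complex_of_real (G (cinv \<phi> x) (cinv \<phi>' y)))) z)) \<zeta>"

text \<open>The factors of a Wick monomial, repeated ones being told apart by an index, and the partial
  pairings of the factors of one monomial with those of another.\<close>

definition factors :: "'a multiset \<Rightarrow> ('a \<times> nat) set" where
  "factors M = {(a, i). i < count M a}"

definition pairings :: "'a multiset \<Rightarrow> 'a multiset \<Rightarrow> (('a \<times> nat) \<times> ('a \<times> nat)) set set" where
  "pairings M N = {p. p \<subseteq> factors M \<times> factors N \<and> inj_on fst p \<and> inj_on snd p}"

definition unpaired ::
  "'a multiset \<Rightarrow> 'a multiset \<Rightarrow> (('a \<times> nat) \<times> ('a \<times> nat)) set \<Rightarrow> 'a multiset" where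
  "unpaired M N p = (M - image_mset (\<lambda>(x, y). fst x) (mset_set p)) +
     (N - image_mset (\<lambda>(x, y). fst y) (mset_set p))"

text \<open>Wick's formula, meant for functionals with disjoint node sets. The coefficient of \<open>K\<close> collects
  the partial pairings of all monomials \<open>M\<close> of \<open>X\<close> and \<open>N\<close> of \<open>Y\<close> that leave \<open>K\<close> unpaired; the series
  is infinite, and absolutely convergent, only if both factors contain exponentials.\<close>

definition fmult ::
  "(complex \<Rightarrow> complex \<Rightarrow> real) \<Rightarrow> functional \<Rightarrow> functional \<Rightarrow> functional" where
  "fmult G X Y K = (\<Sum>\<^sub>\<infinity>(M, N)\<in>UNIV. X M * Y N *
     (\<Sum>p\<in>{p \<in> pairings M N. unpaired M N p = K}.
        \<Prod>((a, i), (b, j))\<in>p. pair_expect G a b))"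


section \<open>Fock space fields\<close>

text \<open>The second condition says that a non-random field is local: its values do not change when the
  chart is restricted to a smaller domain.\<close>

definition nonrandom_field :: "complex set \<Rightarrow> (chart \<Rightarrow> complex \<Rightarrow> complex) \<Rightarrow> bool" where
  "nonrandom_field D f \<longleftrightarrow>
     (\<forall>\<phi>. is_chart D \<phi> \<longrightarrow> smooth_on (cimage \<phi>) (f \<phi>)) \<and>
     (\<forall>\<phi> \<phi>'. is_chart D \<phi> \<longrightarrow> is_chart D \<phi>' \<longrightarrow> cdom \<phi>' \<subseteq> cdom \<phi> \<longrightarrow>
        (\<forall>p\<in>cdom \<phi>'. cmap \<phi>' p = cmap \<phi> p \<and> carg \<phi>' p = carg \<phi> p) \<longrightarrow>
        (\<forall>z\<in>cimage \<phi>'. f \<phi>' z = f \<phi> z))"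

text \<open>A field is given by a list of terms, to be added, and a term by its coefficient and a list of
  factors, to be Wick multiplied: \<open>Der j k\<close> is \<open>\<partial>\<^sup>j \<partial>bar\<^sup>k \<Phi>\<^sub>(\<^sub>0\<^sub>)\<close>, and \<open>WExp \<alpha>\<close> is the Wick exponential of
  \<open>\<alpha> \<Phi>\<^sub>(\<^sub>0\<^sub>)\<close>.\<close>

datatype factor = Der nat nat | WExp complex

type_synonym field_term = "(chart \<Rightarrow> complex \<Rightarrow> complex) \<times> factor list"
type_synonym fock = "field_term list"

definition fock_field :: "complex set \<Rightarrow> fock \<Rightarrow> bool" where
  "fock_field D X \<longleftrightarrow> (\<forall>(f, fs)\<in>set X. nonrandom_field D f)"

fun factor_at :: "chart \<Rightarrow> complex \<Rightarrow> factor \<Rightarrow> functional" where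
  "factor_at \<phi> z (Der j k) = wick_atom (\<phi>, j, k, z)"
| "factor_at \<phi> z (WExp \<alpha>) = wick_exp \<alpha> (\<phi>, 0, 0, z)"

text \<open>The functional \<open>(X \<parallel> \<phi>)(z)\<close>.\<close>

definition field_at :: "fock \<Rightarrow> chart \<Rightarrow> complex \<Rightarrow> functional" where
  "field_at X \<phi> z M =
     (\<Sum>(f, fs)\<leftarrow>X. f \<phi> z * foldr (\<lambda>a Y. wick_prod (factor_at \<phi> z a) Y) fs wick_one M)"

definition nonrandom :: "(chart \<Rightarrow> complex \<Rightarrow> complex) \<Rightarrow> fock" where
  "nonrandom f = [(f, [])]"

definition field_scale :: "complex \<Rightarrow> fock \<Rightarrow> fock" where
  "field_scale c X = map (\<lambda>(f, fs). (\<lambda>\<phi> z. c * f \<phi> z, fs)) X"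

definition field_add :: "fock \<Rightarrow> fock \<Rightarrow> fock" where
  "field_add X Y = X @ Y"

fun factor_cnj :: "factor \<Rightarrow> factor" where
  "factor_cnj (Der j k) = Der k j"
| "factor_cnj (WExp \<alpha>) = WExp (cnj \<alpha>)"

definition field_cnj :: "fock \<Rightarrow> fock" where
  "field_cnj X = map (\<lambda>(f, fs). (\<lambda>\<phi> z. cnj (f \<phi> z), map factor_cnj fs)) X"

text \<open>Leibniz rule; the derivative of \<open>WExp \<alpha>\<close> is \<open>\<alpha> \<partial>\<Phi>\<^sub>(\<^sub>0\<^sub>) \<odot> WExp \<alpha>\<close>.\<close>

definition term_d :: "field_term \<Rightarrow> fock" where
  "term_d = (\<lambda>(f, fs). (\<lambda>\<phi>. dz (f \<phi>), fs) #
     map (\<lambda>i. case fs ! i of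
            Der j k \<Rightarrow> (f, fs[i := Der (Suc j) k])
          | WExp \<alpha> \<Rightarrow> (\<lambda>\<phi> z. \<alpha> * f \<phi> z, Der 1 0 # fs)) [0..<length fs])"

definition field_d :: "fock \<Rightarrow> fock" where
  "field_d X = concat (map term_d X)"

definition field_dbar :: "fock \<Rightarrow> fock" where
  "field_dbar X = field_cnj (field_d (field_cnj X))"

definition corr_eq :: "complex set \<Rightarrow> (complex \<Rightarrow> complex \<Rightarrow> real) \<Rightarrow> fock \<Rightarrow> fock \<Rightarrow> bool" where
  "corr_eq D G X Y \<longleftrightarrow>
     (\<forall>\<phi> z Z. is_chart D \<phi> \<longrightarrow> z \<in> cimage \<phi> \<longrightarrow> is_functional D (D - {cinv \<phi> z}) Z \<longrightarrow>
        expect (fmult G (field_at X \<phi> z) Z) = expect (fmult G (field_at Y \<phi> z) Z))"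

definition holomorphic_field :: "complex set \<Rightarrow> (complex \<Rightarrow> complex \<Rightarrow> real) \<Rightarrow> fock \<Rightarrow> bool" where
  "holomorphic_field D G X \<longleftrightarrow> corr_eq D G (field_dbar X) (nonrandom (\<lambda>\<phi> z. 0))"

definition schwarzian :: "(complex \<Rightarrow> complex) \<Rightarrow> complex \<Rightarrow> complex" where
  "schwarzian h z = deriv (\<lambda>x. deriv (deriv h) x / deriv h x) z
     - (1/2) * (deriv (deriv h) z / deriv h z)\<^sup>2"

definition schwarzian_form ::
  "complex set \<Rightarrow> (complex \<Rightarrow> complex \<Rightarrow> real) \<Rightarrow> complex \<Rightarrow> fock \<Rightarrow> bool" where
  "schwarzian_form D G \<mu> X \<longleftrightarrow>
     (\<forall>\<phi> \<phi>' p Z. is_chart D \<phi> \<longrightarrow> is_chart D \<phi>' \<longrightarrow> p \<in> cdom \<phi> \<inter> cdom \<phi>' \<longrightarrow>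
        is_functional D (D - {p}) Z \<longrightarrow>
        (let z = cmap \<phi> p; h = transition \<phi> \<phi>' in
          expect (fmult G (field_at X \<phi> z) Z) =
            (deriv h z)\<^sup>2 * expect (fmult G (field_at X \<phi>' (h z)) Z) + \<mu> * schwarzian h z * expect Z))"

definition quadratic_differential ::
  "complex set \<Rightarrow> (complex \<Rightarrow> complex \<Rightarrow> real) \<Rightarrow> fock \<Rightarrow> bool" where
  "quadratic_differential D G X \<longleftrightarrow> schwarzian_form D G 0 X"


section \<open>Operator product expansion\<close>

text \<open>\<open>C\<close> is the family of coefficients; the expansion starts with the power \<open>- int N\<close>.\<close>

definition ope ::
  "complex set \<Rightarrow> (complex \<Rightarrow> complex \<Rightarrow> real) \<Rightarrow> fock \<Rightarrow> fock \<Rightarrow> nat \<Rightarrow> (int \<Rightarrow> fock) \<Rightarrow> bool" where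
  "ope D G X Y N C \<longleftrightarrow> holomorphic_field D G X \<and> (\<forall>n. fock_field D (C n)) \<and>
     (\<forall>\<phi> z Z. is_chart D \<phi> \<longrightarrow> z \<in> cimage \<phi> \<longrightarrow> is_functional D (D - {cinv \<phi> z}) Z \<longrightarrow>
        (\<forall>\<^sub>F \<zeta> in at z.
          (\<lambda>k. expect (fmult G (field_at (C (int k - int N)) \<phi> z) Z) * (\<zeta> - z) powi (int k - int N))
            sums expect (fmult G (fmult G (field_at X \<phi> \<zeta>) (field_at Y \<phi> z)) Z)))"

text \<open>Determined up to equality in correlations.\<close>

definition ope_mult ::
  "complex set \<Rightarrow> (complex \<Rightarrow> complex \<Rightarrow> real) \<Rightarrow> fock \<Rightarrow> fock \<Rightarrow> fock" where
  "ope_mult D G X Y = (SOME P. \<exists>N C. ope D G X Y N C \<and> P = C 0)"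


section \<open>Lie derivative and stress tensor\<close>

text \<open>\<open>\<psi>\<close> is the flow of \<open>v\<close> on \<open>U\<close> for times \<open>\<bar>t\<bar> < \<epsilon>\<close>; \<open>\<alpha> t\<close> is the branch of \<open>arg (\<psi> t)'\<close> that is
  continuous in time and vanishes at \<open>t = 0\<close>.\<close>

definition local_flow ::
  "complex set \<Rightarrow> (complex \<Rightarrow> complex) \<Rightarrow> complex set \<Rightarrow> real \<Rightarrow>
    (real \<Rightarrow> complex \<Rightarrow> complex) \<Rightarrow> (real \<Rightarrow> complex \<Rightarrow> real) \<Rightarrow> bool" where
  "local_flow N v U \<epsilon> \<psi> \<alpha> \<longleftrightarrow> open U \<and> U \<subseteq> N \<and> 0 < \<epsilon> \<and>
     (\<forall>z\<in>U. \<psi> 0 z = z \<and> \<alpha> 0 z = 0) \<and>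
     (\<forall>t\<in>{-\<epsilon><..<\<epsilon>}. \<psi> t holomorphic_on U \<and> inj_on (\<psi> t) U \<and>
        (\<forall>z\<in>U. \<psi> t z \<in> N \<and> ((\<lambda>s. \<psi> s z) has_vector_derivative v (\<psi> t z)) (at t))) \<and>
     continuous_on ({-\<epsilon><..<\<epsilon>} \<times> U) (\<lambda>(t, z). \<psi> t z) \<and>
     is_arg_branch ({-\<epsilon><..<\<epsilon>} \<times> U) (\<lambda>(t, z). deriv (\<psi> t) z) (\<lambda>(t, z). \<alpha> t z)"

text \<open>The chart \<open>\<phi> \<circ> \<psi>\<^sub>-\<^sub>t\<close> on \<open>\<psi>\<^sub>t U\<close>.\<close>

definition flow_chart ::
  "chart \<Rightarrow> complex set \<Rightarrow> (complex \<Rightarrow> complex) \<Rightarrow> (complex \<Rightarrow> real) \<Rightarrow> chart" where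
  "flow_chart \<phi> U \<psi>t \<alpha>t = Chart (\<psi>t ` U)
     (\<lambda>p. cmap \<phi> (inv_into U \<psi>t p))
     (\<lambda>p. carg \<phi> (inv_into U \<psi>t p) - \<alpha>t (inv_into U \<psi>t p))"

text \<open>A vector field is given by its expression \<open>v\<close> in the identity chart of \<open>D\<close>; being a
  \<open>(-1, 0)\<close>-differential, it reads as follows in the chart \<open>\<phi>\<close>.\<close>

definition vector_at :: "(complex \<Rightarrow> complex) \<Rightarrow> chart \<Rightarrow> complex \<Rightarrow> complex" where
  "vector_at v \<phi> z = deriv (cmap \<phi>) (cinv \<phi> z) * v (cinv \<phi> z)"

text \<open>The integral of \<open>f\<close> against the conjugate differential of \<open>z\<close>.\<close>

definition cnj_contour_integral ::
  "(real \<Rightarrow> complex) \<Rightarrow> (complex \<Rightarrow> complex) \<Rightarrow> complex" where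
  "cnj_contour_integral g f = cnj (contour_integral g (\<lambda>z. cnj (f z)))"

text \<open>\<open>(A, A bar)\<close> is a stress tensor for \<open>X\<close>. The loop around the point is any sufficiently small
  circle, and the Lie derivative is required to exist.\<close>

definition stress_tensor ::
  "complex set \<Rightarrow> (complex \<Rightarrow> complex \<Rightarrow> real) \<Rightarrow> fock \<Rightarrow> fock \<Rightarrow> bool" where
  "stress_tensor D G A X \<longleftrightarrow>
     fock_field D A \<and> holomorphic_field D G A \<and> quadratic_differential D G A \<and>
     (\<forall>N v \<phi> U \<epsilon> \<psi> \<alpha> p Z.
        open N \<longrightarrow> N \<subseteq> D \<longrightarrow> v holomorphic_on N \<longrightarrow> local_flow N v U \<epsilon> \<psi> \<alpha> \<longrightarrow>
        is_chart D \<phi> \<longrightarrow> U \<subseteq> cdom \<phi> \<longrightarrow> p \<in> U \<longrightarrow> is_functional D (D - {p}) Z \<longrightarrow>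
        (let z = cmap \<phi> p in
         \<forall>\<^sub>F r in at_right 0.
          ((\<lambda>t. expect (fmult G (field_at X (flow_chart \<phi> U (\<psi> t) (\<alpha> t)) z) Z))
            has_vector_derivative
             (1 / (2 * pi * \<i>) * contour_integral (circlepath z r)
                (\<lambda>\<eta>. vector_at v \<phi> \<eta> *
                  expect (fmult G (fmult G (field_at A \<phi> \<eta>) (field_at X \<phi> z)) Z))
              - 1 / (2 * pi * \<i>) * cnj_contour_integral (circlepath z r)
                (\<lambda>\<eta>. cnj (vector_at v \<phi> \<eta>) *
                  expect (fmult G (fmult G (field_at (field_cnj A) \<phi> \<eta>) (field_at X \<phi> z)) Z))))
            (at 0)))"

text \<open>The space \<open>\<F>(W)\<close> for \<open>W = (A, A bar)\<close>.\<close>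

definition stress_family ::
  "complex set \<Rightarrow> (complex \<Rightarrow> complex \<Rightarrow> real) \<Rightarrow> fock \<Rightarrow> fock set" where
  "stress_family D G A = {X. fock_field D X \<and> stress_tensor D G A X}"

definition virasoro_field ::
  "complex set \<Rightarrow> (complex \<Rightarrow> complex \<Rightarrow> real) \<Rightarrow> fock \<Rightarrow> fock \<Rightarrow> bool" where
  "virasoro_field D G A T \<longleftrightarrow> T \<in> stress_family D G A \<and>
     (\<exists>f \<mu>. nonrandom_field D f \<and> holomorphic_field D G (nonrandom f) \<and>
        schwarzian_form D G \<mu> (nonrandom f) \<and>
        corr_eq D G (field_add T (field_scale (-1) A)) (nonrandom f))"

definition central_charge ::
  "complex set \<Rightarrow> (complex \<Rightarrow> complex \<Rightarrow> real) \<Rightarrow> fock \<Rightarrow> real \<Rightarrow> bool" where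
  "central_charge D G T c \<longleftrightarrow> schwarzian_form D G (complex_of_real (c / 12)) T"


section \<open>The modified Gaussian free field\<close>

definition gff :: fock where
  "gff = [(\<lambda>\<phi> z. 1, [Der 0 0])]"

text \<open>Given a branch \<open>\<theta>\<close> of \<open>arg w'\<close> in \<open>D\<close>, this is a branch of \<open>arg (w \<circ> \<phi>\<inverse>)'\<close>, because
  \<open>(w \<circ> \<phi>\<inverse>)' = (w' / \<phi>') \<circ> \<phi>\<inverse>\<close>.\<close>

definition arg_field :: "(complex \<Rightarrow> real) \<Rightarrow> chart \<Rightarrow> complex \<Rightarrow> complex" where
  "arg_field \<theta> \<phi> z = complex_of_real (\<theta> (cinv \<phi> z) - carg \<phi> (cinv \<phi> z))"

definition gff_b :: "real \<Rightarrow> (complex \<Rightarrow> real) \<Rightarrow> fock" where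
  "gff_b b \<theta> = field_add gff (field_scale (- 2 * complex_of_real b) (nonrandom (arg_field \<theta>)))"

end

theory Submission
  imports Defs
begin

text \<open>In the coordinate \<open>w\<close> everything is explicit: the Green's function is
  \<open>ln \<bar>w(\<zeta>) - cnj (w(z))\<bar> - ln \<bar>w(\<zeta>) - w(z)\<bar>\<close>, so that contracting \<open>\<partial>\<Phi>\<^sub>(\<^sub>0\<^sub>)(\<eta>)\<close> with a test functional
  gives \<open>w'(\<eta>)\<close> times a function of \<open>w(\<eta>)\<close> that is holomorphic off the nodes. The stress tensor is
  \<open>A = - J\<^sub>0 \<odot> J\<^sub>0 / 2 + i b \<partial>J\<^sub>0 - j J\<^sub>0\<close> with \<open>J\<^sub>0 = \<partial>\<Phi>\<^sub>(\<^sub>0\<^sub>)\<close> and \<open>j = i b w''/w'\<close> the expectation of \<open>J\<close>. The operator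
  product expansion of \<open>J\<close> with itself gives \<open>T = A + c/12 S\<^sub>w\<close>: the two-point function contributes
  \<open>S\<^sub>w/12\<close>, and \<open>i b \<partial>j - j\<^sup>2/2 = - b\<^sup>2 S\<^sub>w\<close>. By Wick's formula the insertion of \<open>A(\<eta>)\<close> into a correlation has
  poles of order at most four in \<open>w(\<eta>) - w(z)\<close>, and the residue formula turns the contour integrals
  into derivatives of \<open>\<nu> = w' v\<close> at \<open>z\<close>; these are also the time derivatives of the Taylor coefficients
  of the flow.\<close>

section \<open>Wick calculus\<close>

text \<open>Two obstacles shape the proof. A product of functionals is an infinite series when both
  factors contain Wick exponentials, so triple products cannot be rearranged freely. But
  \<open>A\<close> and \<open>J\<close> contain no exponentials: multiplication by them is a finite
  combination of Wick multiplications and contractions. Under the expectation these two operations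
  are adjoint, so \<open>A\<close> can be moved from the field \<open>X\<close> to the test
  functional. What remains are the commutators of contractions with the action of \<open>A\<close>,
  and they produce the poles. The second obstacle is the antiholomorphic half of the stress tensor.
  Complex conjugation of functionals turns it into the holomorphic half acting on the conjugate
  functional. The coefficient \<open>j\<close> in \<open>A\<close> is there to cancel the second
  derivative of \<open>w\<close> that \<open>\<partial>J\<^sub>0\<close> produces in a chart, so
  that correlations with \<open>A\<close> are the square of \<open>w'\<close> times an expression in
  the coordinate \<open>w\<close> alone. The central charge is read off from the pole of order four:
  contracting both currents gives \<open>1/2\<close> and the linear part gives
  \<open>- 6 b^2\<close>, together \<open>c/2\<close>.\<close>

definition partial_matchings :: "'x set \<Rightarrow> 'y set \<Rightarrow> ('x \<times> 'y) set set" where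
  "partial_matchings A B = {p. p \<subseteq> A \<times> B \<and> inj_on fst p \<and> inj_on snd p}"

lemma finite_partial_matchings: "finite A \<Longrightarrow> finite B \<Longrightarrow> finite (partial_matchings A B)"
  by (rule finite_subset[of _ "Pow (A \<times> B)"]) (auto simp: partial_matchings_def)

text \<open>The index sets \<open>A\<close> and \<open>B\<close> keep equal atoms apart, while the
  kernel sees only the atoms \<open>f x\<close> and \<open>g y\<close>. The weight \<open>H\<close>
  of the unpaired indices is arbitrary so that an induction can absorb into it an index that stays
  unpaired.\<close>

definition matching_sum ::
  "('a \<Rightarrow> 'b \<Rightarrow> complex) \<Rightarrow> 'x set \<Rightarrow> ('x \<Rightarrow> 'a) \<Rightarrow> 'y set \<Rightarrow> ('y \<Rightarrow> 'b) \<Rightarrow>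
    ('x set \<Rightarrow> 'y set \<Rightarrow> complex) \<Rightarrow> complex" where
  "matching_sum K A f B g H =
     (\<Sum>p\<in>partial_matchings A B. (\<Prod>(x, y)\<in>p. K (f x) (g y)) * H (A - fst ` p) (B - snd ` p))"

text \<open>The new index either stays unpaired or has exactly one partner \<open>y\<close>;
  deleting that pair leaves a matching that avoids \<open>y\<close>.\<close>

lemma partial_matchings_insert:
  assumes "x \<notin> A"
  shows "partial_matchings (insert x A) B =
    partial_matchings A B \<union> (\<Union>y\<in>B. insert (x, y) ` partial_matchings A (B - {y}))" (is "?L = ?R")
proof
  show "?R \<subseteq> ?L"
  proof
    fix p assume "p \<in> ?R"
    then consider "p \<in> partial_matchings A B"
      | y p' where "y \<in> B" "p = insert (x, y) p'" "p' \<in> partial_matchings A (B - {y})" by auto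
    thus "p \<in> ?L"
    proof cases
      case 1 thus ?thesis by (auto simp: partial_matchings_def)
    next
      case 2
      have "x \<notin> fst ` p'" "y \<notin> snd ` p'" using 2 assms by (auto simp: partial_matchings_def)
      thus ?thesis using 2 by (auto simp: partial_matchings_def inj_on_insert)
    qed
  qed
  show "?L \<subseteq> ?R"
  proof
    fix p assume p: "p \<in> ?L"
    show "p \<in> ?R"
    proof (cases "x \<in> fst ` p")
      case False
      have "p \<subseteq> A \<times> B"
      proof
        fix u assume u: "u \<in> p"
        moreover have "p \<subseteq> insert x A \<times> B" using p by (simp add: partial_matchings_def)
        moreover have "fst u \<noteq> x" using u False by force
        ultimately show "u \<in> A \<times> B" by auto
      qed
      thus ?thesis using p by (simp add: partial_matchings_def)
    next
      case True
      then obtain y where y: "(x, y) \<in> p" by auto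
      define p' where "p' = p - {(x, y)}"
      have pp: "p = insert (x, y) p'" "(x, y) \<notin> p'" using y by (auto simp: p'_def)
      have "inj_on fst p" "inj_on snd p" "p \<subseteq> insert x A \<times> B" using p by (auto simp: partial_matchings_def)
      hence "x \<notin> fst ` p'" "y \<notin> snd ` p'" "inj_on fst p'" "inj_on snd p'" "p' \<subseteq> insert x A \<times> B" "y \<in> B"
        using pp by (auto simp: inj_on_insert)
      moreover have "p' \<subseteq> A \<times> (B - {y})"
      proof
        fix u assume u: "u \<in> p'"
        moreover have "fst u \<noteq> x" "snd u \<noteq> y"
          using u \<open>x \<notin> fst ` p'\<close> \<open>y \<notin> snd ` p'\<close> by force+
        ultimately show "u \<in> A \<times> (B - {y})" using \<open>p' \<subseteq> insert x A \<times> B\<close> by auto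
      qed
      ultimately have "p' \<in> partial_matchings A (B - {y})" "y \<in> B" by (simp_all add: partial_matchings_def)
      thus ?thesis using pp by auto
    qed
  qed
qed

text \<open>Wick's recursion on one factor: it survives and is recorded in the weight, or it is
  contracted with one of the factors in \<open>B\<close>.\<close>

lemma matching_sum_insert:
  assumes "finite A" "finite B" "x \<notin> A"
  shows "matching_sum K (insert x A) f B g H =
    matching_sum K A f B g (\<lambda>A' B'. H (insert x A') B') +
    (\<Sum>y\<in>B. K (f x) (g y) * matching_sum K A f (B - {y}) g H)"
proof -
  let ?t = "\<lambda>p. (\<Prod>(x, y)\<in>p. K (f x) (g y)) * H (insert x A - fst ` p) (B - snd ` p)"
  have fin: "\<And>C. finite C \<Longrightarrow> finite (partial_matchings A C)"
    by (rule finite_partial_matchings[OF assms(1)])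
  have "matching_sum K (insert x A) f B g H = sum ?t (partial_matchings A B) +
     sum ?t (\<Union>y\<in>B. insert (x, y) ` partial_matchings A (B - {y}))"
    unfolding matching_sum_def partial_matchings_insert[OF assms(3)]
    by (rule sum.union_disjoint) (use assms fin in \<open>auto simp: partial_matchings_def\<close>)
  also have "sum ?t (partial_matchings A B) = matching_sum K A f B g (\<lambda>A' B'. H (insert x A') B')"
    unfolding matching_sum_def
  proof (rule sum.cong[OF refl])
    fix p assume "p \<in> partial_matchings A B"
    hence "x \<notin> fst ` p" using assms by (auto simp: partial_matchings_def)
    hence "insert x A - fst ` p = insert x (A - fst ` p)" by auto
    thus "?t p = (\<Prod>(x, y)\<in>p. K (f x) (g y)) * H (insert x (A - fst ` p)) (B - snd ` p)" by simp
  qed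
  also have "sum ?t (\<Union>y\<in>B. insert (x, y) ` partial_matchings A (B - {y})) =
     (\<Sum>y\<in>B. sum ?t (insert (x, y) ` partial_matchings A (B - {y})))"
  proof (rule sum.UNION_disjoint)
    show "\<forall>i\<in>B. \<forall>j\<in>B. i \<noteq> j \<longrightarrow> insert (x, i) ` partial_matchings A (B - {i}) \<inter>
       insert (x, j) ` partial_matchings A (B - {j}) = {}"
    proof (intro ballI impI, rule ccontr)
      fix i j assume ij: "i \<noteq> j" and ne: "insert (x, i) ` partial_matchings A (B - {i}) \<inter>
       insert (x, j) ` partial_matchings A (B - {j}) \<noteq> {}"
      then obtain p q where "p \<in> partial_matchings A (B - {i})" "q \<in> partial_matchings A (B - {j})"
        "insert (x, i) p = insert (x, j) q" by auto
      hence "(x, i) \<in> q" "q \<subseteq> A \<times> (B - {j})" using ij by (auto simp: partial_matchings_def)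
      thus False using assms by auto
    qed
  qed (use assms in \<open>auto intro!: finite_imageI fin\<close>)
  also have "\<dots> = (\<Sum>y\<in>B. K (f x) (g y) * matching_sum K A f (B - {y}) g H)"
  proof (rule sum.cong[OF refl])
    fix y assume y: "y \<in> B"
    have nin: "(x, y) \<notin> p" if "p \<in> partial_matchings A (B - {y})" for p
      using that assms by (auto simp: partial_matchings_def)
    have "sum ?t (insert (x, y) ` partial_matchings A (B - {y})) =
      (\<Sum>p\<in>partial_matchings A (B - {y}). ?t (insert (x, y) p))"
      by (rule sum.reindex_cong[OF _ refl refl]) (intro inj_onI, metis Diff_insert_absorb nin)
    also have "\<dots> = (\<Sum>p\<in>partial_matchings A (B - {y}). K (f x) (g y) *
       ((\<Prod>(x, y)\<in>p. K (f x) (g y)) * H (A - fst ` p) (B - {y} - snd ` p)))"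
    proof (rule sum.cong[OF refl])
      fix p assume p: "p \<in> partial_matchings A (B - {y})"
      hence "finite p" using assms by (auto simp: partial_matchings_def intro: finite_subset[of _ "A \<times> (B - {y})"])
      moreover have "insert x A - insert x (fst ` p) = A - fst ` p" using assms by auto
      moreover have "B - insert y (snd ` p) = B - {y} - snd ` p" by auto
      ultimately show "?t (insert (x, y) p) = K (f x) (g y) *
       ((\<Prod>(x, y)\<in>p. K (f x) (g y)) * H (A - fst ` p) (B - {y} - snd ` p))"
        using nin[OF p] by simp
    qed
    finally show "sum ?t (insert (x, y) ` partial_matchings A (B - {y})) =
      K (f x) (g y) * matching_sum K A f (B - {y}) g H"
      by (simp add: matching_sum_def sum_distrib_left)
  qed
  finally show ?thesis .
qed

text \<open>Deleting one of several copies of an atom leaves a gap in the numbering of the remaining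
  copies; this lemma allows them to be renumbered.\<close>

lemma matching_sum_relabel:
  assumes "inj_on s B" "\<And>y. y \<in> B \<Longrightarrow> g' (s y) = g y"
    "\<And>A' B'. B' \<subseteq> B \<Longrightarrow> H' A' (s ` B') = H A' B'"
  shows "matching_sum K A f (s ` B) g' H' = matching_sum K A f B g H"
  unfolding matching_sum_def
proof (rule sum.reindex_bij_witness[where i = "\<lambda>p. map_prod id (inv_into B s) ` p"
      and j = "\<lambda>p. map_prod id s ` p", symmetric])
  fix p assume p: "p \<in> partial_matchings A B"
  hence sub: "p \<subseteq> A \<times> B" and inj: "inj_on fst p" "inj_on snd p" by (auto simp: partial_matchings_def)
  have fst: "fst ` map_prod id s ` p = fst ` p" by force
  have snd: "snd ` map_prod id s ` p = s ` snd ` p" by force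
  have injp: "inj_on (map_prod id s) p"
    using inj(1) unfolding inj_on_def by fastforce
  have "map_prod id (inv_into B s) ` map_prod id s ` p = (\<lambda>x. x) ` p"
    unfolding image_image by (rule image_cong) (use sub assms(1) in auto)
  thus "map_prod id (inv_into B s) ` map_prod id s ` p = p" by simp
  show "map_prod id s ` p \<in> partial_matchings A (s ` B)"
    unfolding partial_matchings_def
  proof (intro CollectI conjI)
    show "map_prod id s ` p \<subseteq> A \<times> s ` B" using sub by auto
    show "inj_on fst (map_prod id s ` p)" using inj(1) unfolding inj_on_def by fastforce
    show "inj_on snd (map_prod id s ` p)"
    proof (rule inj_onI)
      fix u v assume "u \<in> map_prod id s ` p" "v \<in> map_prod id s ` p" "snd u = snd v"
      then obtain a b a' b' where *: "(a, b) \<in> p" "(a', b') \<in> p" "u = (a, s b)" "v = (a', s b')" "s b = s b'"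
        by auto
      hence "b = b'" using sub assms(1) by (auto simp: inj_on_def)
      thus "u = v" using * inj(2) unfolding inj_on_def by fastforce
    qed
  qed
  have "(\<Prod>(x, y)\<in>map_prod id s ` p. K (f x) (g' y)) = (\<Prod>(x, y)\<in>p. K (f x) (g' (s y)))"
    by (subst prod.reindex[OF injp]) (auto simp: case_prod_unfold intro!: prod.cong)
  also have "\<dots> = (\<Prod>(x, y)\<in>p. K (f x) (g y))"
    by (rule prod.cong[OF refl]) (use sub assms(2) in auto)
  finally have pr: "(\<Prod>(x, y)\<in>map_prod id s ` p. K (f x) (g' y)) = (\<Prod>(x, y)\<in>p. K (f x) (g y))" .
  have "s ` B - s ` snd ` p = s ` (B - snd ` p)"
    by (rule inj_on_image_set_diff[symmetric, OF assms(1)]) (use sub in auto)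
  thus "(\<Prod>(x, y)\<in>map_prod id s ` p. K (f x) (g' y)) *
         H' (A - fst ` map_prod id s ` p) (s ` B - snd ` map_prod id s ` p) =
         (\<Prod>(x, y)\<in>p. K (f x) (g y)) * H (A - fst ` p) (B - snd ` p)"
    unfolding pr fst snd using assms(3)[of "B - snd ` p"] by simp
next
  fix p assume p: "p \<in> partial_matchings A (s ` B)"
  hence sub: "p \<subseteq> A \<times> s ` B" and inj: "inj_on fst p" "inj_on snd p" by (auto simp: partial_matchings_def)
  have "map_prod id s ` map_prod id (inv_into B s) ` p = (\<lambda>x. x) ` p"
    unfolding image_image by (rule image_cong) (use sub in \<open>auto simp: f_inv_into_f\<close>)
  thus "map_prod id s ` map_prod id (inv_into B s) ` p = p" by simp
  show "map_prod id (inv_into B s) ` p \<in> partial_matchings A B"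
    unfolding partial_matchings_def
  proof (intro CollectI conjI)
    show "map_prod id (inv_into B s) ` p \<subseteq> A \<times> B" using sub by (auto simp: inv_into_into)
    show "inj_on fst (map_prod id (inv_into B s) ` p)" using inj(1) unfolding inj_on_def by fastforce
    show "inj_on snd (map_prod id (inv_into B s) ` p)"
    proof (rule inj_onI)
      fix u v assume "u \<in> map_prod id (inv_into B s) ` p" "v \<in> map_prod id (inv_into B s) ` p" "snd u = snd v"
      then obtain a b a' b' where *: "(a, b) \<in> p" "(a', b') \<in> p" "u = (a, inv_into B s b)"
        "v = (a', inv_into B s b')" "inv_into B s b = inv_into B s b'"
        by auto
      hence "b = b'" using sub by (meson inv_into_injective mem_Sigma_iff subsetD)
      thus "u = v" using * inj(2) unfolding inj_on_def by fastforce
    qed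
  qed
qed

lemma matching_sum_empty:
  fixes f :: "'x \<Rightarrow> 'a"
  shows "matching_sum K {} f B g H = H {} B"
proof -
  have "partial_matchings ({} :: 'x set) B = {{}}" by (auto simp: partial_matchings_def)
  thus ?thesis by (simp add: matching_sum_def)
qed

text \<open>The pairs are read backwards. This turns statements about the left factor of a product
  into statements about the right one.\<close>

lemma matching_sum_transpose:
  "matching_sum K A f B g H = matching_sum (\<lambda>x y. K y x) B g A f (\<lambda>B' A'. H A' B')"
  unfolding matching_sum_def
proof (rule sum.reindex_bij_witness[where i = converse and j = converse])
  fix p assume p: "p \<in> partial_matchings A B"
  have *: "p\<inverse> = prod.swap ` p" by force
  show "p\<inverse> \<in> partial_matchings B A" using p
    unfolding partial_matchings_def inj_on_def by fastforce
  have "(\<Prod>(x, y)\<in>p\<inverse>. K (f y) (g x)) = (\<Prod>(x, y)\<in>p. K (f x) (g y))"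
    unfolding * by (subst prod.reindex) (auto simp: case_prod_unfold)
  moreover have "fst ` (p\<inverse>) = snd ` p" "snd ` (p\<inverse>) = fst ` p" by force+
  ultimately show "(\<Prod>(x, y)\<in>p\<inverse>. K (f y) (g x)) * H (A - snd ` (p\<inverse>)) (B - fst ` (p\<inverse>)) =
      (\<Prod>(x, y)\<in>p. K (f x) (g y)) * H (A - fst ` p) (B - snd ` p)" by simp
next
  fix p assume p: "p \<in> partial_matchings B A"
  show "p\<inverse> \<in> partial_matchings A B" using p
    unfolding partial_matchings_def inj_on_def by fastforce
qed auto

section \<open>Factors of a multiset and the recursion for pairings\<close>

lemma finite_factors [simp]: "finite (factors M)"
proof -
  have "factors M \<subseteq> Sigma (set_mset M) (\<lambda>a. {..<count M a})"
    by (auto simp: factors_def) (metis count_inI less_zeroE)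
  thus ?thesis by (rule finite_subset) auto
qed

lemma factors_empty [simp]: "factors {#} = {}" by (auto simp: factors_def)

lemma factors_add: "factors (add_mset a M) = insert (a, count M a) (factors M)"
  by (auto simp: factors_def split: if_splits)

lemma image_mset_factors [simp]: "image_mset fst (mset_set (factors M)) = M"
proof (induction M)
  case (add a M)
  have "(a, count M a) \<notin> factors M" by (simp add: factors_def)
  thus ?case using add by (simp add: factors_add)
qed simp

text \<open>Multiset difference becomes set complement because the copies of each atom are numbered;
  the sum over pairings can then be treated as a \<open>matching_sum\<close>.\<close>

lemma unpaired_pairings:
  assumes "p \<in> partial_matchings (factors M) (factors N)"
  shows "unpaired M N p = image_mset fst (mset_set (factors M - fst ` p)) +
     image_mset fst (mset_set (factors N - snd ` p))"
proof -
  have sub: "p \<subseteq> factors M \<times> factors N" and inj: "inj_on fst p" "inj_on snd p"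
    using assms by (auto simp: partial_matchings_def)
  have "image_mset (\<lambda>(x, y). fst x) (mset_set p) = image_mset fst (image_mset fst (mset_set p))"
    by (simp add: image_mset.compositionality o_def case_prod_unfold)
  hence a: "image_mset (\<lambda>(x, y). fst x) (mset_set p) = image_mset fst (mset_set (fst ` p))"
    by (simp add: image_mset_mset_set inj)
  have "image_mset (\<lambda>(x, y). fst y) (mset_set p) = image_mset fst (image_mset snd (mset_set p))"
    by (simp add: image_mset.compositionality o_def case_prod_unfold)
  hence b: "image_mset (\<lambda>(x, y). fst y) (mset_set p) = image_mset fst (mset_set (snd ` p))"
    by (simp add: image_mset_mset_set inj)
  have c: "M - image_mset fst (mset_set S) = image_mset fst (mset_set (factors M - S))"
    if "S \<subseteq> factors M" for S and M :: "'a multiset"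
  proof -
    have "M - image_mset fst (mset_set S) = image_mset fst (mset_set (factors M)) - image_mset fst (mset_set S)"
      by simp
    also have "\<dots> = image_mset fst (mset_set (factors M) - mset_set S)"
      by (rule image_mset_Diff[symmetric]) (use that in \<open>simp add: subset_imp_msubset_mset_set\<close>)
    also have "mset_set (factors M) - mset_set S = mset_set (factors M - S)"
      by (simp add: mset_set_Diff that)
    finally show ?thesis .
  qed
  show ?thesis unfolding unpaired_def a b
    by (subst (1 2) c) (use sub in auto)
qed

definition pairing_sum ::
  "('a \<Rightarrow> 'a \<Rightarrow> complex) \<Rightarrow> 'a multiset \<Rightarrow> 'a multiset \<Rightarrow> 'a multiset \<Rightarrow> complex" where
  "pairing_sum K M N L = (\<Sum>p\<in>{p \<in> pairings M N. unpaired M N p = L}. \<Prod>((a, i), (b, j))\<in>p. K a b)"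

lemma pairing_sum_matching_sum:
  "pairing_sum K M N L = matching_sum K (factors M) fst (factors N) fst
     (\<lambda>A B. of_bool (image_mset fst (mset_set A) + image_mset fst (mset_set B) = L))"
proof -
  have pm: "pairings M N = partial_matchings (factors M) (factors N)"
    by (simp add: pairings_def partial_matchings_def)
  have "pairing_sum K M N L = (\<Sum>p\<in>partial_matchings (factors M) (factors N).
     if unpaired M N p = L then (\<Prod>((a, i), (b, j))\<in>p. K a b) else 0)"
    unfolding pairing_sum_def pm
    by (rule sum.inter_filter) (simp add: finite_partial_matchings)
  also have "\<dots> = (\<Sum>p\<in>partial_matchings (factors M) (factors N).
     (\<Prod>(x, y)\<in>p. K (fst x) (fst y)) * of_bool (image_mset fst (mset_set (factors M - fst ` p)) +
        image_mset fst (mset_set (factors N - snd ` p)) = L))"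
    by (rule sum.cong[OF refl]) (simp add: unpaired_pairings case_prod_unfold)
  finally show ?thesis by (simp add: matching_sum_def)
qed

lemma pairing_sum_transpose: "pairing_sum K M N L = pairing_sum (\<lambda>a b. K b a) N M L"
  unfolding pairing_sum_matching_sum
  by (subst matching_sum_transpose) (simp add: add.commute)

lemma pairing_sum_empty: "pairing_sum K {#} N L = of_bool (N = L)"
  by (simp add: pairing_sum_matching_sum matching_sum_empty)

text \<open>The recursion of \<open>matching_sum_insert\<close> in terms of multisets: the
  \<open>count N b\<close> copies of \<open>b\<close> are interchangeable and contribute equal
  terms.\<close>

lemma pairing_sum_add:
  "pairing_sum K (add_mset a M) N L = (if a \<in># L then pairing_sum K M N (L - {#a#}) else 0) +
     (\<Sum>b\<in>set_mset N. of_nat (count N b) * K a b * pairing_sum K M (N - {#b#}) L)"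
proof -
  let ?H = "\<lambda>L A B. of_bool (image_mset fst (mset_set A) + image_mset fst (mset_set B) = L) :: complex"
  let ?x = "(a, count M a)"
  have nin: "?x \<notin> factors M" by (simp add: factors_def)
  have "pairing_sum K (add_mset a M) N L =
     matching_sum K (factors M) fst (factors N) fst (\<lambda>A B. ?H L (insert ?x A) B) +
     (\<Sum>y\<in>factors N. K a (fst y) * matching_sum K (factors M) fst (factors N - {y}) fst (?H L))"
    unfolding pairing_sum_matching_sum factors_add
    by (subst matching_sum_insert) (use nin in auto)
  also have "matching_sum K (factors M) fst (factors N) fst (\<lambda>A B. ?H L (insert ?x A) B) =
     (if a \<in># L then pairing_sum K M N (L - {#a#}) else 0)"
  proof -
    have *: "?H L (insert ?x (factors M - fst ` p)) B = (if a \<in># L then ?H (L - {#a#}) (factors M - fst ` p) B else 0)"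
      for p B
    proof -
      have "image_mset fst (mset_set (insert ?x (factors M - fst ` p))) =
         add_mset a (image_mset fst (mset_set (factors M - fst ` p)))"
        using nin by simp
      moreover have "add_mset a X + Y = L \<longleftrightarrow> a \<in># L \<and> X + Y = L - {#a#}" for X Y
        by (metis add_mset_remove_trivial insert_DiffM union_iff union_mset_add_mset_left union_single_eq_member)
      ultimately show ?thesis by simp
    qed
    show ?thesis unfolding matching_sum_def pairing_sum_matching_sum * by simp
  qed
  also have "(\<Sum>y\<in>factors N. K a (fst y) * matching_sum K (factors M) fst (factors N - {y}) fst (?H L)) =
     (\<Sum>y\<in>factors N. K a (fst y) * pairing_sum K M (N - {#fst y#}) L)"
  proof (rule sum.cong[OF refl])
    fix y assume y: "y \<in> factors N"
    obtain b i where bi: "y = (b, i)" by (cases y)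
    \<comment> \<open>Sends the index \<open>i\<close> of the shortened numbering to the last index
      of \<open>b\<close>, so that the image misses exactly the deleted factor
      \<open>(b, i)\<close>.\<close>
    define s where "s = (\<lambda>z. if z = (b, i) then (b, count N b - 1) else z)"
    have i: "i < count N b" using y bi by (auto simp: factors_def)
    have inj: "inj_on s (factors (N - {#b#}))"
      using i by (auto simp: s_def inj_on_def factors_def split: if_splits)
    have img: "s ` factors (N - {#b#}) = factors N - {y}"
    proof (intro equalityI subsetI)
      fix z assume "z \<in> s ` factors (N - {#b#})"
      then obtain c k where "z = s (c, k)" "k < count (N - {#b#}) c" by (auto simp: factors_def)
      thus "z \<in> factors N - {y}" using i bi by (auto simp: s_def factors_def split: if_splits)
    next
      fix z assume z: "z \<in> factors N - {y}"
      obtain c k where ck: "z = (c, k)" "k < count N c" using z by (auto simp: factors_def)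
      show "z \<in> s ` factors (N - {#b#})"
      proof (cases "c = b \<and> k = count N b - 1")
        case True
        hence "i \<noteq> count N b - 1" using z ck bi by auto
        hence "(b, i) \<in> factors (N - {#b#})" using i by (auto simp: factors_def)
        moreover have "s (b, i) = z" using True ck by (simp add: s_def)
        ultimately show ?thesis by force
      next
        case False
        hence "z \<in> factors (N - {#b#})" "s z = z" using ck z bi by (auto simp: factors_def s_def)
        thus ?thesis by force
      qed
    qed
    have "matching_sum K (factors M) fst (s ` factors (N - {#b#})) fst (?H L) =
      matching_sum K (factors M) fst (factors (N - {#b#})) fst (?H L)"
    proof (rule matching_sum_relabel[OF inj])
      show "fst (s z) = fst z" for z by (auto simp: s_def)
      fix A' B' assume B': "B' \<subseteq> factors (N - {#b#})"
      have "image_mset fst (mset_set (s ` B')) = image_mset fst (image_mset s (mset_set B'))"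
        using inj B' by (simp add: image_mset_mset_set inj_on_subset)
      also have "\<dots> = image_mset fst (mset_set B')"
        unfolding image_mset.compositionality by (rule image_mset_cong) (auto simp: s_def)
      finally show "?H L A' (s ` B') = ?H L A' B'" by simp
    qed
    thus "K a (fst y) * matching_sum K (factors M) fst (factors N - {y}) fst (?H L) =
       K a (fst y) * pairing_sum K M (N - {#fst y#}) L"
      by (simp add: img bi pairing_sum_matching_sum)
  qed
  also have "\<dots> = (\<Sum>b\<in>set_mset N. of_nat (count N b) * K a b * pairing_sum K M (N - {#b#}) L)"
  proof -
    have f: "factors N = Sigma (set_mset N) (\<lambda>b. {..<count N b})"
      by (auto simp: factors_def) (metis count_inI less_zeroE)
    have "(\<Sum>y\<in>factors N. K a (fst y) * pairing_sum K M (N - {#fst y#}) L) =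
      (\<Sum>(b, i)\<in>Sigma (set_mset N) (\<lambda>b. {..<count N b}). K a b * pairing_sum K M (N - {#b#}) L)"
      unfolding f by (rule sum.cong) auto
    also have "\<dots> = (\<Sum>b\<in>set_mset N. \<Sum>i<count N b. K a b * pairing_sum K M (N - {#b#}) L)"
      by (rule sum.Sigma[symmetric]) auto
    finally show ?thesis by (simp add: mult.assoc)
  qed
  finally show ?thesis .
qed

section \<open>Wick multiplication, differentiation and contraction\<close>

definition atoms_of :: "('a multiset \<Rightarrow> complex) \<Rightarrow> 'a set" where
  "atoms_of X = (\<Union>M\<in>{M. X M \<noteq> 0}. set_mset M)"

lemma atoms_of_subset_iff: "atoms_of X \<subseteq> F \<longleftrightarrow> (\<forall>M. X M \<noteq> 0 \<longrightarrow> set_mset M \<subseteq> F)"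
  by (auto simp: atoms_of_def)

lemma set_mset_subset_atoms_of: "X M \<noteq> 0 \<Longrightarrow> set_mset M \<subseteq> atoms_of X"
  by (auto simp: atoms_of_def)

definition wick_mult :: "'a \<Rightarrow> ('a multiset \<Rightarrow> complex) \<Rightarrow> 'a multiset \<Rightarrow> complex" where
  "wick_mult a X M = (if a \<in># M then X (M - {#a#}) else 0)"

text \<open>If a functional is regarded as a power series in commuting variables, one for each atom,
  this is the partial derivative in the variable \<open>b\<close>.\<close>

definition wick_deriv :: "'a \<Rightarrow> ('a multiset \<Rightarrow> complex) \<Rightarrow> 'a multiset \<Rightarrow> complex" where
  "wick_deriv b X M = of_nat (count M b + 1) * X (add_mset b M)"

text \<open>A directional derivative with constant coefficients \<open>k\<close>. For
  \<open>k = K a\<close> it collects all ways of pairing one extra factor \<open>a\<close> with a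
  factor of \<open>X\<close>.\<close>

definition contract :: "('a \<Rightarrow> complex) \<Rightarrow> ('a multiset \<Rightarrow> complex) \<Rightarrow> 'a multiset \<Rightarrow> complex" where
  "contract k X M = (\<Sum>b\<in>atoms_of X. k b * wick_deriv b X M)"

lemma finite_submsets: "finite {A. A \<subseteq># M}"
proof (induction M)
  case (add a M)
  have "A \<in> {A. A \<subseteq># M} \<union> add_mset a ` {A. A \<subseteq># M}" if "A \<subseteq># add_mset a M" for A
  proof (cases "a \<in># A")
    case True
    then obtain B where "A = add_mset a B" by (metis insert_DiffM)
    thus ?thesis using that by auto
  next
    case False
    have "A \<subseteq># M"
      unfolding subseteq_mset_def
    proof
      fix x show "count A x \<le> count M x"
        using mset_subset_eq_count[OF that, of x] False by (cases "x = a") (auto simp: not_in_iff)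
    qed
    thus ?thesis by simp
  qed
  thus ?case by (intro finite_subset[OF _ finite_UnI[OF add finite_imageI[OF add]]]) blast
qed simp

lemma wick_prod_atom: "wick_prod (wick_atom a) X = wick_mult a X"
proof
  fix M
  have "wick_prod (wick_atom a) X M = (\<Sum>A\<in>{A. A \<subseteq># M}. if A = {#a#} then X (M - {#a#}) else 0)"
    unfolding wick_prod_def wick_atom_def by (rule sum.cong) auto
  also have "\<dots> = (if {#a#} \<subseteq># M then X (M - {#a#}) else 0)"
    by (subst sum.delta) (auto simp: finite_submsets)
  finally show "wick_prod (wick_atom a) X M = wick_mult a X M" by (simp add: wick_mult_def)
qed

lemma wick_mult_add [simp]: "wick_mult a X (add_mset a M) = X M"
  by (simp add: wick_mult_def)

lemma atoms_of_wick_mult: "atoms_of (wick_mult a X) \<subseteq> insert a (atoms_of X)"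
  unfolding atoms_of_subset_iff
  by (auto simp: wick_mult_def atoms_of_def split: if_splits) (metis in_diff_count insert_DiffM insert_noteq_member)

lemma atoms_of_wick_deriv: "atoms_of (wick_deriv b X) \<subseteq> atoms_of X"
  unfolding atoms_of_subset_iff by (fastforce simp: wick_deriv_def atoms_of_def)

lemma wick_deriv_eq_0: "b \<notin> atoms_of X \<Longrightarrow> wick_deriv b X = (\<lambda>_. 0)"
  by (rule ext) (auto simp: wick_deriv_def atoms_of_def)

text \<open>Functionals with different atoms are compared by summing over a common finite
  set.\<close>

lemma contract_superset:
  assumes "finite F" "atoms_of X \<subseteq> F"
  shows "contract k X M = (\<Sum>b\<in>F. k b * wick_deriv b X M)"
  unfolding contract_def
  by (rule sum.mono_neutral_left) (use assms in \<open>auto simp: wick_deriv_eq_0\<close>)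

lemma atoms_of_contract: "atoms_of (contract k X) \<subseteq> atoms_of X"
proof -
  have "set_mset M \<subseteq> atoms_of X" if nz: "contract k X M \<noteq> 0" for M
  proof -
    obtain b where "k b * wick_deriv b X M \<noteq> 0"
      using sum.not_neutral_contains_not_neutral[OF nz[unfolded contract_def]] by blast
    hence "wick_deriv b X M \<noteq> 0" by auto
    thus ?thesis using atoms_of_wick_deriv set_mset_subset_atoms_of by fastforce
  qed
  thus ?thesis by (simp add: atoms_of_subset_iff)
qed

lemma wick_deriv_commute: "wick_deriv a (wick_deriv b X) = wick_deriv b (wick_deriv a X)"
  by (rule ext) (auto simp: wick_deriv_def add_mset_commute)

text \<open>The product rule for the variable \<open>a\<close> times \<open>X\<close>; the extra
  term is the commutator of a creation and an annihilation operator.\<close>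

lemma wick_deriv_mult:
  "wick_deriv b (wick_mult a X) M = wick_mult a (wick_deriv b X) M + of_bool (a = b) * X M"
proof (cases "a = b")
  case True
  thus ?thesis
  proof (cases "b \<in># M")
    case in_M: True
    then obtain M' where "M = add_mset b M'" by (metis insert_DiffM)
    thus ?thesis using True by (simp add: wick_deriv_def wick_mult_def ring_distribs)
  qed (auto simp: wick_deriv_def wick_mult_def count_eq_zero_iff)
next
  case False
  thus ?thesis by (auto simp: wick_deriv_def wick_mult_def)
qed

text \<open>Contractions are derivatives with constant coefficients, so this is the symmetry of
  second derivatives.\<close>

lemma contract_commute:
  assumes "finite (atoms_of X)"
  shows "contract k (contract l X) = contract l (contract k X)"
proof
  fix M
  let ?F = "atoms_of X"
  have *: "contract k (contract l X) M = (\<Sum>a\<in>?F. \<Sum>b\<in>?F. k a * l b * wick_deriv a (wick_deriv b X) M)" for k l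
    unfolding contract_superset[OF assms atoms_of_contract]
    by (rule sum.cong[OF refl])
       (simp add: contract_def wick_deriv_def sum_distrib_left mult_ac)
  show "contract k (contract l X) M = contract l (contract k X) M"
    unfolding * by (subst sum.swap) (simp add: wick_deriv_commute[of _ _ X] mult.commute)
qed

lemma contract_wick_mult:
  assumes "finite (atoms_of X)"
  shows "contract k (wick_mult a X) M = wick_mult a (contract k X) M + k a * X M"
proof -
  let ?F = "insert a (atoms_of X)"
  have F: "finite ?F" using assms by simp
  have "contract k (wick_mult a X) M = (\<Sum>b\<in>?F. k b * (wick_mult a (wick_deriv b X) M + of_bool (a = b) * X M))"
    unfolding contract_superset[OF F atoms_of_wick_mult] wick_deriv_mult ..
  also have "\<dots> = (\<Sum>b\<in>?F. k b * wick_mult a (wick_deriv b X) M) + (\<Sum>b\<in>?F. if b = a then k a * X M else 0)"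
    unfolding ring_distribs sum.distrib by (intro arg_cong2[where f = "(+)"] sum.cong) auto
  also have "(\<Sum>b\<in>?F. if b = a then k a * X M else 0) = k a * X M"
    using F by (subst sum.delta) auto
  also have "(\<Sum>b\<in>?F. k b * wick_mult a (wick_deriv b X) M) = wick_mult a (contract k X) M"
  proof (cases "a \<in># M")
    case True
    thus ?thesis by (simp add: contract_superset[OF F subset_insertI] wick_mult_def)
  qed (simp add: wick_mult_def)
  finally show ?thesis .
qed

lemma contract_linear:
  assumes "finite (atoms_of X)" "finite (atoms_of Y)"
  shows "contract k (\<lambda>M. c * X M + d * Y M) M = c * contract k X M + d * contract k Y M"
proof -
  let ?F = "atoms_of X \<union> atoms_of Y"
  have F: "finite ?F" using assms by simp
  have s: "atoms_of (\<lambda>M. c * X M + d * Y M) \<subseteq> ?F"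
    unfolding atoms_of_subset_iff
  proof (intro allI impI)
    fix M assume "c * X M + d * Y M \<noteq> 0"
    hence "X M \<noteq> 0 \<or> Y M \<noteq> 0" by auto
    thus "set_mset M \<subseteq> ?F" using set_mset_subset_atoms_of by blast
  qed
  show ?thesis
    unfolding contract_superset[OF F s] contract_superset[OF F Un_upper1] contract_superset[OF F Un_upper2]
    by (simp add: sum_distrib_left sum.distrib[symmetric] wick_deriv_def algebra_simps)
qed

section \<open>Wick's formula\<close>

text \<open>The kernel is a parameter because exchanging the two factors replaces it by its
  transpose.\<close>

definition fock_mult where
  "fock_mult K X Y L = (\<Sum>\<^sub>\<infinity>(M, N)\<in>UNIV. X M * Y N * pairing_sum K M N L)"

lemma fmult_fock_mult: "fmult G = fock_mult (pair_expect G)"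
  by (intro ext) (simp add: fmult_def fock_mult_def pairing_sum_def)

text \<open>A sum that does not converge has the value 0 by convention, so the algebraic rules for
  products have to carry this condition.\<close>

definition multipliable where
  "multipliable K X Y L \<longleftrightarrow> (\<lambda>(M, N). X M * Y N * pairing_sum K M N L) summable_on UNIV"

lemma fock_mult_linear_left:
  assumes "multipliable K X Z L" "multipliable K Y Z L"
  shows "fock_mult K (\<lambda>M. c * X M + d * Y M) Z L = c * fock_mult K X Z L + d * fock_mult K Y Z L"
proof -
  have "fock_mult K (\<lambda>M. c * X M + d * Y M) Z L =
     (\<Sum>\<^sub>\<infinity>(M, N)\<in>UNIV. c * (X M * Z N * pairing_sum K M N L) + d * (Y M * Z N * pairing_sum K M N L))"
    unfolding fock_mult_def by (rule infsum_cong) (auto simp: algebra_simps)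
  also have "\<dots> = c * fock_mult K X Z L + d * fock_mult K Y Z L"
    unfolding fock_mult_def case_prod_unfold using assms unfolding multipliable_def case_prod_unfold
    by (subst infsum_add) (auto intro!: summable_on_cmult_right simp: infsum_cmult_right')
  finally show ?thesis .
qed

lemma multipliable_linear_left:
  assumes "multipliable K X Z L" "multipliable K Y Z L"
  shows "multipliable K (\<lambda>M. c * X M + d * Y M) Z L"
proof -
  have "(\<lambda>(M, N). (c * X M + d * Y M) * Z N * pairing_sum K M N L) =
     (\<lambda>p. c * (\<lambda>(M, N). X M * Z N * pairing_sum K M N L) p + d * (\<lambda>(M, N). Y M * Z N * pairing_sum K M N L) p)"
    by (auto simp: algebra_simps)
  thus ?thesis using assms unfolding multipliable_def
    by (auto intro!: summable_on_add summable_on_cmult_right)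
qed

lemma swap_reindex: "(\<lambda>(M, N). h M N) = (\<lambda>(N, M). h M N) \<circ> prod.swap"
  by auto

lemma fock_mult_commute: "fock_mult K X Y L = fock_mult (\<lambda>a b. K b a) Y X L"
proof -
  have "fock_mult K X Y L = infsum ((\<lambda>(N, M). X M * Y N * pairing_sum K M N L) \<circ> prod.swap) UNIV"
    unfolding fock_mult_def by (subst swap_reindex) simp
  also have "\<dots> = infsum (\<lambda>(N, M). X M * Y N * pairing_sum K M N L) (range prod.swap)"
    by (rule infsum_reindex[symmetric]) simp
  finally show ?thesis unfolding fock_mult_def
    by (subst pairing_sum_transpose[symmetric]) (simp add: surj_swap mult_ac)
qed

lemma has_sum_finite_sum:
  fixes f :: "'i \<Rightarrow> 'p \<Rightarrow> complex"
  assumes "finite I" "\<And>i. i \<in> I \<Longrightarrow> (f i has_sum s i) A"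
  shows "((\<lambda>x. \<Sum>i\<in>I. f i x) has_sum (\<Sum>i\<in>I. s i)) A"
  using assms by (induction I rule: finite_induct) (auto intro: has_sum_add)

lemma summable_on_finite_sum:
  fixes f :: "'i \<Rightarrow> 'p \<Rightarrow> complex"
  assumes "finite I" "\<And>i. i \<in> I \<Longrightarrow> f i summable_on A"
  shows "(\<lambda>x. \<Sum>i\<in>I. f i x) summable_on A"
  using has_sum_finite_sum[OF assms(1)] assms(2) unfolding summable_on_def by metis

lemma infsum_finite_sum:
  fixes f :: "'i \<Rightarrow> 'p \<Rightarrow> complex"
  assumes "finite I" "\<And>i. i \<in> I \<Longrightarrow> f i summable_on A"
  shows "infsum (\<lambda>x. \<Sum>i\<in>I. f i x) A = (\<Sum>i\<in>I. infsum (f i) A)"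
  by (rule infsumI, rule has_sum_finite_sum[OF assms(1)]) (use assms(2) in auto)

text \<open>Wick's theorem for one factor: \<open>a\<close> stays unpaired, which is Wick
  multiplication, or is paired with a factor of \<open>Z\<close>, which is contraction. Summability
  is carried along so that the rule can be iterated.\<close>

lemma fock_mult_wick_mult:
  assumes fin: "finite (atoms_of Z)"
    and s1: "\<And>L'. L = add_mset a L' \<Longrightarrow> multipliable K X Z L'"
    and s2: "\<And>b. b \<in> atoms_of Z \<Longrightarrow> multipliable K X (wick_deriv b Z) L"
  shows "fock_mult K (wick_mult a X) Z L = wick_mult a (fock_mult K X Z) L + fock_mult K X (contract (K a) Z) L"
    and "multipliable K (wick_mult a X) Z L"
    and "multipliable K X (contract (K a) Z) L"
proof -
  define T where "T = (\<lambda>(M, N). X M * Z N * pairing_sum K (add_mset a M) N L)"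
  define T0 where "T0 = (\<lambda>(M, N). X M * Z N * (if a \<in># L then pairing_sum K M N (L - {#a#}) else 0))"
  define S where "S = (\<lambda>b (M, N). X M * Z N * (of_nat (count N b) * K a b * pairing_sum K M (N - {#b#}) L))"
  define S' where "S' = (\<lambda>b (M, N). X M * wick_deriv b Z N * pairing_sum K M N L)"
  have T_eq: "T p = T0 p + (\<Sum>b\<in>atoms_of Z. S b p)" for p
  proof -
    obtain M N where p: "p = (M, N)" by (cases p)
    show ?thesis
    proof (cases "Z N = 0")
      case False
      hence sub: "set_mset N \<subseteq> atoms_of Z" by (rule set_mset_subset_atoms_of)
      have "(\<Sum>b\<in>set_mset N. of_nat (count N b) * K a b * pairing_sum K M (N - {#b#}) L) =
        (\<Sum>b\<in>atoms_of Z. of_nat (count N b) * K a b * pairing_sum K M (N - {#b#}) L)"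
        by (rule sum.mono_neutral_left) (use fin sub in \<open>auto simp: not_in_iff\<close>)
      hence "X M * Z N * (\<Sum>b\<in>set_mset N. of_nat (count N b) * K a b * pairing_sum K M (N - {#b#}) L) =
        (\<Sum>b\<in>atoms_of Z. S b p)" by (simp add: S_def p sum_distrib_left)
      thus ?thesis by (simp add: p T_def T0_def pairing_sum_add ring_distribs)
    qed (simp add: p T_def T0_def S_def)
  qed
  \<comment> \<open>Terms without \<open>b\<close> in \<open>N\<close> vanish, so the sum may be
    indexed by \<open>N\<close> with one copy of \<open>b\<close> removed. The factor
    \<open>count N b\<close> then becomes the weight in \<open>wick_deriv\<close>.\<close>
  have img: "S b p = 0" if "p \<notin> range (\<lambda>(M, N). (M, add_mset b N))" for b p
  proof -
    obtain M N where p: "p = (M, N)" by (cases p)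
    have "b \<notin># N" using that unfolding p by (metis (mono_tags, lifting) case_prod_conv insert_DiffM rangeI)
    thus ?thesis by (simp add: S_def p not_in_iff)
  qed
  have inj: "inj (\<lambda>(M :: 'a multiset, N). (M, add_mset b N))" for b
    by (auto simp: inj_on_def)
  have comp: "S b \<circ> (\<lambda>(M, N). (M, add_mset b N)) = (\<lambda>p. K a b * S' b p)" for b
    by (auto simp: S_def S'_def wick_deriv_def fun_eq_iff)
  have S_sum: "S b summable_on UNIV" if "b \<in> atoms_of Z" for b
  proof -
    have "S' b summable_on UNIV" using s2[OF that] by (simp add: multipliable_def S'_def)
    hence "(S b \<circ> (\<lambda>(M, N). (M, add_mset b N))) summable_on UNIV"
      unfolding comp by (rule summable_on_cmult_right)
    hence "S b summable_on range (\<lambda>(M, N). (M, add_mset b N))"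
      by (simp add: summable_on_reindex[OF inj])
    thus ?thesis by (subst summable_on_cong_neutral[where T = "range (\<lambda>(M, N). (M, add_mset b N))" and g = "S b"])
       (use img in auto)
  qed
  have S_inf: "infsum (S b) UNIV = K a b * infsum (S' b) UNIV" for b
  proof -
    have "infsum (S b) UNIV = infsum (S b) (range (\<lambda>(M, N). (M, add_mset b N)))"
      by (rule infsum_cong_neutral) (use img in auto)
    also have "\<dots> = infsum (\<lambda>p. K a b * S' b p) UNIV"
      by (subst infsum_reindex[OF inj]) (simp add: comp)
    finally show ?thesis by (simp add: infsum_cmult_right')
  qed
  have T0_sum: "T0 summable_on UNIV" and T0_inf: "infsum T0 UNIV = wick_mult a (fock_mult K X Z) L"
  proof (atomize (full), cases "a \<in># L")
    case True
    then obtain L' where L: "L = add_mset a L'" by (metis insert_DiffM)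
    show "T0 summable_on UNIV \<and> infsum T0 UNIV = wick_mult a (fock_mult K X Z) L"
      using s1[OF L] by (simp add: T0_def L multipliable_def fock_mult_def)
  next
    case False
    thus "T0 summable_on UNIV \<and> infsum T0 UNIV = wick_mult a (fock_mult K X Z) L"
      by (simp add: T0_def wick_mult_def case_prod_unfold)
  qed
  have T_sum: "T summable_on UNIV"
    unfolding T_eq[abs_def] by (intro summable_on_add summable_on_finite_sum fin T0_sum S_sum)
  have T_inf: "infsum T UNIV = wick_mult a (fock_mult K X Z) L + (\<Sum>b\<in>atoms_of Z. K a b * infsum (S' b) UNIV)"
    unfolding T_eq[abs_def]
    by (subst infsum_add) (auto intro!: summable_on_finite_sum fin T0_sum S_sum simp: infsum_finite_sum[OF fin] S_sum S_inf T0_inf)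
  have inj': "inj (\<lambda>(M, N :: 'a multiset). (add_mset a M, N))"
    by (auto simp: inj_on_def)
  define R where "R = (\<lambda>(M, N). wick_mult a X M * Z N * pairing_sum K M N L)"
  have compR: "R \<circ> (\<lambda>(M, N). (add_mset a M, N)) = T"
    by (auto simp: R_def T_def)
  have imgR: "R p = 0" if "p \<notin> range (\<lambda>(M, N). (add_mset a M, N))" for p
  proof -
    obtain M N where p: "p = (M, N)" by (cases p)
    have "a \<notin># M" using that unfolding p by (metis (mono_tags, lifting) case_prod_conv insert_DiffM rangeI)
    thus ?thesis by (simp add: R_def p wick_mult_def)
  qed
  have R_inf: "infsum R UNIV = infsum T UNIV"
  proof -
    have "infsum R UNIV = infsum R (range (\<lambda>(M, N). (add_mset a M, N)))"
      by (rule infsum_cong_neutral) (use imgR in auto)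
    thus ?thesis by (subst (asm) infsum_reindex[OF inj']) (simp add: compR)
  qed
  have "R summable_on range (\<lambda>(M, N). (add_mset a M, N))"
    by (simp add: summable_on_reindex[OF inj'] compR T_sum)
  hence "R summable_on UNIV"
    by (subst summable_on_cong_neutral[where T = "range (\<lambda>(M, N). (add_mset a M, N))" and g = R])
       (use imgR in auto)
  thus "multipliable K (wick_mult a X) Z L" by (simp add: multipliable_def R_def)
  define Q where "Q = (\<lambda>(M, N). X M * contract (K a) Z N * pairing_sum K M N L)"
  have Q_eq: "Q p = (\<Sum>b\<in>atoms_of Z. K a b * S' b p)" for p
    by (cases p) (simp add: Q_def S'_def contract_def sum_distrib_left sum_distrib_right mult_ac)
  have S'_sum: "S' b summable_on UNIV" if "b \<in> atoms_of Z" for b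
    using s2[OF that] by (simp add: multipliable_def S'_def)
  have "Q summable_on UNIV" unfolding Q_eq[abs_def]
    by (intro summable_on_finite_sum fin summable_on_cmult_right S'_sum)
  thus "multipliable K X (contract (K a) Z) L" by (simp add: multipliable_def Q_def)
  have "infsum Q UNIV = (\<Sum>b\<in>atoms_of Z. K a b * infsum (S' b) UNIV)"
    unfolding Q_eq[abs_def]
    by (subst infsum_finite_sum) (auto intro!: fin summable_on_cmult_right S'_sum simp: infsum_cmult_right')
  hence "infsum R UNIV = wick_mult a (fock_mult K X Z) L + infsum Q UNIV"
    by (simp add: R_inf T_inf)
  thus "fock_mult K (wick_mult a X) Z L = wick_mult a (fock_mult K X Z) L + fock_mult K X (contract (K a) Z) L"
    by (simp add: fock_mult_def R_def Q_def)
qed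

lemma fock_mult_one: "fock_mult K wick_one Z = Z" and multipliable_one: "multipliable K wick_one Z L"
proof -
  have *: "(\<lambda>(M, N). wick_one M * Z N * pairing_sum K M N L) = (\<lambda>p. if p = ({#}, L) then Z L else 0)" for L
    by (auto simp: wick_one_def pairing_sum_empty fun_eq_iff)
  have "infsum (\<lambda>p. if p = ({#} :: atom multiset, L) then Z L else 0) UNIV = infsum (\<lambda>p. Z L) {({#} :: atom multiset, L)}" for L
    by (rule infsum_cong_neutral) auto
  thus "fock_mult K wick_one Z = Z"
    unfolding fock_mult_def * by (intro ext) simp
  have "(\<lambda>p. if p = ({#} :: atom multiset, L) then Z L else 0) summable_on UNIV \<longleftrightarrow>
      (\<lambda>p. Z L) summable_on {({#} :: atom multiset, L)}"
    by (rule summable_on_cong_neutral) auto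
  thus "multipliable K wick_one Z L" unfolding multipliable_def * by simp
qed

text \<open>The product of two Wick exponentials is an infinite series. Its summability is controlled by
  the following growth condition.\<close>

definition wick_bounded :: "('a multiset \<Rightarrow> complex) \<Rightarrow> bool" where
  "wick_bounded X \<longleftrightarrow> finite (atoms_of X) \<and>
     (\<exists>C\<ge>0. \<exists>r\<ge>1. \<forall>M. norm (X M) \<le> C * r ^ size M / fact (size M))"

lemma wick_boundedE:
  assumes "wick_bounded X"
  obtains C r where "C \<ge> 0" "r \<ge> 1" "\<And>M. norm (X M) \<le> C * r ^ size M / fact (size M)"
  using assms unfolding wick_bounded_def by blast

lemma wick_bounded_finite: "wick_bounded X \<Longrightarrow> finite (atoms_of X)"
  by (simp add: wick_bounded_def)

section \<open>Growth bounds for functionals\<close>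

lemma atoms_of_one: "atoms_of wick_one = {}"
  by (auto simp: atoms_of_def wick_one_def split: if_splits)

lemma atoms_of_atom: "atoms_of (wick_atom a) = {a}"
  by (auto simp: atoms_of_def wick_atom_def split: if_splits)

lemma atoms_of_exp: "atoms_of (wick_exp \<alpha> a) \<subseteq> {a}"
  unfolding atoms_of_subset_iff by (simp add: wick_exp_def)

lemma atoms_of_prod: "atoms_of (wick_prod X Y) \<subseteq> atoms_of X \<union> atoms_of Y"
  unfolding atoms_of_subset_iff
proof (intro allI impI)
  fix M assume "wick_prod X Y M \<noteq> 0"
  then obtain A where A: "A \<subseteq># M" "X A * Y (M - A) \<noteq> 0"
    unfolding wick_prod_def by (elim sum.not_neutral_contains_not_neutral) auto
  have "set_mset M = set_mset A \<union> set_mset (M - A)"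
    using A(1) by (metis set_mset_union subset_mset.add_diff_inverse)
  thus "set_mset M \<subseteq> atoms_of X \<union> atoms_of Y"
    using set_mset_subset_atoms_of[of X A] set_mset_subset_atoms_of[of Y "M - A"] A(2) by auto
qed

lemma atoms_of_linear: "atoms_of (\<lambda>M. c * X M + d * Y M) \<subseteq> atoms_of X \<union> atoms_of Y"
  unfolding atoms_of_subset_iff
proof (intro allI impI)
  fix M assume "c * X M + d * Y M \<noteq> 0"
  hence "X M \<noteq> 0 \<or> Y M \<noteq> 0" by auto
  thus "set_mset M \<subseteq> atoms_of X \<union> atoms_of Y" using set_mset_subset_atoms_of by blast
qed

lemma wick_bounded_one: "wick_bounded wick_one"
  unfolding wick_bounded_def
  by (intro conjI exI[of _ 1]) (auto simp: atoms_of_one wick_one_def)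

lemma wick_bounded_atom: "wick_bounded (wick_atom a)"
  unfolding wick_bounded_def
  by (intro conjI exI[of _ 1]) (auto simp: atoms_of_atom wick_atom_def)

lemma wick_boundedI:
  assumes "finite (atoms_of X)" "C \<ge> 0" "r \<ge> 1" "\<And>M. norm (X M) \<le> C * r ^ size M / fact (size M)"
  shows "wick_bounded X"
  using assms unfolding wick_bounded_def by blast

lemma wick_bounded_exp: "wick_bounded (wick_exp \<alpha> a)"
proof (rule wick_boundedI)
  show "finite (atoms_of (wick_exp \<alpha> a))" by (rule finite_subset[OF atoms_of_exp]) simp
  fix M :: "atom multiset"
  have "norm \<alpha> ^ size M \<le> max 1 (norm \<alpha>) ^ size M" by (rule power_mono) auto
  thus "norm (wick_exp \<alpha> a M) \<le> 1 * max 1 (norm \<alpha>) ^ size M / fact (size M)"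
    by (auto simp: wick_exp_def norm_divide norm_power divide_right_mono)
qed auto

lemma card_submsets: "card {A. A \<subseteq># M} \<le> 2 ^ size M"
proof (induction M)
  case (add a M)
  have "{A. A \<subseteq># add_mset a M} \<subseteq> {A. A \<subseteq># M} \<union> add_mset a ` {A. A \<subseteq># M}"
  proof
    fix A assume A: "A \<in> {A. A \<subseteq># add_mset a M}"
    show "A \<in> {A. A \<subseteq># M} \<union> add_mset a ` {A. A \<subseteq># M}"
    proof (cases "a \<in># A")
      case True
      then obtain B where "A = add_mset a B" by (metis insert_DiffM)
      thus ?thesis using A by auto
    next
      case False
      have "A \<subseteq># M"
        unfolding subseteq_mset_def
      proof
        fix x show "count A x \<le> count M x"
          using mset_subset_eq_count[of A "add_mset a M" x] A False by (cases "x = a") (auto simp: not_in_iff)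
      qed
      thus ?thesis by simp
    qed
  qed
  hence "card {A. A \<subseteq># add_mset a M} \<le> card ({A. A \<subseteq># M} \<union> add_mset a ` {A. A \<subseteq># M})"
    by (intro card_mono) (auto simp: finite_submsets)
  also have "\<dots> \<le> card {A. A \<subseteq># M} + card (add_mset a ` {A. A \<subseteq># M})" by (rule card_Un_le)
  also have "\<dots> \<le> card {A. A \<subseteq># M} + card {A. A \<subseteq># M}"
    by (intro add_left_mono card_image_le) (simp add: finite_submsets)
  finally show ?case using add by simp
qed simp

text \<open>Both bounds carry a factorial: \<open>1 / (k! (n - k)!)\<close> is at most
  \<open>2^n / n!\<close>, and a multiset of size \<open>n\<close> has at most \<open>2^n\<close>
  submultisets. Hence the ratio \<open>4 * R\<close>.\<close>

lemma wick_bounded_prod: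
  assumes "wick_bounded X" "wick_bounded Y"
  shows "wick_bounded (wick_prod X Y)"
proof -
  obtain C r where X: "C \<ge> 0" "r \<ge> 1" "\<And>M. norm (X M) \<le> C * r ^ size M / fact (size M)"
    by (rule wick_boundedE[OF assms(1)]) blast
  obtain C' r' where Y: "C' \<ge> 0" "r' \<ge> 1" "\<And>M. norm (Y M) \<le> C' * r' ^ size M / fact (size M)"
    by (rule wick_boundedE[OF assms(2)]) blast
  define R where "R = max r r'"
  have R: "R \<ge> 1" "r \<le> R" "r' \<le> R" using X Y by (auto simp: R_def)
  have "norm (wick_prod X Y M) \<le> (C * C') * (4 * R) ^ size M / fact (size M)" for M
  proof -
    let ?n = "size M"
    have "norm (X A * Y (M - A)) \<le> C * C' * R ^ ?n * 2 ^ ?n / fact ?n" if A: "A \<subseteq># M" for A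
    proof -
      have k: "size A \<le> ?n" "size (M - A) = ?n - size A"
        using A by (auto simp: size_mset_mono size_Diff_submset)
      have choose_le: "real (?n choose size A) \<le> 2 ^ ?n"
        using binomial_le_pow2[of ?n "size A"] by (metis of_nat_le_iff of_nat_numeral of_nat_power)
      have "norm (X A * Y (M - A)) \<le> (C * r ^ size A / fact (size A)) * (C' * r' ^ (?n - size A) / fact (?n - size A))"
        unfolding norm_mult using X Y(3)[of "M - A"] k by (intro mult_mono) auto
      also have "\<dots> \<le> (C * R ^ size A / fact (size A)) * (C' * R ^ (?n - size A) / fact (?n - size A))"
        using X Y R by (intro mult_mono divide_right_mono mult_left_mono power_mono) auto
      also have "\<dots> = C * C' * R ^ ?n * (1 / (fact (size A) * fact (?n - size A)))"
        using k by (simp add: power_add[symmetric])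
      also have "1 / (fact (size A) * fact (?n - size A)) = of_nat (?n choose size A) / (fact ?n :: real)"
        using binomial_fact[OF k(1), where 'a = real] by (simp add: field_simps)
      also have "C * C' * R ^ ?n * (of_nat (?n choose size A) / (fact ?n :: real)) \<le> C * C' * R ^ ?n * (2 ^ ?n / fact ?n)"
        using choose_le X Y R by (intro mult_left_mono divide_right_mono) auto
      finally show ?thesis by simp
    qed
    hence "norm (wick_prod X Y M) \<le> (\<Sum>A\<in>{A. A \<subseteq># M}. C * C' * R ^ ?n * 2 ^ ?n / fact ?n)"
      unfolding wick_prod_def by (intro sum_norm_le) auto
    also have "\<dots> = real (card {A. A \<subseteq># M}) * (C * C' * R ^ ?n * 2 ^ ?n / fact ?n)" by simp
    also have "\<dots> \<le> 2 ^ ?n * (C * C' * R ^ ?n * 2 ^ ?n / fact ?n)"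
    proof (rule mult_right_mono)
      show "real (card {A. A \<subseteq># M}) \<le> 2 ^ ?n"
        using card_submsets[of M] by (metis of_nat_le_iff of_nat_numeral of_nat_power)
    qed (use X Y R in auto)
    also have "\<dots> = (C * C') * (4 * R) ^ ?n / fact ?n"
    proof -
      have "(4 :: real) ^ ?n = 2 ^ ?n * 2 ^ ?n" unfolding power_mult_distrib[symmetric] by simp
      thus ?thesis by (simp add: power_mult_distrib)
    qed
    finally show ?thesis .
  qed
  moreover have "finite (atoms_of (wick_prod X Y))"
    by (rule finite_subset[OF atoms_of_prod]) (use assms in \<open>simp add: wick_bounded_def\<close>)
  ultimately show ?thesis unfolding wick_bounded_def using X Y R
    by (intro conjI exI[of _ "C * C'"] exI[of _ "4 * R"]) auto
qed

lemma wick_bounded_linear: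
  assumes "wick_bounded X" "wick_bounded Y"
  shows "wick_bounded (\<lambda>M. c * X M + d * Y M)"
proof -
  obtain C r where X: "C \<ge> 0" "r \<ge> 1" "\<And>M. norm (X M) \<le> C * r ^ size M / fact (size M)"
    by (rule wick_boundedE[OF assms(1)]) blast
  obtain C' r' where Y: "C' \<ge> 0" "r' \<ge> 1" "\<And>M. norm (Y M) \<le> C' * r' ^ size M / fact (size M)"
    by (rule wick_boundedE[OF assms(2)]) blast
  define R where "R = max r r'"
  have R: "R \<ge> 1" "r \<le> R" "r' \<le> R" using X Y by (auto simp: R_def)
  have "norm (c * X M + d * Y M) \<le> (norm c * C + norm d * C') * R ^ size M / fact (size M)" for M
  proof -
    have "norm (c * X M + d * Y M) \<le> norm c * norm (X M) + norm d * norm (Y M)"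
      by (metis norm_mult norm_triangle_ineq)
    also have "\<dots> \<le> norm c * (C * r ^ size M / fact (size M)) + norm d * (C' * r' ^ size M / fact (size M))"
      using X Y by (intro add_mono mult_left_mono) auto
    also have "\<dots> \<le> norm c * (C * R ^ size M / fact (size M)) + norm d * (C' * R ^ size M / fact (size M))"
      using X Y R by (intro add_mono mult_left_mono divide_right_mono power_mono) auto
    finally show ?thesis by (simp add: algebra_simps add_divide_distrib)
  qed
  moreover have "finite (atoms_of (\<lambda>M. c * X M + d * Y M))"
    by (rule finite_subset[OF atoms_of_linear]) (use assms in \<open>simp add: wick_bounded_def\<close>)
  ultimately show ?thesis unfolding wick_bounded_def using X Y R
    by (intro conjI exI[of _ "norm c * C + norm d * C'"] exI[of _ "R"]) auto
qed

lemma wick_bounded_add: "wick_bounded X \<Longrightarrow> wick_bounded Y \<Longrightarrow> wick_bounded (\<lambda>M. X M + Y M)"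
  using wick_bounded_linear[of X Y 1 1] by simp

lemma wick_bounded_scale: "wick_bounded X \<Longrightarrow> wick_bounded (\<lambda>M. c * X M)"
  using wick_bounded_linear[of X X c 0] by simp

text \<open>The factor \<open>count M b + 1\<close> is absorbed in passing from
  \<open>(n + 1)!\<close> to \<open>n!\<close>.\<close>

lemma wick_bounded_deriv:
  assumes "wick_bounded X"
  shows "wick_bounded (wick_deriv b X)"
proof -
  obtain C r where X: "C \<ge> 0" "r \<ge> 1" "\<And>M. norm (X M) \<le> C * r ^ size M / fact (size M)"
    by (rule wick_boundedE[OF assms(1)]) blast
  have "norm (wick_deriv b X M) \<le> C * r * r ^ size M / fact (size M)" for M
  proof -
    let ?n = "size M"
    have "norm (wick_deriv b X M) = real (count M b + 1) * norm (X (add_mset b M))"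
      by (simp add: wick_deriv_def norm_mult del: of_nat_Suc)
    also have "\<dots> \<le> real (?n + 1) * (C * r ^ Suc ?n / fact (Suc ?n))"
      using X(3)[of "add_mset b M"] count_le_size[of M b] by (intro mult_mono) auto
    also have "\<dots> = C * r * r ^ ?n / fact ?n" by (simp add: field_simps del: of_nat_Suc)
    finally show ?thesis .
  qed
  moreover have "finite (atoms_of (wick_deriv b X))"
    by (rule finite_subset[OF atoms_of_wick_deriv]) (use assms in \<open>simp add: wick_bounded_def\<close>)
  ultimately show ?thesis unfolding wick_bounded_def using X
    by (intro conjI exI[of _ "C * r"] exI[of _ r]) auto
qed

lemma wick_bounded_zero: "wick_bounded (\<lambda>_. 0)"
  unfolding wick_bounded_def by (intro conjI exI[of _ 1]) (auto simp: atoms_of_def)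

lemma wick_bounded_sum:
  "finite I \<Longrightarrow> (\<And>i. i \<in> I \<Longrightarrow> wick_bounded (X i)) \<Longrightarrow> wick_bounded (\<lambda>M. \<Sum>i\<in>I. X i M)"
  by (induction I rule: finite_induct) (auto intro: wick_bounded_add wick_bounded_zero)

lemma wick_bounded_contract:
  assumes "wick_bounded X"
  shows "wick_bounded (contract k X)"
  unfolding contract_def[abs_def] using assms
  by (intro wick_bounded_sum wick_bounded_scale wick_bounded_deriv) (auto simp: wick_bounded_def)

lemma wick_bounded_mult: fixes a :: atom shows "wick_bounded X \<Longrightarrow> wick_bounded (wick_mult a X)"
  using wick_bounded_prod[OF wick_bounded_atom[of a], of X] by (simp add: wick_prod_atom)

section \<open>Convergence of the series in Wick's formula\<close>

lemma norm_pairing_sum_le: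
  assumes "\<And>a b. a \<in># M \<Longrightarrow> b \<in># N \<Longrightarrow> norm (K a b) \<le> \<kappa>"
  shows "norm (pairing_sum K M N {#}) \<le> (if size M = size N then \<kappa> ^ size M * fact (size M) else 0)"
  using assms
proof (induction M arbitrary: N)
  case empty
  thus ?case by (auto simp: pairing_sum_empty)
next
  case (add a M)
  let ?B = "if Suc (size M) = size N then \<kappa> ^ size M * fact (size M) else 0"
  have "norm (pairing_sum K (add_mset a M) N {#}) \<le>
     (\<Sum>b\<in>set_mset N. real (count N b) * (\<kappa> * ?B))"
    unfolding pairing_sum_add set_mset_empty empty_iff if_False add_0
  proof (rule sum_norm_le)
    fix b assume b: "b \<in># N"
    then obtain N' where N: "N = add_mset b N'" by (metis insert_DiffM)
    have Kab: "norm (K a b) \<le> \<kappa>" using add.prems b by simp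
    have "0 \<le> \<kappa>" by (rule order_trans[OF norm_ge_zero Kab])
    have "norm (pairing_sum K M N' {#}) \<le> (if size M = size N' then \<kappa> ^ size M * fact (size M) else 0)"
      by (rule add.IH) (use add.prems N in simp)
    hence "norm (pairing_sum K M (N - {#b#}) {#}) \<le> ?B" by (simp add: N)
    with Kab show "norm (of_nat (count N b) * K a b * pairing_sum K M (N - {#b#}) {#})
       \<le> real (count N b) * (\<kappa> * ?B)"
      unfolding norm_mult mult.assoc by (intro mult_mono) (use \<open>0 \<le> \<kappa>\<close> in auto)
  qed
  also have "\<dots> = real (size N) * (\<kappa> * ?B)"
    by (simp add: size_multiset_overloaded_eq sum_distrib_right)
  also have "\<dots> = (if size (add_mset a M) = size N then \<kappa> ^ size (add_mset a M) * fact (size (add_mset a M)) else 0)"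
    by (cases "size N") auto
  finally show ?case .
qed

lemma summable_on_times:
  fixes f :: "'a \<Rightarrow> real" and g :: "'b \<Rightarrow> real"
  assumes "f summable_on A" "g summable_on B" "\<And>x. f x \<ge> 0" "\<And>x. g x \<ge> 0"
  shows "(\<lambda>(x, y). f x * g y) summable_on A \<times> B"
proof (rule summable_on_SigmaI)
  show "((\<lambda>y. (\<lambda>(x, y). f x * g y) (x, y)) has_sum f x * infsum g B) B" for x
    using assms(2) by (auto intro: has_sum_cmult_right)
qed (use assms in \<open>auto intro: summable_on_cmult_left\<close>)

text \<open>Splitting off the copies of one atom after another turns the sum into a product of
  geometric series.\<close>

lemma summable_on_half_power_size:
  assumes "finite F"
  shows "(\<lambda>M. (1/2 :: real) ^ size M) summable_on {M. set_mset M \<subseteq> F}"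
  using assms
proof (induction F rule: finite_induct)
  case (insert a F)
  let ?h = "\<lambda>(n, M). replicate_mset n a + M"
  have inj: "inj_on ?h (UNIV \<times> {M. set_mset M \<subseteq> F})"
  proof (rule inj_onI)
    fix p q assume p: "p \<in> UNIV \<times> {M. set_mset M \<subseteq> F}" and q: "q \<in> UNIV \<times> {M. set_mset M \<subseteq> F}" and eq: "?h p = ?h q"
    obtain n M m N where pq: "p = (n, M)" "q = (m, N)" by (cases p, cases q)
    have "count M a = 0" "count N a = 0" using p q insert(2) pq by (auto simp: count_eq_zero_iff)
    hence "n = m" using arg_cong[OF eq, of "\<lambda>M. count M a"] pq by simp
    thus "p = q" using eq pq by simp
  qed
  have img: "?h ` (UNIV \<times> {M. set_mset M \<subseteq> F}) = {M. set_mset M \<subseteq> insert a F}"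
  proof (intro equalityI subsetI)
    fix M assume "M \<in> {M. set_mset M \<subseteq> insert a F}"
    moreover have "M = ?h (count M a, filter_mset (\<lambda>x. x \<noteq> a) M)"
      using multiset_partition[of M "\<lambda>x. x = a"] by (simp add: filter_eq_replicate_mset)
    ultimately show "M \<in> ?h ` (UNIV \<times> {M. set_mset M \<subseteq> F})"
      by (intro image_eqI[where x = "(count M a, filter_mset (\<lambda>x. x \<noteq> a) M)"]) auto
  qed (auto split: if_splits)
  have "(\<lambda>(n, M). (1/2 :: real) ^ n * (1/2) ^ size M) summable_on (UNIV :: nat set) \<times> {M. set_mset M \<subseteq> F}"
    by (rule summable_on_times) (use insert in \<open>auto simp: summable_on_UNIV_nonneg_real_iff\<close>)
  also have "(\<lambda>(n, M). (1/2 :: real) ^ n * (1/2) ^ size M) = (\<lambda>M. (1/2) ^ size M) \<circ> ?h"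
    by (auto simp: power_add)
  finally show ?case unfolding img[symmetric] by (subst summable_on_reindex[OF inj])
qed simp

text \<open>Complete pairings exist only between monomials of equal size \<open>n\<close>, and there
  are \<open>n!\<close> of them. Each of the two growth bounds contributes \<open>1 / n!\<close>, so
  one factorial is left over to beat every power.\<close>

lemma multipliable_empty:
  assumes "wick_bounded X" "wick_bounded Y"
  shows "multipliable K X Y {#}"
proof -
  obtain C r where X: "C \<ge> 0" "r \<ge> 1" "\<And>M. norm (X M) \<le> C * r ^ size M / fact (size M)"
    by (rule wick_boundedE[OF assms(1)]) blast
  obtain C' r' where Y: "C' \<ge> 0" "r' \<ge> 1" "\<And>M. norm (Y M) \<le> C' * r' ^ size M / fact (size M)"
    by (rule wick_boundedE[OF assms(2)]) blast
  define A B where "A = {M. set_mset M \<subseteq> atoms_of X}" and "B = {N. set_mset N \<subseteq> atoms_of Y}"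
  have fin: "finite (atoms_of X)" "finite (atoms_of Y)" using assms by (auto simp: wick_bounded_def)
  define \<kappa> where "\<kappa> = (\<Sum>a\<in>atoms_of X. \<Sum>b\<in>atoms_of Y. norm (K a b))"
  have \<kappa>: "norm (K a b) \<le> \<kappa>" if "a \<in> atoms_of X" "b \<in> atoms_of Y" for a b
  proof -
    have "norm (K a b) \<le> (\<Sum>b\<in>atoms_of Y. norm (K a b))"
      by (rule member_le_sum) (use fin that in auto)
    also have "\<dots> \<le> \<kappa>" unfolding \<kappa>_def
      by (rule member_le_sum[where f = "\<lambda>a. \<Sum>b\<in>atoms_of Y. norm (K a b)"]) (use fin that in \<open>auto intro: sum_nonneg\<close>)
    finally show ?thesis .
  qed
  have \<kappa>0: "\<kappa> \<ge> 0" unfolding \<kappa>_def by (intro sum_nonneg) auto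
  \<comment> \<open>The factor 4 leaves \<open>(1/2)^n\<close> for each of the two monomials, which
    pays for the summation over all multisets.\<close>
  define s where "s = 4 * (r * r' * \<kappa>)"
  have s0: "s \<ge> 0" using X Y \<kappa>0 by (simp add: s_def)
  define T where "T = (\<lambda>(M, N). X M * Y N * pairing_sum K M N {#})"
  have bound: "norm (T (M, N)) \<le> (C * C' * exp s) * ((1/2) ^ size M * (1/2) ^ size N)"
    if "M \<in> A" "N \<in> B" for M N
  proof (cases "size M = size N")
    case True
    let ?n = "size N"
    have "norm (T (M, N)) \<le> (C * r ^ ?n / fact ?n) * (C' * r' ^ ?n / fact ?n) * (\<kappa> ^ ?n * fact ?n)"
      unfolding T_def prod.case norm_mult
      using X(3)[of M] Y(3)[of N] norm_pairing_sum_le[of M N K \<kappa>] \<kappa> that True X Y \<kappa>0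
      by (intro mult_mono) (auto simp: A_def B_def subset_iff)
    also have "\<dots> = C * C' * ((r * r' * \<kappa>) ^ ?n / fact ?n)"
      by (simp add: power_mult_distrib field_simps)
    also have "(r * r' * \<kappa>) ^ ?n / fact ?n = (s ^ ?n / fact ?n) * ((1/2) ^ ?n * (1/2) ^ ?n)"
    proof -
      have "r * r' * \<kappa> = s * ((1/2) * (1/2))" by (simp add: s_def)
      hence "(r * r' * \<kappa>) ^ ?n = s ^ ?n * ((1/2) ^ ?n * (1/2) ^ ?n)" by (simp only: power_mult_distrib)
      thus ?thesis by simp
    qed
    also have "C * C' * ((s ^ ?n / fact ?n) * ((1/2) ^ ?n * (1/2) ^ ?n)) \<le> C * C' * (exp s * ((1/2) ^ ?n * (1/2) ^ ?n))"
    proof (intro mult_left_mono mult_right_mono)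
      have "(\<Sum>k\<in>{?n}. s ^ k /\<^sub>R fact k) \<le> exp s"
        unfolding exp_def by (rule sum_le_suminf) (use s0 summable_exp_generic[of s] in auto)
      thus "s ^ ?n / fact ?n \<le> exp s" by (simp add: field_simps)
    qed (use X Y in auto)
    finally show ?thesis using True by (simp add: mult_ac)
  next
    case False
    have "norm (pairing_sum K M N {#}) \<le> 0"
      using norm_pairing_sum_le[of M N K \<kappa>] \<kappa> that False by (auto simp: A_def B_def subset_iff)
    thus ?thesis using X Y by (simp add: T_def)
  qed
  have "(\<lambda>(M, N). (C * C' * exp s) * ((1/2 :: real) ^ size M * (1/2) ^ size N)) summable_on A \<times> B"
    using summable_on_cmult_right[OF summable_on_times[OF summable_on_half_power_size[OF fin(1)] summable_on_half_power_size[OF fin(2)]],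
      of "C * C' * exp s"] by (simp add: A_def B_def case_prod_unfold)
  hence "(\<lambda>p. norm (T p)) summable_on A \<times> B"
    by (rule summable_on_comparison_test) (use bound in auto)
  hence "T summable_on A \<times> B" by (rule abs_summable_summable)
  also have "T summable_on A \<times> B \<longleftrightarrow> T summable_on UNIV"
    by (rule summable_on_cong_neutral) (auto simp: A_def B_def T_def atoms_of_def)
  finally show ?thesis by (simp add: multipliable_def T_def)
qed

section \<open>Expectations of products and adjointness\<close>

definition expect_prod where "expect_prod K X Z = fock_mult K X Z {#}"

lemma expect_prod_linear_left:
  assumes "wick_bounded X" "wick_bounded Y" "wick_bounded Z"
  shows "expect_prod K (\<lambda>M. c * X M + d * Y M) Z = c * expect_prod K X Z + d * expect_prod K Y Z"
  unfolding expect_prod_def by (intro fock_mult_linear_left multipliable_empty assms)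

lemma expect_prod_commute: "expect_prod K X Z = expect_prod (\<lambda>a b. K b a) Z X"
  unfolding expect_prod_def by (rule fock_mult_commute)

lemma expect_prod_linear_right:
  assumes "wick_bounded X" "wick_bounded Y" "wick_bounded Z"
  shows "expect_prod K Z (\<lambda>M. c * X M + d * Y M) = c * expect_prod K Z X + d * expect_prod K Z Y"
  unfolding expect_prod_commute[where K = K and X = Z] by (rule expect_prod_linear_left[OF assms])

lemma expect_prod_one: "expect_prod K wick_one Z = Z {#}"
  by (simp add: expect_prod_def fock_mult_one)

text \<open>In an expectation nothing may stay unpaired, so the term in which \<open>a\<close>
  survives drops out. Wick multiplication and contraction are thus adjoint to each other.\<close>

lemma expect_prod_mult_left:
  assumes "wick_bounded X" "wick_bounded Z"
  shows "expect_prod K (wick_mult a X) Z = expect_prod K X (contract (K a) Z)"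
  unfolding expect_prod_def using fock_mult_wick_mult(1)[where Z = Z and L = "{#}" and K = K and X = X and a = a] assms
  by (simp add: wick_bounded_finite multipliable_empty wick_bounded_deriv wick_mult_def)

lemma expect_prod_mult_right:
  assumes "wick_bounded X" "wick_bounded Z"
  shows "expect_prod K X (wick_mult a Z) = expect_prod K (contract (\<lambda>b. K b a) X) Z"
  by (subst (1 2) expect_prod_commute) (rule expect_prod_mult_left[OF assms(2,1)])

lemma contract_cong: "(\<And>b. b \<in> atoms_of X \<Longrightarrow> k b = l b) \<Longrightarrow> contract k X = contract l X"
  by (rule ext) (simp add: contract_def)

definition wick_mono :: "atom list \<Rightarrow> functional" where
  "wick_mono as = foldr wick_mult as wick_one"

lemma wick_mono_simps [simp]:
  "wick_mono [] = wick_one" "wick_mono (a # as) = wick_mult a (wick_mono as)"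
  by (simp_all add: wick_mono_def)

text \<open>With a finite monomial on the left the factors are stripped off one by one. Hence every
  coefficient of the product converges, not only the expectation, and the product is bounded again.
  This gives triple products a meaning.\<close>

lemma fock_mult_mono:
  assumes "wick_bounded Z"
  shows "multipliable K (wick_mono as) Z L" "wick_bounded (fock_mult K (wick_mono as) Z)"
    "fock_mult K (wick_mono (a # as)) Z =
      (\<lambda>L. wick_mult a (fock_mult K (wick_mono as) Z) L + fock_mult K (wick_mono as) (contract (K a) Z) L)"
proof -
  have 1: "wick_bounded Z \<Longrightarrow> multipliable K (wick_mono as) Z L" for Z L as
  proof (induction as arbitrary: Z L)
    case Nil thus ?case by (simp add: multipliable_one)
  next
    case (Cons a as)
    thus ?case
      by (auto intro!: fock_mult_wick_mult(2) wick_bounded_finite wick_bounded_deriv)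
  qed
  have 2: "fock_mult K (wick_mono (a # as)) Z =
      (\<lambda>L. wick_mult a (fock_mult K (wick_mono as) Z) L + fock_mult K (wick_mono as) (contract (K a) Z) L)"
    if "wick_bounded Z" for Z a as
    using that by (intro ext, simp, intro fock_mult_wick_mult(1)) (auto intro: 1 wick_bounded_finite wick_bounded_deriv)
  have 3: "wick_bounded Z \<Longrightarrow> wick_bounded (fock_mult K (wick_mono as) Z)" for Z as
  proof (induction as arbitrary: Z)
    case Nil thus ?case by (simp add: fock_mult_one)
  next
    case (Cons a as)
    show ?case unfolding 2[OF Cons.prems]
      by (intro wick_bounded_add wick_bounded_mult Cons wick_bounded_contract)
  qed
  show "multipliable K (wick_mono as) Z L" "wick_bounded (fock_mult K (wick_mono as) Z)"
    "fock_mult K (wick_mono (a # as)) Z =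
      (\<lambda>L. wick_mult a (fock_mult K (wick_mono as) Z) L + fock_mult K (wick_mono as) (contract (K a) Z) L)"
    using 1 2 3 assms by blast+
qed

text \<open>Multiplication by an atom is Wick multiplication plus contraction. These two are
  adjoint, so their sum is self-adjoint as soon as the kernel is symmetric between that atom and the
  atoms of \<open>X\<close>.\<close>

lemma expect_prod_fock_mult:
  assumes "wick_bounded X" "wick_bounded Z"
    and "\<And>a b. a \<in> set as \<Longrightarrow> b \<in> atoms_of X \<Longrightarrow> K a b = K b a"
  shows "expect_prod K (fock_mult K (wick_mono as) X) Z = expect_prod K X (fock_mult K (wick_mono as) Z)"
  using assms
proof (induction as arbitrary: X Z)
  case Nil
  thus ?case by (simp add: fock_mult_one)
next
  case (Cons a as)
  note X = Cons.prems(1) and Z = Cons.prems(2)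
  let ?P = "fock_mult K (wick_mono as)"
  have sym: "contract (K a) X = contract (\<lambda>b. K b a) X"
    by (rule contract_cong) (use Cons.prems(3) in auto)
  have IH1: "expect_prod K (?P X) (contract (K a) Z) = expect_prod K X (?P (contract (K a) Z))"
    by (rule Cons.IH[OF X wick_bounded_contract[OF Z]]) (rule Cons.prems(3); simp)
  have IH2: "expect_prod K (?P (contract (K a) X)) Z = expect_prod K (contract (K a) X) (?P Z)"
    by (rule Cons.IH[OF wick_bounded_contract[OF X] Z])
       (rule Cons.prems(3); simp add: subsetD[OF atoms_of_contract])
  have "expect_prod K (fock_mult K (wick_mono (a # as)) X) Z =
    expect_prod K (\<lambda>L. 1 * wick_mult a (?P X) L + 1 * ?P (contract (K a) X) L) Z"
    by (simp add: fock_mult_mono(3)[OF X] del: wick_mono_simps)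
  also have "\<dots> = expect_prod K (wick_mult a (?P X)) Z + expect_prod K (?P (contract (K a) X)) Z"
    by (subst expect_prod_linear_left) (auto intro!: wick_bounded_mult fock_mult_mono(2) wick_bounded_contract X Z)
  also have "\<dots> = expect_prod K X (?P (contract (K a) Z)) + expect_prod K X (wick_mult a (?P Z))"
    by (subst expect_prod_mult_left, (intro fock_mult_mono(2) X Z)+)
       (simp add: IH1 IH2[unfolded sym] expect_prod_mult_right[OF X fock_mult_mono(2)[OF Z]] sym)
  also have "\<dots> = expect_prod K X (\<lambda>L. 1 * wick_mult a (?P Z) L + 1 * ?P (contract (K a) Z) L)"
    by (subst expect_prod_linear_right) (auto intro!: wick_bounded_mult fock_mult_mono(2) wick_bounded_contract X Z)
  also have "\<dots> = expect_prod K X (fock_mult K (wick_mono (a # as)) Z)"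
    by (simp add: fock_mult_mono(3)[OF Z] del: wick_mono_simps)
  finally show ?case .
qed

section \<open>Functionals\<close>

text \<open>The multiplicity of \<open>b\<close> in the enlarged monomial is the sum of its
  multiplicities in \<open>A\<close> and in the complement of \<open>A\<close>; each part gives one
  term of the product rule.\<close>

lemma wick_deriv_prod:
  "wick_deriv b (wick_prod X Y) M = wick_prod (wick_deriv b X) Y M + wick_prod X (wick_deriv b Y) M"
proof -
  let ?N = "add_mset b M"
  have "wick_deriv b (wick_prod X Y) M = (\<Sum>A\<in>{A. A \<subseteq># ?N}. of_nat (count M b + 1) * (X A * Y (?N - A)))"
    unfolding wick_deriv_def wick_prod_def by (rule sum_distrib_left)
  also have "\<dots> = (\<Sum>A\<in>{A. A \<subseteq># ?N}. of_nat (count A b) * X A * Y (?N - A) + of_nat (count (?N - A) b) * X A * Y (?N - A))"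
  proof (rule sum.cong[OF refl])
    fix A assume "A \<in> {A. A \<subseteq># ?N}"
    hence "A \<subseteq># ?N" by simp
    from mset_subset_eq_count[OF this, of b]
    have "count M b + 1 = count A b + count (?N - A) b" unfolding count_diff count_add_mset by (simp only: refl if_True)
    hence *: "(of_nat (count M b + 1) :: complex) = of_nat (count A b) + of_nat (count (?N - A) b)"
      by (simp only: of_nat_add)
    show "of_nat (count M b + 1) * (X A * Y (?N - A)) =
      of_nat (count A b) * X A * Y (?N - A) + of_nat (count (?N - A) b) * X A * Y (?N - A)"
      unfolding * by (simp only: distrib_right mult.assoc)
  qed
  also have "\<dots> = (\<Sum>A\<in>{A. A \<subseteq># ?N}. of_nat (count A b) * X A * Y (?N - A)) +
     (\<Sum>A\<in>{A. A \<subseteq># ?N}. of_nat (count (?N - A) b) * X A * Y (?N - A))" by (rule sum.distrib)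
  also have "(\<Sum>A\<in>{A. A \<subseteq># ?N}. of_nat (count A b) * X A * Y (?N - A)) =
     (\<Sum>A\<in>add_mset b ` {A. A \<subseteq># M}. of_nat (count A b) * X A * Y (?N - A))"
  proof (rule sum.mono_neutral_right)
    show "\<forall>A\<in>{A. A \<subseteq># ?N} - add_mset b ` {A. A \<subseteq># M}. of_nat (count A b) * X A * Y (?N - A) = 0"
    proof
      fix A assume A: "A \<in> {A. A \<subseteq># ?N} - add_mset b ` {A. A \<subseteq># M}"
      have "b \<notin># A"
      proof
        assume "b \<in># A"
        then obtain B where "A = add_mset b B" by (metis insert_DiffM)
        thus False using A by auto
      qed
      thus "of_nat (count A b) * X A * Y (?N - A) = 0" by (simp add: not_in_iff)
    qed
  qed (auto simp: finite_submsets)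
  also have "\<dots> = wick_prod (wick_deriv b X) Y M"
    unfolding wick_prod_def wick_deriv_def by (subst sum.reindex) (auto simp: inj_on_def)
  also have "(\<Sum>A\<in>{A. A \<subseteq># ?N}. of_nat (count (?N - A) b) * X A * Y (?N - A)) =
     (\<Sum>A\<in>{A. A \<subseteq># M}. of_nat (count (?N - A) b) * X A * Y (?N - A))"
  proof (rule sum.mono_neutral_right)
    show "\<forall>A\<in>{A. A \<subseteq># ?N} - {A. A \<subseteq># M}. of_nat (count (?N - A) b) * X A * Y (?N - A) = 0"
    proof
      fix A assume A: "A \<in> {A. A \<subseteq># ?N} - {A. A \<subseteq># M}"
      have "\<not> count A b \<le> count M b"
      proof
        assume *: "count A b \<le> count M b"
        have "A \<subseteq># M" unfolding subseteq_mset_def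
        proof
          fix x show "count A x \<le> count M x"
            using A * mset_subset_eq_count[of A ?N x] by (cases "x = b") (auto simp: count_add_mset)
        qed
        thus False using A by simp
      qed
      hence "count (?N - A) b = 0" by simp
      thus "of_nat (count (?N - A) b) * X A * Y (?N - A) = 0" by simp
    qed
  next
    show "{A. A \<subseteq># M} \<subseteq> {A. A \<subseteq># ?N}"
      using subset_mset.order_trans[OF _ mset_subset_eq_add_left[of M "{#b#}"]] by auto
  qed (auto simp: finite_submsets)
  also have "\<dots> = wick_prod X (wick_deriv b Y) M"
    unfolding wick_prod_def wick_deriv_def
  proof (rule sum.cong[OF refl])
    fix A assume A: "A \<in> {A. A \<subseteq># M}"
    have "?N - A = add_mset b (M - A)" using subset_mset.diff_add_assoc2[of A M "{#b#}"] A by simp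
    thus "of_nat (count (?N - A) b) * X A * Y (?N - A) =
      X A * (of_nat (count (M - A) b + 1) * Y (add_mset b (M - A)))" by simp
  qed
  finally show ?thesis .
qed

lemma wick_prod_sum_left: "wick_prod (\<lambda>M. \<Sum>i\<in>I. c i * X i M) Y M = (\<Sum>i\<in>I. c i * wick_prod (X i) Y M)"
  unfolding wick_prod_def sum_distrib_left sum_distrib_right by (subst sum.swap) (simp add: mult_ac)

lemma wick_prod_sum_right: "wick_prod Y (\<lambda>M. \<Sum>i\<in>I. c i * X i M) M = (\<Sum>i\<in>I. c i * wick_prod Y (X i) M)"
  unfolding wick_prod_def sum_distrib_left sum_distrib_right by (subst sum.swap) (simp add: mult_ac)

lemma contract_prod:
  assumes "finite (atoms_of X)" "finite (atoms_of Y)"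
  shows "contract k (wick_prod X Y) = (\<lambda>M. wick_prod (contract k X) Y M + wick_prod X (contract k Y) M)"
proof
  fix M
  let ?F = "atoms_of X \<union> atoms_of Y"
  have F: "finite ?F" using assms by simp
  have "contract k X = (\<lambda>M. \<Sum>b\<in>?F. k b * wick_deriv b X M)" "contract k Y = (\<lambda>M. \<Sum>b\<in>?F. k b * wick_deriv b Y M)"
    by (intro ext contract_superset F Un_upper1 Un_upper2)+
  thus "contract k (wick_prod X Y) M = wick_prod (contract k X) Y M + wick_prod X (contract k Y) M"
    unfolding contract_superset[OF F atoms_of_prod]
    by (simp add: wick_deriv_prod ring_distribs sum.distrib wick_prod_sum_left wick_prod_sum_right)
qed

lemma contract_one: "contract k wick_one = (\<lambda>M. 0 * wick_one M)"
  by (rule ext) (simp add: contract_def atoms_of_one)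

lemma contract_atom: "contract k (wick_atom a) = (\<lambda>M. k a * wick_one M)"
  by (rule ext) (auto simp: contract_def atoms_of_atom wick_deriv_def wick_atom_def wick_one_def)

text \<open>A Wick exponential is an eigenvector of every contraction. This is why contraction does
  not lead out of the class of functionals.\<close>

lemma contract_exp: "contract k (wick_exp \<alpha> a) = (\<lambda>M. (k a * \<alpha>) * wick_exp \<alpha> a M)"
proof
  fix M
  have *: "wick_deriv a (wick_exp \<alpha> a) M = \<alpha> * wick_exp \<alpha> a M"
  proof (cases "set_mset M \<subseteq> {a}")
    case True
    hence "M = replicate_mset (size M) a" by (auto intro: multiset_eqI simp: set_mset_subset_singletonD)
    hence "count M a = size M" by (metis count_replicate_mset)
    thus ?thesis using True by (simp add: wick_deriv_def wick_exp_def field_simps del: of_nat_Suc)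
  qed (auto simp: wick_deriv_def wick_exp_def)
  show "contract k (wick_exp \<alpha> a) M = (k a * \<alpha>) * wick_exp \<alpha> a M"
    by (subst contract_superset[OF _ atoms_of_exp]) (simp_all add: *)
qed

lemma is_functional_wick_bounded: "is_functional D S Z \<Longrightarrow> wick_bounded Z"
  by (induction rule: is_functional.induct)
     (auto intro: wick_bounded_one wick_bounded_atom wick_bounded_exp wick_bounded_prod wick_bounded_add wick_bounded_scale)

lemma is_functional_contract: "is_functional D S Z \<Longrightarrow> is_functional D S (contract k Z)"
proof (induction rule: is_functional.induct)
  case one
  show ?case unfolding contract_one by (intro is_functional.intros)
next
  case (prod X Y)
  thus ?case by (subst contract_prod)
    (auto intro: is_functional.intros wick_bounded_finite is_functional_wick_bounded)
next
  case (add X Y)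
  have "contract k (\<lambda>M. X M + Y M) = (\<lambda>M. contract k X M + contract k Y M)"
    using contract_linear[of X Y k 1 1] add by (auto simp: wick_bounded_finite is_functional_wick_bounded)
  thus ?case using add by (auto intro: is_functional.intros)
next
  case (scale X c)
  have "contract k (\<lambda>M. c * X M) = (\<lambda>M. c * contract k X M)"
    using contract_linear[of X X k c 0] scale by (auto simp: wick_bounded_finite is_functional_wick_bounded)
  thus ?case using scale by (auto intro: is_functional.intros)
qed (auto simp: contract_atom contract_exp intro: is_functional.intros)

definition valid_atom :: "complex set \<Rightarrow> complex set \<Rightarrow> atom \<Rightarrow> bool" where
  "valid_atom D S = (\<lambda>(\<phi>, j, k, z). is_chart D \<phi> \<and> z \<in> cimage \<phi> \<and> cinv \<phi> z \<in> S)"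

lemma is_functional_mult:
  assumes "valid_atom D S a" "is_functional D S Z"
  shows "is_functional D S (wick_mult a Z)"
  using assms by (cases a) (auto simp: valid_atom_def wick_prod_atom[symmetric] intro: is_functional.intros)

lemma is_functional_atoms: "is_functional D S Z \<Longrightarrow> a \<in> atoms_of Z \<Longrightarrow> valid_atom D S a"
proof (induction rule: is_functional.induct)
  case (exp \<phi> z \<alpha>)
  thus ?case using atoms_of_exp[of \<alpha> "(\<phi>, 0, 0, z)"] by (auto simp: valid_atom_def)
next
  case (prod X Y)
  thus ?case using atoms_of_prod[of X Y] by auto
next
  case (add X Y)
  thus ?case using atoms_of_linear[of 1 X 1 Y] by auto
next
  case (scale X c)
  thus ?case using atoms_of_linear[of c X 0 X] by auto
qed (auto simp: atoms_of_one atoms_of_atom valid_atom_def)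

lemma is_functional_mono: "is_functional D S Z \<Longrightarrow> S \<subseteq> S' \<Longrightarrow> is_functional D S' Z"
  by (induction rule: is_functional.induct) (auto intro: is_functional.intros)

text \<open>Since the nodes are finitely many, a point that is not a node may be moved slightly, for
  instance by a flow, without meeting one.\<close>

lemma is_functional_finite_nodes:
  "is_functional D S Z \<Longrightarrow> \<exists>F. finite F \<and> F \<subseteq> S \<and> is_functional D F Z"
proof (induction rule: is_functional.induct)
  case one
  show ?case by (intro exI[of _ "{}"]) (auto intro: is_functional.intros)
next
  case (atom \<phi> z j k)
  thus ?case by (intro exI[of _ "{cinv \<phi> z}"]) (auto intro: is_functional.intros)
next
  case (exp \<phi> z \<alpha>)
  thus ?case by (intro exI[of _ "{cinv \<phi> z}"]) (auto intro: is_functional.intros)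
next
  case (prod X Y)
  then obtain F F' where "finite F" "F \<subseteq> S" "is_functional D F X" "finite F'" "F' \<subseteq> S" "is_functional D F' Y" by auto
  thus ?case by (intro exI[of _ "F \<union> F'"]) (auto intro: is_functional.intros is_functional_mono)
next
  case (add X Y)
  then obtain F F' where "finite F" "F \<subseteq> S" "is_functional D F X" "finite F'" "F' \<subseteq> S" "is_functional D F' Y" by auto
  thus ?case by (intro exI[of _ "F \<union> F'"]) (auto intro: is_functional.intros is_functional_mono)
next
  case (scale X c)
  thus ?case by (auto intro: is_functional.intros)
qed

lemma is_functional_fock_mult_mono:
  assumes "\<And>a. a \<in> set as \<Longrightarrow> valid_atom D S a" "is_functional D S Z"
  shows "is_functional D S (fock_mult K (wick_mono as) Z)"
  using assms
proof (induction as arbitrary: Z)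
  case (Cons a as)
  show ?case unfolding fock_mult_mono(3)[OF is_functional_wick_bounded[OF Cons.prems(2)]]
    by (intro is_functional.add is_functional_mult Cons is_functional_contract) (use Cons.prems in auto)
qed (simp add: fock_mult_one)

section \<open>Wirtinger calculus\<close>

lemma frechet_derivative_cong:
  fixes f g :: "complex \<Rightarrow> complex"
  assumes "eventually (\<lambda>x. f x = g x) (nhds z)"
  shows "frechet_derivative f (at z) = frechet_derivative g (at z)"
proof -
  have *: "(g has_derivative f') (at z)"
    if "(f has_derivative f') (at z)" "eventually (\<lambda>x. f x = g x) (nhds z)" for f g :: "complex \<Rightarrow> complex" and f'
    by (rule has_derivative_transform_eventually[OF that(1)])
       (use that(2) eventually_nhds_x_imp_x[OF that(2)] in \<open>auto simp: eventually_at_filter elim: eventually_mono\<close>)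
  have "eventually (\<lambda>x. g x = f x) (nhds z)" using assms by (auto elim: eventually_mono)
  hence "(f has_derivative f') (at z) \<longleftrightarrow> (g has_derivative f') (at z)" for f'
    using *[of f _ g] *[of g _ f] assms by blast
  thus ?thesis unfolding frechet_derivative_def by simp
qed

lemma dz_cong: "eventually (\<lambda>x. f x = g x) (nhds z) \<Longrightarrow> dz f z = dz g z"
  and dzbar_cong: "eventually (\<lambda>x. f x = g x) (nhds z) \<Longrightarrow> dzbar f z = dzbar g z"
  by (simp_all add: dz_def dzbar_def frechet_derivative_cong)

lemma dz_pow_cong:
  "eventually (\<lambda>x. f x = g x) (nhds z) \<Longrightarrow> (dz ^^ j) f z = (dz ^^ j) g z"
proof (induction j arbitrary: z)
  case 0 thus ?case by (auto dest: eventually_nhds_x_imp_x)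
next
  case (Suc j)
  have "eventually (\<lambda>x. (dz ^^ j) f x = (dz ^^ j) g x) (nhds z)"
    using iffD2[OF eventually_eventually Suc.prems] by eventually_elim (rule Suc.IH)
  thus ?case by (simp add: dz_cong)
qed

lemma dzbar_pow_cong:
  "eventually (\<lambda>x. f x = g x) (nhds z) \<Longrightarrow> (dzbar ^^ j) f z = (dzbar ^^ j) g z"
proof (induction j arbitrary: z)
  case 0 thus ?case by (auto dest: eventually_nhds_x_imp_x)
next
  case (Suc j)
  have "eventually (\<lambda>x. (dzbar ^^ j) f x = (dzbar ^^ j) g x) (nhds z)"
    using iffD2[OF eventually_eventually Suc.prems] by eventually_elim (rule Suc.IH)
  thus ?case by (simp add: dzbar_cong)
qed

lemma dz_dzbar_pow_cong:
  assumes "eventually (\<lambda>x. f x = g x) (nhds z)"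
  shows "(dz ^^ j) ((dzbar ^^ k) f) z = (dz ^^ j) ((dzbar ^^ k) g) z"
proof (rule dz_pow_cong)
  show "eventually (\<lambda>x. (dzbar ^^ k) f x = (dzbar ^^ k) g x) (nhds z)"
    using iffD2[OF eventually_eventually assms] by eventually_elim (rule dzbar_pow_cong)
qed

lemma wirtinger_at:
  assumes "(f has_field_derivative f') (at z)" "(g has_field_derivative g') (at z)"
  shows "dz (\<lambda>x. f x + cnj (g x)) z = f'" "dzbar (\<lambda>x. f x + cnj (g x)) z = cnj g'"
    "((\<lambda>x. f x + cnj (g x)) has_derivative (\<lambda>v. f' * v + cnj (g' * v))) (at z)"
proof -
  show d: "((\<lambda>x. f x + cnj (g x)) has_derivative (\<lambda>v. f' * v + cnj (g' * v))) (at z)"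
    using assms unfolding has_field_derivative_def
    by (intro has_derivative_add bounded_linear.has_derivative[OF bounded_linear_cnj]) auto
  have *: "frechet_derivative (\<lambda>x. f x + cnj (g x)) (at z) = (\<lambda>v. f' * v + cnj (g' * v))"
    using frechet_derivative_at[OF d] by simp
  show "dz (\<lambda>x. f x + cnj (g x)) z = f'" "dzbar (\<lambda>x. f x + cnj (g x)) z = cnj g'"
    unfolding dz_def dzbar_def * by (simp_all add: algebra_simps)
qed

text \<open>All functions differentiated here are locally sums of a holomorphic and an
  antiholomorphic function. On these, mixed derivatives vanish and iterated Wirtinger derivatives
  reduce to iterated complex ones.\<close>

lemma wirtinger_power:
  assumes S: "open S" and f: "f holomorphic_on S" and g: "g holomorphic_on S"
    and h: "\<And>x. x \<in> S \<Longrightarrow> h x = f x + cnj (g x)" and "z \<in> S"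
  shows "(dz ^^ j) ((dzbar ^^ k) h) z =
    (if k = 0 then (deriv ^^ j) f z else 0) + (if j = 0 then cnj ((deriv ^^ k) g z) else 0)"
proof -
  have ev: "eventually (\<lambda>x. p x = q x) (nhds x)" if "\<And>x. x \<in> S \<Longrightarrow> p x = q x" "x \<in> S" for p q :: "complex \<Rightarrow> complex" and x
    using eventually_nhds_in_open[OF S that(2)] by eventually_elim (rule that(1))
  have 1: "(dzbar ^^ k) h x = (if k = 0 then f x else 0) + cnj ((deriv ^^ k) g x)" if "x \<in> S" for x
    using that
  proof (induction k arbitrary: x)
    case (Suc k)
    have "(dzbar ^^ Suc k) h x = dzbar (\<lambda>x. (if k = 0 then f x else 0) + cnj ((deriv ^^ k) g x)) x"
      using Suc by (simp, intro dzbar_cong ev) auto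
    also have "\<dots> = cnj ((deriv ^^ Suc k) g x)"
    proof (rule wirtinger_at)
      show "((\<lambda>x. if k = 0 then f x else 0) has_field_derivative (if k = 0 then deriv f x else 0)) (at x)"
        using holomorphic_derivI[OF f S Suc.prems] by auto
    qed (rule has_field_derivative_higher_deriv[OF g S Suc.prems])
    finally show ?case by simp
  qed (simp add: h)
  have "(dz ^^ j) ((dzbar ^^ k) h) x =
    (if k = 0 then (deriv ^^ j) f x else 0) + cnj (if j = 0 then (deriv ^^ k) g x else 0)" if "x \<in> S" for x
    using that
  proof (induction j arbitrary: x)
    case 0 thus ?case by (simp add: 1)
  next
    case (Suc j)
    have "(dz ^^ Suc j) ((dzbar ^^ k) h) x =
       dz (\<lambda>x. (if k = 0 then (deriv ^^ j) f x else 0) + cnj (if j = 0 then (deriv ^^ k) g x else 0)) x"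
      using Suc by (simp, intro dz_cong ev) auto
    also have "\<dots> = (if k = 0 then (deriv ^^ Suc j) f x else 0)"
    proof (rule wirtinger_at)
      show "((\<lambda>x. if k = 0 then (deriv ^^ j) f x else 0) has_field_derivative
          (if k = 0 then (deriv ^^ Suc j) f x else 0)) (at x)"
        using has_field_derivative_higher_deriv[OF f S Suc.prems] by auto
      show "((\<lambda>x. if j = 0 then (deriv ^^ k) g x else 0) has_field_derivative
          (if j = 0 then (deriv ^^ Suc k) g x else 0)) (at x)"
        using has_field_derivative_higher_deriv[OF g S Suc.prems] by auto
    qed
    finally show ?case by simp
  qed
  from this[OF \<open>z \<in> S\<close>] show ?thesis by simp
qed

lemma smooth_on_local:
  assumes "\<And>z. z \<in> S \<Longrightarrow> \<exists>U f g. open U \<and> z \<in> U \<and> f holomorphic_on U \<and> g holomorphic_on U \<and>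
     (\<forall>x\<in>U. h x = f x + cnj (g x))"
  shows "smooth_on S h"
  unfolding smooth_on_def differentiable_on_def
proof (intro allI ballI)
  fix j k :: nat and z assume "z \<in> S"
  then obtain U f g where U: "open U" "z \<in> U" "f holomorphic_on U" "g holomorphic_on U"
    "\<And>x. x \<in> U \<Longrightarrow> h x = f x + cnj (g x)" using assms by metis
  let ?f = "\<lambda>z. if k = 0 then (deriv ^^ j) f z else 0"
  let ?g = "\<lambda>z. if j = 0 then (deriv ^^ k) g z else 0"
  have "(?f has_field_derivative (if k = 0 then (deriv ^^ Suc j) f z else 0)) (at z)"
    using has_field_derivative_higher_deriv[OF U(3,1,2)] by auto
  moreover have "(?g has_field_derivative (if j = 0 then (deriv ^^ Suc k) g z else 0)) (at z)"
    using has_field_derivative_higher_deriv[OF U(4,1,2)] by auto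
  ultimately have "(\<lambda>z. ?f z + cnj (?g z)) differentiable (at z)"
    using wirtinger_at(3) unfolding differentiable_def by blast
  moreover have "(dz ^^ j) ((dzbar ^^ k) h) x = ?f x + cnj (?g x)" if "x \<in> U" for x
    using wirtinger_power[OF U(1,3,4,5) that] by auto
  ultimately have "(dz ^^ j) ((dzbar ^^ k) h) differentiable (at z)"
    unfolding differentiable_def
    by (metis (no_types, lifting) U(1) U(2) has_derivative_transform_within_open)
  thus "(dz ^^ j) ((dzbar ^^ k) h) differentiable at z within S"
    by (rule differentiable_at_withinI)
qed

lemma smooth_on_holomorphic: "open S \<Longrightarrow> f holomorphic_on S \<Longrightarrow> smooth_on S f"
  by (rule smooth_on_local, rule exI[of _ S], rule exI[of _ f], rule exI[of _ "\<lambda>_. 0"]) auto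

lemma dz_holomorphic: "open S \<Longrightarrow> f holomorphic_on S \<Longrightarrow> z \<in> S \<Longrightarrow> dz f z = deriv f z"
  and dzbar_holomorphic: "open S \<Longrightarrow> f holomorphic_on S \<Longrightarrow> z \<in> S \<Longrightarrow> dzbar f z = 0"
  using wirtinger_at(1,2)[of f "deriv f z" z "\<lambda>_. 0" 0] by (auto dest: holomorphic_derivI)

lemma dz_cnj_holomorphic: "open S \<Longrightarrow> f holomorphic_on S \<Longrightarrow> z \<in> S \<Longrightarrow> dz (\<lambda>x. cnj (f x)) z = 0"
  using wirtinger_at(1)[of "\<lambda>_. 0" 0 z f "deriv f z"] by (auto dest: holomorphic_derivI)

lemma dz_const [simp]: "dz (\<lambda>_. c) = (\<lambda>_. 0)"
  by (rule ext) (simp add: dz_def)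

section \<open>Complex analysis\<close>

lemma open_vimage_holomorphic:
  "f holomorphic_on S \<Longrightarrow> open S \<Longrightarrow> open B \<Longrightarrow> open (f -` B \<inter> S)"
  using continuous_on_open_vimage[of S f] holomorphic_on_imp_continuous_on by blast

lemma has_vector_derivative_transform_nhds:
  assumes "eventually (\<lambda>t. f t = g t) (nhds x)" "(g has_vector_derivative d) (at x)"
  shows "(f has_vector_derivative d) (at x)"
proof -
  have "(f has_vector_derivative d) (at x) = (g has_vector_derivative d) (at x)"
    by (rule has_vector_derivative_cong_ev) (use assms(1) eventually_nhds_x_imp_x[OF assms(1)] in simp_all)
  thus ?thesis using assms(2) by simp
qed

section \<open>Conjugation, dependence on a parameter, and residues\<close>

lemma cnj_vimage_open: "open S \<Longrightarrow> open (cnj -` S)"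
  by (intro open_vimage continuous_intros)

lemma holomorphic_on_cnj_cnj:
  assumes "f holomorphic_on S" "open S"
  shows "(\<lambda>x. cnj (f (cnj x))) holomorphic_on (cnj -` S)"
proof -
  have "x \<in> cnj ` (cnj -` S)" if "x \<in> S" for x
    by (rule image_eqI[where x = "cnj x"]) (use that in auto)
  hence "cnj ` (cnj -` S) = S" by auto
  thus ?thesis using holomorphic_on_compose_cnj_cnj[of f "cnj -` S"] assms
    by (simp add: o_def cnj_vimage_open)
qed

lemma higher_deriv_cnj_cnj:
  assumes "f holomorphic_on S" "open S" "cnj z \<in> S"
  shows "(deriv ^^ n) (\<lambda>x. cnj (f (cnj x))) z = cnj ((deriv ^^ n) f (cnj z))"
  using assms(3)
proof (induction n arbitrary: z)
  case (Suc n)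
  let ?g = "(deriv ^^ n) f"
  have "(deriv ^^ Suc n) (\<lambda>x. cnj (f (cnj x))) z = deriv (\<lambda>x. cnj (?g (cnj x))) z"
    using eventually_nhds_in_open[OF cnj_vimage_open[OF assms(2)], of z] Suc
    by (simp, intro deriv_cong_ev) (auto elim!: eventually_mono)
  also have "\<dots> = cnj (deriv ?g (cnj z))"
  proof (rule DERIV_imp_deriv)
    have "(?g has_field_derivative deriv ?g (cnj z)) (at (cnj z))"
      by (rule holomorphic_derivI[OF holomorphic_higher_deriv[OF assms(1,2)] assms(2) Suc.prems])
    from has_field_derivative_cnj_cnj[OF this]
    show "((\<lambda>x. cnj (?g (cnj x))) has_field_derivative cnj (deriv ?g (cnj z))) (at z)"
      by (simp add: o_def)
  qed
  finally show ?case by simp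
qed simp

text \<open>With \<open>c x\<close> read as the inverse of an increment, \<open>q x\<close> is a
  difference quotient. If these converge uniformly in \<open>y\<close>, Weierstrass' theorem lets
  the \<open>y\<close>-derivatives pass to the limit.\<close>

lemma higher_deriv_param_limit:
  assumes "uniform_limit (ball y0 r) q g F" "F \<noteq> bot" "r > 0"
    and "eventually (\<lambda>x. q x = (\<lambda>y. c x * (f x y - h y))) F"
    and "eventually (\<lambda>x. f x holomorphic_on ball y0 r) F" "h holomorphic_on ball y0 r"
  shows "((\<lambda>x. c x * ((deriv ^^ n) (f x) y0 - (deriv ^^ n) h y0)) \<longlongrightarrow> (deriv ^^ n) g y0) F"
proof -
  have "((\<lambda>x. (deriv ^^ n) (q x) y0) \<longlongrightarrow> (deriv ^^ n) g y0) F"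
  proof (rule higher_deriv_complex_uniform_limit[OF assms(1) _ assms(2)])
    show "eventually (\<lambda>x. q x holomorphic_on ball y0 r) F"
      using assms(4,5) by eventually_elim (auto intro!: holomorphic_intros assms(6))
  qed (use assms(3) in auto)
  moreover have "eventually (\<lambda>x. (deriv ^^ n) (q x) y0 = c x * ((deriv ^^ n) (f x) y0 - (deriv ^^ n) h y0)) F"
    using assms(4,5)
  proof eventually_elim
    case (elim x)
    have "(deriv ^^ n) (\<lambda>y. c x * (f x y - h y)) y0 = c x * (deriv ^^ n) (\<lambda>y. f x y - h y) y0"
      by (rule higher_deriv_cmult[of _ "ball y0 r"]) (use elim assms in \<open>auto intro!: holomorphic_intros\<close>)
    also have "(deriv ^^ n) (\<lambda>y. f x y - h y) y0 = (deriv ^^ n) (f x) y0 - (deriv ^^ n) h y0"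
      by (rule higher_deriv_diff[of _ "ball y0 r"]) (use elim assms in auto)
    finally show ?case using elim by simp
  qed
  ultimately show ?thesis by (rule Lim_transform_eventually)
qed

text \<open>The parameter is complex, with \<open>e\<close> the identity, or real, with \<open>e\<close> the embedding.\<close>

lemma higher_deriv_param:
  fixes f :: "'p::euclidean_space \<Rightarrow> complex \<Rightarrow> complex" and e :: "'p \<Rightarrow> complex"
  assumes e: "bounded_linear e" "\<And>h. norm (e h) = norm h" and R: "R > 0" and T: "open T" "y0 \<in> T"
    and d: "\<And>x y. x \<in> ball x0 R \<Longrightarrow> y \<in> T \<Longrightarrow> ((\<lambda>x. f x y) has_derivative (\<lambda>h. e h * fx x y)) (at x)"
    and c: "continuous_on (ball x0 R \<times> T) (\<lambda>(x, y). fx x y)"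
    and h: "\<And>x. x \<in> ball x0 R \<Longrightarrow> f x holomorphic_on T"
  shows "((\<lambda>x. (deriv ^^ n) (f x) y0) has_derivative (\<lambda>h. e h * (deriv ^^ n) (fx x0) y0)) (at x0)"
proof -
  interpret e: bounded_linear e by (rule e(1))
  obtain r where r: "r > 0" "cball y0 r \<subseteq> T" using T open_contains_cball by blast
  have "ball y0 r \<subseteq> T" using r by (auto simp: subset_iff)
  hence hol: "f x holomorphic_on ball y0 r" if "x \<in> ball x0 R" for x
    using holomorphic_on_subset[OF h[OF that]] by blast
  have quot: "norm (inverse (e (x - x0)) * u - v) = norm (u - e (x - x0) * v) / norm (x - x0)" if "x \<noteq> x0" for x u v
  proof -
    have "e (x - x0) \<noteq> 0" using e(2)[of "x - x0"] that by auto
    hence "inverse (e (x - x0)) * u - v = (u - e (x - x0) * v) / e (x - x0)" by (simp add: field_simps)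
    thus ?thesis by (simp add: norm_divide e(2))
  qed
  have lim: "uniform_limit (ball y0 r) (\<lambda>x y. inverse (e (x - x0)) * (f x y - f x0 y)) (fx x0) (at x0)"
    unfolding uniform_limit_iff
  proof (intro allI impI)
    fix \<epsilon> :: real assume \<epsilon>: "\<epsilon> > 0"
    \<comment> \<open>Compactness makes \<open>\<delta>\<close> independent of
      \<open>y\<close>.\<close>
    have "uniformly_continuous_on (cball x0 (R/2) \<times> cball y0 r) (\<lambda>(x, y). fx x y)"
      by (rule compact_uniformly_continuous)
         (use R r in \<open>auto intro!: continuous_on_subset[OF c] compact_Times\<close>)
    then obtain \<delta> where \<delta>: "\<delta> > 0" "\<And>p q. p \<in> cball x0 (R/2) \<times> cball y0 r \<Longrightarrow> q \<in> cball x0 (R/2) \<times> cball y0 r \<Longrightarrow>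
       dist q p < \<delta> \<Longrightarrow> dist (case q of (x, y) \<Rightarrow> fx x y) (case p of (x, y) \<Rightarrow> fx x y) < \<epsilon>/2"
      unfolding uniformly_continuous_on_def using \<epsilon> by (metis half_gt_zero)
    let ?B = "ball x0 (min \<delta> (R/2))"
    have "eventually (\<lambda>x. x \<in> ?B - {x0}) (at x0)"
      using \<delta> R by (intro eventually_at_in_open) auto
    thus "\<forall>\<^sub>F x in at x0. \<forall>y\<in>ball y0 r. dist (inverse (e (x - x0)) * (f x y - f x0 y)) (fx x0 y) < \<epsilon>"
    proof eventually_elim
      case (elim x)
      show ?case
      proof
        fix y assume y: "y \<in> ball y0 r"
        hence yT: "y \<in> T" "y \<in> cball y0 r" using r by auto
        \<comment> \<open>The mean value inequality for \<open>f\<close> minus its linear part at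
          \<open>x0\<close>, whose derivative is small uniformly in \<open>y\<close>.\<close>
        have "norm ((f x y - e x * fx x0 y) - (f x0 y - e x0 * fx x0 y)) \<le> \<epsilon>/2 * norm (x - x0)"
        proof (rule differentiable_bound[where S = ?B and f = "\<lambda>x. f x y - e x * fx x0 y" and x = x and y = x0 and f' = "\<lambda>t h. e h * fx t y - e h * fx x0 y"])
          fix t assume t: "t \<in> ?B"
          show "((\<lambda>x. f x y - e x * fx x0 y) has_derivative (\<lambda>h. e h * fx t y - e h * fx x0 y)) (at t within ?B)"
            by (rule has_derivative_at_withinI[OF has_derivative_diff[OF d has_derivative_mult_left[OF bounded_linear_imp_has_derivative[OF e(1)]]]])
               (use t R yT in auto)
          have "norm (fx t y - fx x0 y) \<le> \<epsilon>/2"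
            using \<delta>(2)[of "(x0, y)" "(t, y)"] t yT R by (auto simp: dist_Pair_Pair dist_norm norm_minus_commute)
          hence "norm (e h * fx t y - e h * fx x0 y) \<le> \<epsilon>/2 * norm h" for h
            unfolding right_diff_distrib[symmetric] norm_mult e(2) mult.commute[of "norm h"] by (rule mult_right_mono) simp
          thus "onorm (\<lambda>h. e h * fx t y - e h * fx x0 y) \<le> \<epsilon>/2" using \<epsilon> by (intro onorm_bound) auto
        qed (use elim \<delta>(1) R in auto)
        hence "norm (f x y - f x0 y - e (x - x0) * fx x0 y) \<le> \<epsilon>/2 * norm (x - x0)"
          by (simp add: e.diff algebra_simps)
        hence "norm (inverse (e (x - x0)) * (f x y - f x0 y) - fx x0 y) \<le> \<epsilon>/2"
          using elim by (subst quot) (auto simp: divide_le_eq)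
        thus "dist (inverse (e (x - x0)) * (f x y - f x0 y)) (fx x0 y) < \<epsilon>" using \<epsilon> by (simp add: dist_norm)
      qed
    qed
  qed
  have "((\<lambda>x. inverse (e (x - x0)) * ((deriv ^^ n) (f x) y0 - (deriv ^^ n) (f x0) y0)) \<longlongrightarrow> (deriv ^^ n) (fx x0) y0) (at x0)"
  proof (rule higher_deriv_param_limit[OF lim _ r(1)])
    have "eventually (\<lambda>x. x \<in> ball x0 R - {x0}) (at x0)" using R by (intro eventually_at_in_open) auto
    thus "\<forall>\<^sub>F x in at x0. f x holomorphic_on ball y0 r"
      by eventually_elim (rule hol, auto)
  qed (use hol[of x0] R in auto)
  hence "((\<lambda>x. norm (inverse (e (x - x0)) * ((deriv ^^ n) (f x) y0 - (deriv ^^ n) (f x0) y0) - (deriv ^^ n) (fx x0) y0)) \<longlongrightarrow> 0) (at x0)"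
    by (simp add: tendsto_norm_zero_iff LIM_zero_iff)
  hence "((\<lambda>x. norm ((deriv ^^ n) (f x) y0 - (deriv ^^ n) (f x0) y0 - e (x - x0) * (deriv ^^ n) (fx x0) y0) / norm (x - x0)) \<longlongrightarrow> 0) (at x0)"
    by (rule Lim_transform_eventually) (auto intro: eventually_mono[OF eventually_neq_at_within[of x0]] simp: quot)
  thus ?thesis
    unfolding has_derivative_iff_norm by (auto intro: bounded_linear_mult_const e(1) bounded_linear_compose[OF bounded_linear_mult_left])
qed

lemma higher_deriv_param_complex:
  fixes f :: "complex \<Rightarrow> complex \<Rightarrow> complex"
  assumes e: "e > 0" and T: "open T" "y0 \<in> T"
    and d: "\<And>x y. x \<in> ball x0 e \<Longrightarrow> y \<in> T \<Longrightarrow> ((\<lambda>x. f x y) has_field_derivative fx x y) (at x)"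
    and c: "continuous_on (ball x0 e \<times> T) (\<lambda>(x, y). fx x y)"
    and h: "\<And>x. x \<in> ball x0 e \<Longrightarrow> f x holomorphic_on T"
  shows "((\<lambda>x. (deriv ^^ n) (f x) y0) has_field_derivative (deriv ^^ n) (fx x0) y0) (at x0)"
proof -
  have d': "((\<lambda>x. f x y) has_derivative (\<lambda>h. h * fx x y)) (at x)" if "x \<in> ball x0 e" "y \<in> T" for x y
    using d[OF that] by (simp only: has_field_derivative_def mult_commute_abs)
  show ?thesis
    using higher_deriv_param[where e = "\<lambda>h. h" and f = f and fx = fx, OF bounded_linear_ident refl e T d' c h]
    by (simp only: has_field_derivative_def mult_commute_abs)
qed

lemma higher_deriv_param_real:
  fixes f :: "real \<Rightarrow> complex \<Rightarrow> complex"
  assumes e: "e > 0" and T: "open T" "y0 \<in> T"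
    and d: "\<And>t y. \<bar>t\<bar> < e \<Longrightarrow> y \<in> T \<Longrightarrow> ((\<lambda>t. f t y) has_vector_derivative fx t y) (at t)"
    and c: "continuous_on ({-e<..<e} \<times> T) (\<lambda>(t, y). fx t y)"
    and h: "\<And>t. \<bar>t\<bar> < e \<Longrightarrow> f t holomorphic_on T"
  shows "((\<lambda>t. (deriv ^^ n) (f t) y0) has_vector_derivative (deriv ^^ n) (fx 0) y0) (at 0)"
  unfolding has_vector_derivative_def scaleR_conv_of_real
proof (rule higher_deriv_param[where e = complex_of_real and f = f and fx = fx, OF bounded_linear_of_real _ e T])
  show "continuous_on (ball 0 e \<times> T) (\<lambda>(t, y). fx t y)" using c by (simp add: ball_eq_greaterThanLessThan)
qed (use d h in \<open>auto simp: has_vector_derivative_def scaleR_conv_of_real\<close>)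

text \<open>Cauchy's formula in the coordinate \<open>W\<close>. Since \<open>W\<close> does not map
  circles to circles, the simple pole is treated in the variable \<open>x\<close>, dividing by the
  zero-free quotient of \<open>W x - W z\<close> by \<open>x - z\<close>; higher poles are reduced
  to it by integration by parts.\<close>

lemma contour_integral_pullback_pole:
  assumes W: "W holomorphic_on ball z R" and r: "0 < r" "r < R"
    and inj: "\<And>x. x \<in> ball z R \<Longrightarrow> x \<noteq> z \<Longrightarrow> W x \<noteq> W z" and W': "deriv W z \<noteq> 0"
    and N: "N holomorphic_on X" "open X" "W ` ball z R \<subseteq> X"
  shows "((\<lambda>x. deriv W x * N (W x) / (W x - W z) ^ Suc n) has_contour_integral
     (2 * of_real pi * \<i> * (deriv ^^ n) N (W z) / fact n)) (circlepath z r)"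
  using N(1)
proof (induction n arbitrary: N)
  case 0
  define Q where "Q = (\<lambda>x. if x = z then deriv W z else (W x - W z) / (x - z))"
  have Q: "Q holomorphic_on ball z R" unfolding Q_def
    by (rule pole_lemma[OF W]) (use r in auto)
  have Q0: "Q x \<noteq> 0" if "x \<in> ball z R" for x using inj[OF that] W' by (auto simp: Q_def)
  have NW: "(\<lambda>x. N (W x)) holomorphic_on ball z R"
    using holomorphic_on_compose_gen[OF W 0 N(3)] by (simp add: o_def)
  let ?f = "\<lambda>x. deriv W x * N (W x) / Q x"
  have f: "?f holomorphic_on ball z R"
    using Q0 by (intro holomorphic_intros holomorphic_deriv W Q NW) auto
  have "((\<lambda>u. ?f u / (u - z)) has_contour_integral (2 * of_real pi * \<i> * ?f z)) (circlepath z r)"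
    by (rule Cauchy_integral_circlepath)
       (use r f in \<open>auto intro!: holomorphic_on_imp_continuous_on intro: holomorphic_on_subset\<close>)
  moreover have "?f u / (u - z) = deriv W u * N (W u) / (W u - W z) ^ Suc 0" if "u \<in> path_image (circlepath z r)" for u
  proof -
    have "u \<noteq> z" using that r by auto
    thus ?thesis by (simp add: Q_def)
  qed
  moreover have "?f z = N (W z)" using W' by (simp add: Q_def)
  ultimately show ?case by (auto elim!: has_contour_integral_eq)
next
  case (Suc n)
  have dN: "deriv N holomorphic_on X" using Suc.prems N(2) by (rule holomorphic_deriv)
  \<comment> \<open>\<open>P'\<close> is the derivative of \<open>P\<close>, so its integral over
    the closed circle vanishes. This trades one order of the pole for one derivative of
    \<open>N\<close>.\<close>
  define P where "P = (\<lambda>x. N (W x) / (W x - W z) ^ Suc n)"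
  define P' where "P' = (\<lambda>x. deriv W x * deriv N (W x) / (W x - W z) ^ Suc n -
      of_nat (Suc n) * (deriv W x * N (W x) / (W x - W z) ^ Suc (Suc n)))"
  have zero: "(P' has_contour_integral (P (pathfinish (circlepath z r)) - P (pathstart (circlepath z r)))) (circlepath z r)"
  proof (rule contour_integral_primitive[where S = "ball z R - {z}"])
    fix x assume x: "x \<in> ball z R - {z}"
    have nz: "W x - W z \<noteq> 0" using inj x by auto
    have dW: "(W has_field_derivative deriv W x) (at x)"
      by (rule holomorphic_derivI[OF W]) (use x in auto)
    have "(N has_field_derivative deriv N (W x)) (at (W x))"
      by (rule holomorphic_derivI[OF Suc.prems N(2)]) (use x N(3) in auto)
    from DERIV_chain2[OF this dW] have dNW: "((\<lambda>x. N (W x)) has_field_derivative deriv N (W x) * deriv W x) (at x)" .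
    have dpow: "((\<lambda>x. (W x - W z) ^ Suc n) has_field_derivative of_nat (Suc n) * (W x - W z) ^ n * deriv W x) (at x)"
      by (rule derivative_eq_intros dW refl)+ simp
    have "(P has_field_derivative (deriv N (W x) * deriv W x * (W x - W z) ^ Suc n -
       N (W x) * (of_nat (Suc n) * (W x - W z) ^ n * deriv W x)) / ((W x - W z) ^ Suc n * (W x - W z) ^ Suc n)) (at x)"
      unfolding P_def by (rule DERIV_divide[OF dNW dpow]) (use nz in simp)
    also have "(deriv N (W x) * deriv W x * (W x - W z) ^ Suc n -
       N (W x) * (of_nat (Suc n) * (W x - W z) ^ n * deriv W x)) / ((W x - W z) ^ Suc n * (W x - W z) ^ Suc n) = P' x"
      unfolding P'_def using nz by (simp add: divide_simps del: of_nat_Suc) (simp add: algebra_simps del: of_nat_Suc)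
    finally show "(P has_field_derivative P' x) (at x within ball z R - {z})"
      by (rule has_field_derivative_at_within)
  qed (use r in auto)
  hence zero: "(P' has_contour_integral 0) (circlepath z r)" by simp
  have IH: "((\<lambda>x. deriv W x * deriv N (W x) / (W x - W z) ^ Suc n) has_contour_integral
     (2 * of_real pi * \<i> * (deriv ^^ n) (deriv N) (W z) / fact n)) (circlepath z r)"
    by (rule Suc.IH[OF dN])
  have "((\<lambda>x. inverse (of_nat (Suc n)) * (deriv W x * deriv N (W x) / (W x - W z) ^ Suc n - P' x)) has_contour_integral
     (inverse (of_nat (Suc n)) * (2 * of_real pi * \<i> * (deriv ^^ n) (deriv N) (W z) / fact n - 0))) (circlepath z r)"
    by (intro has_contour_integral_lmul has_contour_integral_diff IH zero)
  moreover have "inverse (of_nat (Suc n)) * (deriv W x * deriv N (W x) / (W x - W z) ^ Suc n - P' x) =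
      deriv W x * N (W x) / (W x - W z) ^ Suc (Suc n)" for x
    unfolding P'_def by (simp del: of_nat_Suc)
  moreover have "inverse (of_nat (Suc n)) * (2 * of_real pi * \<i> * (deriv ^^ n) (deriv N) (W z) / fact n - 0) =
     2 * of_real pi * \<i> * (deriv ^^ Suc n) N (W z) / fact (Suc n)"
    by (simp add: funpow_swap1 divide_simps del: of_nat_Suc)
  ultimately show ?case by simp
qed

section \<open>The Green's function\<close>

text \<open>The maximum principle for \<open>exp h\<close>, whose modulus is the exponential of
  \<open>Re h\<close>. A positive value would force a maximum on a compact superlevel set; then
  \<open>Re h\<close> is constant and \<open>D\<close> itself is compact, which is impossible for a
  nonempty open set.\<close>

lemma Re_holomorphic_zero_boundary_le:
  assumes D: "open D" "connected D" and h: "h holomorphic_on D"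
    and K: "\<And>\<epsilon>. \<epsilon> > 0 \<Longrightarrow> compact {z\<in>D. Re (h z) \<ge> \<epsilon>}" and z: "z \<in> D"
  shows "Re (h z) \<le> 0"
proof (rule ccontr)
  assume "\<not> Re (h z) \<le> 0"
  define d where "d = Re (h z)"
  have d: "d > 0" using \<open>\<not> Re (h z) \<le> 0\<close> by (simp add: d_def)
  define C where "C = {z\<in>D. Re (h z) \<ge> d}"
  have C: "compact C" "z \<in> C" unfolding C_def using K[OF d] z by (auto simp: d_def)
  have "continuous_on C (\<lambda>z. Re (h z))"
    by (intro continuous_intros continuous_on_subset[OF holomorphic_on_imp_continuous_on[OF h]]) (auto simp: C_def)
  then obtain x where x: "x \<in> C" "\<And>y. y \<in> C \<Longrightarrow> Re (h y) \<le> Re (h x)"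
    using continuous_attains_sup[OF C(1)] C(2) by blast
  have max: "Re (h y) \<le> Re (h x)" if "y \<in> D" for y
    using x(2)[of y] x(1) that by (cases "y \<in> C") (auto simp: C_def)
  have "(\<lambda>z. exp (h z)) constant_on D"
  proof (rule maximum_modulus_principle[OF _ D D(1) subset_refl])
    show "x \<in> D" using x by (simp add: C_def)
    show "(\<lambda>z. exp (h z)) holomorphic_on D" using h by (intro holomorphic_intros)
  qed (use max in auto)
  then obtain c where c: "\<And>y. y \<in> D \<Longrightarrow> exp (h y) = c" by (auto simp: constant_on_def)
  have "Re (h y) = Re (h z)" if "y \<in> D" for y
  proof -
    have "norm (exp (h y)) = norm (exp (h z))" using c that z by simp
    thus ?thesis by simp
  qed
  hence "C = D" by (auto simp: C_def d_def)
  hence "compact D" using C by simp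
  hence "D = UNIV" using D z by (metis clopen compact_imp_closed empty_iff)
  thus False using \<open>compact D\<close> not_compact_UNIV by metis
qed

text \<open>Limit points of the superlevel set cannot lie on the frontier, where \<open>g\<close>
  tends to 0, and the limit at infinity makes the set bounded.\<close>

lemma compact_superlevel:
  fixes D :: "complex set"
  assumes D: "open D" and g: "continuous_on D g" and \<epsilon>: "\<epsilon> > (0 :: real)"
    and bd: "\<And>p. p \<in> frontier D \<Longrightarrow> (g \<longlongrightarrow> 0) (at p within D)"
    and inf: "(g \<longlongrightarrow> 0) (inf at_infinity (principal D))"
  shows "compact {z\<in>D. g z \<ge> (\<epsilon> :: real)}"
proof -
  have "eventually (\<lambda>z. g z < \<epsilon>) (inf at_infinity (principal D))"
    using order_tendstoD(2)[OF inf \<epsilon>] .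
  then obtain B where B: "\<And>z. norm z \<ge> B \<Longrightarrow> z \<in> D \<Longrightarrow> g z < \<epsilon>"
    unfolding eventually_inf_principal eventually_at_infinity by blast
  have "bounded {z\<in>D. g z \<ge> \<epsilon>}"
    unfolding bounded_iff using B by (intro exI[of _ B]) (force simp: not_le[symmetric])
  moreover have "closed {z\<in>D. g z \<ge> \<epsilon>}"
    unfolding closed_limpt
  proof (intro allI impI)
    fix p assume p: "p islimpt {z\<in>D. g z \<ge> \<epsilon>}"
    have nb: "at p within {z\<in>D. g z \<ge> \<epsilon>} \<noteq> bot" using p by (simp add: trivial_limit_within)
    have pD: "p \<in> closure D" using islimpt_subset[OF p, of D] by (auto simp: closure_def)
    have le: "at p within {z\<in>D. g z \<ge> \<epsilon>} \<le> at p within D" by (rule at_le) auto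
    have ev: "eventually (\<lambda>z. g z \<ge> \<epsilon>) (at p within {z\<in>D. g z \<ge> \<epsilon>})"
      by (auto simp: eventually_at_filter)
    show "p \<in> {z\<in>D. g z \<ge> \<epsilon>}"
    proof (cases "p \<in> D")
      case True
      hence "(g \<longlongrightarrow> g p) (at p within D)" using g by (simp add: continuous_on)
      hence "(g \<longlongrightarrow> g p) (at p within {z\<in>D. g z \<ge> \<epsilon>})" by (rule tendsto_mono[OF le])
      hence "\<epsilon> \<le> g p" by (rule tendsto_lowerbound[OF _ ev nb])
      thus ?thesis using True by simp
    next
      case False
      hence "p \<in> frontier D" using pD D by (simp add: frontier_def interior_open)
      hence "(g \<longlongrightarrow> 0) (at p within {z\<in>D. g z \<ge> \<epsilon>})" using bd by (blast intro: tendsto_mono[OF le])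
      hence "\<epsilon> \<le> 0" by (rule tendsto_lowerbound[OF _ ev nb])
      thus ?thesis using \<epsilon> by simp
    qed
  qed
  ultimately show ?thesis by (simp add: compact_eq_bounded_closed)
qed

lemma Re_holomorphic_zero_boundary:
  assumes D: "open D" "connected D" and h: "h holomorphic_on D"
    and bd: "\<And>p. p \<in> frontier D \<Longrightarrow> ((\<lambda>z. Re (h z)) \<longlongrightarrow> 0) (at p within D)"
    and inf: "((\<lambda>z. Re (h z)) \<longlongrightarrow> 0) (inf at_infinity (principal D))"
    and z: "z \<in> D"
  shows "Re (h z) = 0"
proof (rule antisym)
  have c: "continuous_on D (\<lambda>z. Re (h z))" "continuous_on D (\<lambda>z. Re (- h z))"
    using holomorphic_on_imp_continuous_on[OF h] by (intro continuous_intros; simp)+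
  show "Re (h z) \<le> 0"
    by (rule Re_holomorphic_zero_boundary_le[OF D h _ z], rule compact_superlevel[OF D(1) c(1) _ bd inf])
  have "Re (- h z) \<le> 0"
    by (rule Re_holomorphic_zero_boundary_le[OF D holomorphic_on_minus[OF h] _ z],
        rule compact_superlevel[OF D(1) c(2)])
       (use tendsto_minus[OF bd] tendsto_minus[OF inf] in auto)
  thus "0 \<le> Re (h z)" by simp
qed

text \<open>For real \<open>u\<close> the conjugate of \<open>dzbar u\<close> is
  \<open>dz u\<close>, and it is holomorphic because the Laplacian vanishes. Simple connectivity
  gives \<open>F\<close> with derivative \<open>2 dz u\<close>; then \<open>u - Re F\<close> has
  derivative 0 and is constant.\<close>

lemma harmonic_on_eq_Re:
  assumes D: "open D" "connected D" "simply_connected D" and u: "harmonic_on D u"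
  obtains F where "F holomorphic_on D" "\<And>z. z \<in> D \<Longrightarrow> u z = Re (F z)"
proof -
  define U where "U = (\<lambda>z. complex_of_real (u z))"
  have sm: "smooth_on D U" and lap: "\<And>z. z \<in> D \<Longrightarrow> dz (dzbar U) z = 0"
    using u by (auto simp: harmonic_on_def U_def)
  have dU: "U differentiable (at z)" "dzbar U differentiable (at z)" if "z \<in> D" for z
  proof -
    have "U differentiable_on D" using sm[unfolded smooth_on_def, rule_format, of 0 0] by simp
    thus "U differentiable (at z)" using that by (simp only: differentiable_on_eq_differentiable_at[OF D(1)])
    have "dzbar U differentiable_on D" using sm[unfolded smooth_on_def, rule_format, of 0 1] by simp
    thus "dzbar U differentiable (at z)" using that by (simp only: differentiable_on_eq_differentiable_at[OF D(1)])
  qed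
  define g where "g = (\<lambda>z. cnj (dzbar U z))"
  have g: "g holomorphic_on D"
    unfolding holomorphic_on_open[OF D(1)]
  proof
    fix z assume z: "z \<in> D"
    define B where "B = frechet_derivative (dzbar U) (at z)"
    have B: "(dzbar U has_derivative B) (at z)"
      unfolding B_def using dU(2)[OF z] by (simp add: frechet_derivative_works)
    have lin: "linear B" using B by (rule has_derivative_linear)
    \<comment> \<open>The vanishing Laplacian says that the real derivative \<open>B\<close> of
      \<open>dzbar U\<close> is conjugate-linear, so that the conjugate \<open>g\<close> is complex
      differentiable.\<close>
    have "B 1 = \<i> * B \<i>" using lap[OF z] unfolding dz_def B_def[symmetric] by simp
    hence Bi: "B \<i> = - \<i> * B 1" by simp
    have Bv: "B v = B 1 * cnj v" for v
    proof -
      have "Re v *\<^sub>R 1 + Im v *\<^sub>R \<i> = v" by (simp add: complex_eq_iff)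
      moreover have "B (Re v *\<^sub>R 1 + Im v *\<^sub>R \<i>) = Re v *\<^sub>R B 1 + Im v *\<^sub>R B \<i>"
        by (simp only: linear_add[OF lin] linear_scale[OF lin])
      ultimately have "B v = Re v *\<^sub>R B 1 + Im v *\<^sub>R B \<i>" by metis
      also have "\<dots> = B 1 * cnj v" unfolding Bi
        by (simp add: scaleR_conv_of_real complex_eq_iff algebra_simps)
      finally show ?thesis .
    qed
    have "(g has_derivative (\<lambda>v. cnj (B v))) (at z)"
      unfolding g_def by (rule bounded_linear.has_derivative[OF bounded_linear_cnj B])
    also have "(\<lambda>v. cnj (B v)) = (*) (cnj (B 1))"
      by (rule ext, subst Bv) simp
    finally show "\<exists>f'. (g has_field_derivative f') (at z)"
      unfolding has_field_derivative_def by blast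
  qed
  hence "(\<lambda>z. 2 * g z) holomorphic_on D" by (intro holomorphic_intros)
  then obtain F where F: "\<And>z. z \<in> D \<Longrightarrow> (F has_field_derivative 2 * g z) (at z)"
    using D(3) unfolding simply_connected_eq_global_primitive[OF D(1)] by meson
  have der: "((\<lambda>z. u z - Re (F z)) has_derivative (\<lambda>v. 0)) (at z)" if z: "z \<in> D" for z
  proof -
    define B where "B = frechet_derivative U (at z)"
    have B: "(U has_derivative B) (at z)"
      unfolding B_def using dU(1)[OF z] by (simp add: frechet_derivative_works)
    have lin: "linear B" using B by (rule has_derivative_linear)
    have "((\<lambda>z. Im (U z)) has_derivative (\<lambda>v. Im (B v))) (at z)"
      by (rule bounded_linear.has_derivative[OF bounded_linear_Im B])
    moreover have "(\<lambda>z. Im (U z)) = (\<lambda>z. 0)" by (simp add: U_def)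
    ultimately have "((\<lambda>z::complex. 0::real) has_derivative (\<lambda>v. Im (B v))) (at z)" by simp
    moreover have "((\<lambda>z::complex. 0::real) has_derivative (\<lambda>v. 0)) (at z)" by simp
    ultimately have "(\<lambda>v. Im (B v)) = (\<lambda>v. 0)" by (rule has_derivative_unique)
    hence Im0: "Im (B v) = 0" for v by (rule fun_cong)
    have uB: "(u has_derivative (\<lambda>v. Re (B v))) (at z)"
      using bounded_linear.has_derivative[OF bounded_linear_Re B] by (simp add: U_def)
    have FB: "((\<lambda>z. Re (F z)) has_derivative (\<lambda>v. Re (2 * g z * v))) (at z)"
      using F[OF z] unfolding has_field_derivative_def by (rule bounded_linear.has_derivative[OF bounded_linear_Re])
    have "Re (B v) = Re (2 * g z * v)" for v
    proof -
      have "Re v *\<^sub>R 1 + Im v *\<^sub>R \<i> = v" by (simp add: complex_eq_iff)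
      moreover have "B (Re v *\<^sub>R 1 + Im v *\<^sub>R \<i>) = Re v *\<^sub>R B 1 + Im v *\<^sub>R B \<i>"
        by (simp only: linear_add[OF lin] linear_scale[OF lin])
      ultimately have Bv: "B v = Re v *\<^sub>R B 1 + Im v *\<^sub>R B \<i>" by metis
      have gz: "2 * g z = cnj (B 1) - \<i> * cnj (B \<i>)"
        unfolding g_def dzbar_def B_def[symmetric] by simp
      show ?thesis unfolding gz Bv using Im0[of 1] Im0[of \<i>] by (simp add: algebra_simps)
    qed
    thus ?thesis using has_derivative_diff[OF uB FB] by simp
  qed
  show ?thesis
  proof (cases "D = {}")
    case True thus ?thesis using that[of F] by (auto intro: holomorphic_on_empty)
  next
    case False
    then obtain z0 where z0: "z0 \<in> D" by auto
    define c where "c = u z0 - Re (F z0)"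
    show ?thesis
    proof (rule that)
      show "(\<lambda>z. F z + of_real c) holomorphic_on D"
        by (intro holomorphic_intros) (use F D(1) in \<open>auto simp: holomorphic_on_open\<close>)
      fix z assume z: "z \<in> D"
      have "u z - Re (F z) = c" unfolding c_def
        by (rule has_derivative_zero_unique_connected[OF D(1,2) der z z0])
      thus "u z = Re (F z + of_real c)" by simp
    qed
  qed
qed

section \<open>The explicit Green's function and its uniqueness\<close>

locale halfplane_map =
  fixes D :: "complex set" and w :: "complex \<Rightarrow> complex"
  assumes open_D: "open D" and connected_D: "connected D" and sconn_D: "simply_connected D"
    and hol_w: "w holomorphic_on D" and inj_w: "inj_on w D" and img_w: "w ` D = {z. 0 < Im z}"
begin

lemma Im_w: "z \<in> D \<Longrightarrow> 0 < Im (w z)" using img_w by blast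

lemma w_neq: "z \<in> D \<Longrightarrow> \<zeta> \<in> D \<Longrightarrow> z \<noteq> \<zeta> \<Longrightarrow> w z \<noteq> w \<zeta>"
  using inj_w by (auto dest: inj_onD)

lemma w_neq_cnj: "z \<in> D \<Longrightarrow> \<zeta> \<in> D \<Longrightarrow> w z \<noteq> cnj (w \<zeta>)"
  using Im_w[of z] Im_w[of \<zeta>] by (auto simp: complex_eq_iff)

lemma deriv_w: "z \<in> D \<Longrightarrow> deriv w z \<noteq> 0"
  using holomorphic_injective_imp_regular[OF hol_w open_D inj_w] by blast

definition green :: "complex \<Rightarrow> complex \<Rightarrow> real" where
  "green \<zeta> z = ln (cmod (w \<zeta> - cnj (w z))) - ln (cmod (w \<zeta> - w z))"

text \<open>Where \<open>green \<zeta> z\<close> is at least \<open>\<epsilon>\<close>, the point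
  \<open>w \<zeta>\<close> lies in an Apollonian disc containing \<open>w z\<close>, which is
  compact inside the half-plane. The limit 0 at the whole boundary, infinity included, then follows
  without any knowledge of the boundary behaviour of \<open>w\<close>.\<close>

lemma green_compact:
  assumes z: "z \<in> D" and \<epsilon>: "\<epsilon> > 0"
  shows "\<exists>C. compact C \<and> C \<subseteq> D \<and> (\<forall>\<zeta>\<in>D - C. \<bar>green \<zeta> z\<bar> < \<epsilon>)"
proof -
  let ?y = "w z"
  define K where "K = {x. cmod (x - cnj ?y) \<ge> exp \<epsilon> * cmod (x - ?y)}"
  have e: "exp \<epsilon> > 1" using \<epsilon> by simp
  have "K \<subseteq> cball ?y (2 * Im ?y / (exp \<epsilon> - 1))"
  proof
    fix x assume "x \<in> K"
    hence "exp \<epsilon> * cmod (x - ?y) \<le> cmod (x - cnj ?y)" by (simp add: K_def)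
    also have "\<dots> \<le> cmod (x - ?y) + cmod (?y - cnj ?y)" using norm_triangle_ineq[of "x - ?y" "?y - cnj ?y"] by simp
    also have "cmod (?y - cnj ?y) = 2 * Im ?y" using Im_w[OF z] by (simp add: complex_diff_cnj norm_mult)
    finally have "cmod (x - ?y) * (exp \<epsilon> - 1) \<le> 2 * Im ?y" by (simp add: algebra_simps)
    thus "x \<in> cball ?y (2 * Im ?y / (exp \<epsilon> - 1))"
      using e by (simp add: dist_norm norm_minus_commute pos_le_divide_eq)
  qed
  moreover have "closed K" unfolding K_def by (intro closed_Collect_le continuous_intros)
  ultimately have K: "compact K" by (meson bounded_cball bounded_subset compact_eq_bounded_closed)
  have KH: "K \<subseteq> w ` D"
  proof
    fix x assume x: "x \<in> K"
    show "x \<in> w ` D"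
    proof (rule ccontr)
      assume "x \<notin> w ` D"
      hence Im: "Im x \<le> 0" using img_w by auto
      hence ne: "x \<noteq> ?y" using Im_w[OF z] by auto
      have "(Im x + Im ?y)\<^sup>2 \<le> (Im x - Im ?y)\<^sup>2"
        using mult_nonpos_nonneg[OF Im, of "Im ?y"] Im_w[OF z] by (simp add: power2_eq_square algebra_simps)
      hence "(cmod (x - cnj ?y))\<^sup>2 \<le> (cmod (x - ?y))\<^sup>2" by (simp add: cmod_power2)
      hence "cmod (x - cnj ?y) \<le> cmod (x - ?y)" by (rule power2_le_imp_le) simp
      also have "\<dots> < exp \<epsilon> * cmod (x - ?y)" using e ne by simp
      finally show False using x by (simp add: K_def)
    qed
  qed
  obtain v where v: "v holomorphic_on (w ` D)" "\<And>z. z \<in> D \<Longrightarrow> v (w z) = z"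
    using holomorphic_has_inverse[OF hol_w open_D inj_w] by metis
  define C where "C = v ` K"
  have "compact C" unfolding C_def
    by (rule compact_continuous_image[OF _ K]) (use holomorphic_on_imp_continuous_on[OF v(1)] KH in \<open>blast intro: continuous_on_subset\<close>)
  moreover have "C \<subseteq> D" using KH v(2) by (auto simp: C_def)
  moreover have "\<bar>green \<zeta> z\<bar> < \<epsilon>" if \<zeta>: "\<zeta> \<in> D - C" for \<zeta>
  proof -
    have nK: "w \<zeta> \<notin> K"
    proof
      assume "w \<zeta> \<in> K"
      hence "v (w \<zeta>) \<in> C" by (simp add: C_def)
      thus False using \<zeta> v(2)[of \<zeta>] by simp
    qed
    have ne: "w \<zeta> \<noteq> ?y" using nK by (auto simp: K_def)
    have pos: "cmod (w \<zeta> - ?y) > 0" "cmod (w \<zeta> - cnj ?y) > 0" using ne w_neq_cnj[OF _ z] \<zeta> by auto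
    have "cmod (w \<zeta> - cnj ?y) < exp \<epsilon> * cmod (w \<zeta> - ?y)" using nK by (simp add: K_def)
    hence "ln (cmod (w \<zeta> - cnj ?y)) < ln (exp \<epsilon> * cmod (w \<zeta> - ?y))" using pos by simp
    hence 1: "green \<zeta> z < \<epsilon>" using pos by (simp add: green_def ln_mult)
    have "(Im (w \<zeta>) - Im ?y)\<^sup>2 \<le> (Im (w \<zeta>) + Im ?y)\<^sup>2"
      using mult_pos_pos[OF Im_w[of \<zeta>] Im_w[OF z]] \<zeta> by (simp add: power2_eq_square algebra_simps)
    hence "(cmod (w \<zeta> - ?y))\<^sup>2 \<le> (cmod (w \<zeta> - cnj ?y))\<^sup>2" by (simp add: cmod_power2)
    hence "cmod (w \<zeta> - ?y) \<le> cmod (w \<zeta> - cnj ?y)" by (rule power2_le_imp_le) simp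
    hence "green \<zeta> z \<ge> 0" using pos by (simp add: green_def)
    thus ?thesis using 1 by simp
  qed
  ultimately show ?thesis by blast
qed

lemma green_tendsto:
  assumes z: "z \<in> D"
  shows "p \<in> frontier D \<Longrightarrow> ((\<lambda>\<zeta>. green \<zeta> z) \<longlongrightarrow> 0) (at p within D)"
    and "((\<lambda>\<zeta>. green \<zeta> z) \<longlongrightarrow> 0) (inf at_infinity (principal D))"
proof -
  have *: "((\<lambda>\<zeta>. green \<zeta> z) \<longlongrightarrow> 0) F"
    if "\<And>C. compact C \<Longrightarrow> C \<subseteq> D \<Longrightarrow> eventually (\<lambda>\<zeta>. \<zeta> \<in> D - C) F" for F
    unfolding tendsto_iff
  proof (intro allI impI)
    fix \<epsilon> :: real assume "\<epsilon> > 0"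
    from green_compact[OF z this]
    obtain C where C: "compact C" "C \<subseteq> D" "\<forall>\<zeta>\<in>D - C. \<bar>green \<zeta> z\<bar> < \<epsilon>"
      by (elim exE conjE)
    show "eventually (\<lambda>\<zeta>. dist (green \<zeta> z) 0 < \<epsilon>) F"
      using that[OF C(1,2)] by eventually_elim (use C(3) in \<open>simp add: dist_norm\<close>)
  qed
  show "((\<lambda>\<zeta>. green \<zeta> z) \<longlongrightarrow> 0) (at p within D)" if p: "p \<in> frontier D"
  proof (rule *)
    fix C assume C: "compact C" "C \<subseteq> D"
    have "p \<notin> D" using p open_D by (simp add: frontier_def interior_open)
    hence "eventually (\<lambda>x. x \<in> - C) (nhds p)"
      using C by (intro eventually_nhds_in_open) (auto simp: compact_imp_closed)
    thus "eventually (\<lambda>\<zeta>. \<zeta> \<in> D - C) (at p within D)"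
      by (auto simp: eventually_at_filter elim!: eventually_mono)
  qed
  show "((\<lambda>\<zeta>. green \<zeta> z) \<longlongrightarrow> 0) (inf at_infinity (principal D))"
  proof (rule *)
    fix C :: "complex set" assume C: "compact C" "C \<subseteq> D"
    then obtain B where B: "\<And>x. x \<in> C \<Longrightarrow> norm x \<le> B" using compact_imp_bounded[OF C(1)] unfolding bounded_iff by blast
    thus "eventually (\<lambda>\<zeta>. \<zeta> \<in> D - C) (inf at_infinity (principal D))"
      unfolding eventually_inf_principal eventually_at_infinity
    proof (intro exI[of _ "B + 1"] allI impI)
      fix x assume "B + 1 \<le> norm x" "x \<in> D"
      thus "x \<in> D - C" using B[of x] by auto
    qed
  qed
qed

text \<open>The logarithmic singularities cancel: the quotient \<open>Q\<close> of
  \<open>w \<zeta> - w z\<close> by \<open>\<zeta> - z\<close> has no zero, so it has a holomorphic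
  logarithm on the simply connected \<open>D\<close>. Away from \<open>z\<close> the difference of
  the two functions is therefore the real part of a function holomorphic in all of \<open>D\<close>,
  to which the maximum principle applies.\<close>

lemma dirichlet_green_unique:
  assumes G: "dirichlet_green D G" and z: "z \<in> D" and \<zeta>: "\<zeta> \<in> D" "\<zeta> \<noteq> z"
  shows "G \<zeta> z = green \<zeta> z"
proof -
  obtain u where u: "harmonic_on D u" "\<And>\<zeta>. \<zeta> \<in> D - {z} \<Longrightarrow> G \<zeta> z = u \<zeta> - ln (dist \<zeta> z)"
    and bd: "\<And>p. p \<in> frontier D \<Longrightarrow> ((\<lambda>\<zeta>. G \<zeta> z) \<longlongrightarrow> 0) (at p within D)"
    and inf: "((\<lambda>\<zeta>. G \<zeta> z) \<longlongrightarrow> 0) (inf at_infinity (principal D))"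
    using G z unfolding dirichlet_green_def by blast
  obtain F where F: "F holomorphic_on D" "\<And>z. z \<in> D \<Longrightarrow> u z = Re (F z)"
    using harmonic_on_eq_Re[OF open_D connected_D sconn_D u(1)] by blast
  define Q where "Q = (\<lambda>\<zeta>. if \<zeta> = z then deriv w z else (w \<zeta> - w z) / (\<zeta> - z))"
  have Q: "Q holomorphic_on D" unfolding Q_def
    by (rule pole_lemma[OF hol_w]) (use z open_D in \<open>simp add: interior_open\<close>)
  have Q0: "\<forall>x\<in>D. Q x \<noteq> 0" using w_neq[OF _ z] deriv_w[OF z] by (auto simp: Q_def)
  have P: "(\<lambda>\<zeta>. w \<zeta> - cnj (w z)) holomorphic_on D" by (intro holomorphic_intros hol_w)
  have P0: "\<forall>x\<in>D. w x - cnj (w z) \<noteq> 0" using w_neq_cnj[OF _ z] by auto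
  have log: "\<exists>g. g holomorphic_on D \<and> (\<forall>x\<in>D. f x = exp (g x))"
    if "f holomorphic_on D" "\<forall>x\<in>D. f x \<noteq> 0" for f
    using iffD1[OF simply_connected_eq_holomorphic_log[OF open_D] sconn_D, THEN conjunct2, rule_format, of f] that by blast
  obtain L where L: "L holomorphic_on D" "\<And>x. x \<in> D \<Longrightarrow> Q x = exp (L x)"
    using log[OF Q Q0] by blast
  obtain M where M: "M holomorphic_on D" "\<And>x. x \<in> D \<Longrightarrow> w x - cnj (w z) = exp (M x)"
    using log[OF P P0] by blast
  define h where "h = (\<lambda>x. F x - (M x - L x))"
  have h: "h holomorphic_on D" unfolding h_def by (intro holomorphic_intros F L M)
  have Reh: "Re (h x) = G x z - green x z" if x: "x \<in> D" "x \<noteq> z" for x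
  proof -
    have "ln (cmod (w x - cnj (w z))) = Re (M x)" using M(2)[OF x(1)] by simp
    moreover have "cmod (w x - w z) = cmod (Q x) * dist x z"
      using x by (simp add: Q_def norm_divide dist_norm)
    hence "ln (cmod (w x - w z)) = Re (L x) + ln (dist x z)"
      using x L(2)[OF x(1)] by (simp add: ln_mult)
    ultimately show ?thesis using F(2)[OF x(1)] u(2)[of x] x by (simp add: h_def green_def)
  qed
  have "Re (h \<zeta>) = 0"
  proof (rule Re_holomorphic_zero_boundary[OF open_D connected_D h _ _ \<zeta>(1)])
    fix p assume p: "p \<in> frontier D"
    have "p \<noteq> z" using p z open_D by (auto simp: frontier_def interior_open)
    hence "eventually (\<lambda>x. x \<noteq> z) (nhds p)"
      using eventually_nhds_in_open[of "- {z}" p] by auto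
    hence e: "eventually (\<lambda>x. G x z - green x z = Re (h x)) (at p within D)"
      unfolding eventually_at_filter by eventually_elim (use Reh in auto)
    have t: "((\<lambda>x. G x z - green x z) \<longlongrightarrow> 0) (at p within D)"
      using tendsto_diff[OF bd[OF p] green_tendsto(1)[OF z p]] by simp
    show "((\<lambda>x. Re (h x)) \<longlongrightarrow> 0) (at p within D)" by (rule Lim_transform_eventually[OF t e])
  next
    have e: "eventually (\<lambda>x. G x z - green x z = Re (h x)) (inf at_infinity (principal D))"
      unfolding eventually_inf_principal eventually_at_infinity
    proof (intro exI[of _ "norm z + 1"] allI impI)
      fix x assume "norm z + 1 \<le> norm x" "x \<in> D"
      thus "G x z - green x z = Re (h x)" using Reh[of x] by (cases "x = z") auto
    qed
    have t: "((\<lambda>x. G x z - green x z) \<longlongrightarrow> 0) (inf at_infinity (principal D))"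
      using tendsto_diff[OF inf green_tendsto(2)[OF z]] by simp
    show "((\<lambda>x. Re (h x)) \<longlongrightarrow> 0) (inf at_infinity (principal D))" by (rule Lim_transform_eventually[OF t e])
  qed
  thus ?thesis using Reh[OF \<zeta>] by simp
qed

end

section \<open>The propagator\<close>

text \<open>The derivative in \<open>x\<close> of the \<open>n\<close>-th
  \<open>y\<close>-derivative of \<open>log (x - h y)\<close>. The logarithm has only local
  branches, but this derivative is defined globally.\<close>

definition pole_deriv :: "nat \<Rightarrow> (complex \<Rightarrow> complex) \<Rightarrow> complex \<Rightarrow> complex \<Rightarrow> complex" where
  "pole_deriv n h y x = (deriv ^^ n) (\<lambda>y. 1 / (x - h y)) y"

text \<open>On this product of two discs the ratio of \<open>x - h y\<close> to its value at the
  centre stays in the right half-plane, where the principal logarithm is holomorphic.\<close>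

definition log_nbhd :: "(complex \<Rightarrow> complex) \<Rightarrow> complex \<Rightarrow> complex \<Rightarrow> real \<Rightarrow> bool" where
  "log_nbhd h y0 x0 e \<longleftrightarrow> 0 < e \<and> h holomorphic_on ball y0 e \<and>
     (\<forall>x\<in>ball x0 e. \<forall>y\<in>ball y0 e. (x - h y) / (x0 - h y0) \<in> ball 1 1)"

text \<open>All smaller radii are included so that several such conditions can share one
  radius.\<close>

lemma log_nbhd_exists:
  assumes h: "h holomorphic_on T" and T: "open T" "y0 \<in> T" and ne: "x0 \<noteq> h y0"
  shows "\<exists>e>0. \<forall>e'. 0 < e' \<and> e' \<le> e \<longrightarrow> log_nbhd h y0 x0 e'"
proof -
  have cont: "continuous_on (UNIV \<times> T) (\<lambda>p. (fst p - h (snd p)) / (x0 - h y0))"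
    by (intro continuous_intros continuous_on_compose2[OF holomorphic_on_imp_continuous_on[OF h]]) (use ne in auto)
  have "open ((\<lambda>p. (fst p - h (snd p)) / (x0 - h y0)) -` ball 1 1 \<inter> (UNIV \<times> T))"
    by (rule continuous_on_open_vimage[THEN iffD1, rule_format, OF _ cont]) (use T in \<open>auto intro: open_Times\<close>)
  moreover have "(x0, y0) \<in> (\<lambda>p. (fst p - h (snd p)) / (x0 - h y0)) -` ball 1 1 \<inter> (UNIV \<times> T)"
    using T ne by simp
  ultimately obtain A B where AB: "open A" "open B" "(x0, y0) \<in> A \<times> B"
    "A \<times> B \<subseteq> (\<lambda>p. (fst p - h (snd p)) / (x0 - h y0)) -` ball 1 1 \<inter> (UNIV \<times> T)"
    by (rule open_prod_elim)
  obtain e1 where e1: "e1 > 0" "ball x0 e1 \<subseteq> A" using AB open_contains_ball by blast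
  obtain e2 where e2: "e2 > 0" "ball y0 e2 \<subseteq> B" using AB open_contains_ball by blast
  have sub: "(x - h y) / (x0 - h y0) \<in> ball 1 1 \<and> y \<in> T" if "x \<in> ball x0 (min e1 e2)" "y \<in> ball y0 (min e1 e2)" for x y
  proof -
    have "(x, y) \<in> A \<times> B" using that e1 e2 by auto
    thus ?thesis using AB(4) by (auto simp del: mem_ball)
  qed
  have "log_nbhd h y0 x0 e'" if e': "0 < e'" "e' \<le> min e1 e2" for e'
  proof -
    have s: "ball x0 e' \<subseteq> ball x0 (min e1 e2)" "ball y0 e' \<subseteq> ball y0 (min e1 e2)" using e' by auto
    hence "ball y0 e' \<subseteq> T" using sub[of x0] e' by force
    thus ?thesis unfolding log_nbhd_def using s sub e'(1) h by (blast intro: holomorphic_on_subset)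
  qed
  thus ?thesis using e1 e2 by (intro exI[of _ "min e1 e2"]) auto
qed

context
  fixes h y0 x0 e assumes nb: "log_nbhd h y0 x0 e"
begin

lemma log_nbhd_ne:
  assumes "x \<in> ball x0 e" "y \<in> ball y0 e"
  shows "x \<noteq> h y" "x0 \<noteq> h y0" "(x - h y) / (x0 - h y0) \<notin> \<real>\<^sub>\<le>\<^sub>0"
proof -
  have b: "(x - h y) / (x0 - h y0) \<in> ball 1 1" using nb assms by (auto simp: log_nbhd_def)
  hence "Re (1 - (x - h y) / (x0 - h y0)) < 1"
    using complex_Re_le_cmod[of "1 - (x - h y) / (x0 - h y0)"] by (simp add: dist_norm)
  hence "Re ((x - h y) / (x0 - h y0)) > 0" by simp
  thus "(x - h y) / (x0 - h y0) \<notin> \<real>\<^sub>\<le>\<^sub>0" by (auto simp: complex_nonpos_Reals_iff)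
  show "x \<noteq> h y" "x0 \<noteq> h y0" using b by auto
qed

lemma log_nbhd_y_holomorphic:
  assumes "x \<in> ball x0 e"
  shows "(\<lambda>y. Ln ((x - h y) / (x0 - h y0))) holomorphic_on ball y0 e"
    "(\<lambda>y. 1 / (x - h y)) holomorphic_on ball y0 e"
  by (intro holomorphic_intros; use nb log_nbhd_ne[OF assms] in \<open>auto simp: log_nbhd_def\<close>)+

lemma log_nbhd_x_deriv:
  assumes "x \<in> ball x0 e" "y \<in> ball y0 e"
  shows "((\<lambda>x. Ln ((x - h y) / (x0 - h y0))) has_field_derivative 1 / (x - h y)) (at x)"
proof -
  have "((\<lambda>x. (x - h y) / (x0 - h y0)) has_field_derivative 1 / (x0 - h y0)) (at x)"
    by (intro DERIV_cdivide) (auto intro!: derivative_eq_intros)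
  from DERIV_chain2[OF has_field_derivative_Ln[OF log_nbhd_ne(3)[OF assms]] this]
  show ?thesis using log_nbhd_ne(1,2)[OF assms] by simp
qed

text \<open>Differentiation in \<open>x\<close> passes under the \<open>n\<close>-th
  \<open>y\<close>-derivative and replaces the logarithm by a simple pole, which no longer depends
  on the branch.\<close>

lemma log_nbhd_higher_deriv:
  assumes x: "x \<in> ball x0 e"
  shows "((\<lambda>x. (deriv ^^ n) (\<lambda>y. Ln ((x - h y) / (x0 - h y0))) y0) has_field_derivative pole_deriv n h y0 x) (at x)"
  unfolding pole_deriv_def
proof (rule higher_deriv_param_complex[where e = "e - dist x0 x" and T = "ball y0 e"])
  have e: "e > 0" using nb by (simp add: log_nbhd_def)
  have sub: "x' \<in> ball x0 e" if "x' \<in> ball x (e - dist x0 x)" for x'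
    using that dist_triangle[of x0 x' x] by auto
  show "0 < e - dist x0 x" "open (ball y0 e)" "y0 \<in> ball y0 e" using x e by auto
  show "((\<lambda>x. Ln ((x - h y) / (x0 - h y0))) has_field_derivative 1 / (x' - h y)) (at x')"
    if "x' \<in> ball x (e - dist x0 x)" "y \<in> ball y0 e" for x' y
    by (rule log_nbhd_x_deriv[OF sub[OF that(1)] that(2)])
  show "(\<lambda>y. Ln ((x' - h y) / (x0 - h y0))) holomorphic_on ball y0 e" if "x' \<in> ball x (e - dist x0 x)" for x'
    by (rule log_nbhd_y_holomorphic[OF sub[OF that]])
  have hc: "continuous_on (ball y0 e) h" using nb by (auto simp: log_nbhd_def intro: holomorphic_on_imp_continuous_on)
  show "continuous_on (ball x (e - dist x0 x) \<times> ball y0 e) (\<lambda>(x, y). 1 / (x - h y))"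
    unfolding case_prod_unfold
    by (intro continuous_intros continuous_on_compose2[OF hc]) (use log_nbhd_ne(1)[OF sub] in auto)
qed

end

text \<open>Near each point the function is the derivative of a holomorphic one, namely of the
  differentiated local logarithm.\<close>

lemma pole_deriv_holomorphic:
  assumes h: "h holomorphic_on T" and T: "open T" "y0 \<in> T"
  shows "pole_deriv n h y0 holomorphic_on - {h y0}"
proof (rule holomorphic_on_open[THEN iffD2, rule_format])
  fix x0 assume "x0 \<in> - {h y0}"
  then obtain e where e: "log_nbhd h y0 x0 e" using log_nbhd_exists[OF h T] by (metis ComplD insertI1 order_refl)
  hence e0: "e > 0" by (simp add: log_nbhd_def)
  define F where "F = (\<lambda>x. (deriv ^^ n) (\<lambda>y. Ln ((x - h y) / (x0 - h y0))) y0)"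
  have F: "(F has_field_derivative pole_deriv n h y0 x) (at x)" if "x \<in> ball x0 e" for x
    unfolding F_def by (rule log_nbhd_higher_deriv[OF e that])
  hence "F holomorphic_on ball x0 e" unfolding holomorphic_on_open[OF open_ball] by blast
  hence "deriv F holomorphic_on ball x0 e" by (intro holomorphic_deriv) auto
  moreover have "deriv F x = pole_deriv n h y0 x" if "x \<in> ball x0 e" for x
    using F[OF that] by (rule DERIV_imp_deriv)
  ultimately have "pole_deriv n h y0 holomorphic_on ball x0 e" using holomorphic_transform by blast
  thus "\<exists>f'. (pole_deriv n h y0 has_field_derivative f') (at x0)"
    using e0 unfolding holomorphic_on_open[OF open_ball] by auto
qed auto

text \<open>Up to a constant, \<open>2 ln |u|\<close> is a logarithm plus its conjugate. The base
  value \<open>\<alpha>\<close> moves the argument of \<open>Ln\<close> to a place where the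
  principal branch is holomorphic.\<close>

lemma two_ln_cmod:
  assumes "u \<noteq> 0" "\<alpha> \<noteq> 0"
  shows "complex_of_real (2 * ln (cmod u)) = Ln (u / \<alpha>) + cnj (Ln (u / \<alpha>)) + of_real (2 * ln (cmod \<alpha>))"
proof -
  have "Ln (u / \<alpha>) + cnj (Ln (u / \<alpha>)) = of_real (2 * Re (Ln (u / \<alpha>)))" by (simp add: complex_add_cnj)
  also have "Re (Ln (u / \<alpha>)) = ln (cmod (u / \<alpha>))" using assms by (simp add: Re_Ln)
  also have "\<dots> = ln (cmod u) - ln (cmod \<alpha>)" using assms by (simp add: norm_divide ln_div)
  finally show ?thesis by (simp add: algebra_simps)
qed

lemma cinv_chart:
  assumes "is_chart D \<phi>"
  shows "open (cimage \<phi>)" "cinv \<phi> holomorphic_on cimage \<phi>"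
    "z \<in> cimage \<phi> \<Longrightarrow> cinv \<phi> z \<in> cdom \<phi>" "z \<in> cimage \<phi> \<Longrightarrow> cmap \<phi> (cinv \<phi> z) = z"
    "z \<in> cimage \<phi> \<Longrightarrow> cinv \<phi> z \<in> D"
    "p \<in> cdom \<phi> \<Longrightarrow> cinv \<phi> (cmap \<phi> p) = p" "p \<in> cdom \<phi> \<Longrightarrow> cmap \<phi> p \<in> cimage \<phi>" "p \<in> cdom \<phi> \<Longrightarrow> p \<in> D"
proof -
  have c: "open (cdom \<phi>)" "cdom \<phi> \<subseteq> D" "cmap \<phi> holomorphic_on cdom \<phi>" "inj_on (cmap \<phi>) (cdom \<phi>)"
    using assms by (auto simp: is_chart_def)
  show "open (cimage \<phi>)" unfolding cimage_def by (rule open_mapping_thm3[OF c(3,1,4)])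
  have inv: "cinv \<phi> (cmap \<phi> p) = p" if "p \<in> cdom \<phi>" for p
    unfolding cinv_def by (rule inv_into_f_f[OF c(4) that])
  obtain g where g: "g holomorphic_on cmap \<phi> ` cdom \<phi>" "\<And>p. p \<in> cdom \<phi> \<Longrightarrow> g (cmap \<phi> p) = p"
    using holomorphic_has_inverse[OF c(3,1,4)] by metis
  show "cinv \<phi> holomorphic_on cimage \<phi>"
    by (rule holomorphic_transform[OF g(1)[folded cimage_def]]) (auto simp: cimage_def inv g(2))
  show "z \<in> cimage \<phi> \<Longrightarrow> cinv \<phi> z \<in> cdom \<phi>" "z \<in> cimage \<phi> \<Longrightarrow> cmap \<phi> (cinv \<phi> z) = z"
    "z \<in> cimage \<phi> \<Longrightarrow> cinv \<phi> z \<in> D"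
    using c(2) by (auto simp: cimage_def inv)
  show "p \<in> cdom \<phi> \<Longrightarrow> cinv \<phi> (cmap \<phi> p) = p" "p \<in> cdom \<phi> \<Longrightarrow> cmap \<phi> p \<in> cimage \<phi>" "p \<in> cdom \<phi> \<Longrightarrow> p \<in> D"
    using c(2) by (auto simp: cimage_def inv)
qed

text \<open>Complex conjugation of an atom: the free field is real, so only the two kinds of
  derivative change places.\<close>

fun atom_star :: "atom \<Rightarrow> atom" where
  "atom_star (\<phi>, j, k, z) = (\<phi>, k, j, z)"

fun node :: "atom \<Rightarrow> complex" where
  "node (\<phi>, j, k, z) = cinv \<phi> z"

lemma atom_star_star [simp]: "atom_star (atom_star a) = a" and node_star [simp]: "node (atom_star a) = node a"
  by (cases a; simp)+

section \<open>Contraction kernels in the coordinate w\<close>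

context halfplane_map
begin

definition chart_w :: "chart \<Rightarrow> complex \<Rightarrow> complex" where
  "chart_w \<phi> z = w (cinv \<phi> z)"

lemma chart_w_holomorphic: "is_chart D \<phi> \<Longrightarrow> chart_w \<phi> holomorphic_on cimage \<phi>"
  using holomorphic_on_compose_gen[OF cinv_chart(2) hol_w] cinv_chart(5)
  by (auto simp: o_def chart_w_def[abs_def] image_subset_iff)

lemma chart_w_inj: "is_chart D \<phi> \<Longrightarrow> inj_on (chart_w \<phi>) (cimage \<phi>)"
proof (rule inj_onI)
  fix x y assume *: "is_chart D \<phi>" "x \<in> cimage \<phi>" "y \<in> cimage \<phi>" "chart_w \<phi> x = chart_w \<phi> y"
  hence "cinv \<phi> x = cinv \<phi> y"
    using inj_w cinv_chart(5)[OF *(1)] by (auto simp: chart_w_def dest: inj_onD)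
  thus "x = y" using cinv_chart(4)[OF *(1)] * by metis
qed

lemma deriv_chart_w: "is_chart D \<phi> \<Longrightarrow> z \<in> cimage \<phi> \<Longrightarrow> deriv (chart_w \<phi>) z \<noteq> 0"
  using holomorphic_injective_imp_regular[OF chart_w_holomorphic cinv_chart(1) chart_w_inj] by blast

lemma Im_chart_w: "is_chart D \<phi> \<Longrightarrow> z \<in> cimage \<phi> \<Longrightarrow> 0 < Im (chart_w \<phi> z)"
  using Im_w cinv_chart(5) by (auto simp: chart_w_def)

text \<open>Contracting \<open>\<partial>\<Phi>\<^sub>(\<^sub>0\<^sub>)\<close> with an atom gives
  the derivative of the coordinate \<open>w\<close> times this kernel. The first term comes from the
  image charge and has its pole in the lower half-plane; it depends antiholomorphically on
  \<open>z\<close>, hence \<open>l = 0\<close>. The second comes from the charge itself and depends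
  holomorphically on \<open>z\<close>, hence \<open>m = 0\<close>.\<close>

fun kern :: "atom \<Rightarrow> complex \<Rightarrow> complex" where
  "kern (\<phi>, l, m, z) x =
     (if l = 0 then pole_deriv m (\<lambda>y. cnj (chart_w \<phi> (cnj y))) (cnj z) x else 0) -
     (if m = 0 then pole_deriv l (chart_w \<phi>) z x else 0)"

lemma chart_w_cnj_holomorphic:
  "is_chart D \<phi> \<Longrightarrow> (\<lambda>y. cnj (chart_w \<phi> (cnj y))) holomorphic_on (cnj -` cimage \<phi>)"
  by (intro holomorphic_on_cnj_cnj chart_w_holomorphic cinv_chart(1))

lemma kern_holomorphic:
  assumes "valid_atom D S c"
  shows "kern c holomorphic_on {x. 0 < Im x} - {w (node c)}"
proof -
  obtain \<phi> l m z where c: "c = (\<phi>, l, m, z)" by (cases c)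
  have v: "is_chart D \<phi>" "z \<in> cimage \<phi>" using assms by (auto simp: c valid_atom_def)
  have 1: "pole_deriv m (\<lambda>y. cnj (chart_w \<phi> (cnj y))) (cnj z) holomorphic_on {x. 0 < Im x} - {w (node c)}"
    by (rule holomorphic_on_subset[OF pole_deriv_holomorphic[OF chart_w_cnj_holomorphic[OF v(1)]]])
       (use v Im_chart_w[OF v] in \<open>auto simp: cnj_vimage_open cinv_chart(1) complex_eq_iff\<close>)
  have 2: "pole_deriv l (chart_w \<phi>) z holomorphic_on {x. 0 < Im x} - {w (node c)}"
    by (rule holomorphic_on_subset[OF pole_deriv_holomorphic[OF chart_w_holomorphic[OF v(1)]]])
       (use v in \<open>auto simp: cinv_chart(1) c chart_w_def\<close>)
  have "kern c = (\<lambda>x. (if l = 0 then pole_deriv m (\<lambda>y. cnj (chart_w \<phi> (cnj y))) (cnj z) x else 0) -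
     (if m = 0 then pole_deriv l (chart_w \<phi>) z x else 0))" by (simp add: c fun_eq_iff)
  thus ?thesis using 1 2 by (cases "l = 0"; cases "m = 0") (auto intro!: holomorphic_intros)
qed

text \<open>As a function of its second point, \<open>2 G\<close> is the logarithm of the image
  charge minus that of the charge, plus conjugates. The constant \<open>C\<close> makes up for the
  base values of the logarithms and is seen only when no derivative is taken.\<close>

lemma green_wirtinger:
  assumes G: "dirichlet_green D G" and v: "is_chart D \<phi>" "z \<in> cimage \<phi>"
    and nb1: "log_nbhd (chart_w \<phi>) z x0 e" and nb2: "log_nbhd (\<lambda>y. cnj (chart_w \<phi> (cnj y))) (cnj z) x0 e"
    and sub: "ball z e \<subseteq> cimage \<phi>"
    and p: "p \<in> D" "w p \<in> ball x0 e"
  defines "L \<equiv> \<lambda>n x. - (deriv ^^ n) (\<lambda>y. Ln ((x - chart_w \<phi> y) / (x0 - chart_w \<phi> z))) z"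
    and "M \<equiv> \<lambda>n x. (deriv ^^ n) (\<lambda>y. Ln ((x - cnj (chart_w \<phi> (cnj y))) / (x0 - cnj (chart_w \<phi> z)))) (cnj z)"
    and "C \<equiv> complex_of_real (2 * ln (cmod (x0 - cnj (chart_w \<phi> z))) - 2 * ln (cmod (x0 - chart_w \<phi> z)))"
  shows "2 * (dz ^^ l) ((dzbar ^^ m) (\<lambda>y. complex_of_real (G p (cinv \<phi> y)))) z =
     (if m = 0 then L l (w p) + cnj (M l (w p)) else 0) + (if l = 0 then cnj (L m (w p)) + M m (w p) else 0) +
     (if l = 0 \<and> m = 0 then C else 0)"
proof -
  let ?W = "chart_w \<phi>" and ?x = "w p"
  have e: "e > 0" using nb1 by (simp add: log_nbhd_def)
  define f1 where "f1 = (\<lambda>y. Ln ((?x - ?W y) / (x0 - ?W z)))"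
  define f2 where "f2 = (\<lambda>y. Ln ((?x - cnj (?W (cnj y))) / (x0 - cnj (?W z))))"
  define g where "g = (\<lambda>y. cnj (f2 (cnj y)) - f1 y)"
  have f1: "f1 holomorphic_on ball z e"
    unfolding f1_def by (rule log_nbhd_y_holomorphic(1)[OF nb1 p(2)])
  have f2: "f2 holomorphic_on ball (cnj z) e"
    unfolding f2_def using log_nbhd_y_holomorphic(1)[OF nb2 p(2)] by simp
  have cball: "cnj -` ball (cnj z) e = ball z e" by (auto simp: dist_norm) (metis complex_cnj_diff complex_mod_cnj)+
  have f2c: "(\<lambda>y. cnj (f2 (cnj y))) holomorphic_on ball z e"
    using holomorphic_on_cnj_cnj[OF f2] by (simp add: cball)
  have g: "g holomorphic_on ball z e" unfolding g_def by (intro holomorphic_intros f1 f2c)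
  have rep: "complex_of_real (G p (cinv \<phi> y)) = (g y / 2 + C / 2) + cnj (g y / 2)" if y: "y \<in> ball z e" for y
  proof -
    have yD: "cinv \<phi> y \<in> D" using sub y cinv_chart(5)[OF v(1)] by auto
    have cy: "cnj y \<in> ball (cnj z) e" using y by (auto simp: dist_norm) (metis complex_cnj_diff complex_mod_cnj)
    have ne: "?x \<noteq> ?W y" "x0 \<noteq> ?W z" using log_nbhd_ne[OF nb1 p(2) y] by auto
    have ne': "?x \<noteq> cnj (?W y)" "x0 \<noteq> cnj (?W z)" using log_nbhd_ne[OF nb2 p(2) cy] by auto
    have "p \<noteq> cinv \<phi> y" using ne(1) by (auto simp: chart_w_def)
    hence "G p (cinv \<phi> y) = ln (cmod (?x - cnj (?W y))) - ln (cmod (?x - ?W y))"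
      using dirichlet_green_unique[OF G yD p(1)] by (simp add: green_def chart_w_def)
    hence "2 * complex_of_real (G p (cinv \<phi> y)) =
       complex_of_real (2 * ln (cmod (?x - cnj (?W y)))) - complex_of_real (2 * ln (cmod (?x - ?W y)))" by simp
    also have "complex_of_real (2 * ln (cmod (?x - ?W y))) = f1 y + cnj (f1 y) + of_real (2 * ln (cmod (x0 - ?W z)))"
      unfolding f1_def by (rule two_ln_cmod) (use ne in auto)
    also have "complex_of_real (2 * ln (cmod (?x - cnj (?W y)))) =
       f2 (cnj y) + cnj (f2 (cnj y)) + of_real (2 * ln (cmod (x0 - cnj (?W z))))"
      unfolding f2_def complex_cnj_cnj by (rule two_ln_cmod) (use ne' in auto)
    finally have "2 * complex_of_real (G p (cinv \<phi> y)) = g y + cnj (g y) + C"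
      by (simp add: g_def C_def algebra_simps)
    hence "complex_of_real (G p (cinv \<phi> y)) = (g y + cnj (g y) + C) / 2"
      by (metis nonzero_mult_div_cancel_left zero_neq_numeral)
    thus ?thesis by (simp add: add_divide_distrib)
  qed
  have zb: "z \<in> ball z e" using e by simp
  have gh: "(\<lambda>y. g y / 2 + C / 2) holomorphic_on ball z e" "(\<lambda>y. g y / 2) holomorphic_on ball z e"
    using g by (auto intro!: holomorphic_intros)
  have half: "(deriv ^^ n) (\<lambda>y. g y / 2) z = (L n ?x + cnj (M n ?x)) / 2" for n
  proof -
    have "(deriv ^^ n) (\<lambda>y. (1/2) * g y) z = (1/2) * (deriv ^^ n) g z"
      by (rule higher_deriv_cmult[OF g zb]) auto
    also have "(deriv ^^ n) g z = (deriv ^^ n) (\<lambda>y. cnj (f2 (cnj y))) z - (deriv ^^ n) f1 z"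
      unfolding g_def by (rule higher_deriv_diff[OF f2c f1 _ zb]) auto
    also have "(deriv ^^ n) (\<lambda>y. cnj (f2 (cnj y))) z = cnj ((deriv ^^ n) f2 (cnj z))"
      by (rule higher_deriv_cnj_cnj[OF f2]) (use e in auto)
    finally show ?thesis by (simp add: L_def M_def f1_def f2_def)
  qed
  have halfC: "(deriv ^^ n) (\<lambda>y. g y / 2 + C / 2) z = (L n ?x + cnj (M n ?x)) / 2 + (if n = 0 then C / 2 else 0)" for n
    using higher_deriv_add[OF gh(2) holomorphic_on_const[of "C/2"] open_ball zb, of n] half[of n] by simp
  have "(dz ^^ l) ((dzbar ^^ m) (\<lambda>y. complex_of_real (G p (cinv \<phi> y)))) z =
     (if m = 0 then (deriv ^^ l) (\<lambda>y. g y / 2 + C / 2) z else 0) + (if l = 0 then cnj ((deriv ^^ m) (\<lambda>y. g y / 2) z) else 0)"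
    by (rule wirtinger_power[OF open_ball gh rep zb])
  thus ?thesis unfolding half halfC by (auto simp: field_simps)
qed

lemma log_nbhds_chart:
  assumes v: "is_chart D \<phi>" "z \<in> cimage \<phi>" and p: "p \<in> D" "p \<noteq> cinv \<phi> z"
  shows "\<exists>e>0. log_nbhd (chart_w \<phi>) z (w p) e \<and> log_nbhd (\<lambda>y. cnj (chart_w \<phi> (cnj y))) (cnj z) (w p) e \<and>
     ball z e \<subseteq> cimage \<phi>"
proof -
  have zD: "cinv \<phi> z \<in> D" using cinv_chart(5)[OF v] .
  obtain e1 where e1: "e1 > 0" "\<And>e'. 0 < e' \<Longrightarrow> e' \<le> e1 \<Longrightarrow> log_nbhd (chart_w \<phi>) z (w p) e'"
    using log_nbhd_exists[OF chart_w_holomorphic[OF v(1)] cinv_chart(1)[OF v(1)] v(2), of "w p"] w_neq[OF p(1) zD p(2)]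
    by (auto simp: chart_w_def)
  obtain e2 where e2: "e2 > 0" "\<And>e'. 0 < e' \<Longrightarrow> e' \<le> e2 \<Longrightarrow> log_nbhd (\<lambda>y. cnj (chart_w \<phi> (cnj y))) (cnj z) (w p) e'"
    using log_nbhd_exists[OF chart_w_cnj_holomorphic[OF v(1)] cnj_vimage_open[OF cinv_chart(1)[OF v(1)]], of "cnj z" "w p"]
      w_neq_cnj[OF p(1) zD] v(2) by (auto simp: chart_w_def)
  obtain e3 where e3: "e3 > 0" "ball z e3 \<subseteq> cimage \<phi>" using v cinv_chart(1) open_contains_ball by blast
  show ?thesis using e1 e2 e3 by (intro exI[of _ "min e1 (min e2 e3)"]) auto
qed

text \<open>\<open>F\<close> and \<open>F'\<close> are local primitives of the kernels of the atom
  and of its conjugate. They serve both atoms, with exchanged roles, because \<open>G\<close> is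
  real; for the same reason the real constant \<open>C\<close> is shared equally between
  them.\<close>

lemma green_local:
  assumes G: "dirichlet_green D G" and v: "is_chart D \<phi>" "z \<in> cimage \<phi>" and p: "p0 \<in> D" "p0 \<noteq> cinv \<phi> z"
  obtains e F F' where "e > 0"
    "\<And>x. x \<in> ball (w p0) e \<Longrightarrow> (F has_field_derivative kern (\<phi>, l, m, z) x) (at x)"
    "\<And>x. x \<in> ball (w p0) e \<Longrightarrow> (F' has_field_derivative kern (\<phi>, m, l, z) x) (at x)"
    "\<And>p. p \<in> D \<Longrightarrow> w p \<in> ball (w p0) e \<Longrightarrow>
       2 * (dz ^^ l) ((dzbar ^^ m) (\<lambda>y. complex_of_real (G p (cinv \<phi> y)))) z = F (w p) + cnj (F' (w p))"
    "\<And>p. p \<in> D \<Longrightarrow> w p \<in> ball (w p0) e \<Longrightarrow>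
       2 * (dz ^^ m) ((dzbar ^^ l) (\<lambda>y. complex_of_real (G p (cinv \<phi> y)))) z = F' (w p) + cnj (F (w p))"
proof -
  obtain e where e: "e > 0" and nb1: "log_nbhd (chart_w \<phi>) z (w p0) e"
    and nb2: "log_nbhd (\<lambda>y. cnj (chart_w \<phi> (cnj y))) (cnj z) (w p0) e" and sub: "ball z e \<subseteq> cimage \<phi>"
    using log_nbhds_chart[OF v p] by blast
  define L where "L \<equiv> \<lambda>n x. - (deriv ^^ n) (\<lambda>y. Ln ((x - chart_w \<phi> y) / (w p0 - chart_w \<phi> z))) z"
  define M where "M \<equiv> \<lambda>n x. (deriv ^^ n) (\<lambda>y. Ln ((x - cnj (chart_w \<phi> (cnj y))) / (w p0 - cnj (chart_w \<phi> z)))) (cnj z)"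
  define C where "C \<equiv> complex_of_real (2 * ln (cmod (w p0 - cnj (chart_w \<phi> z))) - 2 * ln (cmod (w p0 - chart_w \<phi> z)))"
  define F where "F = (\<lambda>x. (if m = 0 then L l x else 0) + (if l = 0 then M m x else 0) + (if l = 0 \<and> m = 0 then C / 2 else 0))"
  define F' where "F' = (\<lambda>x. (if l = 0 then L m x else 0) + (if m = 0 then M l x else 0) + (if l = 0 \<and> m = 0 then C / 2 else 0))"
  have dL: "(L n has_field_derivative - pole_deriv n (chart_w \<phi>) z x) (at x)" if "x \<in> ball (w p0) e" for n x
    unfolding L_def by (rule DERIV_minus[OF log_nbhd_higher_deriv[OF nb1 that]])
  have dM: "(M n has_field_derivative pole_deriv n (\<lambda>y. cnj (chart_w \<phi> (cnj y))) (cnj z) x) (at x)"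
    if "x \<in> ball (w p0) e" for n x
    unfolding M_def using log_nbhd_higher_deriv[OF nb2 that, of n] by simp
  have C: "cnj C = C" by (simp add: C_def)
  note W = green_wirtinger[OF G v nb1 nb2 sub, folded L_def M_def C_def]
  show ?thesis
  proof (rule that[OF e, of F F'])
    fix x assume x: "x \<in> ball (w p0) e"
    have dL': "((\<lambda>x. if b then L n x else 0) has_field_derivative (if b then - pole_deriv n (chart_w \<phi>) z x else 0)) (at x)" for b n
      using dL[OF x] by simp
    have dM': "((\<lambda>x. if b then M n x else 0) has_field_derivative (if b then pole_deriv n (\<lambda>y. cnj (chart_w \<phi> (cnj y))) (cnj z) x else 0)) (at x)" for b n
      using dM[OF x] by simp
    show "(F has_field_derivative kern (\<phi>, l, m, z) x) (at x)" unfolding F_def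
      by (rule DERIV_cong[OF DERIV_add[OF DERIV_add[OF dL' dM'] DERIV_const]]) auto
    show "(F' has_field_derivative kern (\<phi>, m, l, z) x) (at x)" unfolding F'_def
      by (rule DERIV_cong[OF DERIV_add[OF DERIV_add[OF dL' dM'] DERIV_const]]) auto
  next
    fix p assume p: "p \<in> D" "w p \<in> ball (w p0) e"
    show "2 * (dz ^^ l) ((dzbar ^^ m) (\<lambda>y. complex_of_real (G p (cinv \<phi> y)))) z = F (w p) + cnj (F' (w p))"
      unfolding W[OF p] F_def F'_def by (auto simp: C L_def M_def)
    show "2 * (dz ^^ m) ((dzbar ^^ l) (\<lambda>y. complex_of_real (G p (cinv \<phi> y)))) z = F' (w p) + cnj (F (w p))"
      unfolding W[OF p] F_def F'_def by (auto simp: C L_def M_def)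
  qed
qed

text \<open>One disc and one pair of primitives serve every chart whose point lies nearby. This is
  what allows the chart to vary along a flow.\<close>

lemma pair_expect_eq:
  assumes G: "dirichlet_green D G" and a: "valid_atom D S (\<phi>, j, k, \<zeta>)" and c: "valid_atom D S' c"
    and ne: "cinv \<phi> \<zeta> \<noteq> node c"
  obtains e F F' where "e > 0"
    "\<And>x. x \<in> ball (chart_w \<phi> \<zeta>) e \<Longrightarrow> (F has_field_derivative kern c x) (at x)"
    "\<And>x. x \<in> ball (chart_w \<phi> \<zeta>) e \<Longrightarrow> (F' has_field_derivative kern (atom_star c) x) (at x)"
    "\<And>\<phi>' j k \<zeta>'. is_chart D \<phi>' \<Longrightarrow> \<zeta>' \<in> cimage \<phi>' \<Longrightarrow> chart_w \<phi>' \<zeta>' \<in> ball (chart_w \<phi> \<zeta>) e \<Longrightarrow>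
       pair_expect G (\<phi>', j, k, \<zeta>') c =
        (if k = 0 then (deriv ^^ j) (\<lambda>\<eta>. F (chart_w \<phi>' \<eta>)) \<zeta>' else 0) +
        (if j = 0 then cnj ((deriv ^^ k) (\<lambda>\<eta>. F' (chart_w \<phi>' \<eta>)) \<zeta>') else 0)"
    "\<And>\<phi>' j k \<zeta>'. is_chart D \<phi>' \<Longrightarrow> \<zeta>' \<in> cimage \<phi>' \<Longrightarrow> chart_w \<phi>' \<zeta>' \<in> ball (chart_w \<phi> \<zeta>) e \<Longrightarrow>
       pair_expect G (\<phi>', j, k, \<zeta>') (atom_star c) =
        (if k = 0 then (deriv ^^ j) (\<lambda>\<eta>. F' (chart_w \<phi>' \<eta>)) \<zeta>' else 0) +
        (if j = 0 then cnj ((deriv ^^ k) (\<lambda>\<eta>. F (chart_w \<phi>' \<eta>)) \<zeta>') else 0)"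
proof -
  obtain \<psi> l m z where c': "c = (\<psi>, l, m, z)" by (cases c)
  have v: "is_chart D \<psi>" "z \<in> cimage \<psi>" and p0: "cinv \<phi> \<zeta> \<in> D" "cinv \<phi> \<zeta> \<noteq> cinv \<psi> z"
    using c a ne by (auto simp: c' valid_atom_def intro: cinv_chart(5))
  obtain e F F' where e: "e > 0"
    and F: "\<And>x. x \<in> ball (w (cinv \<phi> \<zeta>)) e \<Longrightarrow> (F has_field_derivative kern (\<psi>, l, m, z) x) (at x)"
    and F': "\<And>x. x \<in> ball (w (cinv \<phi> \<zeta>)) e \<Longrightarrow> (F' has_field_derivative kern (\<psi>, m, l, z) x) (at x)"
    and H: "\<And>p. p \<in> D \<Longrightarrow> w p \<in> ball (w (cinv \<phi> \<zeta>)) e \<Longrightarrow>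
       2 * (dz ^^ l) ((dzbar ^^ m) (\<lambda>y. complex_of_real (G p (cinv \<psi> y)))) z = F (w p) + cnj (F' (w p))"
    and H': "\<And>p. p \<in> D \<Longrightarrow> w p \<in> ball (w (cinv \<phi> \<zeta>)) e \<Longrightarrow>
       2 * (dz ^^ m) ((dzbar ^^ l) (\<lambda>y. complex_of_real (G p (cinv \<psi> y)))) z = F' (w p) + cnj (F (w p))"
    using green_local[OF G v p0] by blast
  have Fh: "F holomorphic_on ball (w (cinv \<phi> \<zeta>)) e" "F' holomorphic_on ball (w (cinv \<phi> \<zeta>)) e"
    unfolding holomorphic_on_open[OF open_ball] using F F' by blast+
  have main: "2 * (dz ^^ j) ((dzbar ^^ k) (\<lambda>x. h (cinv \<phi>' x))) \<zeta>' =
       (if k = 0 then (deriv ^^ j) (\<lambda>\<eta>. F (chart_w \<phi>' \<eta>)) \<zeta>' else 0) +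
       (if j = 0 then cnj ((deriv ^^ k) (\<lambda>\<eta>. F' (chart_w \<phi>' \<eta>)) \<zeta>') else 0)"
    if \<phi>': "is_chart D \<phi>'" "\<zeta>' \<in> cimage \<phi>'" "chart_w \<phi>' \<zeta>' \<in> ball (w (cinv \<phi> \<zeta>)) e"
      and h: "\<And>p. p \<in> D \<Longrightarrow> w p \<in> ball (w (cinv \<phi> \<zeta>)) e \<Longrightarrow> 2 * h p = F (w p) + cnj (F' (w p))"
      and Fh: "F holomorphic_on ball (w (cinv \<phi> \<zeta>)) e" "F' holomorphic_on ball (w (cinv \<phi> \<zeta>)) e"
    for \<phi>' j k \<zeta>' h F F'
  proof -
    define U where "U = chart_w \<phi>' -` ball (w (cinv \<phi> \<zeta>)) e \<inter> cimage \<phi>'"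
    have Wh: "chart_w \<phi>' holomorphic_on cimage \<phi>'" by (rule chart_w_holomorphic[OF \<phi>'(1)])
    have U: "open U" unfolding U_def
      by (rule open_vimage_holomorphic[OF Wh cinv_chart(1)[OF \<phi>'(1)] open_ball])
    have \<zeta>'U: "\<zeta>' \<in> U" using \<phi>' by (simp add: U_def)
    have comp: "(\<lambda>\<eta>. f (chart_w \<phi>' \<eta>)) holomorphic_on U" if "f holomorphic_on ball (w (cinv \<phi> \<zeta>)) e" for f
      using holomorphic_on_compose_gen[OF holomorphic_on_subset[OF Wh, of U] that] by (auto simp: U_def o_def)
    note FU = comp[OF Fh(1)] and FU' = comp[OF Fh(2)]
    have half: "(deriv ^^ n) (\<lambda>\<eta>. f \<eta> / 2) \<zeta>' = (deriv ^^ n) f \<zeta>' / 2" if "f holomorphic_on U" for f n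
      using higher_deriv_cmult[OF that \<zeta>'U U, of n "1/2"] by simp
    have "(dz ^^ j) ((dzbar ^^ k) (\<lambda>x. h (cinv \<phi>' x))) \<zeta>' =
       (if k = 0 then (deriv ^^ j) (\<lambda>\<eta>. F (chart_w \<phi>' \<eta>) / 2) \<zeta>' else 0) +
       (if j = 0 then cnj ((deriv ^^ k) (\<lambda>\<eta>. F' (chart_w \<phi>' \<eta>) / 2) \<zeta>') else 0)"
    proof (rule wirtinger_power[OF U _ _ _ \<zeta>'U])
      fix x assume x: "x \<in> U"
      have "2 * h (cinv \<phi>' x) = F (chart_w \<phi>' x) + cnj (F' (chart_w \<phi>' x))"
        using h[of "cinv \<phi>' x"] x cinv_chart(5)[OF \<phi>'(1)] by (auto simp: U_def chart_w_def)
      hence "h (cinv \<phi>' x) = (F (chart_w \<phi>' x) + cnj (F' (chart_w \<phi>' x))) / 2"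
        by (metis nonzero_mult_div_cancel_left zero_neq_numeral)
      thus "h (cinv \<phi>' x) = F (chart_w \<phi>' x) / 2 + cnj (F' (chart_w \<phi>' x) / 2)"
        by (simp add: add_divide_distrib)
    qed (use FU FU' in \<open>auto intro!: holomorphic_intros\<close>)
    thus ?thesis unfolding half[OF FU] half[OF FU'] by (auto simp: field_simps)
  qed
  show ?thesis
    by (rule that[OF e, of F F'])
       (use F F' main[OF _ _ _ H Fh] main[OF _ _ _ H' Fh(2,1)] in \<open>auto simp: c' chart_w_def[of \<phi> \<zeta>]\<close>)
qed

lemma chart_w_comp_deriv:
  assumes F: "\<And>x. x \<in> ball (chart_w \<phi> \<zeta>) e \<Longrightarrow> (F has_field_derivative f x) (at x)" "e > 0"
    and v: "is_chart D \<phi>" "\<zeta> \<in> cimage \<phi>"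
  shows "(deriv ^^ Suc n) (\<lambda>\<eta>. F (chart_w \<phi> \<eta>)) \<zeta> = (deriv ^^ n) (\<lambda>\<eta>. f (chart_w \<phi> \<eta>) * deriv (chart_w \<phi>) \<eta>) \<zeta>"
proof -
  define U where "U = chart_w \<phi> -` ball (chart_w \<phi> \<zeta>) e \<inter> cimage \<phi>"
  have Wh: "chart_w \<phi> holomorphic_on cimage \<phi>" by (rule chart_w_holomorphic[OF v(1)])
  have U: "open U" unfolding U_def
    by (rule open_vimage_holomorphic[OF Wh cinv_chart(1)[OF v(1)] open_ball])
  have \<zeta>: "\<zeta> \<in> U" using v F(2) by (simp add: U_def)
  have Fh: "F holomorphic_on ball (chart_w \<phi> \<zeta>) e"
    unfolding holomorphic_on_open[OF open_ball] using F by blast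
  have FW: "(\<lambda>\<eta>. F (chart_w \<phi> \<eta>)) holomorphic_on U"
    using holomorphic_on_compose_gen[OF holomorphic_on_subset[OF Wh, of U] Fh] by (auto simp: U_def o_def)
  have d: "deriv (\<lambda>\<eta>. F (chart_w \<phi> \<eta>)) \<eta> = f (chart_w \<phi> \<eta>) * deriv (chart_w \<phi>) \<eta>" if "\<eta> \<in> U" for \<eta>
  proof (rule DERIV_imp_deriv)
    have "(chart_w \<phi> has_field_derivative deriv (chart_w \<phi>) \<eta>) (at \<eta>)"
      by (rule holomorphic_derivI[OF Wh cinv_chart(1)[OF v(1)]]) (use that in \<open>simp add: U_def\<close>)
    from DERIV_chain2[OF F(1) this] that
    show "((\<lambda>\<eta>. F (chart_w \<phi> \<eta>)) has_field_derivative f (chart_w \<phi> \<eta>) * deriv (chart_w \<phi>) \<eta>) (at \<eta>)"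
      by (simp add: U_def)
  qed
  have "(deriv ^^ Suc n) (\<lambda>\<eta>. F (chart_w \<phi> \<eta>)) \<zeta> = (deriv ^^ n) (deriv (\<lambda>\<eta>. F (chart_w \<phi> \<eta>))) \<zeta>"
    by (simp only: funpow_Suc_right o_def)
  also have "\<dots> = (deriv ^^ n) (\<lambda>\<eta>. f (chart_w \<phi> \<eta>) * deriv (chart_w \<phi>) \<eta>) \<zeta>"
    by (rule higher_deriv_cong_ev)
       (use eventually_nhds_in_open[OF U \<zeta>] d in \<open>auto elim: eventually_mono\<close>)
  finally show ?thesis .
qed

text \<open>Off the nodes a pair expectation is locally derived from a holomorphic plus an
  antiholomorphic function of the first point. Hence mixed derivatives vanish, and conjugating both
  atoms exchanges the two summands.\<close>

lemma pair_expect_deriv: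
  assumes G: "dirichlet_green D G" and a: "valid_atom D S (\<phi>, j, k, \<zeta>)" and c: "valid_atom D S' c"
    and ne: "cinv \<phi> \<zeta> \<noteq> node c"
  shows "pair_expect G (\<phi>, Suc n, 0, \<zeta>) c = (deriv ^^ n) (\<lambda>\<eta>. kern c (chart_w \<phi> \<eta>) * deriv (chart_w \<phi>) \<eta>) \<zeta>"
    and "pair_expect G (\<phi>, Suc n, Suc i, \<zeta>) c = 0"
    and "pair_expect G (atom_star (\<phi>, j, k, \<zeta>)) (atom_star c) = cnj (pair_expect G (\<phi>, j, k, \<zeta>) c)"
proof -
  obtain e F F' where e: "e > 0"
    and F: "\<And>x. x \<in> ball (chart_w \<phi> \<zeta>) e \<Longrightarrow> (F has_field_derivative kern c x) (at x)"
    and F': "\<And>x. x \<in> ball (chart_w \<phi> \<zeta>) e \<Longrightarrow> (F' has_field_derivative kern (atom_star c) x) (at x)"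
    and p: "\<And>\<phi>' j k \<zeta>'. is_chart D \<phi>' \<Longrightarrow> \<zeta>' \<in> cimage \<phi>' \<Longrightarrow> chart_w \<phi>' \<zeta>' \<in> ball (chart_w \<phi> \<zeta>) e \<Longrightarrow>
       pair_expect G (\<phi>', j, k, \<zeta>') c =
        (if k = 0 then (deriv ^^ j) (\<lambda>\<eta>. F (chart_w \<phi>' \<eta>)) \<zeta>' else 0) +
        (if j = 0 then cnj ((deriv ^^ k) (\<lambda>\<eta>. F' (chart_w \<phi>' \<eta>)) \<zeta>') else 0)"
    and p': "\<And>\<phi>' j k \<zeta>'. is_chart D \<phi>' \<Longrightarrow> \<zeta>' \<in> cimage \<phi>' \<Longrightarrow> chart_w \<phi>' \<zeta>' \<in> ball (chart_w \<phi> \<zeta>) e \<Longrightarrow>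
       pair_expect G (\<phi>', j, k, \<zeta>') (atom_star c) =
        (if k = 0 then (deriv ^^ j) (\<lambda>\<eta>. F' (chart_w \<phi>' \<eta>)) \<zeta>' else 0) +
        (if j = 0 then cnj ((deriv ^^ k) (\<lambda>\<eta>. F (chart_w \<phi>' \<eta>)) \<zeta>') else 0)"
    using pair_expect_eq[OF G a c ne] by blast
  have v: "is_chart D \<phi>" "\<zeta> \<in> cimage \<phi>" using a by (auto simp: valid_atom_def)
  have b: "chart_w \<phi> \<zeta> \<in> ball (chart_w \<phi> \<zeta>) e" using e by simp
  show "pair_expect G (\<phi>, Suc n, 0, \<zeta>) c = (deriv ^^ n) (\<lambda>\<eta>. kern c (chart_w \<phi> \<eta>) * deriv (chart_w \<phi>) \<eta>) \<zeta>"
    unfolding p[OF v b] using chart_w_comp_deriv[OF F e v, of n] by simp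
  show "pair_expect G (\<phi>, Suc n, Suc i, \<zeta>) c = 0" unfolding p[OF v b] by simp
  show "pair_expect G (atom_star (\<phi>, j, k, \<zeta>)) (atom_star c) = cnj (pair_expect G (\<phi>, j, k, \<zeta>) c)"
    unfolding atom_star.simps p[OF v b] p'[OF v b] by (auto simp: add.commute)
qed

section \<open>Symmetry of pair expectations\<close>

definition simple_pole :: "chart \<Rightarrow> complex \<Rightarrow> complex \<Rightarrow> complex" where
  "simple_pole \<phi> x \<eta> = deriv (chart_w \<phi>) \<eta> / (x - chart_w \<phi> \<eta>)"

lemma simple_pole_deriv:
  assumes v: "is_chart D \<phi>" "\<eta> \<in> cimage \<phi>" and x: "x \<noteq> chart_w \<phi> \<eta>"
  shows "(simple_pole \<phi> x has_field_derivative
     deriv (deriv (chart_w \<phi>)) \<eta> / (x - chart_w \<phi> \<eta>) + (deriv (chart_w \<phi>) \<eta>)\<^sup>2 / (x - chart_w \<phi> \<eta>)\<^sup>2) (at \<eta>)"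
proof -
  have W: "chart_w \<phi> holomorphic_on cimage \<phi>" by (rule chart_w_holomorphic[OF v(1)])
  have d: "(chart_w \<phi> has_field_derivative deriv (chart_w \<phi>) \<eta>) (at \<eta>)"
    by (rule holomorphic_derivI[OF W cinv_chart(1)[OF v(1)] v(2)])
  have d2: "(deriv (chart_w \<phi>) has_field_derivative deriv (deriv (chart_w \<phi>)) \<eta>) (at \<eta>)"
    by (rule holomorphic_derivI[OF holomorphic_deriv[OF W] cinv_chart(1)[OF v(1)] v(2)]) (rule cinv_chart(1)[OF v(1)])
  have alg: "(a * s - b * (0 - b)) / (s * s) = a / s + b\<^sup>2 / s\<^sup>2" if "s \<noteq> 0" for a b s :: complex
    using that by (simp add: field_simps power2_eq_square)
  show ?thesis unfolding simple_pole_def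
    using DERIV_divide[OF d2 DERIV_diff[OF DERIV_const[of x] d]] x by (simp only: alg right_minus_eq not_False_eq_True)
qed

text \<open>Here the derivatives fall on the second point of \<open>G\<close>, whereas
  \<open>kern\<close> comes from a derivative in the first. The sum \<open>simple_pole\<close> is
  minus the logarithmic derivative of \<open>x - W \<eta>\<close>; the term with
  \<open>cnj (w p)\<close> comes from the image charge.\<close>

lemma green_deriv:
  assumes G: "dirichlet_green D G" and v: "is_chart D \<phi>" "\<eta> \<in> cimage \<phi>" and p: "p \<in> D" "p \<noteq> cinv \<phi> \<eta>"
  shows "2 * (dz ^^ Suc n) (\<lambda>y. complex_of_real (G p (cinv \<phi> y))) \<eta> =
     (deriv ^^ n) (simple_pole \<phi> (w p)) \<eta> - (deriv ^^ n) (simple_pole \<phi> (cnj (w p))) \<eta>"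
proof -
  let ?W = "chart_w \<phi>" and ?x = "w p"
  obtain e where e: "e > 0" and nb1: "log_nbhd ?W \<eta> (w p) e"
    and nb2: "log_nbhd (\<lambda>y. cnj (?W (cnj y))) (cnj \<eta>) (w p) e" and sub: "ball \<eta> e \<subseteq> cimage \<phi>"
    using log_nbhds_chart[OF v p] by blast
  have xb: "?x \<in> ball ?x e" using e by simp
  have \<eta>b: "\<eta> \<in> ball \<eta> e" using e by simp
  have W: "?W holomorphic_on cimage \<phi>" by (rule chart_w_holomorphic[OF v(1)])
  have d: "(?W has_field_derivative deriv ?W y) (at y)" if "y \<in> ball \<eta> e" for y
    by (rule holomorphic_derivI[OF W cinv_chart(1)[OF v(1)]]) (use sub that in auto)
  have dLn: "((\<lambda>y. Ln ((x - ?W y) / (x - ?W \<eta>))) has_field_derivative - simple_pole \<phi> x y) (at y)"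
    if y: "y \<in> ball \<eta> e" and ne: "x \<noteq> ?W y" "x \<noteq> ?W \<eta>" "(x - ?W y) / (x - ?W \<eta>) \<notin> \<real>\<^sub>\<le>\<^sub>0" for x y
  proof -
    have "((\<lambda>y. (x - ?W y) / (x - ?W \<eta>)) has_field_derivative (0 - deriv ?W y) / (x - ?W \<eta>)) (at y)"
      by (intro DERIV_cdivide DERIV_diff DERIV_const d y)
    from DERIV_chain2[OF has_field_derivative_Ln[OF ne(3)] this]
    show ?thesis using ne(1,2) by (simp add: simple_pole_def)
  qed
  have iter: "(deriv ^^ Suc n) f \<eta> = - (deriv ^^ n) (simple_pole \<phi> x) \<eta>"
    if f: "\<And>y. y \<in> ball \<eta> e \<Longrightarrow> (f has_field_derivative - simple_pole \<phi> x y) (at y)"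
      and ne: "\<And>y. y \<in> ball \<eta> e \<Longrightarrow> x \<noteq> ?W y" for f x
  proof -
    have sp: "simple_pole \<phi> x holomorphic_on ball \<eta> e"
      unfolding holomorphic_on_open[OF open_ball] using simple_pole_deriv[OF v(1) _ ne] sub by blast
    have "(deriv ^^ Suc n) f \<eta> = (deriv ^^ n) (deriv f) \<eta>" by (simp only: funpow_Suc_right o_def)
    also have "\<dots> = (deriv ^^ n) (\<lambda>y. - simple_pole \<phi> x y) \<eta>"
      by (rule higher_deriv_cong_ev)
         (use eventually_nhds_in_open[OF open_ball \<eta>b] f in \<open>auto elim!: eventually_mono intro!: DERIV_imp_deriv\<close>)
    also have "\<dots> = - (deriv ^^ n) (simple_pole \<phi> x) \<eta>" by (rule higher_deriv_uminus[OF sp _ \<eta>b]) auto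
    finally show ?thesis .
  qed
  have 1: "(deriv ^^ Suc n) (\<lambda>y. Ln ((?x - ?W y) / (?x - ?W \<eta>))) \<eta> = - (deriv ^^ n) (simple_pole \<phi> ?x) \<eta>"
  proof (rule iter)
    fix y assume y: "y \<in> ball \<eta> e"
    note n = log_nbhd_ne[OF nb1 xb y]
    show "((\<lambda>y. Ln ((?x - ?W y) / (?x - ?W \<eta>))) has_field_derivative - simple_pole \<phi> ?x y) (at y)"
      by (rule dLn[OF y n])
    show "?x \<noteq> ?W y" by (rule n(1))
  qed
  have cb: "cnj y \<in> ball (cnj \<eta>) e" if "y \<in> ball \<eta> e" for y
    using that by (auto simp: dist_norm) (metis complex_cnj_diff complex_mod_cnj)
  have 2: "(deriv ^^ Suc n) (\<lambda>y. Ln ((cnj ?x - ?W y) / (cnj ?x - ?W \<eta>))) \<eta> = - (deriv ^^ n) (simple_pole \<phi> (cnj ?x)) \<eta>"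
  proof (rule iter)
    fix y assume y: "y \<in> ball \<eta> e"
    note n = log_nbhd_ne[OF nb2 xb cb[OF y]]
    have "(cnj ?x - ?W y) / (cnj ?x - ?W \<eta>) = cnj ((?x - cnj (?W y)) / (?x - cnj (?W \<eta>)))" by simp
    moreover have "cnj u \<notin> \<real>\<^sub>\<le>\<^sub>0" if "u \<notin> \<real>\<^sub>\<le>\<^sub>0" for u
      using that by (auto simp: complex_nonpos_Reals_iff)
    from this[OF n(3)] have "cnj ((?x - cnj (?W y)) / (?x - cnj (?W \<eta>))) \<notin> \<real>\<^sub>\<le>\<^sub>0"
      by (simp only: complex_cnj_cnj not_False_eq_True)
    ultimately have "(cnj ?x - ?W y) / (cnj ?x - ?W \<eta>) \<notin> \<real>\<^sub>\<le>\<^sub>0" by (simp only: not_False_eq_True)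
    moreover have ne: "cnj ?x \<noteq> ?W y" "cnj ?x \<noteq> ?W \<eta>" using n(1,2) by (metis complex_cnj_cnj)+
    ultimately show "((\<lambda>y. Ln ((cnj ?x - ?W y) / (cnj ?x - ?W \<eta>))) has_field_derivative - simple_pole \<phi> (cnj ?x) y) (at y)"
      by (intro dLn y)
    show "cnj ?x \<noteq> ?W y" by (rule ne(1))
  qed
  have f2: "(\<lambda>y. Ln ((?x - cnj (?W (cnj y))) / (?x - cnj (?W \<eta>)))) holomorphic_on ball (cnj \<eta>) e"
    using log_nbhd_y_holomorphic(1)[OF nb2 xb] by simp
  have "cnj ((deriv ^^ Suc n) (\<lambda>y. Ln ((?x - cnj (?W (cnj y))) / (?x - cnj (?W \<eta>)))) (cnj \<eta>)) =
     (deriv ^^ Suc n) (\<lambda>y. cnj (Ln ((?x - cnj (?W (cnj (cnj y)))) / (?x - cnj (?W \<eta>))))) \<eta>"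
    by (rule higher_deriv_cnj_cnj[OF f2, symmetric]) (use e in auto)
  also have "\<dots> = (deriv ^^ Suc n) (\<lambda>y. Ln ((cnj ?x - ?W y) / (cnj ?x - ?W \<eta>))) \<eta>"
  proof (rule higher_deriv_cong_ev[OF _ refl])
    show "\<forall>\<^sub>F y in nhds \<eta>. cnj (Ln ((?x - cnj (?W (cnj (cnj y)))) / (?x - cnj (?W \<eta>)))) =
       Ln ((cnj ?x - ?W y) / (cnj ?x - ?W \<eta>))"
      using eventually_nhds_in_open[OF open_ball \<eta>b]
    proof eventually_elim
      case (elim y)
      have "(?x - cnj (?W y)) / (?x - cnj (?W \<eta>)) \<notin> \<real>\<^sub>\<le>\<^sub>0" using log_nbhd_ne(3)[OF nb2 xb cb[OF elim]] by simp
      thus ?case by (simp add: cnj_Ln)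
    qed
  qed
  finally have 3: "cnj ((deriv ^^ Suc n) (\<lambda>y. Ln ((?x - cnj (?W (cnj y))) / (?x - cnj (?W \<eta>)))) (cnj \<eta>)) =
     - (deriv ^^ n) (simple_pole \<phi> (cnj ?x)) \<eta>" by (simp only: 2)
  show ?thesis using green_wirtinger[OF G v nb1 nb2 sub p(1) xb, of "Suc n" 0] 1 3 by simp
qed

text \<open>One derivative at \<open>\<eta>\<close> is interchanged with arbitrarily many at the
  other point, on a neighbourhood that avoids the pole.\<close>

lemma simple_pole_swap:
  assumes v: "is_chart D \<phi>" "\<eta> \<in> cimage \<phi>" and h: "h holomorphic_on T" "open T" "y0 \<in> T"
    and ne: "h y0 \<noteq> chart_w \<phi> \<eta>"
  shows "(deriv ^^ j) (\<lambda>y. deriv (simple_pole \<phi> (h y)) \<eta>) y0 = deriv (\<lambda>\<eta>. (deriv ^^ j) (\<lambda>y. simple_pole \<phi> (h y) \<eta>) y0) \<eta>"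
proof -
  let ?W = "chart_w \<phi>" let ?U = "cimage \<phi>"
  note U = cinv_chart(1)[OF v(1)]
  have W: "?W holomorphic_on ?U" by (rule chart_w_holomorphic[OF v(1)])
  have cW: "continuous_on ?U ?W" "continuous_on ?U (deriv ?W)" "continuous_on ?U (deriv (deriv ?W))"
    by (intro holomorphic_on_imp_continuous_on holomorphic_deriv W U)+
  have ch: "continuous_on T h" by (intro holomorphic_on_imp_continuous_on h)
  have "continuous_on (?U \<times> T) (\<lambda>p. h (snd p) - ?W (fst p))"
    by (intro continuous_intros continuous_on_compose2[OF ch] continuous_on_compose2[OF cW(1)]) auto
  hence "open ((\<lambda>p. h (snd p) - ?W (fst p)) -` (- {0}) \<inter> (?U \<times> T))"
    by (rule continuous_on_open_vimage[THEN iffD1, rule_format, rotated]) (use U h in \<open>auto intro: open_Times\<close>)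
  moreover have "(\<eta>, y0) \<in> (\<lambda>p. h (snd p) - ?W (fst p)) -` (- {0}) \<inter> (?U \<times> T)" using v h ne by auto
  ultimately obtain A B where AB: "open A" "open B" "(\<eta>, y0) \<in> A \<times> B"
    "A \<times> B \<subseteq> (\<lambda>p. h (snd p) - ?W (fst p)) -` (- {0}) \<inter> (?U \<times> T)"
    by (rule open_prod_elim)
  obtain e where e: "e > 0" "ball \<eta> e \<subseteq> A" using AB open_contains_ball by blast
  have ok: "x \<in> ?U \<and> y \<in> T \<and> h y \<noteq> ?W x" if "x \<in> ball \<eta> e" "y \<in> B" for x y
    using subsetD[OF AB(4), of "(x, y)"] subsetD[OF e(2) that(1)] that(2) by auto
  have hB: "h holomorphic_on B" using ok[of \<eta>] e by (auto intro: holomorphic_on_subset[OF h(1)])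
  define Ed where "Ed = (\<lambda>x y. deriv (deriv ?W) x / (h y - ?W x) + (deriv ?W x)\<^sup>2 / (h y - ?W x)\<^sup>2)"
  have "((\<lambda>\<eta>. (deriv ^^ j) (\<lambda>y. simple_pole \<phi> (h y) \<eta>) y0) has_field_derivative (deriv ^^ j) (Ed \<eta>) y0) (at \<eta>)"
  proof (rule higher_deriv_param_complex[OF e(1) AB(2)])
    show "y0 \<in> B" using AB by auto
    show "((\<lambda>x. simple_pole \<phi> (h y) x) has_field_derivative Ed x y) (at x)" if "x \<in> ball \<eta> e" "y \<in> B" for x y
      unfolding Ed_def by (rule simple_pole_deriv[OF v(1)]) (use ok[OF that] in auto)
    have s: "ball \<eta> e \<subseteq> ?U" "B \<subseteq> T" using ok AB e by fastforce+
    show "continuous_on (ball \<eta> e \<times> B) (\<lambda>(x, y). Ed x y)"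
      unfolding Ed_def case_prod_unfold
      by (intro continuous_intros continuous_on_compose2[OF ch] continuous_on_compose2[OF cW(1)]
          continuous_on_compose2[OF cW(2)] continuous_on_compose2[OF cW(3)]) (use ok s in auto)
    show "(\<lambda>y. simple_pole \<phi> (h y) x) holomorphic_on B" if "x \<in> ball \<eta> e" for x
      unfolding simple_pole_def by (intro holomorphic_intros hB) (use ok[OF that] in auto)
  qed
  hence "deriv (\<lambda>\<eta>. (deriv ^^ j) (\<lambda>y. simple_pole \<phi> (h y) \<eta>) y0) \<eta> = (deriv ^^ j) (Ed \<eta>) y0" by (rule DERIV_imp_deriv)
  also have "\<dots> = (deriv ^^ j) (\<lambda>y. deriv (simple_pole \<phi> (h y)) \<eta>) y0"
  proof (rule higher_deriv_cong_ev[OF _ refl])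
    have "y0 \<in> B" using AB by auto
    from eventually_nhds_in_open[OF AB(2) this]
    show "\<forall>\<^sub>F y in nhds y0. Ed \<eta> y = deriv (simple_pole \<phi> (h y)) \<eta>"
    proof eventually_elim
      case (elim y)
      have "\<eta> \<in> ball \<eta> e" using e by simp
      from ok[OF this elim] show ?case unfolding Ed_def
        by (intro DERIV_imp_deriv[symmetric] simple_pole_deriv[OF v]) auto
    qed
  qed
  finally show ?thesis by simp
qed

text \<open>Both orders of the arguments lead to derivatives of the same simple poles, taken in the
  opposite order. The current and the stress tensor contain only first and second derivatives of the
  free field, so \<open>n < 2\<close> suffices and at most one derivative at \<open>\<eta>\<close>
  has to be interchanged.\<close>

lemma pair_expect_sym:
  assumes G: "dirichlet_green D G" and a: "valid_atom D S (\<phi>, Suc n, 0, \<eta>)" and b: "valid_atom D S' b"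
    and ne: "cinv \<phi> \<eta> \<noteq> node b" and n: "n < 2"
  shows "pair_expect G (\<phi>, Suc n, 0, \<eta>) b = pair_expect G b (\<phi>, Suc n, 0, \<eta>)"
proof -
  obtain \<psi> j k z where b': "b = (\<psi>, j, k, z)" by (cases b)
  let ?W = "chart_w \<phi>" and ?V = "chart_w \<psi>" and ?Vc = "\<lambda>y. cnj (chart_w \<psi> (cnj y))"
  have v: "is_chart D \<phi>" "\<eta> \<in> cimage \<phi>" using a by (auto simp: valid_atom_def)
  have u: "is_chart D \<psi>" "z \<in> cimage \<psi>" using b by (auto simp: b' valid_atom_def)
  note V = chart_w_holomorphic[OF u(1)] and Vc = chart_w_cnj_holomorphic[OF u(1)]
  note U = cinv_chart(1)[OF v(1)] and U' = cinv_chart(1)[OF u(1)] and U'' = cnj_vimage_open[OF U']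
  have cz: "cnj z \<in> cnj -` cimage \<psi>" using u by simp
  have neW: "?V z \<noteq> ?W \<eta>"
    using w_neq[of "cinv \<psi> z" "cinv \<phi> \<eta>"] ne cinv_chart(5)[OF u] cinv_chart(5)[OF v] by (auto simp: chart_w_def b')
  have neWc: "?Vc (cnj z) \<noteq> ?W \<eta>"
    using w_neq_cnj[of "cinv \<phi> \<eta>" "cinv \<psi> z"] cinv_chart(5)[OF u] cinv_chart(5)[OF v] by (auto simp: chart_w_def)
  have swap: "(deriv ^^ j) (\<lambda>y. (deriv ^^ n) (simple_pole \<phi> (h y)) \<eta>) y0 = (deriv ^^ n) (\<lambda>\<eta>. (deriv ^^ j) (\<lambda>y. simple_pole \<phi> (h y) \<eta>) y0) \<eta>"
    if "h holomorphic_on T" "open T" "y0 \<in> T" "h y0 \<noteq> ?W \<eta>" for h T y0 j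
    using n simple_pole_swap[OF v that] by (cases n) auto
  \<comment> \<open>The common expression to which both sides are reduced; on one side it appears
    with the derivatives interchanged.\<close>
  define R where "R = (\<lambda>\<eta>. (if k = 0 then (deriv ^^ j) (\<lambda>y. simple_pole \<phi> (?V y) \<eta>) z else 0) -
     (if j = 0 then (deriv ^^ k) (\<lambda>y. simple_pole \<phi> (?Vc y) \<eta>) (cnj z) else 0))"
  \<comment> \<open>\<open>kern\<close> and \<open>simple_pole\<close> differ by the sign and by the
    derivative of the coordinate: both come from differentiating \<open>1 / (W x - h y)\<close> in
    \<open>y\<close>.\<close>
  have pole: "- pole_deriv i h y0 (?W x) * deriv ?W x = (deriv ^^ i) (\<lambda>y. simple_pole \<phi> (h y) x) y0"
    if "h holomorphic_on T" "open T" "y0 \<in> T" "h y0 \<noteq> ?W x" for h T y0 i x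
  proof -
    have "open (h -` (- {?W x}) \<inter> T)"
      by (rule open_vimage_holomorphic[OF that(1,2)]) auto
    moreover have "(\<lambda>y. 1 / (?W x - h y)) holomorphic_on (h -` (- {?W x}) \<inter> T)"
      by (intro holomorphic_intros holomorphic_on_subset[OF that(1)]) auto
    ultimately have "(deriv ^^ i) (\<lambda>y. (- deriv ?W x) * (1 / (?W x - h y))) y0 = (- deriv ?W x) * pole_deriv i h y0 (?W x)"
      unfolding pole_deriv_def by (intro higher_deriv_cmult) (use that in auto)
    moreover have "(\<lambda>y. (- deriv ?W x) * (1 / (?W x - h y))) = (\<lambda>y. simple_pole \<phi> (h y) x)"
      unfolding simple_pole_def by (rule ext) (metis minus_divide_divide minus_diff_eq mult.right_neutral times_divide_eq_right)
    ultimately show ?thesis by (simp add: mult.commute)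
  qed
  have kR: "\<forall>\<^sub>F x in nhds \<eta>. kern b (?W x) * deriv ?W x = R x"
  proof -
    have "open (?W -` (- {?V z}) \<inter> cimage \<phi>)"
      by (rule open_vimage_holomorphic[OF chart_w_holomorphic[OF v(1)] U]) auto
    moreover have "\<eta> \<in> ?W -` (- {?V z}) \<inter> cimage \<phi>" using neW v by auto
    ultimately have "\<forall>\<^sub>F x in nhds \<eta>. x \<in> ?W -` (- {?V z}) \<inter> cimage \<phi>" by (rule eventually_nhds_in_open)
    thus ?thesis
    proof eventually_elim
      case (elim x)
      hence n1: "?V z \<noteq> ?W x" by auto
      have n2: "?Vc (cnj z) \<noteq> ?W x"
        using w_neq_cnj[of "cinv \<phi> x" "cinv \<psi> z"] cinv_chart(5)[OF u] cinv_chart(5)[OF v(1)] elim by (auto simp: chart_w_def)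
      show ?case unfolding R_def b' kern.simps pole[OF V U' u(2) n1, symmetric] pole[OF Vc U'' cz n2, symmetric]
        by (auto simp: algebra_simps)
    qed
  qed
  have "pair_expect G (\<phi>, Suc n, 0, \<eta>) b = (deriv ^^ n) (\<lambda>x. kern b (?W x) * deriv ?W x) \<eta>"
    by (rule pair_expect_deriv(1)[OF G a b ne])
  also have "\<dots> = (deriv ^^ n) R \<eta>" by (rule higher_deriv_cong_ev[OF kR refl])
  finally have lhs: "pair_expect G (\<phi>, Suc n, 0, \<eta>) b = (deriv ^^ n) R \<eta>" .
  define Y where "Y = ?V -` (- {?W \<eta>}) \<inter> cimage \<psi>"
  have Y: "open Y" unfolding Y_def
    by (rule open_vimage_holomorphic[OF V U']) auto
  have zY: "z \<in> Y" using neW u by (auto simp: Y_def)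
  have neY: "?V y \<noteq> ?W \<eta>" "cnj (?V y) \<noteq> ?W \<eta>" "y \<in> cimage \<psi>" "cinv \<psi> y \<noteq> cinv \<phi> \<eta>" if "y \<in> Y" for y
    using w_neq_cnj[of "cinv \<phi> \<eta>" "cinv \<psi> y"] cinv_chart(5)[OF u(1)] cinv_chart(5)[OF v] that
    by (auto simp: chart_w_def Y_def)
  \<comment> \<open>For \<open>n < 2\<close> the derivative has a closed form, from which it is seen
    to be holomorphic in the other point.\<close>
  have hol: "(\<lambda>y. (deriv ^^ n) (simple_pole \<phi> (h y)) \<eta>) holomorphic_on Z"
    if h: "h holomorphic_on Z" "\<And>y. y \<in> Z \<Longrightarrow> h y \<noteq> ?W \<eta>" for h Z
  proof (cases "n = 0")
    case True
    thus ?thesis using h by (auto simp: simple_pole_def intro!: holomorphic_intros)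
  next
    case False
    hence eq: "(\<lambda>y. (deriv ^^ n) (simple_pole \<phi> (h y)) \<eta>) = (\<lambda>y. deriv (simple_pole \<phi> (h y)) \<eta>)" using n by (cases n) auto
    have eq': "deriv (simple_pole \<phi> (h y)) \<eta> = deriv (deriv ?W) \<eta> / (h y - ?W \<eta>) + (deriv ?W \<eta>)\<^sup>2 / (h y - ?W \<eta>)\<^sup>2"
      if "y \<in> Z" for y by (rule DERIV_imp_deriv[OF simple_pole_deriv[OF v h(2)[OF that]]])
    have "(\<lambda>y. deriv (deriv ?W) \<eta> / (h y - ?W \<eta>) + (deriv ?W \<eta>)\<^sup>2 / (h y - ?W \<eta>)\<^sup>2) holomorphic_on Z"
      by (intro holomorphic_intros h) (use h in auto)
    thus ?thesis unfolding eq by (rule holomorphic_transform) (rule eq'[symmetric])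
  qed
  define f where "f = (\<lambda>y. (deriv ^^ n) (simple_pole \<phi> (?V y)) \<eta>)"
  define g where "g = (\<lambda>y. cnj ((deriv ^^ n) (simple_pole \<phi> (cnj (?V y))) \<eta>))"
  have f: "f holomorphic_on Y" unfolding f_def
    by (rule hol[OF holomorphic_on_subset[OF V]]) (auto simp: Y_def)
  have gc: "(\<lambda>y. (deriv ^^ n) (simple_pole \<phi> (?Vc y)) \<eta>) holomorphic_on cnj -` Y"
  proof (rule hol[OF holomorphic_on_subset[OF Vc]])
    show "cnj -` Y \<subseteq> cnj -` cimage \<psi>" by (auto simp: Y_def)
    show "?Vc y \<noteq> ?W \<eta>" if "y \<in> cnj -` Y" for y using neY(2)[of "cnj y"] that by (simp only: vimage_eq not_False_eq_True)
  qed
  have g: "g holomorphic_on Y"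
    using holomorphic_on_cnj_cnj[OF gc cnj_vimage_open[OF Y]] by (simp add: g_def vimage_def)
  have fg: "(\<lambda>y. f y / 2) holomorphic_on Y" "(\<lambda>y. - g y / 2) holomorphic_on Y"
    using f g by (auto intro!: holomorphic_intros)
  have half: "(deriv ^^ i) (\<lambda>y. f y / 2) z = (deriv ^^ i) f z / 2" "(deriv ^^ i) (\<lambda>y. - g y / 2) z = - (deriv ^^ i) g z / 2" for i
    using higher_deriv_cmult[OF f zY Y, of i "1/2"] higher_deriv_cmult[OF g zY Y, of i "-1/2"] by simp_all
  have "pair_expect G b (\<phi>, Suc n, 0, \<eta>) =
     2 * (dz ^^ j) ((dzbar ^^ k) (\<lambda>x. (dz ^^ Suc n) (\<lambda>y. complex_of_real (G (cinv \<psi> x) (cinv \<phi> y))) \<eta>)) z"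
    by (simp add: b')
  also have "(dz ^^ j) ((dzbar ^^ k) (\<lambda>x. (dz ^^ Suc n) (\<lambda>y. complex_of_real (G (cinv \<psi> x) (cinv \<phi> y))) \<eta>)) z =
     (if k = 0 then (deriv ^^ j) (\<lambda>y. f y / 2) z else 0) + (if j = 0 then cnj ((deriv ^^ k) (\<lambda>y. - g y / 2) z) else 0)"
  proof (rule wirtinger_power[OF Y fg _ zY])
    fix x assume x: "x \<in> Y"
    have "2 * (dz ^^ Suc n) (\<lambda>y. complex_of_real (G (cinv \<psi> x) (cinv \<phi> y))) \<eta> = f x - cnj (g x)"
      using green_deriv[OF G v, of "cinv \<psi> x" n] neY[OF x] cinv_chart(5)[OF u(1)]
      by (simp add: f_def g_def chart_w_def[of \<psi>])
    hence "(dz ^^ Suc n) (\<lambda>y. complex_of_real (G (cinv \<psi> x) (cinv \<phi> y))) \<eta> = (f x - cnj (g x)) / 2"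
      by (metis nonzero_mult_div_cancel_left zero_neq_numeral)
    thus "(dz ^^ Suc n) (\<lambda>y. complex_of_real (G (cinv \<psi> x) (cinv \<phi> y))) \<eta> = f x / 2 + cnj (- g x / 2)"
      by (simp add: diff_divide_distrib)
  qed
  also have "2 * \<dots> = (if k = 0 then (deriv ^^ j) f z else 0) - (if j = 0 then cnj ((deriv ^^ k) g z) else 0)"
    unfolding half by (auto simp: field_simps)
  also have "cnj ((deriv ^^ k) g z) = (deriv ^^ k) (\<lambda>y. (deriv ^^ n) (simple_pole \<phi> (?Vc y)) \<eta>) (cnj z)"
    using higher_deriv_cnj_cnj[OF gc cnj_vimage_open[OF Y], of z k] zY by (simp add: g_def)
  finally have rhs: "pair_expect G b (\<phi>, Suc n, 0, \<eta>) =
     (if k = 0 then (deriv ^^ n) (\<lambda>\<eta>. (deriv ^^ j) (\<lambda>y. simple_pole \<phi> (?V y) \<eta>) z) \<eta> else 0) -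
     (if j = 0 then (deriv ^^ n) (\<lambda>\<eta>. (deriv ^^ k) (\<lambda>y. simple_pole \<phi> (?Vc y) \<eta>) (cnj z)) \<eta> else 0)"
    unfolding f_def by (simp add: swap[OF V U' u(2) neW] swap[OF Vc U'' cz neWc])
  show ?thesis
  proof (cases "n = 0")
    case True
    thus ?thesis using lhs rhs by (simp add: R_def)
  next
    case False
    hence n1: "n = Suc 0" using n by simp
    have d: "(\<lambda>\<eta>. (deriv ^^ i) (\<lambda>y. simple_pole \<phi> (h y) \<eta>) y0) field_differentiable at \<eta>"
      if h: "h holomorphic_on T" "open T" "y0 \<in> T" "h y0 \<noteq> ?W \<eta>" for h T y0 i
    proof -
      have N: "open (?W -` (- {h y0}) \<inter> cimage \<phi>)"
        by (rule open_vimage_holomorphic[OF chart_w_holomorphic[OF v(1)] U]) auto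
      have \<eta>N: "\<eta> \<in> ?W -` (- {h y0}) \<inter> cimage \<phi>" using v h by auto
      have W: "?W holomorphic_on (?W -` (- {h y0}) \<inter> cimage \<phi>)"
        by (rule holomorphic_on_subset[OF chart_w_holomorphic[OF v(1)]]) auto
      have "(\<lambda>x. pole_deriv i h y0 (?W x)) holomorphic_on (?W -` (- {h y0}) \<inter> cimage \<phi>)"
      proof -
        have "?W ` (?W -` (- {h y0}) \<inter> cimage \<phi>) \<subseteq> - {h y0}" by auto
        from holomorphic_on_compose_gen[OF W pole_deriv_holomorphic[OF h(1,2,3)] this, of i]
        show ?thesis by (simp only: o_def)
      qed
      hence "(\<lambda>x. - pole_deriv i h y0 (?W x) * deriv ?W x) holomorphic_on (?W -` (- {h y0}) \<inter> cimage \<phi>)"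
        by (intro holomorphic_intros holomorphic_deriv W N)
      hence "(\<lambda>x. (deriv ^^ i) (\<lambda>y. simple_pole \<phi> (h y) x) y0) holomorphic_on (?W -` (- {h y0}) \<inter> cimage \<phi>)"
        by (rule holomorphic_transform) (rule pole[OF h(1-3)], auto)
      thus ?thesis using N \<eta>N by (rule holomorphic_on_imp_differentiable_at)
    qed
    have "deriv R \<eta> = (if k = 0 then deriv (\<lambda>\<eta>. (deriv ^^ j) (\<lambda>y. simple_pole \<phi> (?V y) \<eta>) z) \<eta> else 0) -
      (if j = 0 then deriv (\<lambda>\<eta>. (deriv ^^ k) (\<lambda>y. simple_pole \<phi> (?Vc y) \<eta>) (cnj z)) \<eta> else 0)"
      unfolding R_def using d[OF V U' u(2) neW, of j] d[OF Vc U'' cz neWc, of k]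
      by (cases "k = 0"; cases "j = 0") (auto intro!: deriv_diff)
    thus ?thesis using lhs rhs by (simp add: n1)
  qed
qed

end

section \<open>Correlations of fields\<close>

lemma contract_kernel_linear:
  "contract (\<lambda>c. s * k c + t * l c) Z M = s * contract k Z M + t * contract l Z M"
  by (simp add: contract_def sum_distrib_left sum.distrib algebra_simps)

lemma contract_kernel_scale: "contract (\<lambda>c. s * k c) Z = (\<lambda>M. s * contract k Z M)"
  by (rule ext) (simp add: contract_def sum_distrib_left algebra_simps)

lemma contract_scale: "finite (atoms_of Z) \<Longrightarrow> contract k (\<lambda>M. s * Z M) = (\<lambda>M. s * contract k Z M)"
  using contract_linear[of Z Z k s 0] by auto

lemma contract_add: "finite (atoms_of X) \<Longrightarrow> finite (atoms_of Y) \<Longrightarrow>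
   contract k (\<lambda>M. X M + Y M) = (\<lambda>M. contract k X M + contract k Y M)"
  using contract_linear[of X Y k 1 1] by auto

lemma contract_contract_empty:
  assumes "finite (atoms_of X)"
  shows "contract k (contract l X) M = (\<Sum>a\<in>atoms_of X. \<Sum>b\<in>atoms_of X. k a * l b * wick_deriv a (wick_deriv b X) M)"
  unfolding contract_superset[OF assms atoms_of_contract]
  by (rule sum.cong[OF refl]) (simp add: contract_def wick_deriv_def sum_distrib_left mult_ac)

lemma fock_mult_mono1:
  assumes "wick_bounded Z"
  shows "fock_mult K (wick_mono [a]) Z = (\<lambda>M. wick_mult a Z M + contract (K a) Z M)"
  using fock_mult_mono(3)[OF assms, of K a "[]"] by (simp add: fock_mult_one)

text \<open>Contractions commute with each other, so only the Wick multiplication by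
  \<open>a\<close> contributes to the commutator, and it contributes the scalar
  \<open>k a\<close>.\<close>

lemma contract_fock_mult_mono1:
  assumes Z: "wick_bounded Z"
  shows "contract k (fock_mult K (wick_mono [a]) Z) =
     (\<lambda>M. fock_mult K (wick_mono [a]) (contract k Z) M + k a * Z M)"
proof
  fix M
  note fin = wick_bounded_finite
  have "contract k (fock_mult K (wick_mono [a]) Z) M = contract k (wick_mult a Z) M + contract k (contract (K a) Z) M"
    unfolding fock_mult_mono1[OF Z]
    by (subst contract_add) (auto intro!: fin wick_bounded_mult wick_bounded_contract Z)
  also have "\<dots> = (wick_mult a (contract k Z) M + k a * Z M) + contract (K a) (contract k Z) M"
    using contract_wick_mult[OF fin[OF Z], of k a M] contract_commute[OF fin[OF Z], of k "K a"] by simp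
  finally show "contract k (fock_mult K (wick_mono [a]) Z) M = fock_mult K (wick_mono [a]) (contract k Z) M + k a * Z M"
    by (simp add: fock_mult_mono1 wick_bounded_contract Z del: wick_mono_simps)
qed

lemma fock_mult_mono2:
  assumes "wick_bounded Z"
  shows "fock_mult K (wick_mono [a, a']) Z =
     (\<lambda>M. wick_mult a (fock_mult K (wick_mono [a']) Z) M + fock_mult K (wick_mono [a']) (contract (K a) Z) M)"
  by (rule fock_mult_mono(3)[OF assms])

text \<open>The two equal factors give the coefficient 2, which later cancels the \<open>1/2\<close>
  in the stress tensor.\<close>

lemma contract_fock_mult_mono2:
  assumes Z: "wick_bounded Z"
  shows "contract k (fock_mult K (wick_mono [a, a]) Z) =
     (\<lambda>M. fock_mult K (wick_mono [a, a]) (contract k Z) M + 2 * k a * fock_mult K (wick_mono [a]) Z M)"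
proof
  fix M
  note fin = wick_bounded_finite
  let ?F = "fock_mult K (wick_mono [a])"
  have F: "wick_bounded (?F Z)" if "wick_bounded Z" for Z using fock_mult_mono(2)[OF that] .
  have cZ: "wick_bounded (contract l Z)" for l by (rule wick_bounded_contract[OF Z])
  have "contract k (fock_mult K (wick_mono [a, a]) Z) M =
      contract k (wick_mult a (?F Z)) M + contract k (?F (contract (K a) Z)) M"
    unfolding fock_mult_mono2[OF Z]
    by (subst contract_add) (auto intro!: fin wick_bounded_mult F cZ Z simp del: wick_mono_simps)
  also have "contract k (wick_mult a (?F Z)) M = wick_mult a (contract k (?F Z)) M + k a * ?F Z M"
    by (rule contract_wick_mult[OF fin[OF F[OF Z]]])
  also have "contract k (?F Z) = (\<lambda>M. ?F (contract k Z) M + k a * Z M)"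
    by (rule contract_fock_mult_mono1[OF Z])
  also have "contract k (?F (contract (K a) Z)) M = ?F (contract (K a) (contract k Z)) M + k a * contract (K a) Z M"
    using contract_fock_mult_mono1[OF cZ, of k K a] contract_commute[OF fin[OF Z], of k "K a"] by simp
  finally have "contract k (fock_mult K (wick_mono [a, a]) Z) M =
     wick_mult a (?F (contract k Z)) M + ?F (contract (K a) (contract k Z)) M +
     k a * (wick_mult a Z M + contract (K a) Z M) + k a * ?F Z M"
    by (simp add: wick_mult_def algebra_simps del: wick_mono_simps)
  thus "contract k (fock_mult K (wick_mono [a, a]) Z) M =
     fock_mult K (wick_mono [a, a]) (contract k Z) M + 2 * k a * ?F Z M"
    unfolding fock_mult_mono2[OF cZ] fock_mult_mono1[OF Z, of K a, THEN fun_cong, of M, symmetric]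
    by (simp add: algebra_simps del: wick_mono_simps)
qed

text \<open>The action on \<open>Z\<close> of the stress tensor at a point.\<close>

definition stress_op where
  "stress_op K a a' \<beta> \<gamma> Z = (\<lambda>M. (-1/2) * fock_mult K (wick_mono [a, a]) Z M +
     (\<beta> * fock_mult K (wick_mono [a']) Z M + \<gamma> * fock_mult K (wick_mono [a]) Z M))"

lemma wick_bounded_stress_op: "wick_bounded Z \<Longrightarrow> wick_bounded (stress_op K a a' \<beta> \<gamma> Z)"
  unfolding stress_op_def by (intro wick_bounded_add wick_bounded_scale fock_mult_mono(2))

text \<open>The operator is quadratic in the field, so its commutator with a contraction is linear
  in the field plus a scalar.\<close>

lemma contract_stress_op:
  assumes Z: "wick_bounded Z"
  shows "contract k (stress_op K a a' \<beta> \<gamma> Z) =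
     (\<lambda>M. stress_op K a a' \<beta> \<gamma> (contract k Z) M + (- k a) * fock_mult K (wick_mono [a]) Z M + (\<beta> * k a' + \<gamma> * k a) * Z M)"
proof -
  note fin = wick_bounded_finite
  have F: "wick_bounded (fock_mult K (wick_mono as) Z)" for as by (rule fock_mult_mono(2)[OF Z])
  have "contract k (stress_op K a a' \<beta> \<gamma> Z) = (\<lambda>M. (-1/2) * contract k (fock_mult K (wick_mono [a, a]) Z) M +
     (\<beta> * contract k (fock_mult K (wick_mono [a']) Z) M + \<gamma> * contract k (fock_mult K (wick_mono [a]) Z) M))"
    unfolding stress_op_def
    by (simp only: contract_add contract_scale fin F wick_bounded_scale wick_bounded_add)
  thus ?thesis
    unfolding contract_fock_mult_mono2[OF Z] contract_fock_mult_mono1[OF Z]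
    by (simp add: stress_op_def algebra_simps del: wick_mono_simps)
qed

lemma stress_op_empty:
  assumes "wick_bounded Z"
  shows "stress_op K a a' \<beta> \<gamma> Z {#} = (-1/2) * contract (K a) (contract (K a) Z) {#} +
     (\<beta> * contract (K a') Z {#} + \<gamma> * contract (K a) Z {#})"
  unfolding stress_op_def fock_mult_mono2[OF assms] fock_mult_mono1[OF assms] fock_mult_mono1[OF wick_bounded_contract[OF assms]]
  by (simp add: wick_mult_def)

lemma contract_stress_op_empty:
  assumes "wick_bounded Z"
  shows "contract k (stress_op K a a' \<beta> \<gamma> Z) {#} =
     stress_op K a a' \<beta> \<gamma> (contract k Z) {#} - k a * contract (K a) Z {#} + (\<beta> * k a' + \<gamma> * k a) * Z {#}"
  unfolding contract_stress_op[OF assms] fock_mult_mono1[OF assms] by (simp add: wick_mult_def)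

text \<open>The scalar term with \<open>k a * l a\<close> arises when both factors of the quadratic
  part are contracted. For the field \<open>T\<close> it produces the part of the pole of order four
  that does not depend on \<open>b\<close>.\<close>

lemma contract_contract_stress_op_empty:
  assumes Z: "wick_bounded Z"
  shows "contract l (contract k (stress_op K a a' \<beta> \<gamma> Z)) {#} =
     stress_op K a a' \<beta> \<gamma> (contract l (contract k Z)) {#}
     - l a * contract (K a) (contract k Z) {#} - k a * contract (K a) (contract l Z) {#} - k a * l a * Z {#}
     + (\<beta> * l a' + \<gamma> * l a) * contract k Z {#} + (\<beta> * k a' + \<gamma> * k a) * contract l Z {#}"
proof -
  note fin = wick_bounded_finite
  have F: "wick_bounded (fock_mult K (wick_mono [a]) Z)" by (rule fock_mult_mono(2)[OF Z])
  have kZ: "wick_bounded (contract k Z)" "wick_bounded (contract l Z)" by (intro wick_bounded_contract Z)+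
  have S: "wick_bounded (stress_op K a a' \<beta> \<gamma> (contract k Z))" by (rule wick_bounded_stress_op[OF kZ(1)])
  have "contract l (contract k (stress_op K a a' \<beta> \<gamma> Z)) {#} =
     contract l (stress_op K a a' \<beta> \<gamma> (contract k Z)) {#} + (- k a) * contract l (fock_mult K (wick_mono [a]) Z) {#}
     + (\<beta> * k a' + \<gamma> * k a) * contract l Z {#}"
    unfolding contract_stress_op[OF Z]
    by (simp only: contract_add contract_scale fin wick_bounded_add wick_bounded_scale S F Z)
  thus ?thesis
    unfolding contract_stress_op_empty[OF kZ(1)] contract_fock_mult_mono1[OF Z] fock_mult_mono1[OF kZ(2)]
    by (simp add: wick_mult_def algebra_simps del: wick_mono_simps)
qed

section \<open>Fields paired with test functionals\<close>

definition field_term_at :: "chart \<Rightarrow> complex \<Rightarrow> factor list \<Rightarrow> functional" where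
  "field_term_at \<phi> z fs = foldr (\<lambda>a. wick_prod (factor_at \<phi> z a)) fs wick_one"

lemma field_at_Nil: "field_at [] \<phi> z = (\<lambda>M. 0 * wick_one M)"
  by (simp add: field_at_def fun_eq_iff)

lemma field_at_Cons: "field_at ((f, fs) # X) \<phi> z = (\<lambda>M. f \<phi> z * field_term_at \<phi> z fs M + field_at X \<phi> z M)"
  by (simp add: field_at_def field_term_at_def fun_eq_iff)

lemma field_term_at_simps:
  "field_term_at \<phi> z [] = wick_one"
  "field_term_at \<phi> z (Der j k # fs) = wick_mult (\<phi>, j, k, z) (field_term_at \<phi> z fs)"
  by (simp_all add: field_term_at_def wick_prod_atom)

lemma wick_bounded_field_term_at: "wick_bounded (field_term_at \<phi> z fs)"
proof (induction fs)
  case Nil thus ?case by (simp add: field_term_at_def wick_bounded_one)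
next
  case (Cons a fs)
  have "wick_bounded (factor_at \<phi> z a)" by (cases a) (auto intro: wick_bounded_atom wick_bounded_exp)
  thus ?case using wick_bounded_prod[OF _ Cons] by (simp add: field_term_at_def)
qed

lemma wick_bounded_field_at: "wick_bounded (field_at X \<phi> z)"
proof (induction X)
  case Nil
  show ?case unfolding field_at_Nil by (intro wick_bounded_scale wick_bounded_one)
next
  case (Cons t X)
  obtain f fs where t: "t = (f, fs)" by (cases t)
  show ?case unfolding t field_at_Cons
    by (intro wick_bounded_add wick_bounded_scale wick_bounded_field_term_at Cons)
qed

definition corr where "corr G X \<phi> z Z = expect (fmult G (field_at X \<phi> z) Z)"

definition term_corr where "term_corr G fs \<phi> z Z = expect_prod (pair_expect G) (field_term_at \<phi> z fs) Z"

lemma corr_expect_prod: "corr G X \<phi> z Z = expect_prod (pair_expect G) (field_at X \<phi> z) Z"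
  by (simp add: corr_def expect_def expect_prod_def fmult_fock_mult)

lemma corr_Nil: "wick_bounded Z \<Longrightarrow> corr G [] \<phi> z Z = 0"
  using expect_prod_linear_left[of wick_one wick_one Z "pair_expect G" 0 0]
  by (simp add: corr_expect_prod field_at_Nil wick_bounded_one)

lemma corr_Cons: "wick_bounded Z \<Longrightarrow> corr G ((f, fs) # X) \<phi> z Z = f \<phi> z * term_corr G fs \<phi> z Z + corr G X \<phi> z Z"
  using expect_prod_linear_left[of "field_term_at \<phi> z fs" "field_at X \<phi> z" Z "pair_expect G" "f \<phi> z" 1]
  by (simp add: corr_expect_prod term_corr_def field_at_Cons wick_bounded_field_at wick_bounded_field_term_at)

lemma corr_append: "wick_bounded Z \<Longrightarrow> corr G (X @ Y) \<phi> z Z = corr G X \<phi> z Z + corr G Y \<phi> z Z"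
  by (induction X) (auto simp: corr_Nil corr_Cons)

lemma corr_add: "wick_bounded Z \<Longrightarrow> corr G (field_add X Y) \<phi> z Z = corr G X \<phi> z Z + corr G Y \<phi> z Z"
  by (simp add: field_add_def corr_append)

lemma corr_scale: "wick_bounded Z \<Longrightarrow> corr G (field_scale c X) \<phi> z Z = c * corr G X \<phi> z Z"
  by (induction X) (auto simp: field_scale_def corr_Nil corr_Cons algebra_simps)

lemma term_corr_Nil: "term_corr G [] \<phi> z Z = Z {#}"
  by (simp add: term_corr_def field_term_at_simps expect_prod_one)

lemma term_corr_Cons: "wick_bounded Z \<Longrightarrow>
   term_corr G (Der j k # fs) \<phi> z Z = term_corr G fs \<phi> z (contract (pair_expect G (\<phi>, j, k, z)) Z)"
  by (simp add: term_corr_def field_term_at_simps expect_prod_mult_left wick_bounded_field_term_at)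

lemma corr_nonrandom: "wick_bounded Z \<Longrightarrow> corr G (nonrandom f) \<phi> z Z = f \<phi> z * Z {#}"
  by (simp add: nonrandom_def corr_Cons corr_Nil term_corr_Nil)

fun factor_atom :: "chart \<Rightarrow> complex \<Rightarrow> factor \<Rightarrow> atom" where
  "factor_atom \<phi> z (Der j k) = (\<phi>, j, k, z)"
| "factor_atom \<phi> z (WExp \<alpha>) = (\<phi>, 0, 0, z)"

text \<open>The fields without Wick exponentials. Left multiplication by them is a finite
  combination of Wick multiplications and contractions.\<close>

definition derivative_field :: "fock \<Rightarrow> bool" where
  "derivative_field X \<longleftrightarrow> (\<forall>(f, fs)\<in>set X. \<forall>a\<in>set fs. \<exists>j k. a = Der j k)"

lemma field_term_at_mono:
  "(\<forall>a\<in>set fs. \<exists>j k. a = Der j k) \<Longrightarrow> field_term_at \<phi> z fs = wick_mono (map (factor_atom \<phi> z) fs)"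
proof (induction fs)
  case Nil thus ?case by (simp add: field_term_at_simps)
next
  case (Cons a fs)
  then obtain j k where "a = Der j k" by auto
  thus ?case using Cons by (simp add: field_term_at_simps)
qed

lemma multipliable_derivative_field:
  "derivative_field X \<Longrightarrow> wick_bounded Z \<Longrightarrow> multipliable K (field_at X \<phi> z) Z L"
proof (induction X)
  case Nil
  show ?case unfolding field_at_Nil
    using multipliable_linear_left[where c = 0 and d = 0 and K = K and Z = Z and L = L, OF multipliable_one multipliable_one] by simp
next
  case (Cons t X)
  obtain f fs where t: "t = (f, fs)" by (cases t)
  have "multipliable K (field_term_at \<phi> z fs) Z L"
    using Cons t by (subst field_term_at_mono) (auto simp: derivative_field_def intro: fock_mult_mono(1))
  moreover have "multipliable K (field_at X \<phi> z) Z L" using Cons by (auto simp: derivative_field_def)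
  ultimately show ?case unfolding t field_at_Cons
    using multipliable_linear_left[of K "field_term_at \<phi> z fs" Z L "field_at X \<phi> z" "f \<phi> z" 1] by simp
qed

lemma fock_mult_derivative_field_Nil: "fock_mult K (field_at [] \<phi> z) Z = (\<lambda>L. 0 * Z L)"
  using fock_mult_linear_left[where c = 0 and d = 0 and K = K and Z = Z, OF multipliable_one multipliable_one]
  by (auto simp: field_at_Nil fun_eq_iff)

lemma fock_mult_derivative_field_Cons:
  assumes "derivative_field ((f, fs) # X)" "wick_bounded Z"
  shows "fock_mult K (field_at ((f, fs) # X) \<phi> z) Z =
    (\<lambda>L. f \<phi> z * fock_mult K (wick_mono (map (factor_atom \<phi> z) fs)) Z L + fock_mult K (field_at X \<phi> z) Z L)"
proof
  fix L
  have fs: "field_term_at \<phi> z fs = wick_mono (map (factor_atom \<phi> z) fs)"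
    by (rule field_term_at_mono) (use assms in \<open>auto simp: derivative_field_def\<close>)
  have m1: "multipliable K (wick_mono (map (factor_atom \<phi> z) fs)) Z L" by (rule fock_mult_mono(1)[OF assms(2)])
  have m2: "multipliable K (field_at X \<phi> z) Z L"
    by (rule multipliable_derivative_field) (use assms in \<open>auto simp: derivative_field_def\<close>)
  show "fock_mult K (field_at ((f, fs) # X) \<phi> z) Z L =
    f \<phi> z * fock_mult K (wick_mono (map (factor_atom \<phi> z) fs)) Z L + fock_mult K (field_at X \<phi> z) Z L"
    unfolding field_at_Cons fs using fock_mult_linear_left[where c = "f \<phi> z" and d = 1, OF m1 m2] by simp
qed

lemma fock_mult_derivative_field:
  assumes "derivative_field X" "is_chart D \<phi>" "z \<in> cimage \<phi>" "cinv \<phi> z \<in> S"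
  shows "wick_bounded Z \<Longrightarrow> wick_bounded (fock_mult K (field_at X \<phi> z) Z)"
    and "is_functional D S Z \<Longrightarrow> is_functional D S (fock_mult K (field_at X \<phi> z) Z)"
proof -
  show "wick_bounded (fock_mult K (field_at X \<phi> z) Z)" if "wick_bounded Z"
    using assms(1)
  proof (induction X)
    case Nil thus ?case unfolding fock_mult_derivative_field_Nil by (intro wick_bounded_scale that)
  next
    case (Cons t X)
    obtain f fs where t: "t = (f, fs)" by (cases t)
    show ?case unfolding t fock_mult_derivative_field_Cons[OF Cons.prems[unfolded t] that]
      by (intro wick_bounded_add wick_bounded_scale fock_mult_mono(2) that Cons.IH)
         (use Cons.prems in \<open>auto simp: derivative_field_def\<close>)
  qed
  show "is_functional D S (fock_mult K (field_at X \<phi> z) Z)" if "is_functional D S Z"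
    using assms(1)
  proof (induction X)
    case Nil thus ?case unfolding fock_mult_derivative_field_Nil by (intro is_functional.scale that)
  next
    case (Cons t X)
    obtain f fs where t: "t = (f, fs)" by (cases t)
    have "valid_atom D S a" if "a \<in> set (map (factor_atom \<phi> z) fs)" for a
    proof -
      from that obtain x where "a = factor_atom \<phi> z x" by auto
      thus ?thesis using assms(2-4) by (cases x) (auto simp: valid_atom_def)
    qed
    thus ?case unfolding t fock_mult_derivative_field_Cons[OF Cons.prems[unfolded t] is_functional_wick_bounded[OF that]]
      by (intro is_functional.add is_functional.scale is_functional_fock_mult_mono that Cons.IH)
         (use Cons.prems in \<open>auto simp: derivative_field_def\<close>)
  qed
qed

text \<open>The left factor may be moved to the test functional; the right factor may be any Fock space field,
  Wick exponentials included.\<close>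

lemma expect_fmult_fmult:
  assumes A: "derivative_field A" and Z: "wick_bounded Z"
    and sym: "\<And>f fs j k i l. (f, fs) \<in> set A \<Longrightarrow> Der j k \<in> set fs \<Longrightarrow>
      pair_expect G (\<phi>, j, k, \<eta>) (\<phi>, i, l, z) = pair_expect G (\<phi>, i, l, z) (\<phi>, j, k, \<eta>)"
    and v: "is_chart D \<phi>" "z \<in> cimage \<phi>"
  shows "expect (fmult G (fmult G (field_at A \<phi> \<eta>) (field_at X \<phi> z)) Z) = corr G X \<phi> z (fock_mult (pair_expect G) (field_at A \<phi> \<eta>) Z)"
proof -
  let ?K = "pair_expect G" and ?X = "field_at X \<phi> z"
  have X: "wick_bounded ?X" by (rule wick_bounded_field_at)
  have atX: "\<exists>i l. a = (\<phi>, i, l, z)" if "a \<in> atoms_of ?X" for a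
  proof -
    have t: "atoms_of (field_term_at \<phi> z fs) \<subseteq> {a. \<exists>i l. a = (\<phi>, i, l, z)}" for fs
    proof (induction fs)
      case (Cons a fs)
      have "atoms_of (factor_at \<phi> z a) \<subseteq> {a. \<exists>i l. a = (\<phi>, i, l, z)}"
        using atoms_of_exp by (cases a) (fastforce simp: atoms_of_atom)+
      thus ?case using Cons atoms_of_prod[of "factor_at \<phi> z a" "field_term_at \<phi> z fs"]
        by (auto simp: field_term_at_def)
    qed (simp add: field_term_at_simps atoms_of_one)
    have "atoms_of (field_at X \<phi> z) \<subseteq> {a. \<exists>i l. a = (\<phi>, i, l, z)}" for X
    proof (induction X)
      case (Cons t X)
      obtain f fs where t': "t = (f, fs)" by (cases t)
      show ?case unfolding t' field_at_Cons
        using atoms_of_linear[of "f \<phi> z" "field_term_at \<phi> z fs" 1 "field_at X \<phi> z"] t[of fs] Cons by auto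
    qed (simp add: field_at_Nil atoms_of_def)
    thus ?thesis using that by blast
  qed
  have "expect_prod ?K (fock_mult ?K (field_at A \<phi> \<eta>) ?X) Z = expect_prod ?K ?X (fock_mult ?K (field_at A \<phi> \<eta>) Z)"
    using A sym
  proof (induction A)
    case Nil
    show ?case unfolding fock_mult_derivative_field_Nil
      using expect_prod_linear_left[OF X X Z, of ?K 0 0] expect_prod_linear_right[OF Z Z X, of ?K 0 0] by simp
  next
    case (Cons t A)
    obtain f fs where t: "t = (f, fs)" by (cases t)
    have A: "derivative_field A" using Cons.prems by (auto simp: derivative_field_def)
    let ?m = "wick_mono (map (factor_atom \<phi> \<eta>) fs)"
    have m: "expect_prod ?K (fock_mult ?K ?m ?X) Z = expect_prod ?K ?X (fock_mult ?K ?m Z)"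
    proof (rule expect_prod_fock_mult[OF X Z])
      fix a b assume a: "a \<in> set (map (factor_atom \<phi> \<eta>) fs)" and b: "b \<in> atoms_of ?X"
      obtain j k where jk: "a = (\<phi>, j, k, \<eta>)" "Der j k \<in> set fs"
        using a Cons.prems(1) by (fastforce simp: t derivative_field_def)
      obtain i l where "b = (\<phi>, i, l, z)" using atX[OF b] by blast
      thus "?K a b = ?K b a" using Cons.prems(2)[of f fs j k i l] jk by (simp add: t)
    qed
    have IH: "expect_prod ?K (fock_mult ?K (field_at A \<phi> \<eta>) ?X) Z = expect_prod ?K ?X (fock_mult ?K (field_at A \<phi> \<eta>) Z)"
      by (rule Cons.IH[OF A]) (rule Cons.prems(2), auto)
    have bd: "wick_bounded (fock_mult ?K ?m Y)" "wick_bounded (fock_mult ?K (field_at A \<phi> \<eta>) Y)" if "wick_bounded Y" for Y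
    proof -
      show "wick_bounded (fock_mult ?K ?m Y)" by (rule fock_mult_mono(2)[OF that])
      show "wick_bounded (fock_mult ?K (field_at A \<phi> \<eta>) Y)"
        using A
      proof (induction A)
        case Nil thus ?case unfolding fock_mult_derivative_field_Nil by (intro wick_bounded_scale that)
      next
        case (Cons t A)
        obtain f fs where t: "t = (f, fs)" by (cases t)
        show ?case unfolding t fock_mult_derivative_field_Cons[OF Cons.prems[unfolded t] that]
          by (intro wick_bounded_add wick_bounded_scale fock_mult_mono(2) that Cons.IH)
             (use Cons.prems in \<open>auto simp: derivative_field_def\<close>)
      qed
    qed
    show ?case unfolding t fock_mult_derivative_field_Cons[OF Cons.prems(1)[unfolded t] X]
        fock_mult_derivative_field_Cons[OF Cons.prems(1)[unfolded t] Z]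
      using expect_prod_linear_left[OF bd[OF X] Z, of ?K "f \<phi> \<eta>" 1] expect_prod_linear_right[OF bd[OF Z] X, of ?K "f \<phi> \<eta>" 1]
      by (simp add: m IH)
  qed
  thus ?thesis by (simp add: corr_expect_prod expect_def expect_prod_def fmult_fock_mult)
qed

section \<open>Complex conjugation of functionals\<close>

definition func_star :: "functional \<Rightarrow> functional" where
  "func_star Z M = cnj (Z (image_mset atom_star M))"

lemma image_star_star [simp]: "image_mset atom_star (image_mset atom_star M) = M"
  by (simp add: image_mset.compositionality o_def)

lemma inj_atom_star: "inj atom_star"
  by (metis atom_star_star injI)

lemma func_star_star [simp]: "func_star (func_star Z) = Z"
  by (rule ext) (simp add: func_star_def)

lemma func_star_empty: "func_star Z {#} = cnj (Z {#})"
  by (simp add: func_star_def)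

lemma atoms_of_func_star: "atoms_of (func_star Z) = atom_star ` atoms_of Z"
proof -
  have *: "atoms_of (func_star Z) \<subseteq> atom_star ` atoms_of Z" for Z
  proof
    fix a assume "a \<in> atoms_of (func_star Z)"
    then obtain M where M: "Z (image_mset atom_star M) \<noteq> 0" "a \<in># M" by (auto simp: atoms_of_def func_star_def)
    hence "atom_star a \<in> atoms_of Z" by (auto simp: atoms_of_def intro!: exI[of _ "image_mset atom_star M"])
    thus "a \<in> atom_star ` atoms_of Z" by (metis atom_star_star imageI)
  qed
  have "atom_star ` atoms_of Z \<subseteq> atoms_of (func_star Z)"
    using image_mono[OF *[of "func_star Z"], of atom_star] by (simp add: image_image)
  thus ?thesis using *[of Z] by blast
qed

lemma count_image_star: "count (image_mset atom_star M) (atom_star a) = count M a"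
  by (induction M) (simp_all add: inj_eq[OF inj_atom_star])

lemma wick_deriv_func_star: "wick_deriv c (func_star Z) M = cnj (wick_deriv (atom_star c) Z (image_mset atom_star M))"
  by (simp add: wick_deriv_def func_star_def count_image_star)

lemma contract_func_star: "contract k (func_star Z) = func_star (contract (\<lambda>c. cnj (k (atom_star c))) Z)"
proof
  fix M
  have "contract k (func_star Z) M = (\<Sum>b\<in>atoms_of Z. k (atom_star b) * wick_deriv (atom_star b) (func_star Z) M)"
    unfolding contract_def atoms_of_func_star
    by (subst sum.reindex) (auto intro: inj_on_subset[OF inj_atom_star])
  thus "contract k (func_star Z) M = func_star (contract (\<lambda>c. cnj (k (atom_star c))) Z) M"
    by (simp add: func_star_def contract_def wick_deriv_func_star)
qed

lemma wick_mult_func_star: "wick_mult a (func_star Z) = func_star (wick_mult (atom_star a) Z)"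
proof
  fix M
  show "wick_mult a (func_star Z) M = func_star (wick_mult (atom_star a) Z) M"
  proof (cases "a \<in># M")
    case True
    then obtain N where M: "M = add_mset a N" by (metis insert_DiffM)
    show ?thesis by (simp add: M func_star_def)
  next
    case False
    moreover have "atom_star a \<notin># image_mset atom_star M" using False by (simp add: inj_image_mem_iff[OF inj_atom_star])
    ultimately show ?thesis by (simp add: wick_mult_def func_star_def)
  qed
qed

lemma wick_bounded_func_star:
  assumes "wick_bounded Z" shows "wick_bounded (func_star Z)"
proof -
  obtain C r where "C \<ge> 0" "r \<ge> 1" "\<And>M. norm (Z M) \<le> C * r ^ size M / fact (size M)"
    by (rule wick_boundedE[OF assms]) blast
  thus ?thesis
    by (intro wick_boundedI[of _ C r]) (use assms in \<open>auto simp: atoms_of_func_star wick_bounded_def func_star_def dest: spec\<close>, metis size_image_mset)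
qed

section \<open>Test functionals near a point, and the current\<close>

context halfplane_map
begin

text \<open>Keeps what the correlations use of a functional, convergence and nodes away from
  \<open>p\<close>, in a form that is stable under \<open>contract\<close> and under
  \<open>func_star\<close>.\<close>

definition test_at :: "complex \<Rightarrow> functional \<Rightarrow> bool" where
  "test_at p Z \<longleftrightarrow> wick_bounded Z \<and> (\<forall>c\<in>atoms_of Z. valid_atom D (D - {p}) c)"

lemma test_at_bounded: "test_at p Z \<Longrightarrow> wick_bounded Z" and test_at_finite: "test_at p Z \<Longrightarrow> finite (atoms_of Z)"
  by (auto simp: test_at_def wick_bounded_def)

lemma test_at_functional: "is_functional D (D - {p}) Z \<Longrightarrow> test_at p Z"
  by (auto simp: test_at_def is_functional_wick_bounded is_functional_atoms)

lemma test_at_contract: "test_at p Z \<Longrightarrow> test_at p (contract k Z)"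
  using atoms_of_contract[of k Z] by (auto simp: test_at_def wick_bounded_contract)

lemma valid_star: "valid_atom D S (atom_star c) \<longleftrightarrow> valid_atom D S c"
  by (cases c) (simp add: valid_atom_def)

lemma test_at_star: "test_at p Z \<Longrightarrow> test_at p (func_star Z)"
  by (auto simp: test_at_def wick_bounded_func_star atoms_of_func_star valid_star)

lemma test_at_node: "test_at p Z \<Longrightarrow> c \<in> atoms_of Z \<Longrightarrow> node c \<noteq> p"
  by (cases c) (auto simp: test_at_def valid_atom_def)

lemma test_at_valid: "test_at p Z \<Longrightarrow> c \<in> atoms_of Z \<Longrightarrow> valid_atom D (D - {p}) c"
  by (auto simp: test_at_def)

text \<open>There are finitely many nodes, so some disc about \<open>w p\<close> avoids their
  images. It is taken in the coordinate \<open>w\<close> so that it does not refer to a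
  chart.\<close>

lemma test_at_near:
  assumes Z: "test_at p Z" and p: "p \<in> D"
  obtains \<rho> where "\<rho> > 0" "ball (w p) \<rho> \<subseteq> {x. 0 < Im x}"
    "\<And>c. c \<in> atoms_of Z \<Longrightarrow> kern c holomorphic_on ball (w p) \<rho>"
    "\<And>q. q \<in> D \<Longrightarrow> w q \<in> ball (w p) \<rho> \<Longrightarrow> test_at q Z"
proof -
  define S where "S = {x. 0 < Im x} - w ` node ` atoms_of Z"
  have "open {x. 0 < Im x}" by (rule open_halfspace_Im_gt)
  hence "open S" unfolding S_def
    using test_at_finite[OF Z] by (intro open_Diff finite_imp_closed) auto
  moreover have "w p \<in> S"
  proof -
    have "w p \<noteq> w (node c)" if c: "c \<in> atoms_of Z" for c
      using test_at_node[OF Z c] test_at_valid[OF Z c] p w_neq[of p "node c"]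
      by (cases c) (auto simp: valid_atom_def)
    thus ?thesis using Im_w[OF p] by (auto simp: S_def)
  qed
  ultimately obtain \<rho> where \<rho>: "\<rho> > 0" "ball (w p) \<rho> \<subseteq> S" using open_contains_ball by blast
  show ?thesis
  proof (rule that[OF \<rho>(1)])
    show "ball (w p) \<rho> \<subseteq> {x. 0 < Im x}" using \<rho> by (auto simp: S_def)
    show "kern c holomorphic_on ball (w p) \<rho>" if "c \<in> atoms_of Z" for c
      by (rule holomorphic_on_subset[OF kern_holomorphic[OF test_at_valid[OF Z that]]]) (use \<rho> that in \<open>auto simp: S_def\<close>)
    fix q assume q: "q \<in> D" "w q \<in> ball (w p) \<rho>"
    have "valid_atom D (D - {q}) c" if c: "c \<in> atoms_of Z" for c
    proof -
      have "w q \<noteq> w (node c)" using \<rho>(2) q c by (auto simp: S_def)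
      hence "node c \<noteq> q" by auto
      thus ?thesis using test_at_valid[OF Z c] by (cases c) (auto simp: valid_atom_def)
    qed
    thus "test_at q Z" using Z by (simp add: test_at_def)
  qed
qed

text \<open>The contraction of \<open>\<partial>\<Phi>\<^sub>(\<^sub>0\<^sub>)\<close> with a
  functional in the coordinate \<open>w\<close>; a chart adds only the factor
  \<open>deriv (chart_w \<phi>)\<close>.\<close>

definition current :: "complex \<Rightarrow> functional \<Rightarrow> functional" where
  "current x = contract (\<lambda>c. kern c x)"

definition current' :: "complex \<Rightarrow> functional \<Rightarrow> functional" where
  "current' x = contract (\<lambda>c. deriv (kern c) x)"

lemma test_at_current: "test_at p Z \<Longrightarrow> test_at p (current x Z)"
  unfolding current_def by (rule test_at_contract)

text \<open>For fixed \<open>Z\<close> these are finite sums of kernels with constant coefficients.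
  In the last part the two terms of the product rule agree because contractions commute, hence the
  factor 2.\<close>

lemma current_holomorphic:
  assumes "\<And>c. c \<in> atoms_of Z \<Longrightarrow> kern c holomorphic_on ball y \<rho>"
  shows "(\<lambda>x. current x Z {#}) holomorphic_on ball y \<rho>"
    and "(\<lambda>x. current' x Z {#}) holomorphic_on ball y \<rho>"
    and "x \<in> ball y \<rho> \<Longrightarrow> deriv (\<lambda>x. current x Z {#}) x = current' x Z {#}"
    and "finite (atoms_of Z) \<Longrightarrow> (\<lambda>x. current x (current x Z) {#}) holomorphic_on ball y \<rho>"
    and "finite (atoms_of Z) \<Longrightarrow> x \<in> ball y \<rho> \<Longrightarrow>
      ((\<lambda>x. current x (current x Z) {#}) has_field_derivative 2 * current' x (current x Z) {#}) (at x)"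
proof -
  show 1: "(\<lambda>x. current x Z {#}) holomorphic_on ball y \<rho>"
    unfolding current_def contract_def by (intro holomorphic_intros assms)
  show "(\<lambda>x. current' x Z {#}) holomorphic_on ball y \<rho>"
    unfolding current'_def contract_def by (intro holomorphic_intros holomorphic_deriv assms open_ball)
  have d: "(kern c has_field_derivative deriv (kern c) x) (at x)" if "x \<in> ball y \<rho>" "c \<in> atoms_of Z" for x c
    by (rule holomorphic_derivI[OF assms[OF that(2)] open_ball that(1)])
  show "deriv (\<lambda>x. current x Z {#}) x = current' x Z {#}" if x: "x \<in> ball y \<rho>"
    unfolding current_def current'_def contract_def
    by (rule DERIV_imp_deriv) (intro DERIV_sum DERIV_cmult_right d x)
  assume fin: "finite (atoms_of Z)"
  have e: "contract k (contract l Z) {#} = (\<Sum>a\<in>atoms_of Z. \<Sum>b\<in>atoms_of Z. k a * l b * wick_deriv a (wick_deriv b Z) {#})" for k l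
    by (rule contract_contract_empty[OF fin])
  show h: "(\<lambda>x. current x (current x Z) {#}) holomorphic_on ball y \<rho>"
    unfolding current_def e by (intro holomorphic_intros assms)
  assume x: "x \<in> ball y \<rho>"
  have "((\<lambda>x. current x (current x Z) {#}) has_field_derivative
     (\<Sum>a\<in>atoms_of Z. \<Sum>b\<in>atoms_of Z. (deriv (kern a) x * kern b x + deriv (kern b) x * kern a x) * wick_deriv a (wick_deriv b Z) {#})) (at x)"
    unfolding current_def e by (intro DERIV_sum DERIV_cmult_right DERIV_mult d x) auto
  also have "(\<Sum>a\<in>atoms_of Z. \<Sum>b\<in>atoms_of Z. (deriv (kern a) x * kern b x + deriv (kern b) x * kern a x) * wick_deriv a (wick_deriv b Z) {#}) =
     contract (\<lambda>c. deriv (kern c) x) (contract (\<lambda>c. kern c x) Z) {#} + contract (\<lambda>c. kern c x) (contract (\<lambda>c. deriv (kern c) x) Z) {#}"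
    unfolding e sum.distrib[symmetric] by (intro sum.cong refl) (simp add: algebra_simps)
  also have "contract (\<lambda>c. kern c x) (contract (\<lambda>c. deriv (kern c) x) Z) = contract (\<lambda>c. deriv (kern c) x) (contract (\<lambda>c. kern c x) Z)"
    by (rule contract_commute[OF fin])
  finally show "((\<lambda>x. current x (current x Z) {#}) has_field_derivative 2 * current' x (current x Z) {#}) (at x)"
    by (simp add: current_def current'_def)
qed

end

section \<open>The action of the stress tensor on test functionals\<close>

locale gff_setup = halfplane_map +
  fixes G :: "complex \<Rightarrow> complex \<Rightarrow> real" and \<theta> :: "complex \<Rightarrow> real" and b :: real
  assumes green_G: "dirichlet_green D G" and arg_branch: "is_arg_branch D (deriv w) \<theta>"
begin

abbreviation "K \<equiv> pair_expect G"

definition jcoef :: "chart \<Rightarrow> complex \<Rightarrow> complex" where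
  "jcoef \<phi> z = \<i> * of_real b * (deriv (deriv (chart_w \<phi>)) z / deriv (chart_w \<phi>) z)"

text \<open>The correlation of the stress tensor with \<open>Z\<close> in the coordinate
  \<open>w\<close>, where the coefficient \<open>j\<close> vanishes.\<close>

definition tau :: "complex \<Rightarrow> functional \<Rightarrow> complex" where
  "tau x Z = - (1/2) * current x (current x Z) {#} + \<i> * of_real b * current' x Z {#}"

lemma tau_holomorphic:
  assumes "\<And>c. c \<in> atoms_of Z \<Longrightarrow> kern c holomorphic_on ball y \<rho>" "finite (atoms_of Z)"
  shows "(\<lambda>x. tau x Z) holomorphic_on ball y \<rho>"
  unfolding tau_def using current_holomorphic[OF assms(1)] assms(2) by (intro holomorphic_intros) auto

definition stress :: "chart \<Rightarrow> complex \<Rightarrow> functional \<Rightarrow> functional" where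
  "stress \<phi> \<eta> = stress_op K (\<phi>, Suc 0, 0, \<eta>) (\<phi>, Suc (Suc 0), 0, \<eta>) (\<i> * of_real b) (- jcoef \<phi> \<eta>)"

definition stress_bar :: "chart \<Rightarrow> complex \<Rightarrow> functional \<Rightarrow> functional" where
  "stress_bar \<phi> \<eta> = stress_op K (\<phi>, 0, Suc 0, \<eta>) (\<phi>, 0, Suc (Suc 0), \<eta>) (cnj (\<i> * of_real b)) (cnj (- jcoef \<phi> \<eta>))"

definition stress_field :: fock where
  "stress_field = [(\<lambda>\<phi> z. -1/2, [Der (Suc 0) 0, Der (Suc 0) 0]), (\<lambda>\<phi> z. \<i> * of_real b, [Der (Suc (Suc 0)) 0]),
     (\<lambda>\<phi> z. - jcoef \<phi> z, [Der (Suc 0) 0])]"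

lemma derivative_field_stress: "derivative_field stress_field" "derivative_field (field_cnj stress_field)"
  by (auto simp: derivative_field_def stress_field_def field_cnj_def)

lemma fock_mult_stress_field:
  assumes "wick_bounded Z"
  shows "fock_mult K (field_at stress_field \<phi> \<eta>) Z = stress \<phi> \<eta> Z"
    and "fock_mult K (field_at (field_cnj stress_field) \<phi> \<eta>) Z = stress_bar \<phi> \<eta> Z"
  using derivative_field_stress unfolding stress_field_def field_cnj_def stress_def stress_bar_def stress_op_def
  by (simp_all add: fock_mult_derivative_field_Cons fock_mult_derivative_field_Nil assms derivative_field_def del: wick_mono_simps)

lemma wick_bounded_stress: "wick_bounded Z \<Longrightarrow> wick_bounded (stress \<phi> \<eta> Z)" "wick_bounded Z \<Longrightarrow> wick_bounded (stress_bar \<phi> \<eta> Z)"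
  unfolding stress_def stress_bar_def by (simp_all add: wick_bounded_stress_op)

lemma contract_K1:
  assumes v: "is_chart D \<phi>" "\<eta> \<in> cimage \<phi>" and Z: "test_at (cinv \<phi> \<eta>) Z"
  shows "contract (K (\<phi>, Suc 0, 0, \<eta>)) Z = (\<lambda>M. deriv (chart_w \<phi>) \<eta> * current (chart_w \<phi> \<eta>) Z M)"
proof -
  have "contract (K (\<phi>, Suc 0, 0, \<eta>)) Z = contract (\<lambda>c. deriv (chart_w \<phi>) \<eta> * kern c (chart_w \<phi> \<eta>)) Z"
  proof (rule contract_cong)
    fix c assume c: "c \<in> atoms_of Z"
    have a: "valid_atom D {cinv \<phi> \<eta>} (\<phi>, 0, 0, \<eta>)" using v by (simp add: valid_atom_def)
    show "K (\<phi>, Suc 0, 0, \<eta>) c = deriv (chart_w \<phi>) \<eta> * kern c (chart_w \<phi> \<eta>)"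
      using pair_expect_deriv(1)[OF green_G a test_at_valid[OF Z c], of 0] test_at_node[OF Z c] by (simp add: mult.commute)
  qed
  thus ?thesis by (simp add: contract_kernel_scale current_def)
qed

lemma kern_chart_deriv:
  assumes v: "is_chart D \<phi>" "\<eta> \<in> cimage \<phi>" and c: "valid_atom D S c" "node c \<noteq> cinv \<phi> \<eta>"
  shows "((\<lambda>\<eta>. kern c (chart_w \<phi> \<eta>) * deriv (chart_w \<phi>) \<eta>) has_field_derivative
     (deriv (chart_w \<phi>) \<eta>)\<^sup>2 * deriv (kern c) (chart_w \<phi> \<eta>) + deriv (deriv (chart_w \<phi>)) \<eta> * kern c (chart_w \<phi> \<eta>)) (at \<eta>)"
proof -
  let ?W = "chart_w \<phi>"
  note U = cinv_chart(1)[OF v(1)] and W = chart_w_holomorphic[OF v(1)]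
  have "node c \<in> D" using c cinv_chart(5) by (cases c) (auto simp: valid_atom_def)
  hence ne: "?W \<eta> \<noteq> w (node c)" using w_neq[of "cinv \<phi> \<eta>" "node c"] c(2) cinv_chart(5)[OF v] by (auto simp: chart_w_def)
  have op: "open ({x. 0 < Im x} - {w (node c)})" by (intro open_Diff open_halfspace_Im_gt) auto
  have dk: "(kern c has_field_derivative deriv (kern c) (?W \<eta>)) (at (?W \<eta>))"
    by (rule holomorphic_derivI[OF kern_holomorphic[OF c(1)] op]) (use ne Im_chart_w[OF v] in auto)
  have d: "(?W has_field_derivative deriv ?W \<eta>) (at \<eta>)" by (rule holomorphic_derivI[OF W U v(2)])
  have d2: "(deriv ?W has_field_derivative deriv (deriv ?W) \<eta>) (at \<eta>)"
    by (rule holomorphic_derivI[OF holomorphic_deriv[OF W U] U v(2)])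
  show ?thesis
    using DERIV_mult[OF DERIV_chain2[OF dk d] d2] by (rule DERIV_cong) (simp add: power2_eq_square algebra_simps)
qed

lemma contract_K2:
  assumes v: "is_chart D \<phi>" "\<eta> \<in> cimage \<phi>" and Z: "test_at (cinv \<phi> \<eta>) Z"
  shows "contract (K (\<phi>, Suc (Suc 0), 0, \<eta>)) Z = (\<lambda>M. (deriv (chart_w \<phi>) \<eta>)\<^sup>2 * current' (chart_w \<phi> \<eta>) Z M +
     deriv (deriv (chart_w \<phi>)) \<eta> * current (chart_w \<phi> \<eta>) Z M)"
proof -
  have "contract (K (\<phi>, Suc (Suc 0), 0, \<eta>)) Z = contract (\<lambda>c. (deriv (chart_w \<phi>) \<eta>)\<^sup>2 * deriv (kern c) (chart_w \<phi> \<eta>) +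
     deriv (deriv (chart_w \<phi>)) \<eta> * kern c (chart_w \<phi> \<eta>)) Z"
  proof (rule contract_cong)
    fix c assume c: "c \<in> atoms_of Z"
    have a: "valid_atom D {cinv \<phi> \<eta>} (\<phi>, 0, 0, \<eta>)" using v by (simp add: valid_atom_def)
    show "K (\<phi>, Suc (Suc 0), 0, \<eta>) c = (deriv (chart_w \<phi>) \<eta>)\<^sup>2 * deriv (kern c) (chart_w \<phi> \<eta>) +
     deriv (deriv (chart_w \<phi>)) \<eta> * kern c (chart_w \<phi> \<eta>)"
      using pair_expect_deriv(1)[OF green_G a test_at_valid[OF Z c], of "Suc 0"] test_at_node[OF Z c]
        DERIV_imp_deriv[OF kern_chart_deriv[OF v test_at_valid[OF Z c] test_at_node[OF Z c]]] by simp
  qed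
  thus ?thesis by (simp add: contract_kernel_linear current_def current'_def fun_eq_iff)
qed

text \<open>The second derivative of the free field brings in the second derivative of the
  coordinate by the chain rule, and \<open>j\<close> is chosen to cancel it. This makes the stress
  tensor a quadratic differential.\<close>

lemma jcoef_cancel:
  assumes v: "is_chart D \<phi>" "\<eta> \<in> cimage \<phi>"
  shows "\<i> * of_real b * (s\<^sup>2 * u + deriv (deriv (chart_w \<phi>)) \<eta> * t) + (- jcoef \<phi> \<eta>) * (deriv (chart_w \<phi>) \<eta> * t) =
    \<i> * of_real b * (s\<^sup>2 * u)"
  using deriv_chart_w[OF v] by (simp add: jcoef_def algebra_simps)

lemma stress_empty:
  assumes v: "is_chart D \<phi>" "\<eta> \<in> cimage \<phi>" and Z: "test_at (cinv \<phi> \<eta>) Z"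
  shows "stress \<phi> \<eta> Z {#} = (deriv (chart_w \<phi>) \<eta>)\<^sup>2 * tau (chart_w \<phi> \<eta>) Z"
proof -
  let ?x = "chart_w \<phi> \<eta>" and ?d = "deriv (chart_w \<phi>) \<eta>"
  have "contract (K (\<phi>, Suc 0, 0, \<eta>)) (contract (K (\<phi>, Suc 0, 0, \<eta>)) Z) {#} = ?d\<^sup>2 * current ?x (current ?x Z) {#}"
    unfolding contract_K1[OF v Z] contract_scale[OF test_at_finite[OF test_at_current[OF Z]]]
      contract_K1[OF v test_at_current[OF Z]] by (simp add: power2_eq_square)
  thus ?thesis
    unfolding stress_def stress_op_empty[OF test_at_bounded[OF Z]] contract_K1[OF v Z] contract_K2[OF v Z] jcoef_cancel[OF v]
    by (simp add: tau_def algebra_simps)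
qed

text \<open>When a contraction with \<open>c\<close> meets the stress tensor, the atom of the stress
  tensor stands in second place; symmetry brings it back to the form described by
  \<open>kern\<close>.\<close>

lemma sym_K:
  assumes v: "is_chart D \<phi>" "\<eta> \<in> cimage \<phi>" and c: "valid_atom D S c" "node c \<noteq> cinv \<phi> \<eta>"
  shows "K c (\<phi>, Suc 0, 0, \<eta>) = deriv (chart_w \<phi>) \<eta> * kern c (chart_w \<phi> \<eta>)"
    and "K c (\<phi>, Suc (Suc 0), 0, \<eta>) = (deriv (chart_w \<phi>) \<eta>)\<^sup>2 * deriv (kern c) (chart_w \<phi> \<eta>) +
     deriv (deriv (chart_w \<phi>)) \<eta> * kern c (chart_w \<phi> \<eta>)"
proof -
  have a: "valid_atom D {cinv \<phi> \<eta>} (\<phi>, n, 0, \<eta>)" for n using v by (simp add: valid_atom_def)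
  note ne = c(2)[symmetric]
  show "K c (\<phi>, Suc 0, 0, \<eta>) = deriv (chart_w \<phi>) \<eta> * kern c (chart_w \<phi> \<eta>)"
    using pair_expect_sym[OF green_G a c(1) ne, of 0] pair_expect_deriv(1)[OF green_G a c(1) ne, of 0] by (simp add: mult.commute)
  show "K c (\<phi>, Suc (Suc 0), 0, \<eta>) = (deriv (chart_w \<phi>) \<eta>)\<^sup>2 * deriv (kern c) (chart_w \<phi> \<eta>) +
     deriv (deriv (chart_w \<phi>)) \<eta> * kern c (chart_w \<phi> \<eta>)"
    using pair_expect_sym[OF green_G a c(1) ne, of "Suc 0"] pair_expect_deriv(1)[OF green_G a c(1) ne, of "Suc 0"]
      DERIV_imp_deriv[OF kern_chart_deriv[OF v c]] by simp
qed

text \<open>The atom \<open>c\<close> passes through to \<open>Z\<close>, or is paired with one of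
  the two currents of the quadratic part, or with the linear part. The \<open>1/2\<close> disappears
  because either current may be chosen.\<close>

lemma contract_stress:
  assumes v: "is_chart D \<phi>" "\<eta> \<in> cimage \<phi>" and Z: "test_at (cinv \<phi> \<eta>) Z"
    and c: "valid_atom D S c" "node c \<noteq> cinv \<phi> \<eta>"
  shows "contract (K c) (stress \<phi> \<eta> Z) {#} = (deriv (chart_w \<phi>) \<eta>)\<^sup>2 *
    (tau (chart_w \<phi> \<eta>) (contract (K c) Z) - kern c (chart_w \<phi> \<eta>) * current (chart_w \<phi> \<eta>) Z {#} +
     \<i> * of_real b * deriv (kern c) (chart_w \<phi> \<eta>) * Z {#})"
  unfolding stress_def contract_stress_op_empty[OF test_at_bounded[OF Z]]
  unfolding stress_def[symmetric] stress_empty[OF v test_at_contract[OF Z]] contract_K1[OF v Z] sym_K[OF v c] jcoef_cancel[OF v]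
  by (simp add: power2_eq_square algebra_simps)

lemma contract_contract_stress:
  assumes v: "is_chart D \<phi>" "\<eta> \<in> cimage \<phi>" and Z: "test_at (cinv \<phi> \<eta>) Z"
    and c: "valid_atom D S c" "node c \<noteq> cinv \<phi> \<eta>" and c': "valid_atom D S' c'" "node c' \<noteq> cinv \<phi> \<eta>"
  shows "contract (K c') (contract (K c) (stress \<phi> \<eta> Z)) {#} = (deriv (chart_w \<phi>) \<eta>)\<^sup>2 *
    (tau (chart_w \<phi> \<eta>) (contract (K c') (contract (K c) Z))
     - kern c' (chart_w \<phi> \<eta>) * current (chart_w \<phi> \<eta>) (contract (K c) Z) {#}
     - kern c (chart_w \<phi> \<eta>) * current (chart_w \<phi> \<eta>) (contract (K c') Z) {#}
     - kern c (chart_w \<phi> \<eta>) * kern c' (chart_w \<phi> \<eta>) * Z {#}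
     + \<i> * of_real b * deriv (kern c') (chart_w \<phi> \<eta>) * contract (K c) Z {#}
     + \<i> * of_real b * deriv (kern c) (chart_w \<phi> \<eta>) * contract (K c') Z {#})"
  unfolding stress_def contract_contract_stress_op_empty[OF test_at_bounded[OF Z]]
  unfolding stress_def[symmetric] stress_empty[OF v test_at_contract[OF test_at_contract[OF Z]]]
    contract_K1[OF v test_at_contract[OF Z]] sym_K[OF v c] sym_K[OF v c'] jcoef_cancel[OF v]
  by (simp add: power2_eq_square algebra_simps)

lemma contract_K_star:
  assumes "valid_atom D S a" "test_at (node a) Z"
  shows "func_star (contract (K a) Z) = contract (K (atom_star a)) (func_star Z)"
proof -
  obtain \<phi> j k z where a: "a = (\<phi>, j, k, z)" by (cases a)
  have "contract (\<lambda>c. cnj (K (atom_star a) (atom_star c))) Z = contract (K a) Z"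
  proof (rule contract_cong)
    fix c assume c: "c \<in> atoms_of Z"
    have "K (atom_star a) (atom_star c) = cnj (K a c)"
      using pair_expect_deriv(3)[OF green_G assms(1)[unfolded a] test_at_valid[OF assms(2) c]] test_at_node[OF assms(2) c]
      by (simp add: a)
    thus "cnj (K (atom_star a) (atom_star c)) = K a c" by simp
  qed
  thus ?thesis by (simp add: contract_func_star)
qed

text \<open>Pair expectations of conjugate atoms are conjugate. So the antiholomorphic half acts on
  \<open>Z\<close> as the holomorphic half acts on the conjugate of \<open>Z\<close>, and no
  separate computation is needed for it.\<close>

lemma stress_bar_star:
  assumes v: "is_chart D \<phi>" "\<eta> \<in> cimage \<phi>" and Z: "test_at (cinv \<phi> \<eta>) Z"
  shows "func_star (stress_bar \<phi> \<eta> Z) = stress \<phi> \<eta> (func_star Z)"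
proof -
  have a: "valid_atom D {cinv \<phi> \<eta>} (\<phi>, 0, n, \<eta>)" for n using v by (simp add: valid_atom_def)
  have F1: "func_star (fock_mult K (wick_mono [(\<phi>, 0, n, \<eta>)]) Y) = fock_mult K (wick_mono [(\<phi>, n, 0, \<eta>)]) (func_star Y)"
    if Y: "test_at (cinv \<phi> \<eta>) Y" for n Y
  proof -
    note b = test_at_bounded[OF Y]
    have "func_star (contract (K (\<phi>, 0, n, \<eta>)) Y) = contract (K (\<phi>, n, 0, \<eta>)) (func_star Y)"
      using contract_K_star[OF a[of n], of Y] Y by simp
    thus ?thesis unfolding fock_mult_mono1[OF b] fock_mult_mono1[OF wick_bounded_func_star[OF b]] wick_mult_func_star
      by (auto simp: func_star_def fun_eq_iff)
  qed
  have F2: "func_star (fock_mult K (wick_mono [(\<phi>, 0, n, \<eta>), (\<phi>, 0, n, \<eta>)]) Z) =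
     fock_mult K (wick_mono [(\<phi>, n, 0, \<eta>), (\<phi>, n, 0, \<eta>)]) (func_star Z)" for n
  proof -
    note b = test_at_bounded[OF Z]
    have 1: "func_star (contract (K (\<phi>, 0, n, \<eta>)) Z) = contract (K (\<phi>, n, 0, \<eta>)) (func_star Z)"
      using contract_K_star[OF a[of n], of Z] Z by simp
    have "func_star (fock_mult K (wick_mono [(\<phi>, 0, n, \<eta>), (\<phi>, 0, n, \<eta>)]) Z) =
      (\<lambda>M. func_star (wick_mult (\<phi>, 0, n, \<eta>) (fock_mult K (wick_mono [(\<phi>, 0, n, \<eta>)]) Z)) M +
         func_star (fock_mult K (wick_mono [(\<phi>, 0, n, \<eta>)]) (contract (K (\<phi>, 0, n, \<eta>)) Z)) M)"
      unfolding fock_mult_mono2[OF b] by (simp add: func_star_def fun_eq_iff)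
    also have "func_star (fock_mult K (wick_mono [(\<phi>, 0, n, \<eta>)]) (contract (K (\<phi>, 0, n, \<eta>)) Z)) =
      fock_mult K (wick_mono [(\<phi>, n, 0, \<eta>)]) (contract (K (\<phi>, n, 0, \<eta>)) (func_star Z))"
      by (simp only: F1[OF test_at_contract[OF Z]] 1)
    also have "func_star (wick_mult (\<phi>, 0, n, \<eta>) (fock_mult K (wick_mono [(\<phi>, 0, n, \<eta>)]) Z)) =
      wick_mult (\<phi>, n, 0, \<eta>) (fock_mult K (wick_mono [(\<phi>, n, 0, \<eta>)]) (func_star Z))"
      using wick_mult_func_star[of "(\<phi>, n, 0, \<eta>)"] by (simp only: F1[OF Z, symmetric] atom_star.simps)
    finally show ?thesis unfolding fock_mult_mono2[OF wick_bounded_func_star[OF b]] .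
  qed
  have "func_star (stress_bar \<phi> \<eta> Z) = (\<lambda>M. (-1/2) * func_star (fock_mult K (wick_mono [(\<phi>, 0, Suc 0, \<eta>), (\<phi>, 0, Suc 0, \<eta>)]) Z) M +
     (\<i> * of_real b * func_star (fock_mult K (wick_mono [(\<phi>, 0, Suc (Suc 0), \<eta>)]) Z) M +
      (- jcoef \<phi> \<eta>) * func_star (fock_mult K (wick_mono [(\<phi>, 0, Suc 0, \<eta>)]) Z) M))"
    unfolding stress_bar_def stress_op_def by (simp add: func_star_def fun_eq_iff del: wick_mono_simps)
  thus ?thesis unfolding F2 F1[OF Z] stress_def stress_op_def .
qed

lemma test_at_stress:
  assumes v: "is_chart D \<phi>" "\<eta> \<in> cimage \<phi>" "cinv \<phi> \<eta> \<noteq> p" and Z: "is_functional D (D - {p}) Z"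
  shows "is_functional D (D - {p}) (stress \<phi> \<eta> Z)" "is_functional D (D - {p}) (stress_bar \<phi> \<eta> Z)"
proof -
  have "cinv \<phi> \<eta> \<in> D - {p}" using v cinv_chart(5) by auto
  thus "is_functional D (D - {p}) (stress \<phi> \<eta> Z)" "is_functional D (D - {p}) (stress_bar \<phi> \<eta> Z)"
    unfolding fock_mult_stress_field[OF is_functional_wick_bounded[OF Z], symmetric]
    using fock_mult_derivative_field(2)[OF _ v(1,2) _ Z] derivative_field_stress by auto
qed

lemma sym_stress:
  assumes v: "is_chart D \<phi>" "\<eta> \<in> cimage \<phi>" and c: "valid_atom D S c" "node c \<noteq> cinv \<phi> \<eta>" and n: "n = Suc 0 \<or> n = Suc (Suc 0)"
  shows "K (\<phi>, n, 0, \<eta>) c = K c (\<phi>, n, 0, \<eta>)" "K (\<phi>, 0, n, \<eta>) c = K c (\<phi>, 0, n, \<eta>)"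
proof -
  have a: "valid_atom D {cinv \<phi> \<eta>} (\<phi>, i, j, \<eta>)" for i j using v by (simp add: valid_atom_def)
  have s: "K (\<phi>, n, 0, \<eta>) c = K c (\<phi>, n, 0, \<eta>)" if c: "valid_atom D S c" "node c \<noteq> cinv \<phi> \<eta>" for c
    using pair_expect_sym[OF green_G a c(1) c(2)[symmetric], of "n - 1"] n by auto
  show "K (\<phi>, n, 0, \<eta>) c = K c (\<phi>, n, 0, \<eta>)" by (rule s[OF c])
  obtain \<psi> j k z where c': "c = (\<psi>, j, k, z)" by (cases c)
  have 1: "K (\<phi>, 0, n, \<eta>) c = cnj (K (\<phi>, n, 0, \<eta>) (atom_star c))"
    using pair_expect_deriv(3)[OF green_G a[of n 0] iffD2[OF valid_star c(1)]] c(2) by simp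
  have vc: "valid_atom D S (\<psi>, k, j, z)" using c by (simp add: c' valid_atom_def)
  have 2: "K c (\<phi>, 0, n, \<eta>) = cnj (K (atom_star c) (\<phi>, n, 0, \<eta>))"
    using pair_expect_deriv(3)[OF green_G vc a[of n 0]] c by (simp add: c' del: pair_expect.simps)
  show "K (\<phi>, 0, n, \<eta>) c = K c (\<phi>, 0, n, \<eta>)"
    unfolding 1 2 using s[of "atom_star c"] c by (simp add: valid_star)
qed

lemma expect_stress_field:
  assumes v: "is_chart D \<phi>" "\<eta> \<in> cimage \<phi>" "z \<in> cimage \<phi>" "\<eta> \<noteq> z" and Z: "wick_bounded Z"
  shows "expect (fmult G (fmult G (field_at stress_field \<phi> \<eta>) (field_at X \<phi> z)) Z) = corr G X \<phi> z (stress \<phi> \<eta> Z)"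
    and "expect (fmult G (fmult G (field_at (field_cnj stress_field) \<phi> \<eta>) (field_at X \<phi> z)) Z) = corr G X \<phi> z (stress_bar \<phi> \<eta> Z)"
proof -
  have ne: "cinv \<phi> z \<noteq> cinv \<phi> \<eta>" using v cinv_chart(4)[OF v(1)] by metis
  have c: "valid_atom D {cinv \<phi> z} (\<phi>, i, l, z)" "node (\<phi>, i, l, z) \<noteq> cinv \<phi> \<eta>" for i l
    using v ne by (auto simp: valid_atom_def)
  note s = sym_stress[OF v(1,2) c]
  show "expect (fmult G (fmult G (field_at stress_field \<phi> \<eta>) (field_at X \<phi> z)) Z) = corr G X \<phi> z (stress \<phi> \<eta> Z)"
    unfolding fock_mult_stress_field(1)[OF Z, symmetric]
    by (rule expect_fmult_fmult[OF derivative_field_stress(1) Z _ v(1,3)])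
       (use s in \<open>auto simp: stress_field_def simp del: pair_expect.simps\<close>)
  show "expect (fmult G (fmult G (field_at (field_cnj stress_field) \<phi> \<eta>) (field_at X \<phi> z)) Z) = corr G X \<phi> z (stress_bar \<phi> \<eta> Z)"
    unfolding fock_mult_stress_field(2)[OF Z, symmetric]
    by (rule expect_fmult_fmult[OF derivative_field_stress(2) Z _ v(1,3)])
       (use s in \<open>auto simp: stress_field_def field_cnj_def simp del: pair_expect.simps\<close>)
qed

end

section \<open>Charts and non-random fields\<close>

text \<open>A form in which only derivatives at the point itself occur; these are the quantities
  whose time derivatives along a flow are known.\<close>

lemma schwarzian_eq:
  assumes h: "h holomorphic_on S" and S: "open S" "z \<in> S" and nz: "deriv h z \<noteq> 0"
  shows "schwarzian h z = (deriv ^^ 3) h z / deriv h z - (3/2) * ((deriv ^^ 2) h z / deriv h z)\<^sup>2"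
proof -
  have d1: "(deriv h has_field_derivative (deriv ^^ 2) h z) (at z)"
    using has_field_derivative_higher_deriv[OF h S, of 1] by (simp add: numeral_2_eq_2)
  have d2: "(deriv (deriv h) has_field_derivative (deriv ^^ 3) h z) (at z)"
    using has_field_derivative_higher_deriv[OF h S, of 2] by (simp add: numeral_2_eq_2 numeral_3_eq_3)
  have "((\<lambda>x. deriv (deriv h) x / deriv h x) has_field_derivative
     ((deriv ^^ 3) h z * deriv h z - deriv (deriv h) z * (deriv ^^ 2) h z) / (deriv h z * deriv h z)) (at z)"
    by (rule DERIV_divide[OF d2 d1 nz])
  hence "deriv (\<lambda>x. deriv (deriv h) x / deriv h x) z =
     ((deriv ^^ 3) h z * deriv h z - (deriv ^^ 2) h z * (deriv ^^ 2) h z) / (deriv h z * deriv h z)"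
    by (simp add: DERIV_imp_deriv numeral_2_eq_2)
  moreover have "(a * d - c * c) / (d * d) - 1/2 * (c / d)\<^sup>2 = a / d - 3/2 * (c / d)\<^sup>2" if "d \<noteq> 0" for a c d :: complex
    using that by (simp add: field_simps power2_eq_square)
  ultimately show ?thesis using nz by (simp add: schwarzian_def numeral_2_eq_2)
qed

lemma schwarzian_cong:
  assumes "eventually (\<lambda>x. f x = g x) (nhds z)"
  shows "schwarzian f z = schwarzian g z"
proof -
  have 1: "eventually (\<lambda>x. deriv f x = deriv g x) (nhds z)"
    using iffD2[OF eventually_eventually assms] by eventually_elim (rule deriv_cong_ev, auto)
  have 2: "eventually (\<lambda>x. deriv (deriv f) x = deriv (deriv g) x) (nhds z)"
    using iffD2[OF eventually_eventually 1] by eventually_elim (rule deriv_cong_ev, auto)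
  have "eventually (\<lambda>x. deriv (deriv f) x / deriv f x = deriv (deriv g) x / deriv g x) (nhds z)"
    using 1 2 by eventually_elim simp
  hence "deriv (\<lambda>x. deriv (deriv f) x / deriv f x) z = deriv (\<lambda>x. deriv (deriv g) x / deriv g x) z"
    by (rule deriv_cong_ev) simp
  thus ?thesis using eventually_nhds_x_imp_x[OF 1] eventually_nhds_x_imp_x[OF 2] by (simp add: schwarzian_def)
qed

lemma deriv_compose_123:
  assumes V: "V holomorphic_on T" "open T" and h: "h holomorphic_on S" "open S" "h ` S \<subseteq> T" and z: "z \<in> S"
  shows "deriv (\<lambda>x. V (h x)) z = deriv V (h z) * deriv h z"
    and "(deriv ^^ 2) (\<lambda>x. V (h x)) z = (deriv ^^ 2) V (h z) * (deriv h z)\<^sup>2 + deriv V (h z) * (deriv ^^ 2) h z"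
    and "(deriv ^^ 3) (\<lambda>x. V (h x)) z = (deriv ^^ 3) V (h z) * deriv h z ^ 3 +
       3 * (deriv ^^ 2) V (h z) * deriv h z * (deriv ^^ 2) h z + deriv V (h z) * (deriv ^^ 3) h z"
proof -
  have dh: "((deriv ^^ n) h has_field_derivative (deriv ^^ Suc n) h x) (at x)" if "x \<in> S" for n x
    by (rule has_field_derivative_higher_deriv[OF h(1,2) that])
  have dV: "((\<lambda>x. (deriv ^^ n) V (h x)) has_field_derivative (deriv ^^ Suc n) V (h x) * deriv h x) (at x)" if "x \<in> S" for n x
  proof -
    have "h x \<in> T" using h(3) that by auto
    moreover have "(h has_field_derivative deriv h x) (at x)" using dh[OF that, of 0] by simp
    ultimately show ?thesis using DERIV_chain2[OF has_field_derivative_higher_deriv[OF V]] by blast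
  qed
  have ev: "eventually (\<lambda>x. x \<in> S) (nhds x)" if "x \<in> S" for x by (rule eventually_nhds_in_open[OF h(2) that])
  have 1: "deriv (\<lambda>x. V (h x)) x = deriv V (h x) * deriv h x" if "x \<in> S" for x
    using dV[OF that, of 0] by (simp add: DERIV_imp_deriv)
  have 2: "(deriv ^^ 2) (\<lambda>x. V (h x)) x = (deriv ^^ 2) V (h x) * (deriv h x)\<^sup>2 + deriv V (h x) * (deriv ^^ 2) h x"
    if x: "x \<in> S" for x
  proof -
    have "(deriv ^^ 2) (\<lambda>x. V (h x)) x = deriv (\<lambda>x. deriv V (h x) * deriv h x) x"
      unfolding numeral_2_eq_2 funpow.simps o_def id_def
      by (rule deriv_cong_ev) (use ev[OF x] 1 in \<open>auto elim: eventually_mono\<close>)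
    also have "\<dots> = (deriv ^^ 2) V (h x) * (deriv h x)\<^sup>2 + deriv V (h x) * (deriv ^^ 2) h x"
      by (rule DERIV_imp_deriv, rule DERIV_cong[OF DERIV_mult[OF dV[OF x, of 1, simplified] dh[OF x, of 1, simplified]]])
         (simp add: numeral_2_eq_2 power2_eq_square algebra_simps)
    finally show ?thesis .
  qed
  have "(deriv ^^ 3) (\<lambda>x. V (h x)) z = deriv ((deriv ^^ 2) (\<lambda>x. V (h x))) z"
    by (simp add: numeral_3_eq_3 numeral_2_eq_2)
  also have "\<dots> = deriv (\<lambda>x. (deriv ^^ 2) V (h x) * (deriv h x)\<^sup>2 + deriv V (h x) * (deriv ^^ 2) h x) z"
    by (rule deriv_cong_ev) (use ev[OF z] 2 in \<open>auto elim!: eventually_mono\<close>)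
  also have "\<dots> = (deriv ^^ 3) V (h z) * deriv h z ^ 3 +
       3 * (deriv ^^ 2) V (h z) * deriv h z * (deriv ^^ 2) h z + deriv V (h z) * (deriv ^^ 3) h z"
  proof (rule DERIV_imp_deriv)
    have a: "((\<lambda>x. (deriv ^^ 2) V (h x)) has_field_derivative (deriv ^^ 3) V (h z) * deriv h z) (at z)"
      using dV[OF z, of 2] by (simp add: numeral_3_eq_3 numeral_2_eq_2)
    have b: "((\<lambda>x. deriv V (h x)) has_field_derivative (deriv ^^ 2) V (h z) * deriv h z) (at z)"
      using dV[OF z, of 1] by (simp add: numeral_2_eq_2)
    have c: "(deriv h has_field_derivative (deriv ^^ 2) h z) (at z)" using dh[OF z, of 1] by (simp add: numeral_2_eq_2)
    have d: "((deriv ^^ 2) h has_field_derivative (deriv ^^ 3) h z) (at z)"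
      using dh[OF z, of 2] by (simp add: numeral_3_eq_3 numeral_2_eq_2)
    have e: "((\<lambda>x. (deriv h x)\<^sup>2) has_field_derivative 2 * deriv h z * (deriv ^^ 2) h z) (at z)"
      using DERIV_mult[OF c c] unfolding power2_eq_square by (rule DERIV_cong) simp
    show "((\<lambda>x. (deriv ^^ 2) V (h x) * (deriv h x)\<^sup>2 + deriv V (h x) * (deriv ^^ 2) h x) has_field_derivative
       (deriv ^^ 3) V (h z) * deriv h z ^ 3 + 3 * (deriv ^^ 2) V (h z) * deriv h z * (deriv ^^ 2) h z + deriv V (h z) * (deriv ^^ 3) h z) (at z)"
      by (rule DERIV_cong[OF DERIV_add[OF DERIV_mult[OF a e] DERIV_mult[OF b d]]])
         (simp add: power3_eq_cube power2_eq_square algebra_simps)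
  qed
  finally show "(deriv ^^ 3) (\<lambda>x. V (h x)) z = (deriv ^^ 3) V (h z) * deriv h z ^ 3 +
       3 * (deriv ^^ 2) V (h z) * deriv h z * (deriv ^^ 2) h z + deriv V (h z) * (deriv ^^ 3) h z" .
  show "deriv (\<lambda>x. V (h x)) z = deriv V (h z) * deriv h z"
    "(deriv ^^ 2) (\<lambda>x. V (h x)) z = (deriv ^^ 2) V (h z) * (deriv h z)\<^sup>2 + deriv V (h z) * (deriv ^^ 2) h z"
    using 1 2 z by blast+
qed

lemma schwarzian_compose:
  assumes V: "V holomorphic_on T" "open T" and h: "h holomorphic_on S" "open S" "h ` S \<subseteq> T" and z: "z \<in> S"
    and nz: "deriv V (h z) \<noteq> 0" "deriv h z \<noteq> 0"
  shows "schwarzian (\<lambda>x. V (h x)) z = schwarzian V (h z) * (deriv h z)\<^sup>2 + schwarzian h z"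
proof -
  have Vh: "(\<lambda>x. V (h x)) holomorphic_on S" using holomorphic_on_compose_gen[OF h(1) V(1) h(3)] by (simp add: o_def)
  note d = deriv_compose_123[OF V h z]
  have nz': "deriv (\<lambda>x. V (h x)) z \<noteq> 0" using d(1) nz by simp
  have alg: "(v3 * h1 ^ 3 + 3 * v2 * h1 * h2 + v1 * h3) / (v1 * h1) - 3/2 * ((v2 * h1\<^sup>2 + v1 * h2) / (v1 * h1))\<^sup>2 =
     (v3 / v1 - 3/2 * (v2 / v1)\<^sup>2) * h1\<^sup>2 + (h3 / h1 - 3/2 * (h2 / h1)\<^sup>2)"
    if "v1 \<noteq> 0" "h1 \<noteq> 0" for v1 v2 v3 h1 h2 h3 :: complex
    using that by (simp add: field_simps power2_eq_square power3_eq_cube)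
  show ?thesis
    unfolding schwarzian_eq[OF Vh h(2) z nz'] schwarzian_eq[OF V(1,2) subsetD[OF h(3) imageI[OF z]] nz(1)]
      schwarzian_eq[OF h(1,2) z nz(2)] d by (rule alg[OF nz])
qed

text \<open>A branch of the argument that converges to \<open>u0\<close> stays within distance
  \<open>pi\<close> of it, and there \<open>Ln\<close> inverts \<open>exp\<close>. The branch is
  therefore given by the principal logarithm of the quotient.\<close>

lemma branch_unique_near:
  fixes u :: "'x \<Rightarrow> real"
  assumes "(u \<longlongrightarrow> u0) F" "eventually (\<lambda>x. q x = of_real (cmod (q x)) * cis (u x) \<and> q x \<noteq> 0) F"
    and q0: "q0 = of_real (cmod q0) * cis u0" "q0 \<noteq> 0"
  shows "eventually (\<lambda>x. u x = u0 + Im (Ln (q x / q0))) F"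
proof -
  have "eventually (\<lambda>x. dist (u x) u0 < pi) F" using assms(1) pi_gt_zero by (rule tendstoD)
  thus ?thesis using assms(2)
  proof eventually_elim
    case (elim x)
    define r where "r = cmod (q x) / cmod q0"
    have r: "r > 0" using elim q0 by (simp add: r_def)
    have "q x / q0 = (of_real (cmod (q x)) * cis (u x)) / (of_real (cmod q0) * cis u0)"
      using elim q0(1) by metis
    also have "\<dots> = of_real r * cis (u x - u0)" by (simp add: r_def cis_divide[symmetric])
    also have "\<dots> = exp (Complex (ln r) (u x - u0))"
      using r by (simp add: exp_eq_polar)
    finally have "Ln (q x / q0) = Complex (ln r) (u x - u0)"
      using elim(1) by (simp add: Ln_exp dist_real_def abs_less_iff)
    thus ?case by simp
  qed
qed

section \<open>Charts and transition maps in the coordinate w\<close>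

context halfplane_map
begin

lemma chart_w_deriv_eq:
  assumes v: "is_chart D \<phi>" "z \<in> cimage \<phi>"
  shows "deriv (cmap \<phi>) (cinv \<phi> z) \<noteq> 0"
    and "(cinv \<phi> has_field_derivative inverse (deriv (cmap \<phi>) (cinv \<phi> z))) (at z)"
    and "deriv (chart_w \<phi>) z = deriv w (cinv \<phi> z) / deriv (cmap \<phi>) (cinv \<phi> z)"
proof -
  have c: "open (cdom \<phi>)" "cmap \<phi> holomorphic_on cdom \<phi>" "inj_on (cmap \<phi>) (cdom \<phi>)"
    using v by (auto simp: is_chart_def)
  have p: "cinv \<phi> z \<in> cdom \<phi>" using cinv_chart(3)[OF v] .
  show nz: "deriv (cmap \<phi>) (cinv \<phi> z) \<noteq> 0" by (rule holomorphic_injective_imp_regular[OF c(2,1,3) p])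
  have di: "(cinv \<phi> has_field_derivative deriv (cinv \<phi>) z) (at z)"
    by (rule holomorphic_derivI[OF cinv_chart(2)[OF v(1)] cinv_chart(1)[OF v(1)] v(2)])
  have dc: "(cmap \<phi> has_field_derivative deriv (cmap \<phi>) (cinv \<phi> z)) (at (cinv \<phi> z))"
    by (rule holomorphic_derivI[OF c(2,1) p])
  have "((\<lambda>x. cmap \<phi> (cinv \<phi> x)) has_field_derivative deriv (cmap \<phi>) (cinv \<phi> z) * deriv (cinv \<phi>) z) (at z)"
    by (rule DERIV_chain2[OF dc di])
  moreover have "((\<lambda>x. cmap \<phi> (cinv \<phi> x)) has_field_derivative 1) (at z)"
    by (rule has_field_derivative_transform_within_open[OF DERIV_ident cinv_chart(1)[OF v(1)] v(2)])
       (simp add: cinv_chart(4)[OF v(1)])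
  ultimately have "deriv (cmap \<phi>) (cinv \<phi> z) * deriv (cinv \<phi>) z = 1" by (rule DERIV_unique)
  hence "deriv (cinv \<phi>) z = inverse (deriv (cmap \<phi>) (cinv \<phi> z))" using nz by (simp add: field_simps)
  with di show di': "(cinv \<phi> has_field_derivative inverse (deriv (cmap \<phi>) (cinv \<phi> z))) (at z)" by simp
  have dw: "(w has_field_derivative deriv w (cinv \<phi> z)) (at (cinv \<phi> z))"
    by (rule holomorphic_derivI[OF hol_w open_D cinv_chart(5)[OF v]])
  have "((\<lambda>x. w (cinv \<phi> x)) has_field_derivative deriv w (cinv \<phi> z) * inverse (deriv (cmap \<phi>) (cinv \<phi> z))) (at z)"
    by (rule DERIV_chain2[OF dw di'])
  thus "deriv (chart_w \<phi>) z = deriv w (cinv \<phi> z) / deriv (cmap \<phi>) (cinv \<phi> z)"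
    by (simp add: chart_w_def[abs_def] DERIV_imp_deriv divide_inverse)
qed

lemma transition_facts:
  assumes v: "is_chart D \<phi>" "is_chart D \<phi>'"
  defines "S \<equiv> cmap \<phi> ` (cdom \<phi> \<inter> cdom \<phi>')"
  shows "open S" "S \<subseteq> cimage \<phi>" "transition \<phi> \<phi>' holomorphic_on S" "transition \<phi> \<phi>' ` S \<subseteq> cimage \<phi>'"
    "x \<in> S \<Longrightarrow> chart_w \<phi> x = chart_w \<phi>' (transition \<phi> \<phi>' x)"
    "x \<in> S \<Longrightarrow> deriv (transition \<phi> \<phi>') x \<noteq> 0"
    "x \<in> S \<Longrightarrow> deriv (chart_w \<phi>) x = deriv (chart_w \<phi>') (transition \<phi> \<phi>' x) * deriv (transition \<phi> \<phi>') x"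
    "x \<in> S \<Longrightarrow> schwarzian (chart_w \<phi>) x =
       schwarzian (chart_w \<phi>') (transition \<phi> \<phi>' x) * (deriv (transition \<phi> \<phi>') x)\<^sup>2 + schwarzian (transition \<phi> \<phi>') x"
proof -
  have c: "open (cdom \<phi>)" "cmap \<phi> holomorphic_on cdom \<phi>" "inj_on (cmap \<phi>) (cdom \<phi>)"
    and c': "open (cdom \<phi>')" "cmap \<phi>' holomorphic_on cdom \<phi>'" "inj_on (cmap \<phi>') (cdom \<phi>')"
    using v by (auto simp: is_chart_def)
  show S: "open S" unfolding S_def
    by (rule open_mapping_thm3) (use c c' in \<open>auto intro: holomorphic_on_subset inj_on_subset\<close>)
  show sub: "S \<subseteq> cimage \<phi>" by (auto simp: S_def cimage_def)
  have ci: "cinv \<phi> x \<in> cdom \<phi> \<inter> cdom \<phi>'" if "x \<in> S" for x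
    using that cinv_chart(6)[OF v(1)] by (auto simp: S_def)
  have "(\<lambda>x. cmap \<phi>' (cinv \<phi> x)) holomorphic_on S"
    using holomorphic_on_compose_gen[OF holomorphic_on_subset[OF cinv_chart(2)[OF v(1)] sub] c'(2)] ci
    by (auto simp: o_def)
  thus hol: "transition \<phi> \<phi>' holomorphic_on S" by (simp add: transition_def[abs_def])
  show img: "transition \<phi> \<phi>' ` S \<subseteq> cimage \<phi>'" using ci by (auto simp: transition_def cimage_def)
  have eq: "chart_w \<phi> x = chart_w \<phi>' (transition \<phi> \<phi>' x)" if "x \<in> S" for x
    using ci[OF that] cinv_chart(6)[OF v(2)] by (simp add: chart_w_def transition_def)
  thus "x \<in> S \<Longrightarrow> chart_w \<phi> x = chart_w \<phi>' (transition \<phi> \<phi>' x)" .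
  note W' = chart_w_holomorphic[OF v(2)] and U' = cinv_chart(1)[OF v(2)]
  assume x: "x \<in> S"
  have ev: "eventually (\<lambda>y. chart_w \<phi> y = chart_w \<phi>' (transition \<phi> \<phi>' y)) (nhds x)"
    using eventually_nhds_in_open[OF S x] by eventually_elim (rule eq)
  show d: "deriv (chart_w \<phi>) x = deriv (chart_w \<phi>') (transition \<phi> \<phi>' x) * deriv (transition \<phi> \<phi>') x"
    using deriv_cong_ev[OF ev refl] deriv_compose_123(1)[OF W' U' hol S img x] by simp
  have nz: "deriv (chart_w \<phi>) x \<noteq> 0" by (rule deriv_chart_w[OF v(1)]) (use x sub in auto)
  thus nz': "deriv (transition \<phi> \<phi>') x \<noteq> 0" using d by auto
  show "schwarzian (chart_w \<phi>) x =
       schwarzian (chart_w \<phi>') (transition \<phi> \<phi>' x) * (deriv (transition \<phi> \<phi>') x)\<^sup>2 + schwarzian (transition \<phi> \<phi>') x"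
    unfolding schwarzian_cong[OF ev]
    by (rule schwarzian_compose[OF W' U' hol S img x _ nz']) (use d nz in auto)
qed

lemma chart_restrict:
  assumes v: "is_chart D \<phi>" "is_chart D \<phi>'" "cdom \<phi>' \<subseteq> cdom \<phi>" "\<And>p. p \<in> cdom \<phi>' \<Longrightarrow> cmap \<phi>' p = cmap \<phi> p" and z: "z \<in> cimage \<phi>'"
  shows "cinv \<phi>' z = cinv \<phi> z" "z \<in> cimage \<phi>" "eventually (\<lambda>x. chart_w \<phi>' x = chart_w \<phi> x) (nhds z)"
proof -
  have eq: "cinv \<phi>' z = cinv \<phi> z \<and> z \<in> cimage \<phi>" if zi: "z \<in> cimage \<phi>'" for z
  proof -
    obtain p where p: "p \<in> cdom \<phi>'" "z = cmap \<phi>' p" using zi by (auto simp: cimage_def)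
    have "cinv \<phi>' z = p" using p cinv_chart(6)[OF v(2)] by simp
    moreover have "cinv \<phi> z = p" using p cinv_chart(6)[OF v(1)] v(3,4) by auto
    ultimately show ?thesis using p v(3,4) by (auto simp: cimage_def)
  qed
  show "cinv \<phi>' z = cinv \<phi> z" "z \<in> cimage \<phi>" using eq[OF z] by auto
  show "eventually (\<lambda>x. chart_w \<phi>' x = chart_w \<phi> x) (nhds z)"
    using eventually_nhds_in_open[OF cinv_chart(1)[OF v(2)] z] by eventually_elim (simp add: chart_w_def eq)
qed

text \<open>A restricted chart has the same germ of \<open>chart_w\<close>, so a coefficient that
  depends only on this germ is local.\<close>

lemma nonrandom_field_holomorphic:
  assumes "\<And>\<phi>. is_chart D \<phi> \<Longrightarrow> R \<phi> holomorphic_on cimage \<phi>"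
    and "\<And>\<phi> \<phi>' z. eventually (\<lambda>x. chart_w \<phi>' x = chart_w \<phi> x) (nhds z) \<Longrightarrow> R \<phi>' z = R \<phi> z"
  shows "nonrandom_field D R"
  unfolding nonrandom_field_def
proof (intro conjI allI impI ballI)
  show "smooth_on (cimage \<phi>) (R \<phi>)" if "is_chart D \<phi>" for \<phi>
    by (rule smooth_on_holomorphic[OF cinv_chart(1)[OF that] assms(1)[OF that]])
  fix \<phi> \<phi>' z assume v: "is_chart D \<phi>" "is_chart D \<phi>'" "cdom \<phi>' \<subseteq> cdom \<phi>"
    "\<forall>p\<in>cdom \<phi>'. cmap \<phi>' p = cmap \<phi> p \<and> carg \<phi>' p = carg \<phi> p" and z: "z \<in> cimage \<phi>'"
  show "R \<phi>' z = R \<phi> z"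
    by (rule assms(2)) (rule chart_restrict(3)[OF v(1-3) _ z], use v(4) in auto)
qed

lemma nonrandom_field_const: "nonrandom_field D (\<lambda>\<phi> z. c)"
  by (rule nonrandom_field_holomorphic) auto

lemma schwarzian_holomorphic:
  assumes "is_chart D \<phi>"
  shows "schwarzian (chart_w \<phi>) holomorphic_on cimage \<phi>"
  unfolding schwarzian_def[abs_def]
  by (intro holomorphic_intros holomorphic_deriv chart_w_holomorphic[OF assms] cinv_chart(1)[OF assms])
     (use deriv_chart_w[OF assms] in auto)

end

section \<open>The argument of the derivative of w as a non-random field\<close>

context gff_setup
begin

lemma jcoef_holomorphic:
  assumes "is_chart D \<phi>"
  shows "jcoef \<phi> holomorphic_on cimage \<phi>"
  unfolding jcoef_def[abs_def]
  by (intro holomorphic_intros holomorphic_deriv chart_w_holomorphic[OF assms] cinv_chart(1)[OF assms])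
     (use deriv_chart_w[OF assms] in auto)

lemma jcoef_germ:
  assumes "eventually (\<lambda>x. chart_w \<phi>' x = chart_w \<phi> x) (nhds z)"
  shows "(deriv ^^ n) (jcoef \<phi>') z = (deriv ^^ n) (jcoef \<phi>) z"
proof (rule higher_deriv_cong_ev[OF _ refl])
  have 1: "eventually (\<lambda>x. deriv (chart_w \<phi>') x = deriv (chart_w \<phi>) x) (nhds z)"
    using iffD2[OF eventually_eventually assms] by eventually_elim (rule deriv_cong_ev, auto)
  have 2: "eventually (\<lambda>x. deriv (deriv (chart_w \<phi>')) x = deriv (deriv (chart_w \<phi>)) x) (nhds z)"
    using iffD2[OF eventually_eventually 1] by eventually_elim (rule deriv_cong_ev, auto)
  show "eventually (\<lambda>x. jcoef \<phi>' x = jcoef \<phi> x) (nhds z)"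
    using 1 2 by eventually_elim (simp add: jcoef_def)
qed

lemma nonrandom_jcoef: "nonrandom_field D (\<lambda>\<phi>. (deriv ^^ n) (jcoef \<phi>))"
  by (rule nonrandom_field_holomorphic)
     (auto intro: holomorphic_higher_deriv jcoef_holomorphic cinv_chart(1) jcoef_germ)

lemma arg_field_branch:
  assumes v: "is_chart D \<phi>"
  shows "continuous_on (cimage \<phi>) (\<lambda>z. \<theta> (cinv \<phi> z) - carg \<phi> (cinv \<phi> z))"
    and "z \<in> cimage \<phi> \<Longrightarrow> deriv (chart_w \<phi>) z = of_real (cmod (deriv (chart_w \<phi>) z)) * cis (\<theta> (cinv \<phi> z) - carg \<phi> (cinv \<phi> z))"
proof -
  have \<theta>: "continuous_on D \<theta>" "\<And>x. x \<in> D \<Longrightarrow> deriv w x = of_real (cmod (deriv w x)) * cis (\<theta> x)"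
    using arg_branch by (auto simp: is_arg_branch_def)
  have c: "continuous_on (cdom \<phi>) (carg \<phi>)"
    "\<And>x. x \<in> cdom \<phi> \<Longrightarrow> deriv (cmap \<phi>) x = of_real (cmod (deriv (cmap \<phi>) x)) * cis (carg \<phi> x)"
    using v by (auto simp: is_chart_def is_arg_branch_def)
  have ci: "continuous_on (cimage \<phi>) (cinv \<phi>)" by (rule holomorphic_on_imp_continuous_on[OF cinv_chart(2)[OF v]])
  show "continuous_on (cimage \<phi>) (\<lambda>z. \<theta> (cinv \<phi> z) - carg \<phi> (cinv \<phi> z))"
    by (intro continuous_intros continuous_on_compose2[OF \<theta>(1) ci] continuous_on_compose2[OF c(1) ci])
       (use cinv_chart(3,5)[OF v] in auto)
  assume z: "z \<in> cimage \<phi>"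
  define A where "A = deriv w (cinv \<phi> z)"
  define B where "B = deriv (cmap \<phi>) (cinv \<phi> z)"
  have A: "A = of_real (cmod A) * cis (\<theta> (cinv \<phi> z))" unfolding A_def by (rule \<theta>(2)[OF cinv_chart(5)[OF v z]])
  have B: "B = of_real (cmod B) * cis (carg \<phi> (cinv \<phi> z))" unfolding B_def by (rule c(2)[OF cinv_chart(3)[OF v z]])
  have "A / B = of_real (cmod A) * cis (\<theta> (cinv \<phi> z)) / (of_real (cmod B) * cis (carg \<phi> (cinv \<phi> z)))"
    using A B by metis
  also have "\<dots> = of_real (cmod (A / B)) * cis (\<theta> (cinv \<phi> z) - carg \<phi> (cinv \<phi> z))"
    by (simp add: norm_divide cis_divide[symmetric])
  finally show "deriv (chart_w \<phi>) z = of_real (cmod (deriv (chart_w \<phi>) z)) * cis (\<theta> (cinv \<phi> z) - carg \<phi> (cinv \<phi> z))"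
    unfolding chart_w_deriv_eq(3)[OF v z] A_def B_def .
qed

text \<open>Near \<open>z\<close> the branch differs from its value at \<open>z\<close> by the
  imaginary part of \<open>L = Ln (W' x / W' z)\<close>, which is \<open>L / (2 i)\<close> plus its
  conjugate. In this form the Wirtinger derivatives can be computed.\<close>

lemma arg_field_local:
  assumes v: "is_chart D \<phi>" "z \<in> cimage \<phi>"
  obtains U L where "open U" "z \<in> U" "U \<subseteq> cimage \<phi>" "L holomorphic_on U"
    "\<And>x. x \<in> U \<Longrightarrow> arg_field \<theta> \<phi> x = (of_real (\<theta> (cinv \<phi> z) - carg \<phi> (cinv \<phi> z)) + L x / (2 * \<i>)) + cnj (L x / (2 * \<i>))"
    "deriv L z = deriv (deriv (chart_w \<phi>)) z / deriv (chart_w \<phi>) z"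
proof -
  let ?W' = "deriv (chart_w \<phi>)" and ?a = "\<lambda>z. \<theta> (cinv \<phi> z) - carg \<phi> (cinv \<phi> z)"
  note O = cinv_chart(1)[OF v(1)]
  have W': "?W' holomorphic_on cimage \<phi>" by (intro holomorphic_deriv chart_w_holomorphic O v)
  have nz: "?W' z \<noteq> 0" by (rule deriv_chart_w[OF v])
  have c: "continuous (at z) ?a" "continuous (at z) (\<lambda>x. ?W' x / ?W' z)"
    using arg_field_branch(1)[OF v(1)] holomorphic_on_imp_continuous_on[OF W'] O v(2) nz
    by (auto simp: continuous_on_eq_continuous_at intro!: continuous_intros)
  have "eventually (\<lambda>x. x \<in> cimage \<phi>) (nhds z)" by (rule eventually_nhds_in_open[OF O v(2)])
  hence "eventually (\<lambda>x. ?W' x = of_real (cmod (?W' x)) * cis (?a x) \<and> ?W' x \<noteq> 0) (nhds z)"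
    by eventually_elim (use arg_field_branch(2)[OF v(1)] deriv_chart_w[OF v(1)] in blast)
  moreover have "(?a \<longlongrightarrow> ?a z) (nhds z)" using c(1) tendsto_at_iff_tendsto_nhds[of ?a z] by (simp only: continuous_at)
  ultimately have e1: "eventually (\<lambda>x. ?a x = ?a z + Im (Ln (?W' x / ?W' z))) (nhds z)"
    using arg_field_branch(2)[OF v] nz by (intro branch_unique_near)
  have "((\<lambda>x. ?W' x / ?W' z) \<longlongrightarrow> ?W' z / ?W' z) (nhds z)"
    using c(2) tendsto_at_iff_tendsto_nhds[of "\<lambda>x. ?W' x / ?W' z" z] by (simp only: continuous_at)
  hence e2: "eventually (\<lambda>x. ?W' x / ?W' z \<in> ball 1 1) (nhds z)"
    by (rule topological_tendstoD) (use nz in auto)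
  have "eventually (\<lambda>x. x \<in> cimage \<phi> \<and> ?a x = ?a z + Im (Ln (?W' x / ?W' z)) \<and> ?W' x / ?W' z \<in> ball 1 1) (nhds z)"
    using eventually_nhds_in_open[OF O v(2)] e1 e2 by eventually_elim auto
  then obtain U where U: "open U" "z \<in> U"
    "\<And>x. x \<in> U \<Longrightarrow> x \<in> cimage \<phi> \<and> ?a x = ?a z + Im (Ln (?W' x / ?W' z)) \<and> ?W' x / ?W' z \<in> ball 1 1"
    unfolding eventually_nhds by blast
  define L where "L = (\<lambda>x. Ln (?W' x / ?W' z))"
  have np: "?W' x / ?W' z \<notin> \<real>\<^sub>\<le>\<^sub>0" if "x \<in> U" for x
  proof -
    have "?W' x / ?W' z \<in> ball 1 1" using U(3)[OF that] by blast
    hence "Re (1 - ?W' x / ?W' z) < 1"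
      using complex_Re_le_cmod[of "1 - ?W' x / ?W' z"] by (simp add: dist_norm)
    thus ?thesis by (auto simp: complex_nonpos_Reals_iff)
  qed
  have sub: "U \<subseteq> cimage \<phi>" using U(3) by blast
  show ?thesis
  proof (rule that[OF U(1,2) sub])
    show "L holomorphic_on U" unfolding L_def
      by (intro holomorphic_intros holomorphic_on_subset[OF W' sub]) (use np nz in auto)
    show "arg_field \<theta> \<phi> x = (of_real (?a z) + L x / (2 * \<i>)) + cnj (L x / (2 * \<i>))" if "x \<in> U" for x
    proof -
      have "arg_field \<theta> \<phi> x = of_real (?a z + Im (L x))" using U(3)[OF that] by (simp add: arg_field_def L_def)
      thus ?thesis by (simp add: complex_eq_iff)
    qed
    have "(?W' has_field_derivative deriv ?W' z) (at z)" by (rule holomorphic_derivI[OF W' O v(2)])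
    hence "((\<lambda>x. ?W' x / ?W' z) has_field_derivative deriv ?W' z / ?W' z) (at z)" by (rule DERIV_cdivide)
    from DERIV_chain2[OF has_field_derivative_Ln[OF np[OF U(2)]] this]
    show "deriv L z = deriv ?W' z / ?W' z" unfolding L_def using nz by (intro DERIV_imp_deriv) simp
  qed
qed

lemma arg_coef_local:
  assumes v: "is_chart D \<phi>" "z \<in> cimage \<phi>"
  shows "\<exists>U f g. open U \<and> z \<in> U \<and> f holomorphic_on U \<and> g holomorphic_on U \<and>
     (\<forall>x\<in>U. - 2 * complex_of_real b * arg_field \<theta> \<phi> x = f x + cnj (g x)) \<and> deriv f z = jcoef \<phi> z"
proof -
  obtain U L where U: "open U" "z \<in> U" "U \<subseteq> cimage \<phi>" "L holomorphic_on U"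
    "\<And>x. x \<in> U \<Longrightarrow> arg_field \<theta> \<phi> x = (of_real (\<theta> (cinv \<phi> z) - carg \<phi> (cinv \<phi> z)) + L x / (2 * \<i>)) + cnj (L x / (2 * \<i>))"
    "deriv L z = deriv (deriv (chart_w \<phi>)) z / deriv (chart_w \<phi>) z"
    using arg_field_local[OF v] by metis
  let ?c = "- 2 * complex_of_real b"
  \<comment> \<open>Multiplication by \<open>- 2 b\<close> turns \<open>L / (2 i)\<close> into
    \<open>i b L\<close>, whose derivative at \<open>z\<close> is \<open>j\<close>.\<close>
  let ?f = "\<lambda>x. ?c * of_real (\<theta> (cinv \<phi> z) - carg \<phi> (cinv \<phi> z)) + \<i> * of_real b * L x"
  let ?g = "\<lambda>x. \<i> * of_real b * L x"
  have "(?f has_field_derivative 0 + \<i> * of_real b * deriv L z) (at z)"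
    by (intro DERIV_add DERIV_const DERIV_cmult holomorphic_derivI[OF U(4,1,2)])
  hence "deriv ?f z = jcoef \<phi> z" by (simp add: DERIV_imp_deriv U(6) jcoef_def)
  moreover have "?c * arg_field \<theta> \<phi> x = ?f x + cnj (?g x)" if "x \<in> U" for x
    unfolding U(5)[OF that] by (simp add: complex_eq_iff algebra_simps)
  ultimately show ?thesis using U(1,2,4)
    by (intro exI[of _ U] exI[of _ ?f] exI[of _ ?g]) (auto intro!: holomorphic_intros)
qed

lemma dz_arg_coef:
  assumes v: "is_chart D \<phi>" "z \<in> cimage \<phi>"
  shows "dz (\<lambda>z. - 2 * complex_of_real b * arg_field \<theta> \<phi> z) z = jcoef \<phi> z"
proof -
  obtain U f g where U: "open U" "z \<in> U" "f holomorphic_on U" "g holomorphic_on U"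
    "\<And>x. x \<in> U \<Longrightarrow> - 2 * complex_of_real b * arg_field \<theta> \<phi> x = f x + cnj (g x)" "deriv f z = jcoef \<phi> z"
    using arg_coef_local[OF v] by blast
  show ?thesis using wirtinger_power[OF U(1,3,4,5,2), of 1 0] U(6) by simp
qed

lemma nonrandom_arg: "nonrandom_field D (\<lambda>\<phi> z. - 2 * complex_of_real b * arg_field \<theta> \<phi> z)"
  unfolding nonrandom_field_def
proof (intro conjI allI impI ballI)
  show "smooth_on (cimage \<phi>) (\<lambda>z. - 2 * complex_of_real b * arg_field \<theta> \<phi> z)" if "is_chart D \<phi>" for \<phi>
    by (rule smooth_on_local) (use arg_coef_local[OF that] in blast)
  fix \<phi> \<phi>' z assume v: "is_chart D \<phi>" "is_chart D \<phi>'" "cdom \<phi>' \<subseteq> cdom \<phi>"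
    "\<forall>p\<in>cdom \<phi>'. cmap \<phi>' p = cmap \<phi> p \<and> carg \<phi>' p = carg \<phi> p" and z: "z \<in> cimage \<phi>'"
  have "cinv \<phi>' z = cinv \<phi> z" by (rule chart_restrict(1)[OF v(1-3) _ z]) (use v(4) in auto)
  moreover have "cinv \<phi>' z \<in> cdom \<phi>'" by (rule cinv_chart(3)[OF v(2) z])
  ultimately show "- 2 * complex_of_real b * arg_field \<theta> \<phi>' z = - 2 * complex_of_real b * arg_field \<theta> \<phi> z"
    using v(4) by (simp add: arg_field_def)
qed

lemma fock_field_gff: "fock_field D (gff_b b \<theta>)"
  by (auto simp: fock_field_def gff_b_def field_add_def gff_def field_scale_def nonrandom_def nonrandom_field_const intro: nonrandom_arg[simplified])

lemma fock_field_stress: "fock_field D stress_field"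
proof -
  have "nonrandom_field D (\<lambda>\<phi> z. - jcoef \<phi> z)"
  proof (rule nonrandom_field_holomorphic)
    show "(\<lambda>z. - jcoef \<phi> z) holomorphic_on cimage \<phi>" if "is_chart D \<phi>" for \<phi>
      by (rule holomorphic_on_minus[OF jcoef_holomorphic[OF that]])
    show "- jcoef \<phi>' z = - jcoef \<phi> z" if "eventually (\<lambda>x. chart_w \<phi>' x = chart_w \<phi> x) (nhds z)" for \<phi> \<phi>' z
      using jcoef_germ[OF that, of 0] by simp
  qed
  thus ?thesis by (auto simp: fock_field_def stress_field_def nonrandom_field_const)
qed

end

section \<open>The operator product expansion of the current\<close>

lemma smooth_on_cong:
  assumes S: "open S" and eq: "\<And>z. z \<in> S \<Longrightarrow> f z = g z" and g: "smooth_on S g"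
  shows "smooth_on S f"
  unfolding smooth_on_def differentiable_on_def
proof (intro allI ballI)
  fix j k :: nat and z assume z: "z \<in> S"
  have e: "(dz ^^ j) ((dzbar ^^ k) f) x = (dz ^^ j) ((dzbar ^^ k) g) x" if "x \<in> S" for x
    by (rule dz_dzbar_pow_cong) (use eventually_nhds_in_open[OF S that] eq in \<open>auto elim: eventually_mono\<close>)
  have "(dz ^^ j) ((dzbar ^^ k) g) differentiable (at z within S)"
    using g z by (auto simp: smooth_on_def differentiable_on_def)
  then obtain D where "((dz ^^ j) ((dzbar ^^ k) g) has_derivative D) (at z within S)" by (auto simp: differentiable_def)
  hence "((dz ^^ j) ((dzbar ^^ k) f) has_derivative D) (at z within S)"
    using z e by (blast intro: has_derivative_transform)
  thus "(dz ^^ j) ((dzbar ^^ k) f) differentiable (at z within S)" by (auto simp: differentiable_def)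
qed

text \<open>The fields picked out by \<open>ope_mult\<close> have coefficients that are known to be
  smooth and nothing more, so scalar multiples have to be treated at this level of
  generality.\<close>

lemma smooth_on_scale:
  assumes S: "open S" and f: "smooth_on S f"
  shows "smooth_on S (\<lambda>z. c * f z)"
proof -
  have diff: "(dz ^^ j) ((dzbar ^^ k) f) differentiable (at z)" if "z \<in> S" for j k z
    using f that S by (simp add: smooth_on_def differentiable_on_eq_differentiable_at)
  have fr: "frechet_derivative (\<lambda>z. c * g z) (at z) = (\<lambda>v. c * frechet_derivative g (at z) v)"
    if "g differentiable (at z)" for g :: "complex \<Rightarrow> complex" and z
  proof -
    have "(g has_derivative frechet_derivative g (at z)) (at z)" using that by (simp add: frechet_derivative_works)
    hence "((\<lambda>z. c * g z) has_derivative (\<lambda>v. c * frechet_derivative g (at z) v)) (at z)"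
      by (rule has_derivative_mult_right)
    from frechet_derivative_at[OF this] show ?thesis by simp
  qed
  have d: "dz (\<lambda>z. c * g z) z = c * dz g z" "dzbar (\<lambda>z. c * g z) z = c * dzbar g z"
    if "g differentiable (at z)" for g :: "complex \<Rightarrow> complex" and z
    using that by (simp_all add: dz_def dzbar_def fr algebra_simps)
  have ev: "eventually (\<lambda>x. p x = q x) (nhds x)" if "\<And>x. x \<in> S \<Longrightarrow> p x = q x" "x \<in> S" for p q :: "complex \<Rightarrow> complex" and x
    using eventually_nhds_in_open[OF S that(2)] by eventually_elim (rule that(1))
  have 1: "(dzbar ^^ k) (\<lambda>z. c * f z) z = c * (dzbar ^^ k) f z" if "z \<in> S" for k z
    using that
  proof (induction k arbitrary: z)
    case (Suc k)
    have "(dzbar ^^ Suc k) (\<lambda>z. c * f z) z = dzbar (\<lambda>z. c * (dzbar ^^ k) f z) z"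
      using Suc by (simp, intro dzbar_cong ev) auto
    thus ?case using diff[OF Suc.prems, of 0 k] by (simp add: d)
  qed simp
  have 2: "(dz ^^ j) ((dzbar ^^ k) (\<lambda>z. c * f z)) z = c * (dz ^^ j) ((dzbar ^^ k) f) z" if "z \<in> S" for j k z
    using that
  proof (induction j arbitrary: z)
    case 0 thus ?case by (simp add: 1)
  next
    case (Suc j)
    have "(dz ^^ Suc j) ((dzbar ^^ k) (\<lambda>z. c * f z)) z = dz (\<lambda>z. c * (dz ^^ j) ((dzbar ^^ k) f) z) z"
      using Suc by (simp, intro dz_cong ev) auto
    thus ?case using diff[OF Suc.prems, of j k] by (simp add: d)
  qed
  show ?thesis unfolding smooth_on_def differentiable_on_def
  proof (intro allI ballI)
    fix j k :: nat and z assume z: "z \<in> S"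
    have "(dz ^^ j) ((dzbar ^^ k) f) differentiable (at z within S)"
      by (rule differentiable_at_withinI[OF diff[OF z]])
    hence "(\<lambda>z. c * (dz ^^ j) ((dzbar ^^ k) f) z) differentiable (at z within S)"
      by (intro differentiable_mult differentiable_const)
    thus "(dz ^^ j) ((dzbar ^^ k) (\<lambda>z. c * f z)) differentiable (at z within S)"
      by (rule differentiable_transform_within[where d = 1]) (use z in \<open>simp_all add: 2\<close>)
  qed
qed

lemma nonrandom_field_scale:
  assumes "nonrandom_field D f"
  shows "nonrandom_field D (\<lambda>\<phi> z. c * f \<phi> z)"
  unfolding nonrandom_field_def
proof (intro conjI allI impI)
  fix \<phi> assume "is_chart D \<phi>"
  with assms show "smooth_on (cimage \<phi>) (\<lambda>z. c * f \<phi> z)"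
    by (intro smooth_on_scale) (simp_all add: nonrandom_field_def cinv_chart(1)[of D])
next
  fix \<phi> \<phi>' assume "is_chart D \<phi>" "is_chart D \<phi>'" "cdom \<phi>' \<subseteq> cdom \<phi>"
    "\<forall>p\<in>cdom \<phi>'. cmap \<phi>' p = cmap \<phi> p \<and> carg \<phi>' p = carg \<phi> p"
  with assms have "\<forall>z\<in>cimage \<phi>'. f \<phi>' z = f \<phi> z" unfolding nonrandom_field_def by blast
  thus "\<forall>z\<in>cimage \<phi>'. c * f \<phi>' z = c * f \<phi> z" by simp
qed

lemma fock_field_scale: "fock_field D X \<Longrightarrow> fock_field D (field_scale c X)"
  by (auto simp: fock_field_def field_scale_def intro!: nonrandom_field_scale)

lemma fock_field_add: "fock_field D X \<Longrightarrow> fock_field D Y \<Longrightarrow> fock_field D (field_add X Y)"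
  by (auto simp: fock_field_def field_add_def)

text \<open>The coefficients produced by \<open>field_d\<close> are given through \<open>dz\<close>
  and agree with holomorphic expressions only inside the image of the chart.\<close>

lemma nonrandom_field_cong:
  assumes eq: "\<And>\<phi> z. is_chart D \<phi> \<Longrightarrow> z \<in> cimage \<phi> \<Longrightarrow> f \<phi> z = g \<phi> z" and g: "nonrandom_field D g"
  shows "nonrandom_field D f"
  unfolding nonrandom_field_def
proof (intro conjI allI impI ballI)
  show "smooth_on (cimage \<phi>) (f \<phi>)" if "is_chart D \<phi>" for \<phi>
  proof (rule smooth_on_cong[where f = "f \<phi>" and g = "g \<phi>", OF cinv_chart(1)[OF that]])
    show "smooth_on (cimage \<phi>) (g \<phi>)" using g that unfolding nonrandom_field_def by blast
  qed (rule eq[OF that])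
  fix \<phi> \<phi>' z assume v: "is_chart D \<phi>" "is_chart D \<phi>'" "cdom \<phi>' \<subseteq> cdom \<phi>"
    "\<forall>p\<in>cdom \<phi>'. cmap \<phi>' p = cmap \<phi> p \<and> carg \<phi>' p = carg \<phi> p" and z: "z \<in> cimage \<phi>'"
  obtain p where p: "p \<in> cdom \<phi>'" "z = cmap \<phi>' p" using z by (auto simp: cimage_def)
  hence "p \<in> cdom \<phi>" "z = cmap \<phi> p" using v(3,4) by auto
  hence "z \<in> cimage \<phi>" by (simp add: cimage_def)
  moreover have "g \<phi>' z = g \<phi> z" using g v z unfolding nonrandom_field_def by blast
  ultimately show "f \<phi>' z = f \<phi> z" using eq[OF v(1)] eq[OF v(2) z] by simp
qed

lemma higher_deriv_sum_cmult:
  assumes "finite I" "\<And>i. i \<in> I \<Longrightarrow> f i holomorphic_on S" "open S" "z \<in> S"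
  shows "(deriv ^^ n) (\<lambda>x. \<Sum>i\<in>I. f i x * c i) z = (\<Sum>i\<in>I. (deriv ^^ n) (f i) z * c i)"
  using assms(1,2)
proof (induction I rule: finite_induct)
  case (insert i I)
  have h: "(\<lambda>x. c i * f i x) holomorphic_on S" "(\<lambda>x. \<Sum>i\<in>I. f i x * c i) holomorphic_on S"
    using insert by (auto intro!: holomorphic_intros)
  have "(deriv ^^ n) (\<lambda>x. c i * f i x + (\<Sum>i\<in>I. f i x * c i)) z =
     (deriv ^^ n) (\<lambda>x. c i * f i x) z + (deriv ^^ n) (\<lambda>x. \<Sum>i\<in>I. f i x * c i) z"
    by (rule higher_deriv_add[OF h assms(3,4)])
  also have "(deriv ^^ n) (\<lambda>x. c i * f i x) z = c i * (deriv ^^ n) (f i) z"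
    by (rule higher_deriv_cmult[OF _ assms(4,3)]) (use insert in auto)
  finally show ?case using insert by (simp add: mult.commute)
qed simp

text \<open>The recursion for the inverse series expresses each coefficient through earlier ones,
  dividing only by \<open>F z $ 0\<close>.\<close>

lemma fps_inverse_nth_holomorphic:
  fixes F :: "complex \<Rightarrow> complex fps"
  assumes F: "\<And>n. (\<lambda>z. F z $ n) holomorphic_on S" and nz: "\<And>z. z \<in> S \<Longrightarrow> F z $ 0 \<noteq> 0"
  shows "(\<lambda>z. inverse (F z) $ n) holomorphic_on S"
proof (induction n rule: less_induct)
  case (less n)
  have eq: "inverse (F z) $ n = (of_bool (n = 0) - (\<Sum>i<n. inverse (F z) $ i * F z $ (n - i))) / F z $ 0" if z: "z \<in> S" for z
  proof -
    have "inverse (F z) * F z = 1" by (rule inverse_mult_eq_1[OF nz[OF z]])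
    hence "(inverse (F z) * F z) $ n = of_bool (n = 0)" by (simp only:) simp
    hence "(\<Sum>i=0..n. inverse (F z) $ i * F z $ (n - i)) = of_bool (n = 0)" by (simp only: fps_mult_nth)
    moreover have "(\<Sum>i=0..n. inverse (F z) $ i * F z $ (n - i)) =
       (\<Sum>i<n. inverse (F z) $ i * F z $ (n - i)) + inverse (F z) $ n * F z $ 0"
      by (simp add: atLeast0AtMost lessThan_Suc_atMost[symmetric])
    ultimately show ?thesis using nz[OF z] by (simp add: field_simps)
  qed
  have "(\<lambda>z. (of_bool (n = 0) - (\<Sum>i<n. inverse (F z) $ i * F z $ (n - i))) / F z $ 0) holomorphic_on S"
    by (intro holomorphic_intros less F) (use nz in auto)
  thus ?case by (rule holomorphic_transform) (simp add: eq)
qed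

lemma fps_mult_nth_holomorphic:
  fixes F G :: "complex \<Rightarrow> complex fps"
  assumes "\<And>n. (\<lambda>z. F z $ n) holomorphic_on S" "\<And>n. (\<lambda>z. G z $ n) holomorphic_on S"
  shows "(\<lambda>z. (F z * G z) $ n) holomorphic_on S"
  unfolding fps_mult_nth by (intro holomorphic_intros assms)

section \<open>The two-point function of the current\<close>

context halfplane_map
begin

text \<open>Taylor coefficients of \<open>- t\<^sup>2 W'(z) W'(z + t) / (W(z + t) - W(z))\<^sup>2\<close>, that is, of \<open>t\<^sup>2\<close> times the
  two-point function of \<open>\<partial>\<Phi>\<^sub>(\<^sub>0\<^sub>)\<close>.\<close>

definition two_point_fps :: "chart \<Rightarrow> complex \<Rightarrow> complex fps" where
  "two_point_fps \<phi> z = fps_const (- deriv (chart_w \<phi>) z) * fps_expansion (deriv (chart_w \<phi>)) z *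
     inverse (fps_shift 1 (fps_expansion (chart_w \<phi>) z) * fps_shift 1 (fps_expansion (chart_w \<phi>) z))"

lemma two_point_fps_holomorphic:
  assumes v: "is_chart D \<phi>"
  shows "(\<lambda>z. two_point_fps \<phi> z $ n) holomorphic_on cimage \<phi>"
proof -
  note W = chart_w_holomorphic[OF v] and U = cinv_chart(1)[OF v]
  have W': "deriv (chart_w \<phi>) holomorphic_on cimage \<phi>" by (rule holomorphic_deriv[OF W U])
  have 1: "(\<lambda>z. fps_const (- deriv (chart_w \<phi>) z) $ n) holomorphic_on cimage \<phi>" for n
    by (cases n) (auto intro!: holomorphic_intros W')
  have 2: "(\<lambda>z. fps_expansion (deriv (chart_w \<phi>)) z $ n) holomorphic_on cimage \<phi>" for n
    unfolding fps_expansion_def by (auto intro!: holomorphic_intros holomorphic_higher_deriv W' U)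
  have 3: "(\<lambda>z. fps_shift 1 (fps_expansion (chart_w \<phi>) z) $ n) holomorphic_on cimage \<phi>" for n
    unfolding fps_expansion_def by (simp del: funpow.simps) (intro holomorphic_intros holomorphic_higher_deriv W U, auto)
  show ?thesis unfolding two_point_fps_def
    by (intro fps_mult_nth_holomorphic fps_inverse_nth_holomorphic 1 2 3)
       (use deriv_chart_w[OF v] in \<open>simp add: fps_expansion_def\<close>)
qed

lemma nonrandom_two_point: "nonrandom_field D (\<lambda>\<phi> z. two_point_fps \<phi> z $ n)"
proof (rule nonrandom_field_holomorphic[OF two_point_fps_holomorphic])
  fix \<phi> \<phi>' z assume ev: "eventually (\<lambda>x. chart_w \<phi>' x = chart_w \<phi> x) (nhds z)"
  have 1: "(deriv ^^ n) (chart_w \<phi>') z = (deriv ^^ n) (chart_w \<phi>) z" for n by (rule higher_deriv_cong_ev[OF ev refl])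
  hence 2: "(deriv ^^ n) (deriv (chart_w \<phi>')) z = (deriv ^^ n) (deriv (chart_w \<phi>)) z" for n
    using 1[of "Suc n"] by (simp only: funpow_Suc_right o_def)
  show "two_point_fps \<phi>' z $ n = two_point_fps \<phi> z $ n"
    unfolding two_point_fps_def fps_expansion_def 1 2 using 1[of 1] by simp
qed

text \<open>The first coefficients are \<open>-1\<close>, \<open>0\<close> and minus one sixth of
  the Schwarzian. The factor \<open>- 1/2\<close> in \<open>T\<close> makes this one twelfth, the
  central charge 1 of the free field with \<open>b = 0\<close>.\<close>

lemma two_point_fps_2:
  assumes v: "is_chart D \<phi>" "z \<in> cimage \<phi>"
  shows "two_point_fps \<phi> z $ 2 = - schwarzian (chart_w \<phi>) z / 6"
proof -
  let ?W = "chart_w \<phi>"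
  note U = cinv_chart(1)[OF v(1)]
  define d1 d2 d3 where "d1 = deriv ?W z" and "d2 = (deriv ^^ 2) ?W z" and "d3 = (deriv ^^ 3) ?W z"
  have nz: "d1 \<noteq> 0" unfolding d1_def by (rule deriv_chart_w[OF v])
  \<comment> \<open>\<open>B\<close> expands the difference quotient of \<open>W\<close> at
    \<open>z\<close>, and \<open>E\<close> below expands \<open>W'\<close>. Comparing the first
    three coefficients in \<open>c * (B * B) = - d1 * E\<close> determines those of
    \<open>c\<close>.\<close>
  define B where "B = fps_shift 1 (fps_expansion ?W z)"
  define E where "E = fps_expansion (deriv ?W) z"
  define c where "c = two_point_fps \<phi> z"
  have B: "B $ 0 = d1" "B $ 1 = d2 / 2" "B $ 2 = d3 / 6"
    unfolding B_def fps_expansion_def d1_def d2_def d3_def by (simp_all add: numeral_2_eq_2 numeral_3_eq_3 fact_numeral)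
  have E: "E $ 0 = d1" "E $ 1 = d2" "E $ 2 = d3 / 2"
    unfolding E_def fps_expansion_def d1_def d2_def d3_def by (simp_all add: numeral_2_eq_2 numeral_3_eq_3)
  have BB: "(B * B) $ 0 = d1 * d1" "(B * B) $ 1 = d1 * d2" "(B * B) $ 2 = d1 * d3 / 3 + d2 * d2 / 4"
    unfolding fps_mult_nth by (simp_all add: numeral_2_eq_2 B[unfolded numeral_2_eq_2 One_nat_def] field_simps)
  have "c * (B * B) = fps_const (- d1) * E * (inverse (B * B) * (B * B))"
    by (simp add: c_def two_point_fps_def B_def E_def d1_def mult_ac)
  also have "inverse (B * B) * (B * B) = 1" by (rule inverse_mult_eq_1) (use BB nz in simp)
  finally have eq: "c * (B * B) = fps_const (- d1) * E" by simp
  have e: "(\<Sum>i=0..n. c $ i * (B * B) $ (n - i)) = - d1 * E $ n" for n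
    unfolding fps_mult_nth[symmetric] eq by simp
  have "c $ 0 * (d1 * d1) = (-1) * (d1 * d1)" using e[of 0] BB E by simp
  hence c0: "c $ 0 = -1" using nz by (simp only: mult_cancel_right) simp
  have "c $ 0 * (d1 * d2) + c $ 1 * (d1 * d1) = - d1 * d2" using e[of 1] BB E by simp
  hence c1: "c $ 1 = 0" using c0 nz by simp
  have "c $ 0 * (d1 * d3 / 3 + d2 * d2 / 4) + c $ 1 * (d1 * d2) + c $ 2 * (d1 * d1) = - d1 * (d3 / 2)"
    using e[of 2] BB E by (simp add: numeral_2_eq_2)
  hence "c $ 2 * (d1 * d1) = d2 * d2 / 4 - d1 * d3 / 6" using c0 c1 by (simp add: field_simps)
  hence c2: "c $ 2 = (d2 * d2 / 4 - d1 * d3 / 6) / (d1 * d1)" using nz by (simp add: eq_divide_eq)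
  have s: "schwarzian ?W z = d3 / d1 - (3/2) * (d2 / d1)\<^sup>2"
    unfolding d1_def d2_def d3_def
    by (rule schwarzian_eq[OF chart_w_holomorphic[OF v(1)] U v(2)]) (use nz in \<open>simp add: d1_def\<close>)
  show ?thesis unfolding c_def[symmetric] c2 s using nz by (simp add: field_simps power2_eq_square)
qed

lemma two_point_fps_expansion:
  assumes v: "is_chart D \<phi>" "z \<in> cimage \<phi>"
  obtains s where "s has_fps_expansion two_point_fps \<phi> z"
    "eventually (\<lambda>t. t \<noteq> 0 \<longrightarrow> s t = t\<^sup>2 * (- deriv (chart_w \<phi>) (z + t) * deriv (chart_w \<phi>) z / (chart_w \<phi> (z + t) - chart_w \<phi> z)\<^sup>2)) (nhds 0)"
proof -
  let ?W = "chart_w \<phi>"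
  note U = cinv_chart(1)[OF v(1)] and W = chart_w_holomorphic[OF v(1)]
  define A where "A = fps_expansion ?W z"
  define B where "B = fps_shift 1 A"
  define E where "E = fps_expansion (deriv ?W) z"
  have an: "?W analytic_on {z}" "deriv ?W analytic_on {z}"
    using W holomorphic_deriv[OF W U] U v(2) analytic_at by blast+
  have A: "(\<lambda>t. ?W (z + t)) has_fps_expansion A" unfolding A_def by (rule analytic_at_imp_has_fps_expansion[OF an(1)])
  have E: "(\<lambda>t. deriv ?W (z + t)) has_fps_expansion E" unfolding E_def by (rule analytic_at_imp_has_fps_expansion[OF an(2)])
  \<comment> \<open>The shifted series converges together with \<open>A\<close>, so its sum can
    replace the difference quotient, at \<open>t = 0\<close> as well.\<close>
  have "fps_conv_radius B > 0" using A by (simp add: B_def has_fps_expansion_def)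
  hence B: "eval_fps B has_fps_expansion B" by (rule eval_fps_has_fps_expansion)
  have B0: "B $ 0 \<noteq> 0" unfolding B_def A_def fps_expansion_def using deriv_chart_w[OF v] by simp
  have XB: "A = fps_const (?W z) + fps_X * B"
    by (rule fps_ext) (auto simp: B_def A_def fps_expansion_def)
  have "(\<lambda>t. ?W z + t * eval_fps B t) has_fps_expansion A"
    unfolding XB by (intro fps_expansion_intros B)
  hence ev: "eventually (\<lambda>t. ?W (z + t) = ?W z + t * eval_fps B t) (nhds 0)"
    using A unfolding has_fps_expansion_def by (auto elim: eventually_elim2)
  define s where "s = (\<lambda>t. (- deriv ?W z) * deriv ?W (z + t) * inverse (eval_fps B t * eval_fps B t))"
  show ?thesis
  proof (rule that)
    show "s has_fps_expansion two_point_fps \<phi> z"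
      unfolding s_def two_point_fps_def A_def[symmetric] B_def[symmetric] E_def[symmetric]
      by (intro has_fps_expansion_mult has_fps_expansion_inverse has_fps_expansion_const B E) (use B0 in simp)
    show "eventually (\<lambda>t. t \<noteq> 0 \<longrightarrow> s t = t\<^sup>2 * (- deriv ?W (z + t) * deriv ?W z / (?W (z + t) - ?W z)\<^sup>2)) (nhds 0)"
      using ev by eventually_elim (auto simp: s_def divide_simps power2_eq_square)
  qed
qed

lemma kern_first:
  assumes v: "is_chart D \<phi>" "z \<in> cimage \<phi>" and x: "x \<noteq> chart_w \<phi> z"
  shows "kern (\<phi>, Suc 0, 0, z) x = - deriv (chart_w \<phi>) z / (x - chart_w \<phi> z)\<^sup>2"
proof -
  have d: "(chart_w \<phi> has_field_derivative deriv (chart_w \<phi>) z) (at z)"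
    by (rule holomorphic_derivI[OF chart_w_holomorphic[OF v(1)] cinv_chart(1)[OF v(1)] v(2)])
  have "((\<lambda>y. 1 / (x - chart_w \<phi> y)) has_field_derivative
    (0 * (x - chart_w \<phi> z) - 1 * (0 - deriv (chart_w \<phi>) z)) / ((x - chart_w \<phi> z) * (x - chart_w \<phi> z))) (at z)"
    by (intro DERIV_divide DERIV_diff DERIV_const d) (use x in auto)
  hence "deriv (\<lambda>y. 1 / (x - chart_w \<phi> y)) z = deriv (chart_w \<phi>) z / (x - chart_w \<phi> z)\<^sup>2"
    by (simp add: DERIV_imp_deriv power2_eq_square)
  thus ?thesis by (simp add: pole_deriv_def)
qed

end

section \<open>The current J and its operator product expansion\<close>

context gff_setup
begin

text \<open>The coefficient as \<open>field_d\<close> produces it. It equals the holomorphic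
  expression \<open>jcoef\<close> on the image of the chart, where \<open>dz\<close> is
  meaningful.\<close>

definition jarg :: "chart \<Rightarrow> complex \<Rightarrow> complex" where
  "jarg \<phi> = dz (\<lambda>z. - 2 * complex_of_real b * arg_field \<theta> \<phi> z)"

lemma jarg_eq: "is_chart D \<phi> \<Longrightarrow> z \<in> cimage \<phi> \<Longrightarrow> jarg \<phi> z = jcoef \<phi> z"
  unfolding jarg_def by (rule dz_arg_coef)

lemma jarg_eventually:
  assumes v: "is_chart D \<phi>" "z \<in> cimage \<phi>"
  shows "eventually (\<lambda>x. jarg \<phi> x = jcoef \<phi> x) (nhds z)"
  by (rule eventually_mono[OF eventually_nhds_in_open[OF cinv_chart(1)[OF v(1)] v(2)]]) (rule jarg_eq[OF v(1)])

lemma dz_jarg: "is_chart D \<phi> \<Longrightarrow> z \<in> cimage \<phi> \<Longrightarrow> dz (jarg \<phi>) z = deriv (jcoef \<phi>) z"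
  using dz_cong[OF jarg_eventually] dz_holomorphic[OF cinv_chart(1) jcoef_holomorphic] by simp

definition J_field :: fock where "J_field = field_d (gff_b b \<theta>)"

lemma gff_b_eq: "gff_b b \<theta> = [(\<lambda>\<phi> z. 1, [Der 0 0]), (\<lambda>\<phi> z. - 2 * complex_of_real b * arg_field \<theta> \<phi> z, [])]"
  by (simp add: gff_b_def field_add_def gff_def field_scale_def nonrandom_def)

lemma J_field_eq: "J_field = [(\<lambda>\<phi> z. 0, [Der 0 0]), (\<lambda>\<phi> z. 1, [Der (Suc 0) 0]), (jarg, [])]"
  unfolding J_field_def gff_b_eq field_d_def term_d_def by (simp add: jarg_def[abs_def])

lemma d_J_field_eq: "field_d J_field = [(\<lambda>\<phi> z. 0, [Der 0 0]), (\<lambda>\<phi> z. 0, [Der (Suc 0) 0]), (\<lambda>\<phi> z. 0, [Der (Suc 0) 0]),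
   (\<lambda>\<phi> z. 1, [Der (Suc (Suc 0)) 0]), (\<lambda>\<phi>. dz (jarg \<phi>), [])]"
  unfolding J_field_eq field_d_def term_d_def by simp

lemma corr_gff:
  assumes "wick_bounded Z"
  shows "corr G (gff_b b \<theta>) \<phi> z Z = contract (K (\<phi>, 0, 0, z)) Z {#} - 2 * of_real b * arg_field \<theta> \<phi> z * Z {#}"
  using assms by (simp add: gff_b_eq corr_Cons corr_Nil term_corr_Cons term_corr_Nil)

lemma corr_J:
  assumes "wick_bounded Z"
  shows "corr G J_field \<phi> z Z = contract (K (\<phi>, Suc 0, 0, z)) Z {#} + jarg \<phi> z * Z {#}"
  using assms by (simp add: J_field_eq corr_Cons corr_Nil term_corr_Cons term_corr_Nil)

lemma corr_d_J:
  assumes "wick_bounded Z"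
  shows "corr G (field_d J_field) \<phi> z Z = contract (K (\<phi>, Suc (Suc 0), 0, z)) Z {#} + dz (jarg \<phi>) z * Z {#}"
  using assms by (simp add: d_J_field_eq corr_Cons corr_Nil term_corr_Cons term_corr_Nil)

lemma fock_field_J: "fock_field D J_field" "fock_field D (field_d J_field)"
proof -
  have 1: "nonrandom_field D jarg"
    by (rule nonrandom_field_cong[OF jarg_eq]) (use nonrandom_jcoef[of 0] in auto)
  have 2: "nonrandom_field D (\<lambda>\<phi>. dz (jarg \<phi>))"
    by (rule nonrandom_field_cong[OF dz_jarg]) (use nonrandom_jcoef[of 1] in auto)
  show "fock_field D J_field" "fock_field D (field_d J_field)"
    by (simp add: fock_field_def J_field_eq nonrandom_field_const 1)
      (simp add: fock_field_def d_J_field_eq nonrandom_field_const 2)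
qed

lemma contract_K_mixed:
  assumes v: "is_chart D \<phi>" "z \<in> cimage \<phi>" and Z: "test_at (cinv \<phi> z) Z"
  shows "contract (K (\<phi>, Suc i, Suc j, z)) Z = (\<lambda>M. 0)"
proof -
  have a: "valid_atom D {cinv \<phi> z} (\<phi>, 0, 0, z)" using v by (simp add: valid_atom_def)
  have "contract (K (\<phi>, Suc i, Suc j, z)) Z = contract (\<lambda>_. 0) Z"
  proof (rule contract_cong)
    fix c assume c: "c \<in> atoms_of Z"
    show "K (\<phi>, Suc i, Suc j, z) c = 0"
      by (rule pair_expect_deriv(2)[OF green_G a test_at_valid[OF Z c]]) (use test_at_node[OF Z c] in auto)
  qed
  thus ?thesis by (simp add: contract_def fun_eq_iff)
qed

lemma contract_zero: "contract k (\<lambda>M. 0) = (\<lambda>M. 0)"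
  by (simp add: contract_def fun_eq_iff wick_deriv_def)

lemma dz_cnj_jcoef:
  assumes v: "is_chart D \<phi>" "z \<in> cimage \<phi>"
  shows "dz (\<lambda>x. cnj (jarg \<phi> x)) z = 0" "dz (\<lambda>x. cnj (- jcoef \<phi> x)) z = 0"
proof -
  note U = cinv_chart(1)[OF v(1)] and j = jcoef_holomorphic[OF v(1)]
  have "dz (\<lambda>x. cnj (jarg \<phi> x)) z = dz (\<lambda>x. cnj (jcoef \<phi> x)) z"
    by (rule dz_cong) (use jarg_eventually[OF v] in \<open>auto elim: eventually_mono\<close>)
  thus "dz (\<lambda>x. cnj (jarg \<phi> x)) z = 0" using dz_cnj_holomorphic[OF U j v(2)] by simp
  show "dz (\<lambda>x. cnj (- jcoef \<phi> x)) z = 0"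
    by (rule dz_cnj_holomorphic[OF U _ v(2)]) (rule holomorphic_on_minus[OF j])
qed

lemma corr_eq_iff: "corr_eq D G X Y \<longleftrightarrow> (\<forall>\<phi> z Z. is_chart D \<phi> \<longrightarrow> z \<in> cimage \<phi> \<longrightarrow> is_functional D (D - {cinv \<phi> z}) Z \<longrightarrow>
   corr G X \<phi> z Z = corr G Y \<phi> z Z)"
  by (simp add: corr_eq_def corr_def)

lemma holomorphic_J: "holomorphic_field D G J_field"
  unfolding holomorphic_field_def corr_eq_iff
proof (intro allI impI)
  fix \<phi> z Z assume v: "is_chart D \<phi>" "z \<in> cimage \<phi>" and Z: "is_functional D (D - {cinv \<phi> z}) Z"
  note b = is_functional_wick_bounded[OF Z] and T = test_at_functional[OF Z]
  have eq: "field_dbar J_field = [(\<lambda>\<phi> z. 0, [Der 0 0]), (\<lambda>\<phi> z. 0, [Der 0 (Suc 0)]), (\<lambda>\<phi> z. 0, [Der (Suc 0) 0]),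
    (\<lambda>\<phi> z. 1, [Der (Suc 0) (Suc 0)]), (\<lambda>\<phi> z. cnj (dz (\<lambda>x. cnj (jarg \<phi> x)) z), [])]"
    unfolding field_dbar_def J_field_eq field_cnj_def field_d_def term_d_def by simp
  show "corr G (field_dbar J_field) \<phi> z Z = corr G (nonrandom (\<lambda>\<phi> z. 0)) \<phi> z Z"
    unfolding eq by (simp add: corr_nonrandom corr_Cons corr_Nil term_corr_Cons term_corr_Nil b dz_cnj_jcoef[OF v] contract_K_mixed[OF v T])
qed

lemma holomorphic_stress: "holomorphic_field D G stress_field"
  unfolding holomorphic_field_def corr_eq_iff
proof (intro allI impI)
  fix \<phi> z Z assume v: "is_chart D \<phi>" "z \<in> cimage \<phi>" and Z: "is_functional D (D - {cinv \<phi> z}) Z"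
  note b = is_functional_wick_bounded[OF Z] and T = test_at_functional[OF Z]
  have eq: "field_dbar stress_field = [(\<lambda>\<phi> z. 0, [Der (Suc 0) 0, Der (Suc 0) 0]), (\<lambda>\<phi> z. -1/2, [Der (Suc 0) (Suc 0), Der (Suc 0) 0]),
     (\<lambda>\<phi> z. -1/2, [Der (Suc 0) 0, Der (Suc 0) (Suc 0)]), (\<lambda>\<phi> z. 0, [Der (Suc (Suc 0)) 0]),
     (\<lambda>\<phi> z. \<i> * of_real b, [Der (Suc (Suc 0)) (Suc 0)]), (\<lambda>\<phi> z. cnj (dz (\<lambda>x. cnj (- jcoef \<phi> x)) z), [Der (Suc 0) 0]),
     (\<lambda>\<phi> z. - jcoef \<phi> z, [Der (Suc 0) (Suc 0)])]"
    unfolding field_dbar_def stress_field_def field_cnj_def field_d_def term_d_def by (simp add: numeral_2_eq_2)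
  note c = wick_bounded_contract[OF b] contract_K_mixed[OF v T] contract_K_mixed[OF v test_at_contract[OF T]]
  show "corr G (field_dbar stress_field) \<phi> z Z = corr G (nonrandom (\<lambda>\<phi> z. 0)) \<phi> z Z"
    unfolding eq by (simp add: corr_nonrandom corr_Cons corr_Nil term_corr_Cons term_corr_Nil b dz_cnj_jcoef[OF v] c contract_zero
      wick_bounded_zero del: complex_cnj_minus)
qed

lemma corr_stress_field:
  assumes "wick_bounded Z"
  shows "corr G stress_field \<phi> z Z = stress \<phi> z Z {#}"
  using fock_mult_stress_field(1)[OF assms, of \<phi> z] by (simp add: corr_expect_prod expect_prod_def)

text \<open>In passing to another chart, the square of \<open>deriv (chart_w \<phi>)\<close> picks
  up the square of the derivative of the transition map, and the Schwarzian of
  \<open>chart_w \<phi>\<close> obeys the cocycle rule. So it is enough to know a correlation in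
  terms of the coordinate \<open>w\<close>.\<close>

lemma schwarzian_formI:
  assumes "\<And>\<phi> z Z. is_chart D \<phi> \<Longrightarrow> z \<in> cimage \<phi> \<Longrightarrow> is_functional D (D - {cinv \<phi> z}) Z \<Longrightarrow>
     corr G X \<phi> z Z = s * (deriv (chart_w \<phi>) z)\<^sup>2 * tau (chart_w \<phi> z) Z + \<mu> * schwarzian (chart_w \<phi>) z * Z {#}"
  shows "schwarzian_form D G \<mu> X"
  unfolding schwarzian_form_def Let_def
proof (intro allI impI)
  fix \<phi> \<phi>' p Z assume v: "is_chart D \<phi>" "is_chart D \<phi>'" and p: "p \<in> cdom \<phi> \<inter> cdom \<phi>'" and Z: "is_functional D (D - {p}) Z"
  let ?z = "cmap \<phi> p" and ?h = "transition \<phi> \<phi>'"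
  have S: "?z \<in> cmap \<phi> ` (cdom \<phi> \<inter> cdom \<phi>')" using p by auto
  note t = transition_facts[OF v]
  have cz: "cinv \<phi> ?z = p" using cinv_chart(6)[OF v(1)] p by auto
  have h: "?h ?z = cmap \<phi>' p" by (simp add: transition_def cz)
  have chz: "cinv \<phi>' (?h ?z) = p" using cinv_chart(6)[OF v(2)] p by (simp add: h)
  have zi: "?z \<in> cimage \<phi>" "?h ?z \<in> cimage \<phi>'" using p by (auto simp: cimage_def h)
  have "corr G X \<phi> ?z Z = (deriv ?h ?z)\<^sup>2 * corr G X \<phi>' (?h ?z) Z + \<mu> * schwarzian ?h ?z * Z {#}"
    using assms[OF v(1) zi(1)] assms[OF v(2) zi(2)] Z t(5,7,8)[OF S]
    by (simp add: cz chz power_mult_distrib algebra_simps)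
  thus "expect (fmult G (field_at X \<phi> ?z) Z) = (deriv ?h ?z)\<^sup>2 * expect (fmult G (field_at X \<phi>' (?h ?z)) Z) +
     \<mu> * schwarzian ?h ?z * expect Z" by (simp add: corr_def expect_def)
qed

lemma quadratic_stress: "quadratic_differential D G stress_field"
  unfolding quadratic_differential_def
  by (rule schwarzian_formI[where s = 1])
     (simp add: corr_stress_field is_functional_wick_bounded stress_empty test_at_functional)

text \<open>Everything in the product of the two currents except their mutual contraction. As a
  function of \<open>\<zeta>\<close> it has no pole at \<open>z\<close>.\<close>

definition JJ_regular :: "chart \<Rightarrow> complex \<Rightarrow> functional \<Rightarrow> complex \<Rightarrow> complex" where
  "JJ_regular \<phi> z Z \<zeta> = deriv (chart_w \<phi>) \<zeta> * current (chart_w \<phi> \<zeta>) (contract (K (\<phi>, Suc 0, 0, z)) Z) {#} +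
     jcoef \<phi> z * (deriv (chart_w \<phi>) \<zeta> * current (chart_w \<phi> \<zeta>) Z {#}) +
     jcoef \<phi> \<zeta> * (contract (K (\<phi>, Suc 0, 0, z)) Z {#} + jcoef \<phi> z * Z {#})"

lemma JJ_correlation:
  assumes v: "is_chart D \<phi>" "z \<in> cimage \<phi>" "\<zeta> \<in> cimage \<phi>" "\<zeta> \<noteq> z" and Z: "test_at (cinv \<phi> z) Z" "test_at (cinv \<phi> \<zeta>) Z"
  shows "expect (fmult G (fmult G (field_at J_field \<phi> \<zeta>) (field_at J_field \<phi> z)) Z) =
    JJ_regular \<phi> z Z \<zeta> + (- deriv (chart_w \<phi>) \<zeta> * deriv (chart_w \<phi>) z / (chart_w \<phi> \<zeta> - chart_w \<phi> z)\<^sup>2) * Z {#}"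
proof -
  let ?W = "chart_w \<phi>" and ?a = "(\<phi>, Suc 0, 0, \<zeta>)" and ?b = "(\<phi>, Suc 0, 0, z)"
  \<comment> \<open>Drops the term of \<open>J_field\<close> with coefficient 0. It contains the
    undifferentiated field, for which the symmetry of the kernel required by
    \<open>expect_fmult_fmult\<close> has not been established.\<close>
  define J' where "J' = [(\<lambda>\<phi> (z :: complex). 1 :: complex, [Der (Suc 0) 0]), (jarg, [])]"
  have J': "field_at J_field \<phi> \<zeta> = field_at J' \<phi> \<zeta>"
    unfolding J_field_eq J'_def by (simp add: field_at_Cons fun_eq_iff)
  have der: "derivative_field J'" by (simp add: derivative_field_def J'_def)
  note bd = test_at_bounded[OF Z(1)]
  have ne: "cinv \<phi> z \<noteq> cinv \<phi> \<zeta>" using v cinv_chart(4)[OF v(1)] by metis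
  have c: "valid_atom D {cinv \<phi> z} (\<phi>, i, l, z)" "node (\<phi>, i, l, z) \<noteq> cinv \<phi> \<zeta>" for i l
    using v ne by (auto simp: valid_atom_def)
  have "expect (fmult G (fmult G (field_at J_field \<phi> \<zeta>) (field_at J_field \<phi> z)) Z) =
     corr G J_field \<phi> z (fock_mult K (field_at J' \<phi> \<zeta>) Z)"
    unfolding J' by (rule expect_fmult_fmult[OF der bd _ v(1,2)])
      (use sym_stress(1)[OF v(1,3) c] in \<open>auto simp: J'_def simp del: pair_expect.simps\<close>)
  also have "fock_mult K (field_at J' \<phi> \<zeta>) Z = (\<lambda>M. fock_mult K (wick_mono [?a]) Z M + jarg \<phi> \<zeta> * Z M)" (is "_ = ?Y")
    using der unfolding J'_def
    by (simp add: fock_mult_derivative_field_Cons fock_mult_derivative_field_Nil bd derivative_field_def fock_mult_one)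
  also have "corr G J_field \<phi> z ?Y = contract (K ?b) ?Y {#} + jarg \<phi> z * ?Y {#}"
    by (rule corr_J) (intro wick_bounded_add wick_bounded_scale fock_mult_mono(2) bd)
  also have "contract (K ?b) ?Y = (\<lambda>M. contract (K ?b) (fock_mult K (wick_mono [?a]) Z) M + jarg \<phi> \<zeta> * contract (K ?b) Z M)"
    by (simp only: contract_add contract_scale wick_bounded_finite wick_bounded_scale fock_mult_mono(2) bd)
  also have "contract (K ?b) (fock_mult K (wick_mono [?a]) Z) =
     (\<lambda>M. fock_mult K (wick_mono [?a]) (contract (K ?b) Z) M + K ?b ?a * Z M)"
    by (rule contract_fock_mult_mono1[OF bd])
  also have "fock_mult K (wick_mono [?a]) (contract (K ?b) Z) =
     (\<lambda>M. wick_mult ?a (contract (K ?b) Z) M + contract (K ?a) (contract (K ?b) Z) M)"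
    by (rule fock_mult_mono1[OF wick_bounded_contract[OF bd]])
  also have "fock_mult K (wick_mono [?a]) Z = (\<lambda>M. wick_mult ?a Z M + contract (K ?a) Z M)" by (rule fock_mult_mono1[OF bd])
  also have "K ?b ?a = deriv ?W \<zeta> * kern ?b (?W \<zeta>)" by (rule sym_K(1)[OF v(1,3) c])
  also have "kern ?b (?W \<zeta>) = - deriv ?W z / (?W \<zeta> - ?W z)\<^sup>2"
    by (rule kern_first[OF v(1,2)]) (use chart_w_inj[OF v(1)] v in \<open>auto dest: inj_onD\<close>)
  also have "contract (K ?a) Z = (\<lambda>M. deriv ?W \<zeta> * current (?W \<zeta>) Z M)" by (rule contract_K1[OF v(1,3) Z(2)])
  also have "contract (K ?a) (contract (K ?b) Z) = (\<lambda>M. deriv ?W \<zeta> * current (?W \<zeta>) (contract (K ?b) Z) M)"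
    by (rule contract_K1[OF v(1,3) test_at_contract[OF Z(2)]])
  finally show ?thesis
    unfolding JJ_regular_def jarg_eq[OF v(1,2)] jarg_eq[OF v(1,3)]
    by (simp add: wick_mult_def algebra_simps del: pair_expect.simps)
qed

text \<open>The two-point series is stored after multiplication by the square of \<open>t\<close>,
  hence the index \<open>n + 2\<close>. The other terms are Taylor coefficients of the regular part
  and begin at \<open>n = 0\<close>.\<close>

definition JJ_coeff :: "int \<Rightarrow> fock" where
  "JJ_coeff n = (\<lambda>\<phi> z. two_point_fps \<phi> z $ nat (n + 2), []) #
     (if n \<ge> 0 then
       [(\<lambda>\<phi> z. 1 / fact (nat n), [Der (Suc (nat n)) 0, Der (Suc 0) 0]),
        (\<lambda>\<phi> z. jcoef \<phi> z / fact (nat n), [Der (Suc (nat n)) 0]),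
        (\<lambda>\<phi> z. (deriv ^^ nat n) (jcoef \<phi>) z / fact (nat n), [Der (Suc 0) 0]),
        (\<lambda>\<phi> z. jcoef \<phi> z * (deriv ^^ nat n) (jcoef \<phi>) z / fact (nat n), [])]
      else [])"

lemma fock_field_JJ_coeff: "fock_field D (JJ_coeff n)"
proof -
  have 1: "nonrandom_field D (\<lambda>\<phi> z. 1 / fact m :: complex)" for m by (rule nonrandom_field_const)
  have 3: "nonrandom_field D (\<lambda>\<phi> z. (deriv ^^ m) (jcoef \<phi>) z / fact m)" for m
    using nonrandom_field_scale[OF nonrandom_jcoef[of m], of "1 / fact m"] by simp
  have 2: "nonrandom_field D (\<lambda>\<phi> z. jcoef \<phi> z / fact m)" for m
    using nonrandom_field_scale[OF nonrandom_jcoef[of 0], of "1 / fact m"] by simp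
  have 4: "nonrandom_field D (\<lambda>\<phi> z. jcoef \<phi> z * (deriv ^^ m) (jcoef \<phi>) z / fact m)" for m
  proof (rule nonrandom_field_holomorphic)
    show "(\<lambda>z. jcoef \<phi> z * (deriv ^^ m) (jcoef \<phi>) z / fact m) holomorphic_on cimage \<phi>" if v: "is_chart D \<phi>" for \<phi>
      by (intro holomorphic_intros holomorphic_higher_deriv jcoef_holomorphic[OF v] cinv_chart(1)[OF v]) auto
    show "jcoef \<phi>' z * (deriv ^^ m) (jcoef \<phi>') z / fact m = jcoef \<phi> z * (deriv ^^ m) (jcoef \<phi>) z / fact m"
      if "eventually (\<lambda>x. chart_w \<phi>' x = chart_w \<phi> x) (nhds z)" for \<phi> \<phi>' z
      using jcoef_germ[OF that, of 0] jcoef_germ[OF that, of m] by simp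
  qed
  show ?thesis unfolding fock_field_def JJ_coeff_def
    by (auto simp: nonrandom_two_point 1 2 3 4)
qed

lemma chart_current_holomorphic:
  assumes v: "is_chart D \<phi>" "z \<in> cimage \<phi>" and Z: "test_at (cinv \<phi> z) Z"
  obtains U where "open U" "z \<in> U" "U \<subseteq> cimage \<phi>" "\<And>\<zeta>. \<zeta> \<in> U \<Longrightarrow> test_at (cinv \<phi> \<zeta>) Z"
    "\<And>c. c \<in> atoms_of Z \<Longrightarrow> (\<lambda>\<zeta>. kern c (chart_w \<phi> \<zeta>) * deriv (chart_w \<phi>) \<zeta>) holomorphic_on U"
proof -
  note O = cinv_chart(1)[OF v(1)] and W = chart_w_holomorphic[OF v(1)]
  obtain \<rho> where \<rho>: "\<rho> > 0" "\<And>c. c \<in> atoms_of Z \<Longrightarrow> kern c holomorphic_on ball (w (cinv \<phi> z)) \<rho>"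
    "\<And>q. q \<in> D \<Longrightarrow> w q \<in> ball (w (cinv \<phi> z)) \<rho> \<Longrightarrow> test_at q Z"
    using test_at_near[OF Z cinv_chart(5)[OF v]] by metis
  define U where "U = chart_w \<phi> -` ball (w (cinv \<phi> z)) \<rho> \<inter> cimage \<phi>"
  show ?thesis
  proof (rule that)
    show "open U" unfolding U_def by (rule open_vimage_holomorphic[OF W O open_ball])
    show "z \<in> U" using v \<rho>(1) by (simp add: U_def chart_w_def)
    show sub: "U \<subseteq> cimage \<phi>" by (auto simp: U_def)
    show "test_at (cinv \<phi> \<zeta>) Z" if "\<zeta> \<in> U" for \<zeta>
      by (rule \<rho>(3)) (use that cinv_chart(5)[OF v(1)] in \<open>auto simp: U_def chart_w_def\<close>)
    show "(\<lambda>\<zeta>. kern c (chart_w \<phi> \<zeta>) * deriv (chart_w \<phi>) \<zeta>) holomorphic_on U" if "c \<in> atoms_of Z" for c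
    proof -
      have "(\<lambda>\<zeta>. kern c (chart_w \<phi> \<zeta>)) holomorphic_on U"
        using holomorphic_on_compose_gen[OF holomorphic_on_subset[OF W sub] \<rho>(2)[OF that]] by (auto simp: U_def o_def)
      thus ?thesis by (intro holomorphic_intros holomorphic_on_subset[OF holomorphic_deriv[OF W O] sub])
    qed
  qed
qed

lemma contract_K_higher:
  assumes v: "is_chart D \<phi>" "z \<in> cimage \<phi>" and Z: "test_at (cinv \<phi> z) Z"
  shows "contract (K (\<phi>, Suc n, 0, z)) Z {#} = (deriv ^^ n) (\<lambda>\<zeta>. deriv (chart_w \<phi>) \<zeta> * current (chart_w \<phi> \<zeta>) Z {#}) z"
proof -
  obtain U where U: "open U" "z \<in> U" and h: "\<And>c. c \<in> atoms_of Z \<Longrightarrow> (\<lambda>\<zeta>. kern c (chart_w \<phi> \<zeta>) * deriv (chart_w \<phi>) \<zeta>) holomorphic_on U"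
    using chart_current_holomorphic[OF v Z] by metis
  have a: "valid_atom D {cinv \<phi> z} (\<phi>, 0, 0, z)" using v by (simp add: valid_atom_def)
  have "contract (K (\<phi>, Suc n, 0, z)) Z {#} =
     (\<Sum>c\<in>atoms_of Z. (deriv ^^ n) (\<lambda>\<zeta>. kern c (chart_w \<phi> \<zeta>) * deriv (chart_w \<phi>) \<zeta>) z * wick_deriv c Z {#})"
    unfolding contract_def
  proof (rule sum.cong[OF refl])
    fix c assume c: "c \<in> atoms_of Z"
    show "K (\<phi>, Suc n, 0, z) c * wick_deriv c Z {#} =
      (deriv ^^ n) (\<lambda>\<zeta>. kern c (chart_w \<phi> \<zeta>) * deriv (chart_w \<phi>) \<zeta>) z * wick_deriv c Z {#}"
      using pair_expect_deriv(1)[OF green_G a test_at_valid[OF Z c], of n] test_at_node[OF Z c] by simp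
  qed
  also have "\<dots> = (deriv ^^ n) (\<lambda>\<zeta>. \<Sum>c\<in>atoms_of Z. (kern c (chart_w \<phi> \<zeta>) * deriv (chart_w \<phi>) \<zeta>) * wick_deriv c Z {#}) z"
    by (rule higher_deriv_sum_cmult[OF test_at_finite[OF Z] h U, symmetric])
  also have "(\<lambda>\<zeta>. \<Sum>c\<in>atoms_of Z. (kern c (chart_w \<phi> \<zeta>) * deriv (chart_w \<phi>) \<zeta>) * wick_deriv c Z {#}) =
     (\<lambda>\<zeta>. deriv (chart_w \<phi>) \<zeta> * current (chart_w \<phi> \<zeta>) Z {#})"
    by (simp add: current_def contract_def sum_distrib_left mult_ac)
  finally show ?thesis .
qed

lemma JJ_regular_expansion:
  assumes v: "is_chart D \<phi>" "z \<in> cimage \<phi>" and Z: "test_at (cinv \<phi> z) Z"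
  obtains U where "open U" "z \<in> U" "U \<subseteq> cimage \<phi>" "\<And>\<zeta>. \<zeta> \<in> U \<Longrightarrow> test_at (cinv \<phi> \<zeta>) Z" "JJ_regular \<phi> z Z holomorphic_on U"
    "\<And>n. (deriv ^^ n) (JJ_regular \<phi> z Z) z = contract (K (\<phi>, Suc n, 0, z)) (contract (K (\<phi>, Suc 0, 0, z)) Z) {#} +
      jcoef \<phi> z * contract (K (\<phi>, Suc n, 0, z)) Z {#} +
      (deriv ^^ n) (jcoef \<phi>) z * (contract (K (\<phi>, Suc 0, 0, z)) Z {#} + jcoef \<phi> z * Z {#})"
proof -
  let ?Zb = "contract (K (\<phi>, Suc 0, 0, z)) Z"
  note Zb = test_at_contract[OF Z, of "K (\<phi>, Suc 0, 0, z)"]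
  obtain U where U: "open U" "z \<in> U" "U \<subseteq> cimage \<phi>" "\<And>\<zeta>. \<zeta> \<in> U \<Longrightarrow> test_at (cinv \<phi> \<zeta>) Z"
    and h: "\<And>c. c \<in> atoms_of Z \<Longrightarrow> (\<lambda>\<zeta>. kern c (chart_w \<phi> \<zeta>) * deriv (chart_w \<phi>) \<zeta>) holomorphic_on U"
    using chart_current_holomorphic[OF v Z] by metis
  have hol: "(\<lambda>\<zeta>. deriv (chart_w \<phi>) \<zeta> * current (chart_w \<phi> \<zeta>) Y {#}) holomorphic_on U" if "atoms_of Y \<subseteq> atoms_of Z" for Y
  proof -
    have "(\<lambda>\<zeta>. \<Sum>c\<in>atoms_of Y. (kern c (chart_w \<phi> \<zeta>) * deriv (chart_w \<phi>) \<zeta>) * wick_deriv c Y {#}) holomorphic_on U"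
      by (intro holomorphic_on_sum holomorphic_on_mult[OF h holomorphic_on_const]) (use that in auto)
    moreover have "(\<lambda>\<zeta>. \<Sum>c\<in>atoms_of Y. (kern c (chart_w \<phi> \<zeta>) * deriv (chart_w \<phi>) \<zeta>) * wick_deriv c Y {#}) =
      (\<lambda>\<zeta>. deriv (chart_w \<phi>) \<zeta> * current (chart_w \<phi> \<zeta>) Y {#})"
      by (simp add: current_def contract_def sum_distrib_left mult_ac)
    ultimately show ?thesis by simp
  qed
  define f1 where "f1 = (\<lambda>\<zeta>. deriv (chart_w \<phi>) \<zeta> * current (chart_w \<phi> \<zeta>) ?Zb {#})"
  define f2 where "f2 = (\<lambda>\<zeta>. deriv (chart_w \<phi>) \<zeta> * current (chart_w \<phi> \<zeta>) Z {#})"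
  define q where "q = ?Zb {#} + jcoef \<phi> z * Z {#}"
  have f: "f1 holomorphic_on U" "f2 holomorphic_on U" "jcoef \<phi> holomorphic_on U"
    unfolding f1_def f2_def using hol[OF atoms_of_contract] hol[OF subset_refl] holomorphic_on_subset[OF jcoef_holomorphic[OF v(1)] U(3)] by auto
  have eq: "JJ_regular \<phi> z Z = (\<lambda>\<zeta>. (f1 \<zeta> + jcoef \<phi> z * f2 \<zeta>) + q * jcoef \<phi> \<zeta>)"
    by (simp add: JJ_regular_def fun_eq_iff f1_def f2_def q_def)
  have g: "(\<lambda>\<zeta>. jcoef \<phi> z * f2 \<zeta>) holomorphic_on U" "(\<lambda>\<zeta>. q * jcoef \<phi> \<zeta>) holomorphic_on U"
    "(\<lambda>\<zeta>. f1 \<zeta> + jcoef \<phi> z * f2 \<zeta>) holomorphic_on U"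
    by (intro holomorphic_intros f)+
  show ?thesis
  proof (rule that[OF U])
    show "JJ_regular \<phi> z Z holomorphic_on U" unfolding eq by (intro holomorphic_intros f)
    fix n
    have "(deriv ^^ n) (JJ_regular \<phi> z Z) z = (deriv ^^ n) f1 z + jcoef \<phi> z * (deriv ^^ n) f2 z + q * (deriv ^^ n) (jcoef \<phi>) z"
      unfolding eq higher_deriv_add[OF g(3,2) U(1,2)] higher_deriv_add[OF f(1) g(1) U(1,2)]
        higher_deriv_cmult[OF f(2) U(2,1)] higher_deriv_cmult[OF f(3) U(2,1)] ..
    also have "(deriv ^^ n) f1 z = contract (K (\<phi>, Suc n, 0, z)) ?Zb {#}" unfolding f1_def by (rule contract_K_higher[OF v Zb, symmetric])
    also have "(deriv ^^ n) f2 z = contract (K (\<phi>, Suc n, 0, z)) Z {#}" unfolding f2_def by (rule contract_K_higher[OF v Z, symmetric])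
    finally show "(deriv ^^ n) (JJ_regular \<phi> z Z) z = contract (K (\<phi>, Suc n, 0, z)) ?Zb {#} +
      jcoef \<phi> z * contract (K (\<phi>, Suc n, 0, z)) Z {#} + (deriv ^^ n) (jcoef \<phi>) z * (?Zb {#} + jcoef \<phi> z * Z {#})"
      by (simp add: q_def mult.commute)
  qed
qed

text \<open>The expansion of the correlation multiplied by the square of \<open>\<zeta> - z\<close>,
  which clears the negative powers.\<close>

definition JJ_fps :: "chart \<Rightarrow> complex \<Rightarrow> functional \<Rightarrow> complex fps" where
  "JJ_fps \<phi> z Z = fps_const (Z {#}) * two_point_fps \<phi> z + fps_X ^ 2 * fps_expansion (JJ_regular \<phi> z Z) z"

lemma JJ_fps_coeff:
  assumes v: "is_chart D \<phi>" "z \<in> cimage \<phi>" and Z: "test_at (cinv \<phi> z) Z"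
  shows "corr G (JJ_coeff (int k - 2)) \<phi> z Z = JJ_fps \<phi> z Z $ k"
proof -
  note bd = test_at_bounded[OF Z] wick_bounded_contract[OF test_at_bounded[OF Z]]
  obtain U where "\<And>n. (deriv ^^ n) (JJ_regular \<phi> z Z) z = contract (K (\<phi>, Suc n, 0, z)) (contract (K (\<phi>, Suc 0, 0, z)) Z) {#} +
      jcoef \<phi> z * contract (K (\<phi>, Suc n, 0, z)) Z {#} +
      (deriv ^^ n) (jcoef \<phi>) z * (contract (K (\<phi>, Suc 0, 0, z)) Z {#} + jcoef \<phi> z * Z {#})"
    using JJ_regular_expansion[OF v Z] by metis
  note d = this
  have comm: "contract (K (\<phi>, Suc 0, 0, z)) (contract (K (\<phi>, Suc n, 0, z)) Z) = contract (K (\<phi>, Suc n, 0, z)) (contract (K (\<phi>, Suc 0, 0, z)) Z)" for n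
    by (rule contract_commute[OF test_at_finite[OF Z]])
  show ?thesis
  proof (cases "k \<ge> 2")
    case False
    hence "JJ_fps \<phi> z Z $ k = two_point_fps \<phi> z $ k * Z {#}" by (simp add: JJ_fps_def fps_X_power_mult_nth mult.commute)
    thus ?thesis using False by (simp add: JJ_coeff_def corr_Cons corr_Nil term_corr_Nil bd)
  next
    case True
    then obtain m where k: "k = m + 2" using le_Suc_ex by (metis add.commute)
    have "JJ_fps \<phi> z Z $ k = two_point_fps \<phi> z $ k * Z {#} + (deriv ^^ m) (JJ_regular \<phi> z Z) z / fact m"
      by (simp add: JJ_fps_def fps_X_power_mult_nth k fps_expansion_def mult.commute)
    moreover have "nat (int m + 2) = m + 2" by simp
    ultimately show ?thesis unfolding d
      by (simp add: JJ_coeff_def corr_Cons corr_Nil term_corr_Nil term_corr_Cons bd k comm field_simps del: pair_expect.simps)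
  qed
qed

lemma JJ_eventually:
  assumes v: "is_chart D \<phi>" "z \<in> cimage \<phi>" and Z: "test_at (cinv \<phi> z) Z"
  shows "fps_conv_radius (JJ_fps \<phi> z Z) > 0"
    and "eventually (\<lambda>t. t \<noteq> 0 \<longrightarrow> eval_fps (JJ_fps \<phi> z Z) t =
      t\<^sup>2 * expect (fmult G (fmult G (field_at J_field \<phi> (z + t)) (field_at J_field \<phi> z)) Z)) (nhds 0)"
proof -
  obtain U where U: "open U" "z \<in> U" "U \<subseteq> cimage \<phi>" "\<And>\<zeta>. \<zeta> \<in> U \<Longrightarrow> test_at (cinv \<phi> \<zeta>) Z" "JJ_regular \<phi> z Z holomorphic_on U"
    by (rule JJ_regular_expansion[OF v Z]) (rule that; assumption)
  obtain s where s: "s has_fps_expansion two_point_fps \<phi> z"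
    "eventually (\<lambda>t. t \<noteq> 0 \<longrightarrow> s t = t\<^sup>2 * (- deriv (chart_w \<phi>) (z + t) * deriv (chart_w \<phi>) z / (chart_w \<phi> (z + t) - chart_w \<phi> z)\<^sup>2)) (nhds 0)"
    by (rule two_point_fps_expansion[OF v])
  have "JJ_regular \<phi> z Z analytic_on {z}" using U analytic_at by blast
  hence r: "(\<lambda>t. JJ_regular \<phi> z Z (z + t)) has_fps_expansion fps_expansion (JJ_regular \<phi> z Z) z"
    by (rule analytic_at_imp_has_fps_expansion)
  have e: "(\<lambda>t. Z {#} * s t + t ^ 2 * JJ_regular \<phi> z Z (z + t)) has_fps_expansion JJ_fps \<phi> z Z"
    unfolding JJ_fps_def by (intro fps_expansion_intros s r)
  show "fps_conv_radius (JJ_fps \<phi> z Z) > 0" using e by (simp add: has_fps_expansion_def)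
  have "eventually (\<lambda>t. t \<in> (\<lambda>t. z + t) -` U) (nhds 0)"
    by (rule eventually_nhds_in_open) (use U in \<open>auto intro!: open_vimage continuous_intros\<close>)
  moreover have "eventually (\<lambda>t. eval_fps (JJ_fps \<phi> z Z) t = Z {#} * s t + t ^ 2 * JJ_regular \<phi> z Z (z + t)) (nhds 0)"
    using e by (simp add: has_fps_expansion_def)
  ultimately show "eventually (\<lambda>t. t \<noteq> 0 \<longrightarrow> eval_fps (JJ_fps \<phi> z Z) t =
      t\<^sup>2 * expect (fmult G (fmult G (field_at J_field \<phi> (z + t)) (field_at J_field \<phi> z)) Z)) (nhds 0)"
    using s(2)
  proof eventually_elim
    case (elim t)
    show ?case
    proof
      assume t: "t \<noteq> 0"
      have "z + t \<in> U" "z + t \<noteq> z" using elim(1) t by auto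
      note J = JJ_correlation[OF v(1,2) subsetD[OF U(3) this(1)] this(2) Z U(4)[OF this(1)]]
      show "eval_fps (JJ_fps \<phi> z Z) t = t\<^sup>2 * expect (fmult G (fmult G (field_at J_field \<phi> (z + t)) (field_at J_field \<phi> z)) Z)"
        unfolding J elim(2) using elim(3) t by (simp add: algebra_simps)
    qed
  qed
qed

lemma ope_JJ: "ope D G J_field J_field 2 JJ_coeff"
  unfolding ope_def
proof (intro conjI allI impI)
  show "holomorphic_field D G J_field" by (rule holomorphic_J)
  show "fock_field D (JJ_coeff n)" for n by (rule fock_field_JJ_coeff)
  fix \<phi> z Z assume v: "is_chart D \<phi>" "z \<in> cimage \<phi>" and Z: "is_functional D (D - {cinv \<phi> z}) Z"
  note T = test_at_functional[OF Z] and E = JJ_eventually[OF v test_at_functional[OF Z]]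
  have "eventually (\<lambda>t. t \<in> eball 0 (fps_conv_radius (JJ_fps \<phi> z Z))) (nhds 0)"
    by (rule eventually_nhds_in_open) (use E(1) in \<open>auto simp: zero_ereal_def\<close>)
  with E(2) have "eventually (\<lambda>t. t \<noteq> 0 \<longrightarrow> (\<lambda>k. JJ_fps \<phi> z Z $ k * t powi (int k - 2)) sums
     expect (fmult G (fmult G (field_at J_field \<phi> (z + t)) (field_at J_field \<phi> z)) Z)) (nhds 0)"
  proof eventually_elim
    case (elim t)
    show ?case
    proof
      assume t: "t \<noteq> 0"
      have "(\<lambda>k. JJ_fps \<phi> z Z $ k * t ^ k) sums eval_fps (JJ_fps \<phi> z Z) t"
        using summable_fps[of t "JJ_fps \<phi> z Z"] elim(2) by (simp add: eval_fps_def summable_sums in_eball_iff)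
      hence "(\<lambda>k. JJ_fps \<phi> z Z $ k * t ^ k / t\<^sup>2) sums (eval_fps (JJ_fps \<phi> z Z) t / t\<^sup>2)" by (rule sums_divide)
      thus "(\<lambda>k. JJ_fps \<phi> z Z $ k * t powi (int k - 2)) sums
        expect (fmult G (fmult G (field_at J_field \<phi> (z + t)) (field_at J_field \<phi> z)) Z)"
        using elim(1) t by (simp add: power_int_diff)
    qed
  qed
  hence "eventually (\<lambda>t. (\<lambda>k. JJ_fps \<phi> z Z $ k * t powi (int k - 2)) sums
     expect (fmult G (fmult G (field_at J_field \<phi> (z + t)) (field_at J_field \<phi> z)) Z)) (at 0)"
    unfolding eventually_at_filter by (rule eventually_mono) simp
  hence "\<forall>\<^sub>F \<zeta> in at z. (\<lambda>k. JJ_fps \<phi> z Z $ k * (\<zeta> - z) powi (int k - 2)) sums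
     expect (fmult G (fmult G (field_at J_field \<phi> \<zeta>) (field_at J_field \<phi> z)) Z)"
    by (subst at_to_0) (simp add: eventually_filtermap add.commute)
  thus "\<forall>\<^sub>F \<zeta> in at z. (\<lambda>k. expect (fmult G (field_at (JJ_coeff (int k - int 2)) \<phi> z) Z) * (\<zeta> - z) powi (int k - int 2)) sums
     expect (fmult G (fmult G (field_at J_field \<phi> \<zeta>) (field_at J_field \<phi> z)) Z)"
    using JJ_fps_coeff[OF v T] by (simp add: corr_def)
qed

text \<open>\<open>ope_mult\<close> picks some expansion, with unknown \<open>N\<close> and unknown
  coefficient fields. Uniqueness of power series shows that its coefficient of order 0 has the same
  correlations as the one found above.\<close>

lemma ope_JJ_unique:
  assumes ope: "ope D G J_field J_field N C" and v: "is_chart D \<phi>" "z \<in> cimage \<phi>" and Z: "is_functional D (D - {cinv \<phi> z}) Z"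
  shows "corr G (C 0) \<phi> z Z = JJ_fps \<phi> z Z $ 2"
proof -
  define e where "e = (\<lambda>k. corr G (C (int k - int N)) \<phi> z Z)"
  let ?E = "\<lambda>t. expect (fmult G (fmult G (field_at J_field \<phi> (z + t)) (field_at J_field \<phi> z)) Z)"
  note T = test_at_functional[OF Z] and F = JJ_eventually[OF v test_at_functional[OF Z]]
  have "\<forall>\<^sub>F \<zeta> in at z. (\<lambda>k. e k * (\<zeta> - z) powi (int k - int N)) sums expect (fmult G (fmult G (field_at J_field \<phi> \<zeta>) (field_at J_field \<phi> z)) Z)"
    using ope v Z unfolding ope_def e_def corr_def by blast
  hence ev: "eventually (\<lambda>t. t \<noteq> 0 \<longrightarrow> (\<lambda>k. e k * t powi (int k - int N)) sums ?E t) (nhds 0)"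
    by (subst (asm) at_to_0) (simp add: eventually_filtermap eventually_at_filter add.commute)
  have sums: "eventually (\<lambda>t. t \<noteq> 0 \<longrightarrow> (\<lambda>k. e k * t ^ k) sums (t ^ N * ?E t)) (nhds 0)"
    using ev
  proof eventually_elim
    case (elim t)
    show ?case
    proof
      assume t: "t \<noteq> 0"
      have "(\<lambda>k. t ^ N * (e k * t powi (int k - int N))) sums (t ^ N * ?E t)" using elim t by (intro sums_mult) auto
      thus "(\<lambda>k. e k * t ^ k) sums (t ^ N * ?E t)" using t by (simp add: power_int_diff)
    qed
  qed
  define A where "A = Abs_fps e"
  have A: "fps_conv_radius A > 0"
  proof -
    obtain S where S: "open S" "0 \<in> S" "\<And>t. t \<in> S \<Longrightarrow> t \<noteq> 0 \<Longrightarrow> (\<lambda>k. e k * t ^ k) sums (t ^ N * ?E t)"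
      using sums unfolding eventually_nhds by blast
    obtain r where r: "r > 0" "ball 0 r \<subseteq> S" using S open_contains_ball by blast
    \<comment> \<open>Convergence at one nonzero point is enough for a positive radius.\<close>
    have "complex_of_real (r/2) \<in> S" "complex_of_real (r/2) \<noteq> 0" using r by auto
    hence "summable (\<lambda>k. e k * complex_of_real (r/2) ^ k)" using S(3) sums_summable by blast
    hence "conv_radius e \<ge> norm (complex_of_real (r/2))" by (rule conv_radius_geI)
    moreover have "ereal (norm (complex_of_real (r/2))) > 0" using r by simp
    ultimately have "conv_radius e > 0" by (rule less_le_trans[rotated])
    thus ?thesis by (simp add: fps_conv_radius_def A_def)
  qed
  have evA: "eventually (\<lambda>t. t \<noteq> 0 \<longrightarrow> eval_fps A t = t ^ N * ?E t) (nhds 0)"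
    using sums by eventually_elim (auto simp: eval_fps_def A_def sums_iff)
  \<comment> \<open>Clearing the poles would need only the powers 2 and \<open>N\<close>. The
    additional factor \<open>t\<close> makes both sides vanish at 0, where nothing is known about
    the two sums, so that they agree on a full neighbourhood.\<close>
  have hA: "(\<lambda>t. t ^ 3 * eval_fps A t) has_fps_expansion fps_X ^ 3 * A"
    by (intro fps_expansion_intros eval_fps_has_fps_expansion A)
  have hF: "(\<lambda>t. t ^ (N + 1) * eval_fps (JJ_fps \<phi> z Z) t) has_fps_expansion fps_X ^ (N + 1) * JJ_fps \<phi> z Z"
    by (intro fps_expansion_intros eval_fps_has_fps_expansion F)
  have "eventually (\<lambda>t. t ^ 3 * eval_fps A t = t ^ (N + 1) * eval_fps (JJ_fps \<phi> z Z) t) (nhds 0)"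
    using evA F(2)
  proof eventually_elim
    case (elim t)
    show ?case using elim by (cases "t = 0") (auto simp: power_add power2_eq_square power3_eq_cube)
  qed
  moreover have "eventually (\<lambda>t. eval_fps (fps_X ^ 3 * A) t = t ^ 3 * eval_fps A t) (nhds 0)"
    using hA by (simp add: has_fps_expansion_def)
  moreover have "eventually (\<lambda>t. eval_fps (fps_X ^ (N + 1) * JJ_fps \<phi> z Z) t = t ^ (N + 1) * eval_fps (JJ_fps \<phi> z Z) t) (nhds 0)"
    using hF by (simp only: has_fps_expansion_def)
  ultimately have "eventually (\<lambda>t. eval_fps (fps_X ^ 3 * A) t = eval_fps (fps_X ^ (N + 1) * JJ_fps \<phi> z Z) t) (nhds 0)"
    by eventually_elim simp
  hence "fps_X ^ 3 * A = fps_X ^ (N + 1) * JJ_fps \<phi> z Z"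
    using hA hF by (intro eval_fps_eqD) (auto simp: has_fps_expansion_def)
  from arg_cong[OF this, of "\<lambda>f. f $ (N + 3)"] have "e N = JJ_fps \<phi> z Z $ 2"
    by (simp only: fps_X_power_mult_nth) (simp add: A_def)
  thus ?thesis by (simp add: e_def)
qed

section \<open>The field T\<close>

definition T_field :: fock where
  "T_field = field_add (field_scale (- (1/2)) (ope_mult D G J_field J_field)) (field_scale (\<i> * complex_of_real b) (field_d J_field))"

lemma ope_mult_JJ: "\<exists>N C. ope D G J_field J_field N C \<and> ope_mult D G J_field J_field = C 0"
  unfolding ope_mult_def by (rule someI_ex) (use ope_JJ in blast)

lemma fock_field_T: "fock_field D T_field"
proof -
  have "fock_field D (ope_mult D G J_field J_field)" using ope_mult_JJ unfolding ope_def by metis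
  thus ?thesis unfolding T_field_def by (intro fock_field_add fock_field_scale fock_field_J)
qed

definition charge :: complex where "charge = of_real (1 - 12 * b\<^sup>2)"

lemma jcoef_schwarzian:
  assumes v: "is_chart D \<phi>" "z \<in> cimage \<phi>"
  shows "\<i> * of_real b * deriv (jcoef \<phi>) z - (jcoef \<phi> z)\<^sup>2 / 2 = - of_real (b\<^sup>2) * schwarzian (chart_w \<phi>) z"
proof -
  let ?W = "chart_w \<phi>"
  note W = chart_w_holomorphic[OF v(1)] and U = cinv_chart(1)[OF v(1)]
  have "(\<lambda>x. deriv (deriv ?W) x / deriv ?W x) holomorphic_on cimage \<phi>"
    by (intro holomorphic_intros holomorphic_deriv W U) (use deriv_chart_w[OF v(1)] in auto)
  from holomorphic_derivI[OF this U v(2)]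
  have "deriv (jcoef \<phi>) z = \<i> * of_real b * deriv (\<lambda>x. deriv (deriv ?W) x / deriv ?W x) z"
    unfolding jcoef_def[abs_def] by (intro DERIV_imp_deriv DERIV_cmult)
  thus ?thesis by (simp add: schwarzian_def jcoef_def power_mult_distrib algebra_simps power2_eq_square)
qed

lemma corr_T:
  assumes v: "is_chart D \<phi>" "z \<in> cimage \<phi>" and Z: "is_functional D (D - {cinv \<phi> z}) Z"
  shows "corr G T_field \<phi> z Z = stress \<phi> z Z {#} + charge / 12 * schwarzian (chart_w \<phi>) z * Z {#}"
proof -
  obtain N C where C: "ope D G J_field J_field N C" "ope_mult D G J_field J_field = C 0" using ope_mult_JJ by blast
  note T = test_at_functional[OF Z] and bd = is_functional_wick_bounded[OF Z]
  let ?b = "(\<phi>, Suc 0, 0, z)" and ?S = "schwarzian (chart_w \<phi>) z"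
  obtain U where d: "\<And>n. (deriv ^^ n) (JJ_regular \<phi> z Z) z = contract (K (\<phi>, Suc n, 0, z)) (contract (K ?b) Z) {#} +
      jcoef \<phi> z * contract (K (\<phi>, Suc n, 0, z)) Z {#} + (deriv ^^ n) (jcoef \<phi>) z * (contract (K ?b) Z {#} + jcoef \<phi> z * Z {#})"
    using JJ_regular_expansion[OF v T] by metis
  have "JJ_fps \<phi> z Z $ 2 = two_point_fps \<phi> z $ 2 * Z {#} + JJ_regular \<phi> z Z z"
    by (simp add: JJ_fps_def fps_X_power_mult_nth fps_expansion_def mult.commute)
  hence P: "corr G (ope_mult D G J_field J_field) \<phi> z Z = - ?S / 6 * Z {#} + (contract (K ?b) (contract (K ?b) Z) {#} +
      2 * jcoef \<phi> z * contract (K ?b) Z {#} + (jcoef \<phi> z)\<^sup>2 * Z {#})"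
    unfolding C(2) ope_JJ_unique[OF C(1) v Z] two_point_fps_2[OF v] using d[of 0]
    by (simp add: power2_eq_square algebra_simps del: pair_expect.simps)
  have dJ: "corr G (field_d J_field) \<phi> z Z = contract (K (\<phi>, Suc (Suc 0), 0, z)) Z {#} + deriv (jcoef \<phi>) z * Z {#}"
    by (simp add: corr_d_J bd dz_jarg[OF v] del: pair_expect.simps)
  have st: "stress \<phi> z Z {#} = (-1/2) * contract (K ?b) (contract (K ?b) Z) {#} +
     (\<i> * of_real b * contract (K (\<phi>, Suc (Suc 0), 0, z)) Z {#} + (- jcoef \<phi> z) * contract (K ?b) Z {#})"
    unfolding stress_def by (rule stress_op_empty[OF bd])
  have "corr G T_field \<phi> z Z = stress \<phi> z Z {#} + (?S / 12 + (\<i> * of_real b * deriv (jcoef \<phi>) z - (jcoef \<phi> z)\<^sup>2 / 2)) * Z {#}"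
    unfolding T_field_def corr_add[OF bd] corr_scale[OF bd] P dJ st by (simp add: algebra_simps add_divide_distrib del: pair_expect.simps)
  also have "?S / 12 + (\<i> * of_real b * deriv (jcoef \<phi>) z - (jcoef \<phi> z)\<^sup>2 / 2) = charge / 12 * ?S"
    unfolding jcoef_schwarzian[OF v] by (simp add: charge_def algebra_simps add_divide_distrib diff_divide_distrib)
  finally show ?thesis .
qed

lemma corr_T_tau:
  assumes v: "is_chart D \<phi>" "z \<in> cimage \<phi>" and Z: "is_functional D (D - {cinv \<phi> z}) Z"
  shows "corr G T_field \<phi> z Z = (deriv (chart_w \<phi>) z)\<^sup>2 * tau (chart_w \<phi> z) Z + charge / 12 * schwarzian (chart_w \<phi>) z * Z {#}"
  unfolding corr_T[OF assms] by (simp add: stress_empty[OF v] test_at_functional[OF Z])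

lemma schwarzian_form_T: "schwarzian_form D G (charge / 12) T_field"
  by (rule schwarzian_formI[where s = 1]) (simp add: corr_T_tau)

lemma T_minus_stress:
  "\<exists>f \<mu>. nonrandom_field D f \<and> holomorphic_field D G (nonrandom f) \<and> schwarzian_form D G \<mu> (nonrandom f) \<and>
     corr_eq D G (field_add T_field (field_scale (-1) stress_field)) (nonrandom f)"
proof (intro exI conjI)
  let ?f = "\<lambda>\<phi> z. charge / 12 * schwarzian (chart_w \<phi>) z"
  have hol: "?f \<phi> holomorphic_on cimage \<phi>" if "is_chart D \<phi>" for \<phi>
    by (intro holomorphic_intros schwarzian_holomorphic that)
  show "nonrandom_field D ?f"
  proof (rule nonrandom_field_holomorphic[OF hol])
    show "?f \<phi>' z = ?f \<phi> z" if "eventually (\<lambda>x. chart_w \<phi>' x = chart_w \<phi> x) (nhds z)" for \<phi> \<phi>' z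
      using schwarzian_cong[OF that] by simp
  qed
  show "holomorphic_field D G (nonrandom ?f)"
    unfolding holomorphic_field_def corr_eq_iff
  proof (intro allI impI)
    fix \<phi> z Z assume v: "is_chart D \<phi>" "z \<in> cimage \<phi>" and Z: "is_functional D (D - {cinv \<phi> z}) Z"
    have eq: "field_dbar (nonrandom ?f) = [(\<lambda>\<phi> z. cnj (dz (\<lambda>x. cnj (?f \<phi> x)) z), [])]"
      by (simp add: field_dbar_def nonrandom_def field_cnj_def field_d_def term_d_def)
    have "dz (\<lambda>x. cnj (?f \<phi> x)) z = 0" by (rule dz_cnj_holomorphic[OF cinv_chart(1)[OF v(1)] hol[OF v(1)] v(2)])
    thus "corr G (field_dbar (nonrandom ?f)) \<phi> z Z = corr G (nonrandom (\<lambda>\<phi> z. 0)) \<phi> z Z"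
      unfolding eq by (simp add: corr_nonrandom corr_Cons corr_Nil is_functional_wick_bounded[OF Z])
  qed
  show "schwarzian_form D G (charge / 12) (nonrandom ?f)"
    by (rule schwarzian_formI[where s = 0]) (simp add: corr_nonrandom is_functional_wick_bounded)
  show "corr_eq D G (field_add T_field (field_scale (-1) stress_field)) (nonrandom ?f)"
    unfolding corr_eq_iff
    by (auto simp: corr_add corr_scale corr_nonrandom is_functional_wick_bounded corr_T corr_stress_field)
qed

end

section \<open>Stress tensors\<close>

context halfplane_map
begin

text \<open>The numerators \<open>f n\<close> may be arbitrary holomorphic functions of the
  coordinate \<open>w\<close>, so that no Laurent expansion is needed. Exactly one factor
  \<open>deriv (chart_w \<phi>)\<close> is present because a vector field times a quadratic
  differential is a 1-form.\<close>

lemma pole_sum_contour: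
  assumes v: "is_chart D \<phi>" "z \<in> cimage \<phi>" and \<rho>: "\<rho> > 0"
    and h: "h holomorphic_on ball (chart_w \<phi> z) \<rho>" and f: "\<And>n. n < N \<Longrightarrow> f n holomorphic_on ball (chart_w \<phi> z) \<rho>"
    and F: "\<And>\<eta>. \<eta> \<in> cimage \<phi> \<Longrightarrow> \<eta> \<noteq> z \<Longrightarrow> chart_w \<phi> \<eta> \<in> ball (chart_w \<phi> z) \<rho> \<Longrightarrow>
      F \<eta> = deriv (chart_w \<phi>) \<eta> * (h (chart_w \<phi> \<eta>) + (\<Sum>n<N. f n (chart_w \<phi> \<eta>) / (chart_w \<phi> \<eta> - chart_w \<phi> z) ^ Suc n))"
  shows "eventually (\<lambda>r. contour_integral (circlepath z r) F =
    2 * of_real pi * \<i> * (\<Sum>n<N. (deriv ^^ n) (f n) (chart_w \<phi> z) / fact n)) (at_right 0)"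
proof -
  let ?W = "chart_w \<phi>" and ?y = "chart_w \<phi> z"
  note W = chart_w_holomorphic[OF v(1)] and O = cinv_chart(1)[OF v(1)]
  have "open (?W -` ball ?y \<rho> \<inter> cimage \<phi>)"
    by (rule open_vimage_holomorphic[OF W O open_ball])
  moreover have "z \<in> ?W -` ball ?y \<rho> \<inter> cimage \<phi>" using v \<rho> by simp
  ultimately obtain R where R: "R > 0" "ball z R \<subseteq> ?W -` ball ?y \<rho> \<inter> cimage \<phi>"
    using open_contains_ball by blast
  have sub: "ball z R \<subseteq> cimage \<phi>" "?W ` ball z R \<subseteq> ball ?y \<rho>" using R(2) by auto
  note WR = holomorphic_on_subset[OF W sub(1)]
  have W'R: "deriv ?W holomorphic_on ball z R" by (rule holomorphic_deriv[OF WR open_ball])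
  have inj: "?W x \<noteq> ?W z" if "x \<in> ball z R" "x \<noteq> z" for x
    using inj_onD[OF chart_w_inj[OF v(1)]] that sub(1) v(2) by blast
  have hW: "(\<lambda>\<eta>. h (?W \<eta>)) holomorphic_on ball z R"
    using holomorphic_on_compose_gen[OF WR h sub(2)] by (simp add: o_def)
  have "contour_integral (circlepath z r) F = 2 * of_real pi * \<i> * (\<Sum>n<N. (deriv ^^ n) (f n) ?y / fact n)"
    if r: "0 < r" "r < R" for r
  proof -
    have im: "path_image (circlepath z r) \<subseteq> ball z R - {z}" using r by auto
    have 1: "((\<lambda>\<eta>. deriv ?W \<eta> * h (?W \<eta>)) has_contour_integral 0) (circlepath z r)"
      by (rule Cauchy_theorem_convex_simple[of _ "ball z R"]) (use im in \<open>auto intro!: holomorphic_intros W'R hW\<close>)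
    have "((\<lambda>\<eta>. deriv ?W \<eta> * f n (?W \<eta>) / (?W \<eta> - ?y) ^ Suc n) has_contour_integral
       (2 * of_real pi * \<i> * (deriv ^^ n) (f n) ?y / fact n)) (circlepath z r)" if "n < N" for n
      by (rule contour_integral_pullback_pole[OF WR r inj deriv_chart_w[OF v] f[OF that] open_ball sub(2)])
    hence "((\<lambda>\<eta>. \<Sum>n<N. deriv ?W \<eta> * f n (?W \<eta>) / (?W \<eta> - ?y) ^ Suc n) has_contour_integral
       (\<Sum>n<N. 2 * of_real pi * \<i> * (deriv ^^ n) (f n) ?y / fact n)) (circlepath z r)"
      by (intro has_contour_integral_sum) auto
    from has_contour_integral_add[OF 1 this]
    have "(F has_contour_integral (0 + (\<Sum>n<N. 2 * of_real pi * \<i> * (deriv ^^ n) (f n) ?y / fact n))) (circlepath z r)"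
    proof (rule has_contour_integral_eq)
      fix \<eta> assume "\<eta> \<in> path_image (circlepath z r)"
      hence "\<eta> \<in> ball z R" "\<eta> \<noteq> z" using im by auto
      hence "\<eta> \<in> cimage \<phi>" "\<eta> \<noteq> z" "?W \<eta> \<in> ball ?y \<rho>" using sub by blast+
      thus "deriv ?W \<eta> * h (?W \<eta>) + (\<Sum>n<N. deriv ?W \<eta> * f n (?W \<eta>) / (?W \<eta> - ?y) ^ Suc n) = F \<eta>"
        by (simp add: F algebra_simps sum_distrib_left)
    qed
    from contour_integral_unique[OF this] show ?thesis by (simp add: sum_distrib_left)
  qed
  thus ?thesis using R(1) by (auto simp: eventually_at_right_field)
qed

definition winv :: "complex \<Rightarrow> complex" where "winv = inv_into D w"

lemma winv: "p \<in> D \<Longrightarrow> winv (w p) = p" "0 < Im x \<Longrightarrow> winv x \<in> D" "0 < Im x \<Longrightarrow> w (winv x) = x"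
  "winv holomorphic_on {x. 0 < Im x}"
proof -
  show 1: "winv (w p) = p" if "p \<in> D" for p unfolding winv_def by (rule inv_into_f_f[OF inj_w that])
  show "winv x \<in> D" "w (winv x) = x" if "0 < Im x"
    using that img_w inv_into_into[of x w D] f_inv_into_f[of x w D] by (auto simp: winv_def)
  obtain g where g: "g holomorphic_on w ` D" "\<And>p. p \<in> D \<Longrightarrow> g (w p) = p"
    using holomorphic_has_inverse[OF hol_w open_D inj_w] by metis
  show "winv holomorphic_on {x. 0 < Im x}"
    by (rule holomorphic_transform[OF g(1)[unfolded img_w]]) (use img_w g(2) 1 in \<open>force simp: set_eq_iff image_iff\<close>)
qed

text \<open>The new chart is \<open>\<phi>\<close> composed with the inverse of
  \<open>\<psi> t\<close>. The coordinate \<open>cmap \<phi> u\<close> therefore stays fixed while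
  the point it describes moves to \<open>\<psi> t u\<close>.\<close>

lemma flow_chart_facts:
  assumes N: "N \<subseteq> D" and fl: "local_flow N v U \<epsilon> \<psi> \<alpha>" and \<phi>: "is_chart D \<phi>" "U \<subseteq> cdom \<phi>"
    and t: "t \<in> {-\<epsilon><..<\<epsilon>}"
  defines "\<phi>t \<equiv> flow_chart \<phi> U (\<psi> t) (\<alpha> t)"
  shows "is_chart D \<phi>t"
    and "u \<in> U \<Longrightarrow> cmap \<phi> u \<in> cimage \<phi>t" "u \<in> U \<Longrightarrow> cinv \<phi>t (cmap \<phi> u) = \<psi> t u"
    and "u \<in> U \<Longrightarrow> chart_w \<phi>t (cmap \<phi> u) = w (\<psi> t u)"
    and "u \<in> U \<Longrightarrow> arg_field \<theta> \<phi>t (cmap \<phi> u) = of_real (\<theta> (\<psi> t u) + \<alpha> t u - carg \<phi> u)"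
proof -
  have U: "open U" "U \<subseteq> N" and h: "\<psi> t holomorphic_on U" "inj_on (\<psi> t) U" "\<And>u. u \<in> U \<Longrightarrow> \<psi> t u \<in> N"
    using fl t unfolding local_flow_def by blast+
  have br: "is_arg_branch ({-\<epsilon><..<\<epsilon>} \<times> U) (\<lambda>(t, z). deriv (\<psi> t) z) (\<lambda>(t, z). \<alpha> t z)"
    using fl unfolding local_flow_def by blast
  have c: "open (cdom \<phi>)" "cmap \<phi> holomorphic_on cdom \<phi>" "inj_on (cmap \<phi>) (cdom \<phi>)"
    "continuous_on (cdom \<phi>) (carg \<phi>)" "\<And>u. u \<in> cdom \<phi> \<Longrightarrow> deriv (cmap \<phi>) u = of_real (cmod (deriv (cmap \<phi>) u)) * cis (carg \<phi> u)"
    using \<phi>(1) unfolding is_chart_def is_arg_branch_def by blast+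
  let ?i = "inv_into U (\<psi> t)"
  have i: "?i (\<psi> t u) = u" if "u \<in> U" for u by (rule inv_into_f_f[OF h(2) that])
  obtain g where g: "g holomorphic_on \<psi> t ` U" "\<And>u. u \<in> U \<Longrightarrow> deriv (\<psi> t) u * deriv g (\<psi> t u) = 1" "\<And>u. u \<in> U \<Longrightarrow> g (\<psi> t u) = u"
    using holomorphic_has_inverse[OF h(1) U(1) h(2)] by metis
  have op: "open (\<psi> t ` U)" by (rule open_mapping_thm3[OF h(1) U(1) h(2)])
  have ih: "?i holomorphic_on \<psi> t ` U" by (rule holomorphic_transform[OF g(1)]) (auto simp: g(3) i)
  have im: "?i ` \<psi> t ` U \<subseteq> U" using i by auto
  have di: "deriv ?i (\<psi> t u) = 1 / deriv (\<psi> t) u" "deriv (\<psi> t) u \<noteq> 0" if u: "u \<in> U" for u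
  proof -
    have "eventually (\<lambda>x. ?i x = g x) (nhds (\<psi> t u))"
      by (rule eventually_mono[OF eventually_nhds_in_open[OF op imageI[OF u]]]) (auto simp: i g(3))
    hence "deriv ?i (\<psi> t u) = deriv g (\<psi> t u)" by (rule deriv_cong_ev) simp
    moreover show nz: "deriv (\<psi> t) u \<noteq> 0" using g(2)[OF u] by auto
    ultimately show "deriv ?i (\<psi> t u) = 1 / deriv (\<psi> t) u" using g(2)[OF u] by (simp add: eq_divide_eq mult.commute)
  qed
  have cm: "(\<lambda>p. cmap \<phi> (?i p)) holomorphic_on \<psi> t ` U"
    using holomorphic_on_compose_gen[OF ih holomorphic_on_subset[OF c(2) \<phi>(2)] im] by (simp add: o_def)
  have dc: "deriv (\<lambda>p. cmap \<phi> (?i p)) (\<psi> t u) = deriv (cmap \<phi>) u / deriv (\<psi> t) u" if u: "u \<in> U" for u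
  proof -
    have "(?i has_field_derivative 1 / deriv (\<psi> t) u) (at (\<psi> t u))"
      using holomorphic_derivI[OF ih op imageI[OF u]] di[OF u] by simp
    moreover have "(cmap \<phi> has_field_derivative deriv (cmap \<phi>) u) (at (?i (\<psi> t u)))"
      unfolding i[OF u] by (rule holomorphic_derivI[OF c(2,1)]) (use u \<phi>(2) in auto)
    ultimately have "((\<lambda>p. cmap \<phi> (?i p)) has_field_derivative deriv (cmap \<phi>) u * (1 / deriv (\<psi> t) u)) (at (\<psi> t u))"
      by (rule DERIV_chain2[rotated])
    thus ?thesis by (simp add: DERIV_imp_deriv)
  qed
  have \<alpha>c: "continuous_on U (\<alpha> t)"
  proof -
    have "continuous_on U ((\<lambda>(t, z). \<alpha> t z) \<circ> (\<lambda>z. (t, z)))"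
      by (rule continuous_on_compose) (use t br in \<open>auto intro!: continuous_intros elim: continuous_on_subset simp: is_arg_branch_def\<close>)
    thus ?thesis by (simp add: o_def)
  qed
  have \<alpha>d: "deriv (\<psi> t) u = of_real (cmod (deriv (\<psi> t) u)) * cis (\<alpha> t u)" if "u \<in> U" for u
    using br t that unfolding is_arg_branch_def by (auto dest!: bspec[of _ _ "(t, u)"])
  have ic: "continuous_on (\<psi> t ` U) ?i" using ih by (rule holomorphic_on_imp_continuous_on)
  have "continuous_on (\<psi> t ` U) (\<lambda>p. carg \<phi> (?i p) - \<alpha> t (?i p))"
    by (intro continuous_intros continuous_on_compose2[OF continuous_on_subset[OF c(4) \<phi>(2)] ic im] continuous_on_compose2[OF \<alpha>c ic im])
  moreover have "deriv (\<lambda>p. cmap \<phi> (?i p)) p = of_real (cmod (deriv (\<lambda>p. cmap \<phi> (?i p)) p)) * cis (carg \<phi> (?i p) - \<alpha> t (?i p))"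
    if p: "p \<in> \<psi> t ` U" for p
  proof -
    obtain u where u: "u \<in> U" "p = \<psi> t u" using p by auto
    have "deriv (cmap \<phi>) u / deriv (\<psi> t) u =
      (of_real (cmod (deriv (cmap \<phi>) u)) * cis (carg \<phi> u)) / (of_real (cmod (deriv (\<psi> t) u)) * cis (\<alpha> t u))"
      using c(5) \<alpha>d u(1) \<phi>(2) by (metis subsetD)
    also have "\<dots> = of_real (cmod (deriv (cmap \<phi>) u) / cmod (deriv (\<psi> t) u)) * (cis (carg \<phi> u) / cis (\<alpha> t u))"
      by simp
    finally show ?thesis unfolding u(2) dc[OF u(1)] i[OF u(1)] cis_divide by (simp add: norm_divide norm_mult)
  qed
  ultimately have branch: "is_arg_branch (\<psi> t ` U) (deriv (\<lambda>p. cmap \<phi> (?i p))) (\<lambda>p. carg \<phi> (?i p) - \<alpha> t (?i p))"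
    by (simp add: is_arg_branch_def)
  have inj: "inj_on (\<lambda>p. cmap \<phi> (?i p)) (\<psi> t ` U)"
    using inj_on_subset[OF c(3) \<phi>(2)] by (auto simp: inj_on_def i)
  show ch: "is_chart D \<phi>t"
    unfolding is_chart_def \<phi>t_def flow_chart_def using op h(3) N cm inj branch by auto
  show im': "cmap \<phi> u \<in> cimage \<phi>t" and ci: "cinv \<phi>t (cmap \<phi> u) = \<psi> t u" if u: "u \<in> U" for u
  proof -
    have 1: "\<psi> t u \<in> cdom \<phi>t" "cmap \<phi>t (\<psi> t u) = cmap \<phi> u" using u by (auto simp: \<phi>t_def flow_chart_def i)
    show "cmap \<phi> u \<in> cimage \<phi>t" "cinv \<phi>t (cmap \<phi> u) = \<psi> t u"
      using cinv_chart(7,6)[OF ch 1(1)] by (simp_all add: 1(2))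
  qed
  show "chart_w \<phi>t (cmap \<phi> u) = w (\<psi> t u)" if "u \<in> U" by (simp add: chart_w_def ci that)
  show "arg_field \<theta> \<phi>t (cmap \<phi> u) = of_real (\<theta> (\<psi> t u) + \<alpha> t u - carg \<phi> u)" if u: "u \<in> U"
    using u by (simp add: arg_field_def ci) (simp add: \<phi>t_def flow_chart_def i)
qed

end

section \<open>The chart given by w\<close>

context gff_setup
begin

text \<open>In this chart \<open>j\<close> vanishes and atoms with holomorphic derivatives have pure
  powers of \<open>x - y\<close> as kernels.\<close>

definition std_chart :: chart where "std_chart = Chart D w \<theta>"

lemma std_chart: "is_chart D std_chart" "cimage std_chart = {x. 0 < Im x}" "0 < Im x \<Longrightarrow> cinv std_chart x = winv x"
  "0 < Im x \<Longrightarrow> chart_w std_chart x = x" "0 < Im x \<Longrightarrow> deriv (chart_w std_chart) x = 1"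
  "0 < Im x \<Longrightarrow> deriv (deriv (chart_w std_chart)) x = 0" "0 < Im x \<Longrightarrow> jcoef std_chart x = 0"
proof -
  show 0: "is_chart D std_chart"
    using open_D hol_w inj_w arg_branch by (simp add: is_chart_def std_chart_def)
  show "cimage std_chart = {x. 0 < Im x}" by (simp add: cimage_def std_chart_def img_w)
  have ci: "cinv std_chart = winv" by (simp add: cinv_def std_chart_def winv_def)
  thus "cinv std_chart x = winv x" by simp
  have c: "chart_w std_chart x = x" if "0 < Im x" for x using winv(3)[OF that] by (simp add: chart_w_def ci)
  have op: "open {x. 0 < Im x}" by (rule open_halfspace_Im_gt)
  have d: "deriv (chart_w std_chart) x = 1" if x: "0 < Im x" for x
  proof -
    have "eventually (\<lambda>x. chart_w std_chart x = x) (nhds x)"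
      using eventually_nhds_in_open[OF op, of x] x by (auto elim!: eventually_mono simp: c)
    thus ?thesis by (subst deriv_cong_ev[of _ "\<lambda>x. x"]) auto
  qed
  have dd: "deriv (deriv (chart_w std_chart)) x = 0" if x: "0 < Im x" for x
  proof -
    have "eventually (\<lambda>x. deriv (chart_w std_chart) x = 1) (nhds x)"
      using eventually_nhds_in_open[OF op, of x] x by (auto elim!: eventually_mono simp: d)
    thus ?thesis by (subst deriv_cong_ev[of _ "\<lambda>x. 1"]) auto
  qed
  assume x: "0 < Im x"
  show "chart_w std_chart x = x" "deriv (chart_w std_chart) x = 1" "deriv (deriv (chart_w std_chart)) x = 0" "jcoef std_chart x = 0"
    using c[OF x] d[OF x] dd[OF x] by (simp_all add: jcoef_def)
qed

lemma std_contract: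
  assumes y: "0 < Im y" and Z: "test_at (winv y) Z"
  shows "contract (K (std_chart, Suc 0, 0, y)) Z = current y Z" "contract (K (std_chart, Suc (Suc 0), 0, y)) Z = current' y Z"
  using contract_K1[OF std_chart(1), of y Z] contract_K2[OF std_chart(1), of y Z] y Z by (simp_all add: std_chart)

lemma tau_std:
  assumes y: "0 < Im y" and Z: "test_at (winv y) Z"
  shows "tau y Z = - (1/2) * contract (K (std_chart, Suc 0, 0, y)) (contract (K (std_chart, Suc 0, 0, y)) Z) {#} +
    \<i> * of_real b * contract (K (std_chart, Suc (Suc 0), 0, y)) Z {#}"
  unfolding std_contract[OF y Z] std_contract[OF y test_at_current[OF Z]] tau_def ..

lemma kern_std:
  assumes y: "0 < Im y" and x: "x \<noteq> y"
  shows "kern (std_chart, Suc 0, 0, y) x = - 1 / (x - y)\<^sup>2" "deriv (kern (std_chart, Suc 0, 0, y)) x = 2 / (x - y) ^ 3"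
    "kern (std_chart, Suc (Suc 0), 0, y) x = - 2 / (x - y) ^ 3" "deriv (kern (std_chart, Suc (Suc 0), 0, y)) x = 6 / (x - y) ^ 4"
proof -
  have op: "open ({s. 0 < Im s} - {x})" for x by (intro open_Diff open_halfspace_Im_gt) auto
  have op': "open (- {y})" by auto
  have k1: "kern (std_chart, Suc 0, 0, y) x = - 1 / (x - y)\<^sup>2" if x: "x \<noteq> y" for x
    using kern_first[OF std_chart(1), of y x] x y by (simp add: std_chart)
  have k2: "kern (std_chart, Suc (Suc 0), 0, y) x = - 2 / (x - y) ^ 3" if x: "x \<noteq> y" for x
  proof -
    have 1: "deriv (\<lambda>s. 1 / (x - chart_w std_chart s)) s = 1 / (x - s)\<^sup>2" if s: "s \<in> {s. 0 < Im s} - {x}" for s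
    proof -
      have "eventually (\<lambda>s. 1 / (x - chart_w std_chart s) = 1 / (x - s)) (nhds s)"
        using eventually_nhds_in_open[OF op s] by (auto elim!: eventually_mono simp: std_chart)
      hence "deriv (\<lambda>s. 1 / (x - chart_w std_chart s)) s = deriv (\<lambda>s. 1 / (x - s)) s" by (rule deriv_cong_ev) simp
      also have "\<dots> = 1 / (x - s)\<^sup>2"
        by (rule DERIV_imp_deriv) (use s in \<open>auto intro!: derivative_eq_intros simp: power2_eq_square\<close>)
      finally show ?thesis .
    qed
    have "eventually (\<lambda>s. deriv (\<lambda>s. 1 / (x - chart_w std_chart s)) s = 1 / (x - s)\<^sup>2) (nhds y)"
      using eventually_nhds_in_open[OF op, of y x] x y by (auto elim!: eventually_mono simp: 1)
    hence "deriv (deriv (\<lambda>s. 1 / (x - chart_w std_chart s))) y = deriv (\<lambda>s. 1 / (x - s)\<^sup>2) y" by (rule deriv_cong_ev) simp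
    also have "\<dots> = 2 / (x - y) ^ 3"
      by (rule DERIV_imp_deriv) (use x in \<open>auto intro!: derivative_eq_intros simp: divide_simps power2_eq_square power3_eq_cube\<close>)
    finally show ?thesis by (simp add: pole_deriv_def)
  qed
  show "kern (std_chart, Suc 0, 0, y) x = - 1 / (x - y)\<^sup>2" "kern (std_chart, Suc (Suc 0), 0, y) x = - 2 / (x - y) ^ 3"
    using k1[OF x] k2[OF x] .
  have "eventually (\<lambda>x. x \<in> - {y}) (nhds x)" by (rule eventually_nhds_in_open[OF op']) (use x in auto)
  hence e: "eventually (\<lambda>x. kern (std_chart, Suc 0, 0, y) x = - 1 / (x - y)\<^sup>2) (nhds x)"
    "eventually (\<lambda>x. kern (std_chart, Suc (Suc 0), 0, y) x = - 2 / (x - y) ^ 3) (nhds x)"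
    by (auto elim!: eventually_mono simp: k1 k2 simp del: kern.simps)
  have "deriv (kern (std_chart, Suc 0, 0, y)) x = deriv (\<lambda>x. - 1 / (x - y)\<^sup>2) x" by (rule deriv_cong_ev[OF e(1) refl])
  also have "\<dots> = 2 / (x - y) ^ 3"
    by (rule DERIV_imp_deriv) (use x in \<open>auto intro!: derivative_eq_intros simp: divide_simps power2_eq_square power3_eq_cube\<close>)
  finally show "deriv (kern (std_chart, Suc 0, 0, y)) x = 2 / (x - y) ^ 3" .
  have "deriv (kern (std_chart, Suc (Suc 0), 0, y)) x = deriv (\<lambda>x. - 2 / (x - y) ^ 3) x" by (rule deriv_cong_ev[OF e(2) refl])
  also have "\<dots> = 6 / (x - y) ^ 4"
    by (rule DERIV_imp_deriv) (use x in \<open>auto intro!: derivative_eq_intros simp: divide_simps power2_eq_square power3_eq_cube power4_eq_xxxx\<close>)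
  finally show "deriv (kern (std_chart, Suc (Suc 0), 0, y)) x = 6 / (x - y) ^ 4" .
qed

text \<open>For an antiholomorphic derivative only the image charge contributes, and its pole lies
  in the lower half-plane.\<close>

lemma kern_std_star_holomorphic:
  assumes "0 < Im y"
  shows "kern (std_chart, 0, Suc n, y) holomorphic_on {x. 0 < Im x}"
proof -
  have "pole_deriv (Suc n) (\<lambda>s. cnj (chart_w std_chart (cnj s))) (cnj y) holomorphic_on {x. 0 < Im x}"
    by (rule holomorphic_on_subset[OF pole_deriv_holomorphic[OF chart_w_cnj_holomorphic[OF std_chart(1)]]])
       (use assms in \<open>auto simp: cnj_vimage_open cinv_chart(1)[OF std_chart(1)] std_chart(2,4) complex_eq_iff open_halfspace_Im_lt\<close>)
  thus ?thesis by (rule holomorphic_transform) simp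
qed

end

section \<open>A flow near a point, in the coordinate w\<close>

locale flow_point = gff_setup +
  fixes N v U \<epsilon> \<psi> \<alpha> \<phi> p
  assumes N: "open N" "N \<subseteq> D" "v holomorphic_on N" and flow: "local_flow N v U \<epsilon> \<psi> \<alpha>"
    and chart: "is_chart D \<phi>" "U \<subseteq> cdom \<phi>" and p_U: "p \<in> U"
begin

definition \<nu> :: "complex \<Rightarrow> complex" where "\<nu> x = deriv w (winv x) * v (winv x)"

definition \<Psi> :: "real \<Rightarrow> complex \<Rightarrow> complex" where "\<Psi> t x = w (\<psi> t (winv x))"

abbreviation "z \<equiv> cmap \<phi> p"
abbreviation "y \<equiv> w p"
abbreviation "\<phi>t t \<equiv> flow_chart \<phi> U (\<psi> t) (\<alpha> t)"

lemma flow_facts: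
  "open U" "U \<subseteq> N" "0 < \<epsilon>" "u \<in> U \<Longrightarrow> \<psi> 0 u = u" "u \<in> U \<Longrightarrow> \<alpha> 0 u = 0"
  "t \<in> {-\<epsilon><..<\<epsilon>} \<Longrightarrow> \<psi> t holomorphic_on U" "t \<in> {-\<epsilon><..<\<epsilon>} \<Longrightarrow> inj_on (\<psi> t) U" "t \<in> {-\<epsilon><..<\<epsilon>} \<Longrightarrow> u \<in> U \<Longrightarrow> \<psi> t u \<in> N"
  "t \<in> {-\<epsilon><..<\<epsilon>} \<Longrightarrow> u \<in> U \<Longrightarrow> ((\<lambda>s. \<psi> s u) has_vector_derivative v (\<psi> t u)) (at t)"
  "continuous_on ({-\<epsilon><..<\<epsilon>} \<times> U) (\<lambda>(t, z). \<psi> t z)"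
  "is_arg_branch ({-\<epsilon><..<\<epsilon>} \<times> U) (\<lambda>(t, z). deriv (\<psi> t) z) (\<lambda>(t, z). \<alpha> t z)"
  using flow unfolding local_flow_def by blast+

lemma point_facts: "z \<in> cimage \<phi>" "cinv \<phi> z = p" "chart_w \<phi> z = y" "p \<in> D" "p \<in> N" "0 < Im y"
  "open (w ` U)" "open (w ` N)" "y \<in> w ` U" "y \<in> w ` N" "U \<subseteq> D"
proof -
  have pc: "p \<in> cdom \<phi>" using p_U chart by auto
  show "z \<in> cimage \<phi>" "cinv \<phi> z = p" using cinv_chart(7,6)[OF chart(1) pc] .
  thus "chart_w \<phi> z = y" by (simp add: chart_w_def)
  show UD: "U \<subseteq> D" using flow_facts(2) N(2) by auto
  thus "p \<in> D" using p_U by auto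
  thus "0 < Im y" by (rule Im_w)
  show "p \<in> N" using p_U flow_facts(2) by auto
  thus "y \<in> w ` N" by auto
  show "y \<in> w ` U" using p_U by auto
  show "open (w ` U)" by (rule open_mapping_thm3[OF holomorphic_on_subset[OF hol_w UD] flow_facts(1) inj_on_subset[OF inj_w UD]])
  show "open (w ` N)" by (rule open_mapping_thm3[OF holomorphic_on_subset[OF hol_w N(2)] N(1) inj_on_subset[OF inj_w N(2)]])
qed

lemma winv_image: "S \<subseteq> D \<Longrightarrow> winv ` w ` S \<subseteq> S" "S \<subseteq> D \<Longrightarrow> winv holomorphic_on w ` S"
  using winv(1) by (auto simp: subset_iff) (rule holomorphic_on_subset[OF winv(4)], use Im_w in auto)

lemma \<nu>_holomorphic: "\<nu> holomorphic_on w ` N"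
proof -
  note i = winv_image[OF N(2)]
  have "(\<lambda>x. deriv w (winv x)) holomorphic_on w ` N" "(\<lambda>x. v (winv x)) holomorphic_on w ` N"
    using holomorphic_on_compose_gen[OF i(2) holomorphic_on_subset[OF holomorphic_deriv[OF hol_w open_D] N(2)] i(1)]
      holomorphic_on_compose_gen[OF i(2) N(3) i(1)] by (simp_all add: o_def)
  thus ?thesis unfolding \<nu>_def[abs_def] by (rule holomorphic_on_mult)
qed

lemma vector_at_\<nu>:
  assumes "\<eta> \<in> cimage \<phi>"
  shows "vector_at v \<phi> \<eta> * deriv (chart_w \<phi>) \<eta> = \<nu> (chart_w \<phi> \<eta>)"
proof -
  let ?q = "cinv \<phi> \<eta>"
  have "?q \<in> D" using cinv_chart(5)[OF chart(1) assms] .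
  thus ?thesis unfolding chart_w_deriv_eq(3)[OF chart(1) assms]
    using chart_w_deriv_eq(1)[OF chart(1) assms] by (simp add: vector_at_def \<nu>_def chart_w_def winv(1))
qed

lemma w_flow_deriv:
  assumes "t \<in> {-\<epsilon><..<\<epsilon>}" "u \<in> U"
  shows "((\<lambda>t. w (\<psi> t u)) has_vector_derivative deriv w (\<psi> t u) * v (\<psi> t u)) (at t)"
proof -
  have "\<psi> t u \<in> D" using flow_facts(8)[OF assms] N by auto
  hence "(w has_field_derivative deriv w (\<psi> t u)) (at (\<psi> t u))" by (rule holomorphic_derivI[OF hol_w open_D])
  from field_vector_diff_chain_at[OF flow_facts(9)[OF assms] this]
  show ?thesis by (simp add: o_def mult.commute)
qed

lemma \<Psi>_holomorphic:
  assumes t: "t \<in> {-\<epsilon><..<\<epsilon>}"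
  shows "\<Psi> t holomorphic_on w ` U"
proof -
  note i = winv_image[OF point_facts(11)]
  have "(\<lambda>x. \<psi> t (winv x)) holomorphic_on w ` U"
    using holomorphic_on_compose_gen[OF i(2) flow_facts(6)[OF t] i(1)] by (simp add: o_def)
  moreover have "(\<lambda>x. \<psi> t (winv x)) ` w ` U \<subseteq> D" using i(1) flow_facts(8)[OF t] N(2) by auto
  ultimately show ?thesis using holomorphic_on_compose_gen[OF _ hol_w] by (force simp: o_def \<Psi>_def[abs_def])
qed

text \<open>The flow equation is differentiated \<open>n\<close> times in the space variable, which
  commutes with the time derivative. At time 0 the flow is the identity, so its right-hand side is
  \<open>\<nu>\<close> itself.\<close>

lemma \<Psi>_deriv: "((\<lambda>t. (deriv ^^ n) (\<Psi> t) y) has_vector_derivative (deriv ^^ n) \<nu> y) (at 0)"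
proof -
  let ?g = "\<lambda>t x. deriv w (\<psi> t (winv x)) * v (\<psi> t (winv x))"
  have "((\<lambda>t. (deriv ^^ n) (\<Psi> t) y) has_vector_derivative (deriv ^^ n) (?g 0) y) (at 0)"
  proof (rule higher_deriv_param_real[OF flow_facts(3) point_facts(7,9)])
    fix t x assume t: "\<bar>t\<bar> < \<epsilon>" and x: "x \<in> w ` U"
    show "((\<lambda>t. \<Psi> t x) has_vector_derivative ?g t x) (at t)"
      unfolding \<Psi>_def by (rule w_flow_deriv) (use t x winv_image(1)[OF point_facts(11)] in auto)
  next
    fix t assume t: "\<bar>t\<bar> < \<epsilon>"
    show "\<Psi> t holomorphic_on w ` U" by (rule \<Psi>_holomorphic) (use t in auto)
  next
    let ?T = "{-\<epsilon><..<\<epsilon>} \<times> w ` U"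
    have "continuous_on ?T (\<lambda>s. winv (snd s))"
      by (rule continuous_on_compose2[OF holomorphic_on_imp_continuous_on[OF winv_image(2)[OF point_facts(11)]] continuous_on_snd[OF continuous_on_id]]) auto
    hence "continuous_on ?T (\<lambda>s. (fst s, winv (snd s)))" by (intro continuous_intros)
    hence c: "continuous_on ?T (\<lambda>s. (\<lambda>(t, z). \<psi> t z) (fst s, winv (snd s)))"
      by (rule continuous_on_compose2[OF flow_facts(10)]) (use winv_image(1)[OF point_facts(11)] in auto)
    have im: "(\<lambda>s. \<psi> (fst s) (winv (snd s))) ` ?T \<subseteq> N"
      using flow_facts(8) winv_image(1)[OF point_facts(11)] by (auto simp: image_subset_iff)
    have cw: "continuous_on N (deriv w)" "continuous_on N v"
      using holomorphic_on_subset[OF holomorphic_deriv[OF hol_w open_D] N(2)] N(3) by (auto intro: holomorphic_on_imp_continuous_on)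
    have "continuous_on ?T (\<lambda>s. deriv w (\<psi> (fst s) (winv (snd s))) * v (\<psi> (fst s) (winv (snd s))))"
      using c by (intro continuous_intros continuous_on_compose2[OF cw(1) _ im] continuous_on_compose2[OF cw(2) _ im]) simp_all
    thus "continuous_on ?T (\<lambda>(t, x). ?g t x)" by (simp add: case_prod_unfold)
  qed
  moreover have "eventually (\<lambda>x. ?g 0 x = \<nu> x) (nhds y)"
    using eventually_nhds_in_open[OF point_facts(7,9)]
    by eventually_elim (use winv_image(1)[OF point_facts(11)] flow_facts(4) in \<open>auto simp: \<nu>_def image_subset_iff\<close>)
  hence "(deriv ^^ n) (?g 0) y = (deriv ^^ n) \<nu> y" by (rule higher_deriv_cong_ev) simp
  ultimately show ?thesis by simp
qed

lemma \<Psi>_0: "(deriv ^^ n) (\<Psi> 0) y = (deriv ^^ n) (\<lambda>x. x) y"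
proof (rule higher_deriv_cong_ev)
  show "eventually (\<lambda>x. \<Psi> 0 x = x) (nhds y)"
    using eventually_nhds_in_open[OF point_facts(7,9)]
    by eventually_elim (use winv(1) flow_facts(4) point_facts(11) in \<open>auto simp: \<Psi>_def\<close>)
qed simp

lemma chart_w_flow:
  assumes t: "t \<in> {-\<epsilon><..<\<epsilon>}"
  shows "eventually (\<lambda>\<xi>. chart_w (\<phi>t t) \<xi> = \<Psi> t (chart_w \<phi> \<xi>)) (nhds z)"
proof -
  have "open (cmap \<phi> ` U)"
    using chart by (intro open_mapping_thm3[OF _ flow_facts(1)]) (auto simp: is_chart_def intro: holomorphic_on_subset inj_on_subset)
  hence "eventually (\<lambda>\<xi>. \<xi> \<in> cmap \<phi> ` U) (nhds z)" by (rule eventually_nhds_in_open) (use p_U in auto)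
  thus ?thesis
  proof eventually_elim
    case (elim \<xi>)
    then obtain u where u: "u \<in> U" "\<xi> = cmap \<phi> u" by auto
    hence "cinv \<phi> \<xi> = u" "u \<in> D" using cinv_chart(6)[OF chart(1)] chart(2) point_facts(11) by auto
    thus ?case using flow_chart_facts(4)[OF N(2) flow chart t u(1)] u by (simp add: \<Psi>_def chart_w_def winv(1))
  qed
qed

lemma deriv_\<Psi>:
  assumes t: "t \<in> {-\<epsilon><..<\<epsilon>}"
  shows "deriv (\<Psi> t) y * deriv w p = deriv w (\<psi> t p) * deriv (\<psi> t) p"
proof -
  have D: "\<psi> t p \<in> D" using flow_facts(8)[OF t p_U] N by auto
  have "(\<Psi> t has_field_derivative deriv (\<Psi> t) y) (at (w p))"
    by (rule holomorphic_derivI[OF \<Psi>_holomorphic[OF t] point_facts(7,9)])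
  from DERIV_chain2[OF this holomorphic_derivI[OF hol_w open_D point_facts(4)]]
  have 1: "((\<lambda>u. \<Psi> t (w u)) has_field_derivative deriv (\<Psi> t) y * deriv w p) (at p)" .
  have "((\<lambda>u. w (\<psi> t u)) has_field_derivative deriv w (\<psi> t p) * deriv (\<psi> t) p) (at p)"
    by (rule DERIV_chain2[OF holomorphic_derivI[OF hol_w open_D D] holomorphic_derivI[OF flow_facts(6)[OF t] flow_facts(1) p_U]])
  hence "deriv (\<lambda>u. w (\<psi> t u)) p = deriv w (\<psi> t p) * deriv (\<psi> t) p" by (rule DERIV_imp_deriv)
  moreover have "eventually (\<lambda>u. \<Psi> t (w u) = w (\<psi> t u)) (nhds p)"
    using eventually_nhds_in_open[OF flow_facts(1) p_U]
    by eventually_elim (use point_facts(11) winv(1) in \<open>auto simp: \<Psi>_def\<close>)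
  hence "deriv (\<lambda>u. \<Psi> t (w u)) p = deriv (\<lambda>u. w (\<psi> t u)) p" by (rule deriv_cong_ev) simp
  ultimately show ?thesis using DERIV_imp_deriv[OF 1] by simp
qed

lemma eventually_time: "eventually (\<lambda>t. t \<in> {-\<epsilon><..<\<epsilon>}) (nhds 0)"
  by (rule eventually_nhds_in_open) (use flow_facts(3) in auto)

lemma \<nu>_has_deriv: "(\<nu> has_field_derivative deriv \<nu> y) (at y)"
  by (rule holomorphic_derivI[OF \<nu>_holomorphic point_facts(8,10)])

text \<open>The sum of the two branches is a continuous argument of
  \<open>deriv w (\<psi> t p) * deriv (\<psi> t) p\<close>, that is, of
  \<open>deriv (\<Psi> t) y * deriv w p\<close>. It thus changes by the imaginary part of the
  logarithm of \<open>deriv (\<Psi> t) y\<close>, whose time derivative at 0 is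
  \<open>deriv \<nu> y\<close>.\<close>

lemma arg_flow_deriv: "((\<lambda>t. \<theta> (\<psi> t p) + \<alpha> t p) has_vector_derivative Im (deriv \<nu> y)) (at 0)"
proof -
  define A where "A = (\<lambda>t. \<theta> (\<psi> t p) + \<alpha> t p)"
  define q where "q = (\<lambda>t. deriv (\<Psi> t) y)"
  have q0: "q 0 = 1" using \<Psi>_0[of 1] by (simp add: q_def)
  have dq: "(q has_vector_derivative deriv \<nu> y) (at 0)" using \<Psi>_deriv[of 1] by (simp add: q_def)
  have nz: "deriv w p \<noteq> 0" by (rule deriv_w[OF point_facts(4)])
  have th: "deriv w x = of_real (cmod (deriv w x)) * cis (\<theta> x)" if "x \<in> D" for x using arg_branch that by (simp add: is_arg_branch_def)
  have al: "deriv (\<psi> t) p = of_real (cmod (deriv (\<psi> t) p)) * cis (\<alpha> t p)" if "t \<in> {-\<epsilon><..<\<epsilon>}" for t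
    using flow_facts(11) that p_U unfolding is_arg_branch_def by (auto dest!: bspec[of _ _ "(t, p)"])
  have A0: "A 0 = \<theta> p" using flow_facts(4,5)[OF p_U] by (simp add: A_def)
  have Qe: "q t * deriv w p = of_real (cmod (q t * deriv w p)) * cis (A t)" if t: "t \<in> {-\<epsilon><..<\<epsilon>}" for t
  proof -
    have D: "\<psi> t p \<in> D" using flow_facts(8)[OF t p_U] N by auto
    have e: "q t * deriv w p = deriv w (\<psi> t p) * deriv (\<psi> t) p" unfolding q_def by (rule deriv_\<Psi>[OF t])
    also have "\<dots> = (of_real (cmod (deriv w (\<psi> t p))) * cis (\<theta> (\<psi> t p))) * (of_real (cmod (deriv (\<psi> t) p)) * cis (\<alpha> t p))"
      using th[OF D] al[OF t] by metis
    finally have "q t * deriv w p = of_real (cmod (deriv w (\<psi> t p) * deriv (\<psi> t) p)) * cis (A t)"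
      by (simp add: norm_mult A_def cis_mult[symmetric] mult_ac)
    thus ?thesis by (simp only: e)
  qed
  have cA: "(A \<longlongrightarrow> A 0) (at 0)"
  proof -
    have "isCont (\<lambda>t. \<psi> t p) 0"
      using flow_facts(9)[of 0 p] flow_facts(3) p_U by (intro has_vector_derivative_continuous) auto
    moreover have "isCont \<theta> (\<psi> 0 p)"
      using arg_branch open_D point_facts(4) flow_facts(4)[OF p_U] by (simp add: is_arg_branch_def continuous_on_eq_continuous_at)
    ultimately have 1: "isCont (\<lambda>t. \<theta> (\<psi> t p)) 0" by (rule isCont_o2)
    have "continuous_on {-\<epsilon><..<\<epsilon>} (\<lambda>t. (\<lambda>(t, z). \<alpha> t z) (t, p))"
      using flow_facts(11) p_U unfolding is_arg_branch_def by (elim conjE continuous_on_compose2) (auto intro!: continuous_intros)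
    hence "isCont (\<lambda>t. \<alpha> t p) 0" using flow_facts(3) by (simp add: continuous_on_eq_continuous_at)
    with 1 show ?thesis by (simp add: A_def isCont_def tendsto_add)
  qed
  have cq: "(q \<longlongrightarrow> q 0) (at 0)" using has_vector_derivative_continuous[OF dq] by (simp add: isCont_def)
  have qn: "eventually (\<lambda>t. q t \<noteq> 0) (at 0)" using tendsto_imp_eventually_ne[OF cq] q0 by simp
  have Q0: "deriv w p = of_real (cmod (deriv w p)) * cis (A 0)" using th[OF point_facts(4)] by (simp add: A0)
  have time: "eventually (\<lambda>t. t \<in> {-\<epsilon><..<\<epsilon>}) (at 0)" using eventually_time by (rule filter_leD[OF at_within_le_nhds])
  have "eventually (\<lambda>t. A t = A 0 + Im (Ln (q t * deriv w p / deriv w p))) (at 0)"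
    by (rule branch_unique_near[OF cA _ Q0 nz]) (use time qn in \<open>eventually_elim, use Qe nz in auto\<close>)
  hence ev: "eventually (\<lambda>t. A t = A 0 + Im (Ln (q t))) (nhds 0)"
    using nz q0 by (auto simp: eventually_nhds_conv_at)
  have "(Ln has_field_derivative inverse (q 0)) (at (q 0))" by (rule has_field_derivative_Ln) (simp add: q0)
  from field_vector_diff_chain_at[OF dq this]
  have "((\<lambda>t. Ln (q t)) has_vector_derivative deriv \<nu> y) (at 0)" by (simp add: o_def q0)
  hence "((\<lambda>t. A 0 + Im (Ln (q t))) has_vector_derivative 0 + Im (deriv \<nu> y)) (at 0)"
    by (intro has_vector_derivative_add has_vector_derivative_const bounded_linear.has_vector_derivative[OF bounded_linear_Im])
  hence "(A has_vector_derivative Im (deriv \<nu> y)) (at 0)"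
    by (intro has_vector_derivative_transform_nhds[OF ev]) simp
  thus ?thesis by (simp add: A_def)
qed

text \<open>One radius in the coordinate \<open>w\<close> at which all factors of the integrands are
  holomorphic and every point \<open>\<eta>\<close> inside is still away from the nodes of
  \<open>Z\<close>.\<close>

definition near :: "functional \<Rightarrow> real \<Rightarrow> bool" where
  "near Z \<rho> \<longleftrightarrow> 0 < \<rho> \<and> ball y \<rho> \<subseteq> {x. 0 < Im x} \<and> \<nu> holomorphic_on ball y \<rho> \<and>
     (\<forall>c\<in>atoms_of Z. kern c holomorphic_on ball y \<rho>) \<and>
     (\<forall>\<eta>\<in>cimage \<phi>. chart_w \<phi> \<eta> \<in> ball y \<rho> \<longrightarrow> test_at (cinv \<phi> \<eta>) Z)"

lemma nearD:
  assumes "near Z \<rho>"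
  shows "\<rho> > 0" "ball y \<rho> \<subseteq> {x. 0 < Im x}" "\<nu> holomorphic_on ball y \<rho>"
    "\<And>c. c \<in> atoms_of Z \<Longrightarrow> kern c holomorphic_on ball y \<rho>"
    "\<And>\<eta>. \<eta> \<in> cimage \<phi> \<Longrightarrow> chart_w \<phi> \<eta> \<in> ball y \<rho> \<Longrightarrow> test_at (cinv \<phi> \<eta>) Z"
  using assms unfolding near_def by blast+

lemma near_exists:
  assumes Z: "test_at p Z"
  shows "\<exists>\<rho>. near Z \<rho>"
proof -
  obtain r1 where r1: "r1 > 0" "ball y r1 \<subseteq> {x. 0 < Im x}" "\<And>c. c \<in> atoms_of Z \<Longrightarrow> kern c holomorphic_on ball y r1"
    "\<And>q. q \<in> D \<Longrightarrow> w q \<in> ball y r1 \<Longrightarrow> test_at q Z"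
    by (rule test_at_near[OF Z point_facts(4)]) (rule that; assumption)
  obtain r2 where r2: "r2 > 0" "ball y r2 \<subseteq> w ` N" using point_facts(8,10) open_contains_ball by blast
  let ?r = "min r1 r2"
  have sub: "ball y ?r \<subseteq> ball y r1" "ball y ?r \<subseteq> w ` N" using r2 by auto
  have "near Z ?r" unfolding near_def
  proof (intro conjI ballI impI)
    show "?r > 0" "ball y ?r \<subseteq> {x. 0 < Im x}" "\<nu> holomorphic_on ball y ?r"
      using r1 r2 sub \<nu>_holomorphic holomorphic_on_subset by auto
    show "kern c holomorphic_on ball y ?r" if "c \<in> atoms_of Z" for c by (rule holomorphic_on_subset[OF r1(3)[OF that] sub(1)])
    show "test_at (cinv \<phi> \<eta>) Z" if "\<eta> \<in> cimage \<phi>" "chart_w \<phi> \<eta> \<in> ball y ?r" for \<eta>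
      by (rule r1(4)) (use that sub(1) cinv_chart(5)[OF chart(1)] in \<open>auto simp: chart_w_def\<close>)
  qed
  thus ?thesis ..
qed

lemma node_ne: "\<eta> \<in> cimage \<phi> \<Longrightarrow> \<eta> \<noteq> z \<Longrightarrow> cinv \<phi> \<eta> \<noteq> p"
  using cinv_chart(4)[OF chart(1)] point_facts(1,2) by metis

lemma chart_w_ne: "\<eta> \<in> cimage \<phi> \<Longrightarrow> \<eta> \<noteq> z \<Longrightarrow> chart_w \<phi> \<eta> \<noteq> y"
  using inj_onD[OF chart_w_inj[OF chart(1)]] point_facts(1,3) by metis

lemma vector_square:
  assumes "\<eta> \<in> cimage \<phi>"
  shows "vector_at v \<phi> \<eta> * ((deriv (chart_w \<phi>) \<eta>)\<^sup>2 * A) = deriv (chart_w \<phi>) \<eta> * (\<nu> (chart_w \<phi> \<eta>) * A)"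
  unfolding vector_at_\<nu>[OF assms, symmetric] by (simp add: power2_eq_square)

lemma tau_holomorphic_sub:
  assumes "\<And>c. c \<in> atoms_of Z \<Longrightarrow> kern c holomorphic_on ball y \<rho>" "finite (atoms_of Z)" "atoms_of Y \<subseteq> atoms_of Z"
  shows "(\<lambda>x. tau x Y) holomorphic_on ball y \<rho>" "(\<lambda>x. current x Y {#}) holomorphic_on ball y \<rho>"
  by (rule tau_holomorphic[OF assms(1)[OF subsetD[OF assms(3)]] finite_subset[OF assms(3,2)]], assumption)
     (rule current_holomorphic(1)[OF assms(1)[OF subsetD[OF assms(3)]]], assumption)

section \<open>The Ward identity for the modified free field\<close>

lemma gff_contour:
  assumes Z: "test_at p Z"
  shows "eventually (\<lambda>r. contour_integral (circlepath z r) (\<lambda>\<eta>. vector_at v \<phi> \<eta> * corr G (gff_b b \<theta>) \<phi> z (stress \<phi> \<eta> Z)) =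
    2 * of_real pi * \<i> * (\<nu> y * current y Z {#} + \<i> * of_real b * deriv \<nu> y * Z {#})) (at_right 0)"
proof -
  let ?W = "chart_w \<phi>" and ?b = "(\<phi>, 0, 0, z) :: atom"
  define a where "a = 2 * of_real b * arg_field \<theta> \<phi> z"
  obtain \<rho> where "near Z \<rho>" using near_exists[OF Z] ..
  note \<rho> = nearD[OF this]
  note hol = tau_holomorphic_sub[OF \<rho>(4) test_at_finite[OF Z]]
  have ne: "x \<noteq> cnj y" if "x \<in> ball y \<rho>" for x
    using subsetD[OF \<rho>(2) that] point_facts(6) by (auto simp: complex_eq_iff)
  \<comment> \<open>The undifferentiated field has a charge at \<open>y\<close> and an image charge
    at \<open>cnj y\<close>; only the first is a singularity in the half-plane.\<close>
  have k: "kern ?b = (\<lambda>x. 1 / (x - cnj y) - 1 / (x - y))"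
    by (simp add: fun_eq_iff pole_deriv_def point_facts(3))
  have k': "deriv (kern ?b) x = - (1 / (x - cnj y)\<^sup>2) + 1 / (x - y)\<^sup>2" if "x \<noteq> cnj y" "x \<noteq> y" for x
    unfolding k by (rule DERIV_imp_deriv) (use that in \<open>auto intro!: derivative_eq_intros simp: power2_eq_square\<close>)
  \<comment> \<open>The numerators of the poles of first and second order at \<open>y\<close>. The
    terms of the image charge are regular there and go into \<open>h\<close>.\<close>
  define f where "f n = (if n = 0 then (\<lambda>x. \<nu> x * current x Z {#}) else (\<lambda>x. \<i> * of_real b * Z {#} * \<nu> x))" for n :: nat
  define h where "h x = \<nu> x * (tau x (contract (K ?b) Z) - current x Z {#} / (x - cnj y) - \<i> * of_real b * Z {#} / (x - cnj y)\<^sup>2 - a * tau x Z)" for x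
  have "eventually (\<lambda>r. contour_integral (circlepath z r) (\<lambda>\<eta>. vector_at v \<phi> \<eta> * corr G (gff_b b \<theta>) \<phi> z (stress \<phi> \<eta> Z)) =
    2 * of_real pi * \<i> * (\<Sum>n<2. (deriv ^^ n) (f n) (?W z) / fact n)) (at_right 0)"
  proof (rule pole_sum_contour[OF chart(1) point_facts(1) \<rho>(1)])
    show "h holomorphic_on ball (?W z) \<rho>" unfolding h_def point_facts(3)
      by (intro holomorphic_intros \<rho>(3) hol atoms_of_contract subset_refl) (use ne in auto)
    show "f n holomorphic_on ball (?W z) \<rho>" if "n < 2" for n
      unfolding f_def point_facts(3) by (auto intro!: holomorphic_intros \<rho>(3) hol)
    fix \<eta> assume \<eta>: "\<eta> \<in> cimage \<phi>" "\<eta> \<noteq> z" "?W \<eta> \<in> ball (?W z) \<rho>"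
    define x where "x = ?W \<eta>"
    have x: "x \<in> ball y \<rho>" "x \<noteq> y" "x \<noteq> cnj y" using \<eta> chart_w_ne ne by (auto simp: x_def point_facts(3))
    note T = \<rho>(5)[OF \<eta>(1) \<eta>(3)[unfolded point_facts(3)]]
    have vb: "valid_atom D {p} ?b" "node ?b \<noteq> cinv \<phi> \<eta>"
      using chart(1) point_facts(1,2) node_ne[OF \<eta>(1,2)] by (auto simp: valid_atom_def)
    have c: "corr G (gff_b b \<theta>) \<phi> z (stress \<phi> \<eta> Z) = (deriv ?W \<eta>)\<^sup>2 *
      (tau x (contract (K ?b) Z) - kern ?b x * current x Z {#} + \<i> * of_real b * deriv (kern ?b) x * Z {#} - a * tau x Z)"
      unfolding corr_gff[OF wick_bounded_stress(1)[OF test_at_bounded[OF Z]]] contract_stress[OF chart(1) \<eta>(1) T vb]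
        stress_empty[OF chart(1) \<eta>(1) T] a_def[symmetric] x_def[symmetric] by (simp only: right_diff_distrib mult_ac)
    show "vector_at v \<phi> \<eta> * corr G (gff_b b \<theta>) \<phi> z (stress \<phi> \<eta> Z) =
      deriv ?W \<eta> * (h (?W \<eta>) + (\<Sum>n<2. f n (?W \<eta>) / (?W \<eta> - ?W z) ^ Suc n))"
      unfolding c vector_square[OF \<eta>(1)] x_def[symmetric] k'[OF x(3,2)] point_facts(3) unfolding k h_def
      by (simp add: numeral_2_eq_2 f_def) (simp add: divide_inverse power2_eq_square algebra_simps)
  qed
  moreover have "(deriv ^^ 1) (f 1) y = \<i> * of_real b * Z {#} * deriv \<nu> y"
    using DERIV_imp_deriv[OF DERIV_cmult[OF \<nu>_has_deriv]] by (simp add: f_def)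
  ultimately show ?thesis by (simp add: numeral_2_eq_2 point_facts(3) f_def mult_ac)
qed

text \<open>The field is real. Its antiholomorphic contour integral is thereby reduced to the
  holomorphic one with the conjugate test functional.\<close>

lemma corr_gff_star:
  assumes Y: "test_at p Y"
  shows "cnj (corr G (gff_b b \<theta>) \<phi> z Y) = corr G (gff_b b \<theta>) \<phi> z (func_star Y)"
proof -
  have vb: "valid_atom D {p} (\<phi>, 0, 0, z)" using chart(1) point_facts(1,2) by (simp add: valid_atom_def)
  have "cnj (contract (K (\<phi>, 0, 0, z)) Y {#}) = contract (K (\<phi>, 0, 0, z)) (func_star Y) {#}"
    unfolding func_star_empty[symmetric] using contract_K_star[OF vb] Y by (simp add: point_facts(2))
  thus ?thesis
    unfolding corr_gff[OF test_at_bounded[OF Y]] corr_gff[OF wick_bounded_func_star[OF test_at_bounded[OF Y]]]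
    by (simp add: func_star_empty arg_field_def)
qed

lemma cnj_current: "cnj (current x (func_star Z) {#}) = contract (\<lambda>c. cnj (kern (atom_star c) x)) Z {#}"
  unfolding current_def contract_func_star by (simp add: func_star_empty)

text \<open>The primitives \<open>F\<close> and \<open>F'\<close> are evaluated at the moving point,
  so one gives the holomorphic and the other, after conjugation, the antiholomorphic half of the
  derivative. The argument adds \<open>- 2 b\<close> times the imaginary part of
  \<open>deriv \<nu> y\<close>.\<close>

lemma gff_flow:
  assumes Z: "test_at p Z"
  shows "((\<lambda>t. corr G (gff_b b \<theta>) (\<phi>t t) z Z) has_vector_derivative
    (\<nu> y * current y Z {#} + \<i> * of_real b * deriv \<nu> y * Z {#}) +
    cnj (\<nu> y * current y (func_star Z) {#} + \<i> * of_real b * deriv \<nu> y * func_star Z {#})) (at 0)"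
proof -
  have t0: "0 \<in> {-\<epsilon><..<\<epsilon>}" using flow_facts(3) by simp
  have dw: "((\<lambda>t. w (\<psi> t p)) has_vector_derivative \<nu> y) (at 0)"
    using w_flow_deriv[OF t0 p_U] by (simp add: flow_facts(4)[OF p_U] \<nu>_def winv(1) point_facts(4))
  have "((\<lambda>t. w (\<psi> t p)) \<longlongrightarrow> w (\<psi> 0 p)) (nhds 0)"
    using iffD1[OF tendsto_at_iff_tendsto_nhds[of "\<lambda>t. w (\<psi> t p)" 0]] has_vector_derivative_continuous[OF dw]
    by (simp only: isCont_def)
  hence wc: "((\<lambda>t. w (\<psi> t p)) \<longlongrightarrow> y) (nhds 0)" by (simp add: flow_facts(4)[OF p_U])
  have va: "valid_atom D {p} (\<phi>, 0, 0, z)" using chart(1) point_facts(1,2) by (simp add: valid_atom_def)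
  have dK: "((\<lambda>t. K (\<phi>t t, 0, 0, z) c) has_vector_derivative \<nu> y * kern c y + cnj (\<nu> y * kern (atom_star c) y)) (at 0)"
    if c: "c \<in> atoms_of Z" for c
  proof -
    have nc: "cinv \<phi> z \<noteq> node c" using test_at_node[OF Z c] point_facts(2) by auto
    obtain e F F' where e: "e > 0"
      "\<And>x. x \<in> ball (chart_w \<phi> z) e \<Longrightarrow> (F has_field_derivative kern c x) (at x)"
      "\<And>x. x \<in> ball (chart_w \<phi> z) e \<Longrightarrow> (F' has_field_derivative kern (atom_star c) x) (at x)"
      "\<And>\<phi>' j k \<zeta>'. is_chart D \<phi>' \<Longrightarrow> \<zeta>' \<in> cimage \<phi>' \<Longrightarrow> chart_w \<phi>' \<zeta>' \<in> ball (chart_w \<phi> z) e \<Longrightarrow>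
         K (\<phi>', j, k, \<zeta>') c = (if k = 0 then (deriv ^^ j) (\<lambda>\<eta>. F (chart_w \<phi>' \<eta>)) \<zeta>' else 0) +
          (if j = 0 then cnj ((deriv ^^ k) (\<lambda>\<eta>. F' (chart_w \<phi>' \<eta>)) \<zeta>') else 0)"
      using pair_expect_eq[OF green_G va test_at_valid[OF Z c] nc] by metis
    have "eventually (\<lambda>t. w (\<psi> t p) \<in> ball y e) (nhds 0)"
      using topological_tendstoD[OF wc open_ball] e(1) by simp
    with eventually_time have ev: "eventually (\<lambda>t. K (\<phi>t t, 0, 0, z) c = F (w (\<psi> t p)) + cnj (F' (w (\<psi> t p)))) (nhds 0)"
    proof eventually_elim
      case (elim t)
      note f = flow_chart_facts[OF N(2) flow chart elim(1)]
      show ?case using e(4)[OF f(1) f(2)[OF p_U], of 0 0] elim(2) by (simp add: f(4)[OF p_U] point_facts(3))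
    qed
    have yb: "w (\<psi> 0 p) \<in> ball (chart_w \<phi> z) e" using e(1) flow_facts(4)[OF p_U] point_facts(3) by simp
    have "((\<lambda>t. F (w (\<psi> t p)) + cnj (F' (w (\<psi> t p)))) has_vector_derivative \<nu> y * kern c y + cnj (\<nu> y * kern (atom_star c) y)) (at 0)"
      using field_vector_diff_chain_at[OF dw e(2)[OF yb]] field_vector_diff_chain_at[OF dw e(3)[OF yb]]
      by (intro has_vector_derivative_add has_vector_derivative_cnj) (simp_all add: o_def flow_facts(4)[OF p_U])
    thus ?thesis by (rule has_vector_derivative_transform_nhds[OF ev])
  qed
  have 1: "((\<lambda>t. contract (K (\<phi>t t, 0, 0, z)) Z {#}) has_vector_derivative
    (\<Sum>c\<in>atoms_of Z. (\<nu> y * kern c y + cnj (\<nu> y * kern (atom_star c) y)) * wick_deriv c Z {#})) (at 0)"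
    unfolding contract_def
    by (intro has_vector_derivative_sum has_vector_derivative_mult_left dK)
  have 2: "(\<Sum>c\<in>atoms_of Z. (\<nu> y * kern c y + cnj (\<nu> y * kern (atom_star c) y)) * wick_deriv c Z {#}) =
    \<nu> y * current y Z {#} + cnj (\<nu> y * current y (func_star Z) {#})"
    unfolding complex_cnj_mult cnj_current by (simp add: current_def contract_def sum_distrib_left sum.distrib algebra_simps)
  have "((\<lambda>t. of_real (\<theta> (\<psi> t p) + \<alpha> t p - carg \<phi> p) :: complex) has_vector_derivative of_real (Im (deriv \<nu> y))) (at 0)"
    using has_vector_derivative_of_real[OF has_vector_derivative_diff[OF arg_flow_deriv has_vector_derivative_const,
      unfolded has_real_derivative_iff_has_vector_derivative[symmetric]]] by simp
  moreover have "eventually (\<lambda>t. arg_field \<theta> (\<phi>t t) z = of_real (\<theta> (\<psi> t p) + \<alpha> t p - carg \<phi> p)) (nhds 0)"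
    using eventually_time by eventually_elim (rule flow_chart_facts(5)[OF N(2) flow chart _ p_U])
  ultimately have 3: "((\<lambda>t. arg_field \<theta> (\<phi>t t) z) has_vector_derivative of_real (Im (deriv \<nu> y))) (at 0)"
    by (rule has_vector_derivative_transform_nhds[rotated])
  have "((\<lambda>t. corr G (gff_b b \<theta>) (\<phi>t t) z Z) has_vector_derivative
    (\<nu> y * current y Z {#} + cnj (\<nu> y * current y (func_star Z) {#})) - 2 * of_real b * of_real (Im (deriv \<nu> y)) * Z {#}) (at 0)"
    unfolding corr_gff[OF test_at_bounded[OF Z]] using 1 unfolding 2
    by (intro has_vector_derivative_diff has_vector_derivative_mult_left has_vector_derivative_mult_right 3)
  \<comment> \<open>This splits the contribution of the argument into \<open>i b \<nu>'\<close> and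
    its conjugate, one for each contour integral.\<close>
  moreover have "- (2 * of_real b * of_real (Im (deriv \<nu> y))) = \<i> * of_real b * (deriv \<nu> y - cnj (deriv \<nu> y))"
    by (simp add: complex_eq_iff)
  hence "A - 2 * of_real b * of_real (Im (deriv \<nu> y)) * Z {#} = A + \<i> * of_real b * (deriv \<nu> y - cnj (deriv \<nu> y)) * Z {#}" for A
    by (metis diff_conv_add_uminus mult_minus_left)
  ultimately show ?thesis by (simp add: func_star_empty algebra_simps)
qed

text \<open>These are the derivatives that the residue formula asks for at the poles of order two
  and three, together with that of \<open>tau\<close>. The difference of currents in the last part
  vanishes at \<open>y\<close>, which is why the second derivative of \<open>\<nu>\<close> does not
  appear.\<close>

lemma derivs_y:
  assumes hol: "\<And>c. c \<in> atoms_of Z \<Longrightarrow> kern c holomorphic_on ball y \<rho>" "finite (atoms_of Z)" and \<rho>: "\<rho> > 0"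
  defines "D1' \<equiv> current' y Z {#}" and "D1'' \<equiv> deriv (\<lambda>x. current' x Z {#}) y"
    and "D2 \<equiv> current y (current y Z) {#}" and "D2' \<equiv> current' y (current y Z) {#}"
  shows "((\<lambda>x. tau x Z) has_field_derivative - D2' + \<i> * of_real b * D1'') (at y)"
    and "deriv (\<lambda>x. \<nu> x * current x (current y Z) {#}) y = deriv \<nu> y * D2 + \<nu> y * D2'"
    and "(deriv ^^ 2) (\<lambda>x. \<nu> x * (current x Z {#} - current y Z {#})) y = 2 * deriv \<nu> y * D1' + \<nu> y * D1''"
proof -
  have yb: "y \<in> ball y \<rho>" using \<rho> by simp
  note c = current_holomorphic[OF hol(1)]
  have d1: "((\<lambda>x. current x Z {#}) has_field_derivative current' x Z {#}) (at x)" if "x \<in> ball y \<rho>" for x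
    using holomorphic_derivI[OF c(1) open_ball that] c(3)[OF _ that] by simp
  have d2: "((\<lambda>x. current' x Z {#}) has_field_derivative D1'') (at y)"
    unfolding D1''_def by (rule holomorphic_derivI[OF c(2) open_ball yb])
  have "((\<lambda>x. current x (current x Z) {#}) has_field_derivative 2 * D2') (at y)"
    unfolding D2'_def by (rule c(5)[OF _ hol(2) yb])
  from DERIV_add[OF DERIV_cmult[OF this, of "- (1/2)"] DERIV_cmult[OF d2, of "\<i> * of_real b"]]
  show "((\<lambda>x. tau x Z) has_field_derivative - D2' + \<i> * of_real b * D1'') (at y)"
    unfolding tau_def by simp
  have hol2: "kern c holomorphic_on ball y \<rho>" if "c \<in> atoms_of (current y Z)" for c
    by (rule hol(1)) (use that atoms_of_contract[of "\<lambda>c. kern c y" Z] in \<open>auto simp: current_def\<close>)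
  note c2 = current_holomorphic[OF hol2]
  have "((\<lambda>x. current x (current y Z) {#}) has_field_derivative D2') (at y)"
    unfolding D2'_def using holomorphic_derivI[OF c2(1) open_ball yb] c2(3)[OF _ yb] by simp
  from DERIV_imp_deriv[OF DERIV_mult[OF \<nu>_has_deriv this]]
  show "deriv (\<lambda>x. \<nu> x * current x (current y Z) {#}) y = deriv \<nu> y * D2 + \<nu> y * D2'"
    by (simp add: D2_def algebra_simps)
  have n1: "(\<nu> has_field_derivative deriv \<nu> x) (at x)" if "x \<in> w ` N" for x
    by (rule holomorphic_derivI[OF \<nu>_holomorphic point_facts(8) that])
  have n2: "(deriv \<nu> has_field_derivative deriv (deriv \<nu>) y) (at y)"
    by (rule holomorphic_derivI[OF holomorphic_deriv[OF \<nu>_holomorphic] _ point_facts(10)]) (rule point_facts(8))+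
  let ?g = "\<lambda>x. deriv \<nu> x * (current x Z {#} - current y Z {#}) + \<nu> x * current' x Z {#}"
  have "eventually (\<lambda>x. x \<in> ball y \<rho> \<inter> w ` N) (nhds y)"
    by (rule eventually_nhds_in_open) (use yb point_facts(8,10) in auto)
  hence "eventually (\<lambda>x. deriv (\<lambda>x. \<nu> x * (current x Z {#} - current y Z {#})) x = ?g x) (nhds y)"
  proof eventually_elim
    case (elim x)
    have "((\<lambda>x. current x Z {#} - current y Z {#}) has_field_derivative current' x Z {#} - 0) (at x)"
      by (intro DERIV_diff DERIV_const d1) (use elim in auto)
    from DERIV_imp_deriv[OF DERIV_mult[OF n1 this]] elim show ?case by (simp add: algebra_simps)
  qed
  hence "deriv (deriv (\<lambda>x. \<nu> x * (current x Z {#} - current y Z {#}))) y = deriv ?g y" by (rule deriv_cong_ev) simp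
  also have "\<dots> = 2 * deriv \<nu> y * D1' + \<nu> y * D1''"
  proof (rule DERIV_imp_deriv)
    have "((\<lambda>x. current x Z {#} - current y Z {#}) has_field_derivative current' y Z {#} - 0) (at y)"
      by (intro DERIV_diff DERIV_const d1 yb)
    from DERIV_add[OF DERIV_mult[OF n2 this] DERIV_mult[OF \<nu>_has_deriv d2]]
    show "(?g has_field_derivative 2 * deriv \<nu> y * D1' + \<nu> y * D1'') (at y)"
      by (rule DERIV_cong) (simp add: D1'_def algebra_simps)
  qed
  finally show "(deriv ^^ 2) (\<lambda>x. \<nu> x * (current x Z {#} - current y Z {#})) y = 2 * deriv \<nu> y * D1' + \<nu> y * D1''"
    by (simp add: numeral_2_eq_2)
qed

section \<open>The Ward identity for T\<close>

lemma winv_y: "winv y = p" using winv(1) point_facts(4) by simp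

text \<open>Written with atoms of \<open>std_chart\<close>, the singular terms become pure powers.
  The chart \<open>\<phi>\<close> enters only through the square of
  \<open>deriv (chart_w \<phi>)\<close> and through the Schwarzian.\<close>

lemma corr_T_std:
  assumes Z: "is_functional D (D - {p}) Z"
  shows "corr G T_field \<phi> z Z = (deriv (chart_w \<phi>) z)\<^sup>2 * (- (1/2) * contract (K (std_chart, Suc 0, 0, y)) (contract (K (std_chart, Suc 0, 0, y)) Z) {#} +
    \<i> * of_real b * contract (K (std_chart, Suc (Suc 0), 0, y)) Z {#}) + charge / 12 * schwarzian (chart_w \<phi>) z * Z {#}"
  using corr_T_tau[OF chart(1) point_facts(1), of Z] Z tau_std[OF point_facts(6)] test_at_functional[OF Z]
  by (simp add: point_facts winv_y)

text \<open>The infinitesimal transformation law of a Schwarzian form: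
  \<open>2 \<nu>' \<tau> + \<nu> \<tau>' + c/12 \<nu>'''\<close>, times the square of the derivative
  of the coordinate. The bracket after \<open>\<nu> y\<close> is the derivative of
  \<open>tau\<close> at \<open>y\<close>.\<close>

definition ward_T :: "functional \<Rightarrow> complex" where
  "ward_T Z = (deriv (chart_w \<phi>) z)\<^sup>2 * (2 * deriv \<nu> y * tau y Z +
     \<nu> y * (- current' y (current y Z) {#} + \<i> * of_real b * deriv (\<lambda>x. current' x Z {#}) y) +
     charge / 12 * (deriv ^^ 3) \<nu> y * Z {#})"

lemma T_contour:
  assumes F: "is_functional D (D - {p}) Z"
  shows "eventually (\<lambda>r. contour_integral (circlepath z r) (\<lambda>\<eta>. vector_at v \<phi> \<eta> * corr G T_field \<phi> z (stress \<phi> \<eta> Z)) =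
    2 * of_real pi * \<i> * ward_T Z) (at_right 0)"
proof -
  note Z = test_at_functional[OF F]
  let ?W = "chart_w \<phi>"
  define s where "s = charge / 12 * schwarzian ?W z"
  define k where "k = (deriv ?W z)\<^sup>2"
  define a1 :: atom where "a1 = (std_chart, Suc 0, 0, y)"
  define a2 :: atom where "a2 = (std_chart, Suc (Suc 0), 0, y)"
  define \<beta> where "\<beta> = \<i> * of_real b"
  define Z0 where "Z0 = Z {#}"
  obtain \<rho> where "near Z \<rho>" using near_exists[OF Z] ..
  note \<rho> = nearD[OF this]
  have hol: "(\<lambda>x. tau x Y) holomorphic_on ball y \<rho>" "(\<lambda>x. current x Y {#}) holomorphic_on ball y \<rho>"
    if "atoms_of Y \<subseteq> atoms_of Z" for Y
    using tau_holomorphic_sub[OF \<rho>(4) test_at_finite[OF Z] that] by simp_all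
  have sub: "atoms_of (contract l Z) \<subseteq> atoms_of Z" "atoms_of (contract l (contract m Z)) \<subseteq> atoms_of Z" for l m
    by (rule atoms_of_contract) (rule order_trans[OF atoms_of_contract atoms_of_contract])
  have c1: "contract (K a1) Z = current y Z" and c2: "contract (K a2) Z = current' y Z"
    using std_contract[OF point_facts(6)] Z by (simp_all add: winv_y a1_def a2_def)
  \<comment> \<open>The numerators of the poles of order \<open>n + 1\<close>. They are left as
    functions of \<open>x\<close> and not expanded at \<open>y\<close>, so no simple pole appears.
    In order three, the two contributions with \<open>\<beta>\<close> combine into a difference that
    vanishes at \<open>y\<close>.\<close>
  define f where "f n = (if n = 0 then (\<lambda>x. 0) else if n = 1 then (\<lambda>x. - k * (\<nu> x * current x (current y Z) {#}))
    else if n = 2 then (\<lambda>x. (2 * \<beta> * k) * (\<nu> x * (current x Z {#} - current y Z {#}))) else (\<lambda>x. (charge / 2 * k * Z0) * \<nu> x))" for n :: nat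
  define h where "h x = \<nu> x * (k * (- (1/2) * tau x (contract (K a1) (contract (K a1) Z)) + \<beta> * tau x (contract (K a2) Z)) + s * tau x Z)" for x
  have "eventually (\<lambda>r. contour_integral (circlepath z r) (\<lambda>\<eta>. vector_at v \<phi> \<eta> * corr G T_field \<phi> z (stress \<phi> \<eta> Z)) =
    2 * of_real pi * \<i> * (\<Sum>n<4. (deriv ^^ n) (f n) (?W z) / fact n)) (at_right 0)"
  proof (rule pole_sum_contour[OF chart(1) point_facts(1) \<rho>(1)])
    show "h holomorphic_on ball (?W z) \<rho>" unfolding h_def point_facts(3)
      by (intro holomorphic_intros \<rho>(3) hol sub subset_refl)
    show "f n holomorphic_on ball (?W z) \<rho>" if "n < 4" for n
      unfolding f_def point_facts(3) using hol(2)[OF sub(1)[of "\<lambda>c. kern c y"]]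
      by (auto intro!: holomorphic_intros \<rho>(3) hol simp: current_def[of y])
    fix \<eta> assume \<eta>: "\<eta> \<in> cimage \<phi>" "\<eta> \<noteq> z" "?W \<eta> \<in> ball (?W z) \<rho>"
    define x where "x = ?W \<eta>"
    have x: "x \<in> ball y \<rho>" "x \<noteq> y" using \<eta> chart_w_ne by (auto simp: x_def point_facts(3))
    note T = \<rho>(5)[OF \<eta>(1) \<eta>(3)[unfolded point_facts(3)]]
    have va: "valid_atom D {p} a1" "valid_atom D {p} a2" "node a1 \<noteq> cinv \<phi> \<eta>" "node a2 \<noteq> cinv \<phi> \<eta>"
      using std_chart point_facts(6) winv_y node_ne[OF \<eta>(1,2)] by (auto simp: valid_atom_def a1_def a2_def)
    have kn: "kern a1 x = - (1 / (x - y)\<^sup>2)" "deriv (kern a1) x = 2 / (x - y) ^ 3" "kern a2 x = - (2 / (x - y) ^ 3)" "deriv (kern a2) x = 6 / (x - y) ^ 4"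
      using kern_std[OF point_facts(6) x(2)] by (simp_all add: a1_def a2_def del: kern.simps)
    have st: "is_functional D (D - {p}) (stress \<phi> \<eta> Z)" by (rule test_at_stress(1)[OF chart(1) \<eta>(1) node_ne[OF \<eta>(1,2)] F])
    have c: "corr G T_field \<phi> z (stress \<phi> \<eta> Z) = (deriv ?W \<eta>)\<^sup>2 * (k * (- (1/2) * (tau x (contract (K a1) (contract (K a1) Z))
       - 2 * kern a1 x * current x (current y Z) {#} - kern a1 x * kern a1 x * Z0 + 2 * \<beta> * deriv (kern a1) x * current y Z {#})
       + \<beta> * (tau x (contract (K a2) Z) - kern a2 x * current x Z {#} + \<beta> * deriv (kern a2) x * Z0)) + s * tau x Z)"
      unfolding corr_T_std[OF st] a1_def[symmetric] a2_def[symmetric] contract_contract_stress[OF chart(1) \<eta>(1) T va(1,3) va(1,3)]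
        contract_stress[OF chart(1) \<eta>(1) T va(2,4)] stress_empty[OF chart(1) \<eta>(1) T] s_def[symmetric] k_def[symmetric] x_def[symmetric]
        \<beta>_def[symmetric] Z0_def[symmetric] c1
      by (simp only: distrib_left distrib_right right_diff_distrib left_diff_distrib mult_ac mult_2 mult_minus_left mult_minus_right) simp
    \<comment> \<open>The pole of order four collects \<open>1/2\<close> from contracting both
      currents and \<open>6 \<beta>^2\<close> from the linear part. Their sum is
      \<open>charge / 2\<close>, as the square of \<open>\<beta>\<close> is
      \<open>- b^2\<close>.\<close>
    have ch: "charge = 1 + 12 * (\<beta> * \<beta>)" by (simp add: \<beta>_def charge_def power2_eq_square complex_eq_iff)
    have xy: "x - y \<noteq> 0" using x by simp
    have alg: "n * (k * (- (1/2) * (t1 - 2 * (- (1 / u ^ 2)) * d2 - (- (1 / u ^ 2)) * (- (1 / u ^ 2)) * Z0 + 2 * \<beta> * (2 / u ^ 3) * e)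
       + \<beta> * (t2 - (- (2 / u ^ 3)) * d1 + \<beta> * (6 / u ^ 4) * Z0)) + s * t) =
       n * (k * (- (1/2) * t1 + \<beta> * t2) + s * t) + (- k * (n * d2) / u ^ 2 + (2 * \<beta> * k) * (n * (d1 - e)) / u ^ 3 + (charge / 2 * k * Z0) * n / u ^ 4)"
      if u: "u \<noteq> 0" for n t1 t2 t u d1 d2 e
    proof -
      define i where "i = inverse u"
      show ?thesis unfolding ch divide_inverse[of _ "u ^ _"] power_inverse[symmetric] i_def[symmetric]
        by (simp add: algebra_simps power2_eq_square power3_eq_cube power4_eq_xxxx)
    qed
    show "vector_at v \<phi> \<eta> * corr G T_field \<phi> z (stress \<phi> \<eta> Z) =
      deriv ?W \<eta> * (h (?W \<eta>) + (\<Sum>n<4. f n (?W \<eta>) / (?W \<eta> - ?W z) ^ Suc n))"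
      unfolding c vector_square[OF \<eta>(1)] unfolding x_def[symmetric] kn point_facts(3) alg[OF xy]
      by (simp add: h_def f_def eval_nat_numeral)
  qed
  moreover have "(\<Sum>n<4. (deriv ^^ n) (f n) (?W z) / fact n) = ward_T Z"
  proof -
    note d = derivs_y[OF \<rho>(4) test_at_finite[OF Z] \<rho>(1)]
    have yb: "y \<in> ball y \<rho>" using \<rho>(1) by simp
    have g: "(\<lambda>x. \<nu> x * current x (current y Z) {#}) holomorphic_on ball y \<rho>"
      "(\<lambda>x. \<nu> x * (current x Z {#} - current y Z {#})) holomorphic_on ball y \<rho>"
      using hol(2)[OF sub(1)[of "\<lambda>c. kern c y"]]
      by (auto intro!: holomorphic_intros \<rho>(3) hol simp: current_def[of y])
    have f1: "deriv (f 1) y = - k * (deriv \<nu> y * current y (current y Z) {#} + \<nu> y * current' y (current y Z) {#})"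
      using higher_deriv_cmult[OF g(1) yb open_ball, of 1 "- k"] d(2) by (simp add: f_def)
    have f2: "(deriv ^^ 2) (f 2) y = 2 * \<beta> * k * (2 * deriv \<nu> y * current' y Z {#} + \<nu> y * deriv (\<lambda>x. current' x Z {#}) y)"
      using higher_deriv_cmult[OF g(2) yb open_ball, of 2 "2 * \<beta> * k"] d(3) by (simp add: f_def)
    \<comment> \<open>Division by \<open>3!\<close> in the residue formula will turn
      \<open>charge / 2\<close> into \<open>charge / 12\<close>.\<close>
    have f3: "(deriv ^^ 3) (f 3) y = charge / 2 * k * Z0 * (deriv ^^ 3) \<nu> y"
      using higher_deriv_cmult[OF \<rho>(3) yb open_ball, of 3 "charge / 2 * k * Z0"] by (simp add: f_def)
    have "(\<Sum>n<4. (deriv ^^ n) (f n) (?W z) / fact n) = deriv (f 1) y + (deriv ^^ 2) (f 2) y / 2 + (deriv ^^ 3) (f 3) y / 6"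
      by (simp add: point_facts(3) numeral_2_eq_2 numeral_3_eq_3 lessThan_Suc[of "Suc (Suc (Suc 0))", unfolded eval_nat_numeral] eval_nat_numeral fact_numeral f_def[of 0])
    also have "\<dots> = ward_T Z"
      unfolding f1 f2 f3 ward_T_def tau_def k_def[symmetric] \<beta>_def[symmetric] Z0_def[symmetric] by (simp add: algebra_simps)
    finally show ?thesis .
  qed
  ultimately show ?thesis by simp
qed

text \<open>After conjugation the atoms of \<open>T\<close> carry antiholomorphic derivatives, while
  the stress tensor acting on the conjugate functional is holomorphic. Their contractions see only
  the image charge, so the integrand extends holomorphically across the point.\<close>

lemma T_bar_contour:
  assumes F: "is_functional D (D - {p}) Z"
  shows "eventually (\<lambda>r. contour_integral (circlepath z r) (\<lambda>\<eta>. vector_at v \<phi> \<eta> * cnj (corr G T_field \<phi> z (stress_bar \<phi> \<eta> Z))) = 0) (at_right 0)"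
proof -
  define Y where "Y = func_star Z"
  have Z: "test_at p Y" unfolding Y_def by (rule test_at_star[OF test_at_functional[OF F]])
  let ?W = "chart_w \<phi>"
  define s where "s = cnj (charge / 12 * schwarzian ?W z)"
  define k where "k = cnj ((deriv ?W z)\<^sup>2)"
  define a1 :: atom where "a1 = (std_chart, 0, Suc 0, y)"
  define a2 :: atom where "a2 = (std_chart, 0, Suc (Suc 0), y)"
  define \<beta> where "\<beta> = \<i> * of_real b"
  obtain \<rho> where "near Y \<rho>" using near_exists[OF Z] ..
  note \<rho> = nearD[OF this]
  have hol: "(\<lambda>x. tau x X) holomorphic_on ball y \<rho>" "(\<lambda>x. current x X {#}) holomorphic_on ball y \<rho>"
    if "atoms_of X \<subseteq> atoms_of Y" for X
    using tau_holomorphic_sub[OF \<rho>(4) test_at_finite[OF Z] that] by simp_all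
  have sub: "atoms_of (contract l Y) \<subseteq> atoms_of Y" "atoms_of (contract l (contract m Y)) \<subseteq> atoms_of Y" for l m
    by (rule atoms_of_contract) (rule order_trans[OF atoms_of_contract atoms_of_contract])
  have kh: "kern a1 holomorphic_on ball y \<rho>" "kern a2 holomorphic_on ball y \<rho>"
    unfolding a1_def a2_def by (rule holomorphic_on_subset[OF kern_std_star_holomorphic[OF point_facts(6)] \<rho>(2)])+
  have kh': "deriv (kern a1) holomorphic_on ball y \<rho>" "deriv (kern a2) holomorphic_on ball y \<rho>"
    by (rule holomorphic_deriv[OF kh(1) open_ball]) (rule holomorphic_deriv[OF kh(2) open_ball])
  define H where "H x = k * (- (1/2) * (tau x (contract (K a1) (contract (K a1) Y))
       - kern a1 x * current x (contract (K a1) Y) {#} - kern a1 x * current x (contract (K a1) Y) {#} - kern a1 x * kern a1 x * Y {#}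
       + \<beta> * deriv (kern a1) x * contract (K a1) Y {#} + \<beta> * deriv (kern a1) x * contract (K a1) Y {#})
       + cnj \<beta> * (tau x (contract (K a2) Y) - kern a2 x * current x Y {#} + \<beta> * deriv (kern a2) x * Y {#})) + s * tau x Y" for x
  have "eventually (\<lambda>r. contour_integral (circlepath z r) (\<lambda>\<eta>. vector_at v \<phi> \<eta> * cnj (corr G T_field \<phi> z (stress_bar \<phi> \<eta> Z))) =
    2 * of_real pi * \<i> * (\<Sum>n<0. (deriv ^^ n) (\<lambda>x. 0) (?W z) / fact n)) (at_right 0)"
  proof (rule pole_sum_contour[OF chart(1) point_facts(1) \<rho>(1)])
    show "(\<lambda>x. \<nu> x * H x) holomorphic_on ball (?W z) \<rho>" unfolding H_def point_facts(3)
      by (intro holomorphic_intros \<rho>(3) hol sub subset_refl kh kh')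
    fix \<eta> assume \<eta>: "\<eta> \<in> cimage \<phi>" "\<eta> \<noteq> z" "?W \<eta> \<in> ball (?W z) \<rho>"
    note T = \<rho>(5)[OF \<eta>(1) \<eta>(3)[unfolded point_facts(3)]]
    have va: "valid_atom D {p} a1" "valid_atom D {p} a2" "node a1 \<noteq> cinv \<phi> \<eta>" "node a2 \<noteq> cinv \<phi> \<eta>"
      using std_chart point_facts(6) winv_y node_ne[OF \<eta>(1,2)] by (auto simp: valid_atom_def a1_def a2_def)
    have st: "is_functional D (D - {p}) (stress_bar \<phi> \<eta> Z)" by (rule test_at_stress(2)[OF chart(1) \<eta>(1) node_ne[OF \<eta>(1,2)] F])
    have star: "func_star (stress_bar \<phi> \<eta> Z) = stress \<phi> \<eta> Y"
    proof -
      have "test_at (cinv \<phi> \<eta>) Z" using test_at_star[OF T] by (simp add: Y_def)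
      thus ?thesis unfolding Y_def by (rule stress_bar_star[OF chart(1) \<eta>(1)])
    qed
    have n: "valid_atom D {p} (std_chart, n, 0, y)" "node (std_chart, n, 0, y) = p" for n
      using std_chart point_facts(6) winv_y by (auto simp: valid_atom_def)
    have cs: "func_star (contract (K (std_chart, n, 0, y)) X) = contract (K (std_chart, 0, n, y)) (func_star X)" if "test_at p X" for n X
      using contract_K_star[OF n(1)[of n], of X] n(2)[of n] that by simp
    note st' = test_at_functional[OF st]
    have c: "cnj (corr G T_field \<phi> z (stress_bar \<phi> \<eta> Z)) = k * (- (1/2) * contract (K a1) (contract (K a1) (stress \<phi> \<eta> Y)) {#} +
      cnj \<beta> * contract (K a2) (stress \<phi> \<eta> Y) {#}) + s * stress \<phi> \<eta> Y {#}"
      unfolding corr_T_std[OF st] a1_def a2_def star[symmetric] cs[OF st', symmetric] cs[OF test_at_contract[OF st'], symmetric]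
      by (simp add: func_star_empty k_def s_def \<beta>_def)
    show "vector_at v \<phi> \<eta> * cnj (corr G T_field \<phi> z (stress_bar \<phi> \<eta> Z)) =
      deriv ?W \<eta> * (\<nu> (?W \<eta>) * H (?W \<eta>) + (\<Sum>n<0. 0 / (?W \<eta> - ?W z) ^ Suc n))"
      unfolding c contract_contract_stress[OF chart(1) \<eta>(1) T va(1,3) va(1,3)] contract_stress[OF chart(1) \<eta>(1) T va(2,4)]
        stress_empty[OF chart(1) \<eta>(1) T] vector_at_\<nu>[OF \<eta>(1), symmetric] H_def \<beta>_def[symmetric]
      by (simp add: power2_eq_square algebra_simps)
  qed simp
  thus ?thesis by simp
qed

text \<open>By the cocycle rule for the Schwarzian, the correlation in the moving chart depends on
  time only through the derivatives \<open>P 0\<close> to \<open>P 3\<close> of the flow map at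
  \<open>y\<close>, whose time derivatives are known.\<close>

lemma T_flow:
  assumes F: "is_functional D (D - {p}) Z"
  shows "((\<lambda>t. corr G T_field (\<phi>t t) z Z) has_vector_derivative ward_T Z) (at 0)"
proof -
  note Z = test_at_functional[OF F]
  let ?W = "chart_w \<phi>"
  define d where "d = deriv ?W z"
  define P where "P n t = (deriv ^^ n) (\<Psi> t) y" for n t
  have dP: "(P n has_vector_derivative (deriv ^^ n) \<nu> y) (at 0)" for n unfolding P_def by (rule \<Psi>_deriv)
  have P0: "P 0 0 = y" "P 1 0 = 1" "P 2 0 = 0" "P 3 0 = 0"
    unfolding P_def \<Psi>_0 by (simp_all add: numeral_2_eq_2 numeral_3_eq_3)
  \<comment> \<open>The formula for correlations of \<open>T\<close> has to hold at the moved point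
    \<open>\<psi> t p\<close>; for small times this point avoids the finite set \<open>A\<close> of
    nodes.\<close>
  obtain A where A: "finite A" "A \<subseteq> D - {p}" "is_functional D A Z" using is_functional_finite_nodes[OF F] by blast
  have "((\<lambda>t. \<psi> t p) \<longlongrightarrow> \<psi> 0 p) (nhds 0)"
    using iffD1[OF tendsto_at_iff_tendsto_nhds[of "\<lambda>t. \<psi> t p" 0]] has_vector_derivative_continuous[OF flow_facts(9)[OF _ p_U], of 0] flow_facts(3)
    by (simp add: isCont_def)
  moreover have "open (- A)" "\<psi> 0 p \<in> - A" using A by (auto simp: flow_facts(4)[OF p_U] intro: finite_imp_closed)
  ultimately have evA: "eventually (\<lambda>t. \<psi> t p \<in> - A) (nhds 0)" by (rule topological_tendstoD)
  define R where "R t = (P 1 t * d)\<^sup>2 * tau (P 0 t) Z + charge / 12 *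
      ((P 3 t * inverse (P 1 t) - (3/2) * (P 2 t * inverse (P 1 t))\<^sup>2) * d\<^sup>2 + schwarzian ?W z) * Z {#}" for t
  have ev: "eventually (\<lambda>t. corr G T_field (\<phi>t t) z Z = (P 1 t * d)\<^sup>2 * tau (P 0 t) Z + charge / 12 *
      ((P 3 t * inverse (P 1 t) - (3/2) * (P 2 t * inverse (P 1 t))\<^sup>2) * d\<^sup>2 + schwarzian ?W z) * Z {#}) (nhds 0)"
    using eventually_time evA
  proof eventually_elim
    case (elim t)
    note f = flow_chart_facts[OF N(2) flow chart elim(1)]
    have zt: "z \<in> cimage (\<phi>t t)" "cinv (\<phi>t t) z = \<psi> t p" "chart_w (\<phi>t t) z = P 0 t"
      using f(2,3,4)[OF p_U] by (simp_all add: P_def \<Psi>_def winv_y)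
    have Ft: "is_functional D (D - {cinv (\<phi>t t) z}) Z"
      by (rule is_functional_mono[OF A(3)]) (use A(2) elim(2) zt(2) in auto)
    note cw = chart_w_flow[OF elim(1)]
    define S where "S = ?W -` (w ` U) \<inter> cimage \<phi>"
    have "open S" unfolding S_def
      by (rule open_vimage_holomorphic[OF chart_w_holomorphic[OF chart(1)] cinv_chart(1)[OF chart(1)] point_facts(7)])
    hence S: "?W holomorphic_on S" "open S" "?W ` S \<subseteq> w ` U" "z \<in> S"
      using holomorphic_on_subset[OF chart_w_holomorphic[OF chart(1)], of S] point_facts(1,3,9) by (auto simp: S_def)
    note \<Psi>h = \<Psi>_holomorphic[OF elim(1)]
    have dW: "d \<noteq> 0" unfolding d_def by (rule deriv_chart_w[OF chart(1) point_facts(1)])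
    have "deriv (chart_w (\<phi>t t)) z = deriv (\<lambda>x. \<Psi> t (?W x)) z" by (rule deriv_cong_ev[OF cw refl])
    also have "\<dots> = deriv (\<Psi> t) (?W z) * deriv ?W z" by (rule deriv_compose_123(1)[OF \<Psi>h point_facts(7) S])
    finally have dd: "deriv (chart_w (\<phi>t t)) z = P 1 t * d" by (simp add: P_def d_def point_facts(3))
    have P1: "P 1 t \<noteq> 0" using dd deriv_chart_w[OF f(1) zt(1)] by auto
    have "schwarzian (chart_w (\<phi>t t)) z = schwarzian (\<lambda>x. \<Psi> t (?W x)) z" by (rule schwarzian_cong[OF cw])
    also have "\<dots> = schwarzian (\<Psi> t) (?W z) * (deriv ?W z)\<^sup>2 + schwarzian ?W z"
      by (rule schwarzian_compose[OF \<Psi>h point_facts(7) S]) (use P1 dW in \<open>simp_all add: P_def d_def point_facts(3)\<close>)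
    also have "schwarzian (\<Psi> t) (?W z) = P 3 t / P 1 t - (3/2) * (P 2 t / P 1 t)\<^sup>2"
      unfolding point_facts(3) using schwarzian_eq[OF \<Psi>h point_facts(7,9)] P1 by (simp add: P_def)
    finally have sw: "schwarzian (chart_w (\<phi>t t)) z =
      (P 3 t * inverse (P 1 t) - (3/2) * (P 2 t * inverse (P 1 t))\<^sup>2) * d\<^sup>2 + schwarzian ?W z"
      by (simp only: d_def divide_inverse)
    show ?case unfolding corr_T_tau[OF f(1) zt(1) Ft] dd zt(3) sw ..
  qed
  obtain \<rho> where "near Z \<rho>" using near_exists[OF Z] ..
  note \<rho> = nearD[OF this]
  define \<tau>' where "\<tau>' = - current' y (current y Z) {#} + \<i> * of_real b * deriv (\<lambda>x. current' x Z {#}) y"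
  have "((\<lambda>x. tau x Z) has_field_derivative \<tau>') (at (P 0 0))"
    unfolding P0 \<tau>'_def by (rule derivs_y(1)[OF \<rho>(4) test_at_finite[OF Z] \<rho>(1)])
  from field_vector_diff_chain_at[OF dP[of 0] this]
  have d\<tau>: "((\<lambda>t. tau (P 0 t) Z) has_vector_derivative \<nu> y * \<tau>') (at 0)" by (simp add: o_def)
  have "(inverse has_field_derivative - 1) (at (P 1 0))" unfolding P0
    using DERIV_inverse[of "1 :: complex"] by simp
  from field_vector_diff_chain_at[OF dP[of 1] this]
  have dI: "((\<lambda>t. inverse (P 1 t)) has_vector_derivative - deriv \<nu> y) (at 0)" by (simp add: o_def)
  have d1: "(P 1 has_vector_derivative deriv \<nu> y) (at 0)" using dP[of 1] by simp
  note dq = has_vector_derivative_mult[OF dP[of 2] dI]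
  note dm = has_vector_derivative_mult[OF d1 has_vector_derivative_const[of d]]
  \<comment> \<open>The product rule written out in full. At time 0 the flow map is the identity, so
    \<open>P 2\<close> and \<open>P 3\<close> vanish there and the squared term of the Schwarzian
    contributes nothing to the derivative.\<close>
  have "(R has_vector_derivative ((P 1 0 * d) * (P 1 0 * 0 + deriv \<nu> y * d) + (P 1 0 * 0 + deriv \<nu> y * d) * (P 1 0 * d)) * tau (P 0 0) Z +
     (P 1 0 * d * (P 1 0 * d)) * (\<nu> y * \<tau>') + charge / 12 * (((P 3 0 * - deriv \<nu> y + (deriv ^^ 3) \<nu> y * inverse (P 1 0)) - (3/2) *
      ((P 2 0 * inverse (P 1 0)) * (P 2 0 * - deriv \<nu> y + (deriv ^^ 2) \<nu> y * inverse (P 1 0)) +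
       (P 2 0 * - deriv \<nu> y + (deriv ^^ 2) \<nu> y * inverse (P 1 0)) * (P 2 0 * inverse (P 1 0)))) * d\<^sup>2 + 0) * Z {#}) (at 0)"
    unfolding R_def power2_eq_square[of "P 1 _ * d"] power2_eq_square[of "P 2 _ * inverse (P 1 _)"]
    apply (rule has_vector_derivative_add)
     apply (rule has_vector_derivative_eq_rhs[OF has_vector_derivative_mult[OF has_vector_derivative_mult[OF dm dm] d\<tau>]], simp only: add.commute)
    apply (intro has_vector_derivative_mult_left has_vector_derivative_mult_right has_vector_derivative_add has_vector_derivative_diff
      has_vector_derivative_const has_vector_derivative_mult[OF dP[of 3] dI] has_vector_derivative_mult[OF dq dq])
    done
  hence "(R has_vector_derivative ward_T Z) (at 0)"
    by (rule has_vector_derivative_eq_rhs) (simp only: P0, simp add: ward_T_def \<tau>'_def d_def power2_eq_square algebra_simps)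
  thus ?thesis by (rule has_vector_derivative_transform_nhds[OF ev[folded R_def]])
qed

end

section \<open>From residues to the stress tensor\<close>

context gff_setup
begin

text \<open>\<open>R\<close> and \<open>R'\<close> are the residues of the two halves. The second
  integral has a conjugated correlation because an integral against the conjugate differential is
  the conjugate of an ordinary contour integral.\<close>

definition ward_identity ::
  "fock \<Rightarrow> (complex \<Rightarrow> complex) \<Rightarrow> chart \<Rightarrow> (real \<Rightarrow> chart) \<Rightarrow> complex \<Rightarrow> functional \<Rightarrow> complex \<Rightarrow> complex \<Rightarrow> bool" where
  "ward_identity X v \<phi> \<phi>' z Z R R' \<longleftrightarrow>
     ((\<lambda>t. corr G X (\<phi>' t) z Z) has_vector_derivative R + cnj R') (at 0) \<and>
     eventually (\<lambda>r. contour_integral (circlepath z r) (\<lambda>\<eta>. vector_at v \<phi> \<eta> * corr G X \<phi> z (stress \<phi> \<eta> Z)) =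
       2 * of_real pi * \<i> * R) (at_right 0) \<and>
     eventually (\<lambda>r. contour_integral (circlepath z r) (\<lambda>\<eta>. vector_at v \<phi> \<eta> * cnj (corr G X \<phi> z (stress_bar \<phi> \<eta> Z))) =
       2 * of_real pi * \<i> * R') (at_right 0)"

lemma stress_tensorI:
  assumes X: "\<And>N v U \<epsilon> \<psi> \<alpha> \<phi> p Z. flow_point D w G \<theta> N v U \<epsilon> \<psi> \<alpha> \<phi> p \<Longrightarrow> is_functional D (D - {p}) Z \<Longrightarrow>
    \<exists>R R'. ward_identity X v \<phi> (\<lambda>t. flow_chart \<phi> U (\<psi> t) (\<alpha> t)) (cmap \<phi> p) Z R R'"
  shows "stress_tensor D G stress_field X"
  unfolding stress_tensor_def Let_def
proof (intro conjI allI impI)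
  show "fock_field D stress_field" "holomorphic_field D G stress_field" "quadratic_differential D G stress_field"
    by (rule fock_field_stress holomorphic_stress quadratic_stress)+
  fix N v \<phi> U \<epsilon> \<psi> \<alpha> p Z
  assume a: "open N" "N \<subseteq> D" "v holomorphic_on N" "local_flow N v U \<epsilon> \<psi> \<alpha>" "is_chart D \<phi>" "U \<subseteq> cdom \<phi>" "p \<in> U"
    and F: "is_functional D (D - {p}) Z"
  interpret flow_point D w G \<theta> b N v U \<epsilon> \<psi> \<alpha> \<phi> p by unfold_locales (use a in auto)
  obtain R R' where R: "((\<lambda>t. corr G X (\<phi>t t) z Z) has_vector_derivative R + cnj R') (at 0)"
    "eventually (\<lambda>r. contour_integral (circlepath z r) (\<lambda>\<eta>. vector_at v \<phi> \<eta> * corr G X \<phi> z (stress \<phi> \<eta> Z)) = 2 * of_real pi * \<i> * R) (at_right 0)"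
    "eventually (\<lambda>r. contour_integral (circlepath z r) (\<lambda>\<eta>. vector_at v \<phi> \<eta> * cnj (corr G X \<phi> z (stress_bar \<phi> \<eta> Z))) = 2 * of_real pi * \<i> * R') (at_right 0)"
    using X[OF flow_point_axioms F] unfolding ward_identity_def by blast
  obtain e where e: "e > 0" "ball z e \<subseteq> cimage \<phi>"
    using cinv_chart(1)[OF chart(1)] point_facts(1) open_contains_ball by blast
  have "eventually (\<lambda>r. 0 < r \<and> r < e) (at_right (0::real))" using e(1) by (auto simp: eventually_at_right_field)
  with R(2,3) show "\<forall>\<^sub>F r in at_right 0. ((\<lambda>t. expect (fmult G (field_at X (flow_chart \<phi> U (\<psi> t) (\<alpha> t)) (cmap \<phi> p)) Z)) has_vector_derivative
     (1 / (2 * pi * \<i>) * contour_integral (circlepath (cmap \<phi> p) r)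
        (\<lambda>\<eta>. vector_at v \<phi> \<eta> * expect (fmult G (fmult G (field_at stress_field \<phi> \<eta>) (field_at X \<phi> (cmap \<phi> p))) Z))
      - 1 / (2 * pi * \<i>) * cnj_contour_integral (circlepath (cmap \<phi> p) r)
        (\<lambda>\<eta>. cnj (vector_at v \<phi> \<eta>) * expect (fmult G (fmult G (field_at (field_cnj stress_field) \<phi> \<eta>) (field_at X \<phi> (cmap \<phi> p))) Z)))) (at 0)"
  proof eventually_elim
    case (elim r)
    have on: "\<eta> \<in> cimage \<phi> \<and> \<eta> \<noteq> z" if "\<eta> \<in> path_image (circlepath z r)" for \<eta>
      using that elim(3) e(2) by auto
    note E = expect_stress_field[OF chart(1) _ point_facts(1) _ is_functional_wick_bounded[OF F]]
    have 1: "contour_integral (circlepath z r) (\<lambda>\<eta>. vector_at v \<phi> \<eta> * expect (fmult G (fmult G (field_at stress_field \<phi> \<eta>) (field_at X \<phi> z)) Z)) =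
      2 * of_real pi * \<i> * R"
      unfolding elim(1)[symmetric] by (rule contour_integral_eq) (use on E(1) in auto)
    have "contour_integral (circlepath z r) (\<lambda>\<eta>. cnj (cnj (vector_at v \<phi> \<eta>) *
        expect (fmult G (fmult G (field_at (field_cnj stress_field) \<phi> \<eta>) (field_at X \<phi> z)) Z))) = 2 * of_real pi * \<i> * R'"
      unfolding elim(2)[symmetric] by (rule contour_integral_eq) (use on E(2) in auto)
    \<comment> \<open>Conjugation reverses the sign of \<open>2 pi i\<close>. Together with the
      minus sign in the definition of a stress tensor this gives the sum
      \<open>R + cnj R'\<close>.\<close>
    hence 2: "cnj_contour_integral (circlepath z r) (\<lambda>\<eta>. cnj (vector_at v \<phi> \<eta>) *
        expect (fmult G (fmult G (field_at (field_cnj stress_field) \<phi> \<eta>) (field_at X \<phi> z)) Z)) = - (2 * of_real pi * \<i> * cnj R')"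
      unfolding cnj_contour_integral_def by simp
    show ?case unfolding 1 2 using R(1) by (simp add: corr_def)
  qed
qed

text \<open>As the field is real, its second residue is the first one taken for the conjugate test
  functional.\<close>

lemma stress_tensor_gff: "stress_tensor D G stress_field (gff_b b \<theta>)"
proof (rule stress_tensorI)
  fix N v U \<epsilon> \<psi> \<alpha> \<phi> p Z
  assume "flow_point D w G \<theta> N v U \<epsilon> \<psi> \<alpha> \<phi> p" and F: "is_functional D (D - {p}) Z"
  then interpret flow_point D w G \<theta> b N v U \<epsilon> \<psi> \<alpha> \<phi> p by simp
  note Z = test_at_functional[OF F]
  obtain \<rho> where "near Z \<rho>" using near_exists[OF Z] ..
  note \<rho> = nearD[OF this]
  have "open (chart_w \<phi> -` ball y \<rho> \<inter> cimage \<phi>)"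
    by (rule open_vimage_holomorphic[OF chart_w_holomorphic[OF chart(1)] cinv_chart(1)[OF chart(1)] open_ball])
  then obtain e where e: "e > 0" "ball z e \<subseteq> chart_w \<phi> -` ball y \<rho> \<inter> cimage \<phi>"
    using point_facts(1,3) \<rho>(1) open_contains_ball by (metis IntI centre_in_ball vimageI)
  have eq: "vector_at v \<phi> \<eta> * cnj (corr G (gff_b b \<theta>) \<phi> z (stress_bar \<phi> \<eta> Z)) =
    vector_at v \<phi> \<eta> * corr G (gff_b b \<theta>) \<phi> z (stress \<phi> \<eta> (func_star Z))"
    if \<eta>: "\<eta> \<in> ball z e" "\<eta> \<noteq> z" for \<eta>
  proof -
    have \<eta>': "\<eta> \<in> cimage \<phi>" "chart_w \<phi> \<eta> \<in> ball y \<rho>" using e(2) \<eta> by auto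
    note sb = stress_bar_star[OF chart(1) \<eta>'(1) \<rho>(5)[OF \<eta>']]
    have "test_at p (stress_bar \<phi> \<eta> Z)"
      by (rule test_at_functional[OF test_at_stress(2)[OF chart(1) \<eta>'(1) node_ne[OF \<eta>'(1) \<eta>(2)] F]])
    from corr_gff_star[OF this] show ?thesis by (simp add: sb)
  qed
  have ev: "eventually (\<lambda>r. 0 < r \<and> r < e) (at_right (0::real))" using e(1) by (auto simp: eventually_at_right_field)
  have "eventually (\<lambda>r. contour_integral (circlepath z r) (\<lambda>\<eta>. vector_at v \<phi> \<eta> * cnj (corr G (gff_b b \<theta>) \<phi> z (stress_bar \<phi> \<eta> Z))) =
    2 * of_real pi * \<i> * (\<nu> y * current y (func_star Z) {#} + \<i> * of_real b * deriv \<nu> y * func_star Z {#})) (at_right 0)"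
    using gff_contour[OF test_at_star[OF Z]] ev
  proof eventually_elim
    case (elim r)
    have "\<eta> \<in> ball z e \<and> \<eta> \<noteq> z" if "\<eta> \<in> path_image (circlepath z r)" for \<eta> using that elim(2) by auto
    hence "contour_integral (circlepath z r) (\<lambda>\<eta>. vector_at v \<phi> \<eta> * cnj (corr G (gff_b b \<theta>) \<phi> z (stress_bar \<phi> \<eta> Z))) =
      contour_integral (circlepath z r) (\<lambda>\<eta>. vector_at v \<phi> \<eta> * corr G (gff_b b \<theta>) \<phi> z (stress \<phi> \<eta> (func_star Z)))"
      by (intro contour_integral_eq eq) auto
    thus ?case using elim(1) by simp
  qed
  with gff_flow[OF Z] gff_contour[OF Z]
  show "\<exists>R R'. ward_identity (gff_b b \<theta>) v \<phi> (\<lambda>t. flow_chart \<phi> U (\<psi> t) (\<alpha> t)) (cmap \<phi> p) Z R R'"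
    unfolding ward_identity_def by blast
qed

lemma stress_tensor_T: "stress_tensor D G stress_field T_field"
proof (rule stress_tensorI)
  fix N v U \<epsilon> \<psi> \<alpha> \<phi> p Z
  assume "flow_point D w G \<theta> N v U \<epsilon> \<psi> \<alpha> \<phi> p" and F: "is_functional D (D - {p}) Z"
  then interpret flow_point D w G \<theta> b N v U \<epsilon> \<psi> \<alpha> \<phi> p by simp
  show "\<exists>R R'. ward_identity T_field v \<phi> (\<lambda>t. flow_chart \<phi> U (\<psi> t) (\<alpha> t)) (cmap \<phi> p) Z R R'"
    using T_flow[OF F] T_contour[OF F] T_bar_contour[OF F] unfolding ward_identity_def by (intro exI[of _ "ward_T Z"] exI[of _ 0]) simp
qed

lemma virasoro:
  "gff_b b \<theta> \<in> stress_family D G stress_field \<and> virasoro_field D G stress_field T_field \<and> central_charge D G T_field (1 - 12 * b\<^sup>2)"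
proof (intro conjI)
  show "gff_b b \<theta> \<in> stress_family D G stress_field"
    by (simp add: stress_family_def fock_field_gff stress_tensor_gff)
  show "virasoro_field D G stress_field T_field"
    unfolding virasoro_field_def stress_family_def using fock_field_T stress_tensor_T T_minus_stress by blast
  show "central_charge D G T_field (1 - 12 * b\<^sup>2)"
    unfolding central_charge_def using schwarzian_form_T by (simp add: charge_def)
qed

end

theorem proposition10p1:
  fixes D :: "complex set" and q :: "nat \<Rightarrow> complex set" and w :: "complex \<Rightarrow> complex"
    and \<theta> :: "complex \<Rightarrow> real" and G :: "complex \<Rightarrow> complex \<Rightarrow> real" and b :: real
  defines "\<Phi> \<equiv> gff_b b \<theta>"
  defines "J \<equiv> field_d \<Phi>"
  defines "T \<equiv> field_add (field_scale (- (1/2)) (ope_mult D G J J))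
                 (field_scale (\<i> * complex_of_real b) (field_d J))"
  assumes "open D" and "connected D" and "simply_connected D"
    and "dirichlet_green D G"
    and "prime_end D q"
    and "w holomorphic_on D" and "inj_on w D" and "w ` D = {z. 0 < Im z}"
    and "prime_end_to_infinity D q w"
    and "is_arg_branch D (deriv w) \<theta>"
  shows "\<exists>A. \<Phi> \<in> stress_family D G A \<and> virasoro_field D G A T \<and> central_charge D G T (1 - 12 * b\<^sup>2)"
proof -
  interpret gff_setup D w G \<theta> b by unfold_locales (use assms in auto)
  have "T = T_field" by (simp add: T_def J_def \<Phi>_def T_field_def J_field_def)
  thus ?thesis using virasoro unfolding \<Phi>_def by blast
qed

end
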